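(* 1. Let $X$ be a second countable Radon measure space. If $(T_t)_{t \geq 0}$ is a weak* continuous semigroup of selfadjoint unital completely positive measurable Schur multipliers on $B(L^2(X))$ with continuous symbols, then there exist a real Hilbert space $H$ and a continuous function $\alpha \colon X \to H$, $x\mapsto\alpha_x$, such that for every $t\ge0$ the symbol $\phi_t$ of $T_t$ is $$\phi_t(x,y)=e^{-t\|\alpha_x-\alpha_y\|_{H}^2}, \quad \text{for almost all } x,y \in X.$$ 2. Let $X$ be a (complete) $\sigma$-finite measure space. If $(T_t)_{t \geq 0}$ is a weak* continuous semigroup of selfadjoint unital completely positive measurable Schur multipliers on $B(L^2(X))$, then there exist a real Hilbert space $H$ and a weak measurable function $\alpha \colon X \to H$, $x\mapsto\alpha_x$, such that for every $t\ge0$ the symbol $\phi_t$ of $T_t$ is $$\phi_t(x,y)=e^{-t\|\alpha_x-\alpha_y\|_{H}^2}, \quad \text{for almost all } x,y \in X.$$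
   Context: All measure spaces are assumed complete (every subset of a null set is measurable). A second countable Radon measure space is a second countable locally compact space equipped with a Radon measure. $S^1_X,S^2_X,S^\infty_X$ denote the trace class, Hilbert-Schmidt and compact operators on the complex Hilbert space $L^2(X)$. For $f\in L^2(X\times X)$, $K_f\in S^2_X$ is the operator $(K_f\xi)(x)=\int_X f(x,y)\xi(y)\,dy$. A function $\varphi\in L^\infty(X\times X)$ induces a measurable Schur multiplier if $K_f\mapsto K_{\varphi f}$ ($f\in L^2(X\times X)$) induces a bounded operator $S^\infty_X\to B(L^2(X))$; this operator then has a unique weak* continuous extension $M_\varphi\colon B(L^2(X))\to B(L^2(X))$, called the measurable Schur multiplier with symbol $\varphi$. It is selfadjoint if its restriction $S^2_X\to S^2_X$, $K_f\mapsto K_{\varphi f}$, is selfadjoint on the Hilbert space $S^2_X$. Weak* continuity of the semigroup means that $t\mapsto\langle T_t(x),y\rangle_{B(L^2(X)),S^1_X}$ is continuous on $[0,\infty)$ for any $x\in B(L^2(X))$ and $y\in S^1_X$. A function $\alpha\colon X\to H$ is weak measurable if $x\mapsto\langle\alpha_x,h\rangle_H$ is measurable for any $h\in H$. *)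

theory Defs
  imports "HOL-Analysis.Analysis"
begin

section \<open>The complex Hilbert space $L^2$ of a measure space\<close>

text \<open>
  Elements of $L^2(M)$ are given by representatives: square integrable functions, where functions
  that agree almost everywhere are identified. Consequently an operator on $L^2(M)$ is a map on
  representatives, and linearity and equality of operators are required almost everywhere
  (boundedness then makes an operator compatible with almost everywhere equality).
\<close>

definition L2_space :: "'a measure \<Rightarrow> ('a \<Rightarrow> complex) set" where
  "L2_space M = {f \<in> borel_measurable M. integrable M (\<lambda>x. (norm (f x))\<^sup>2)}"

definition l2_inner :: "'a measure \<Rightarrow> ('a \<Rightarrow> complex) \<Rightarrow> ('a \<Rightarrow> complex) \<Rightarrow> complex" where
  "l2_inner M f g = (\<integral>x. f x * cnj (g x) \<partial>M)"

definition l2_norm :: "'a measure \<Rightarrow> ('a \<Rightarrow> complex) \<Rightarrow> real" where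
  "l2_norm M f = sqrt (\<integral>x. (norm (f x))\<^sup>2 \<partial>M)"

definition onb :: "'a measure \<Rightarrow> ('a \<Rightarrow> complex) set \<Rightarrow> bool" where
  "onb M E \<longleftrightarrow> E \<subseteq> L2_space M \<and>
     (\<forall>e\<in>E. \<forall>e'\<in>E. l2_inner M e e' = (if e = e' then 1 else 0)) \<and>
     (\<forall>f\<in>L2_space M. (\<forall>e\<in>E. l2_inner M f e = 0) \<longrightarrow> (AE x in M. f x = 0))"

text \<open>
  The trace and the Hilbert-Schmidt inner product below do not depend on the orthonormal basis.
\<close>

definition some_onb :: "'a measure \<Rightarrow> ('a \<Rightarrow> complex) set" where
  "some_onb M = (SOME E. onb M E)"


section \<open>Operators on $L^2$\<close>

type_synonym 'a l2op = "('a \<Rightarrow> complex) \<Rightarrow> ('a \<Rightarrow> complex)"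

definition bounded_ops :: "'a measure \<Rightarrow> 'a l2op set" where
  "bounded_ops M = {A. (\<forall>f\<in>L2_space M. A f \<in> L2_space M) \<and>
     (\<forall>f\<in>L2_space M. \<forall>g\<in>L2_space M. \<forall>c.
        AE x in M. A (\<lambda>y. f y + c * g y) x = A f x + c * A g x) \<and>
     (\<exists>C. \<forall>f\<in>L2_space M. l2_norm M (A f) \<le> C * l2_norm M f)}"

definition op_eq :: "'a measure \<Rightarrow> 'a l2op \<Rightarrow> 'a l2op \<Rightarrow> bool" where
  "op_eq M A B \<longleftrightarrow> (\<forall>f\<in>L2_space M. AE x in M. A f x = B f x)"

definition op_norm :: "'a measure \<Rightarrow> 'a l2op \<Rightarrow> real" where
  "op_norm M A = Inf {C. 0 \<le> C \<and> (\<forall>f\<in>L2_space M. l2_norm M (A f) \<le> C * l2_norm M f)}"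

definition positive_op :: "'a measure \<Rightarrow> 'a l2op \<Rightarrow> bool" where
  "positive_op M A \<longleftrightarrow> (\<forall>f\<in>L2_space M. l2_inner M (A f) f \<in> \<real>\<^sub>\<ge>\<^sub>0)"

definition compact_ops :: "'a measure \<Rightarrow> 'a l2op set" where
  "compact_ops M = {A \<in> bounded_ops M.
     \<forall>u :: nat \<Rightarrow> 'a \<Rightarrow> complex. (\<forall>n. u n \<in> L2_space M \<and> l2_norm M (u n) \<le> 1) \<longrightarrow>
       (\<exists>r g. strict_mono r \<and> g \<in> L2_space M \<and>
          (\<lambda>n. l2_norm M (\<lambda>x. A (u (r n)) x - g x)) \<longlonglongrightarrow> 0)}"

definition hs_ops :: "'a measure \<Rightarrow> 'a l2op set" where
  "hs_ops M = {A \<in> bounded_ops M. (\<lambda>e. (l2_norm M (A e))\<^sup>2) summable_on some_onb M}"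

definition hs_inner :: "'a measure \<Rightarrow> 'a l2op \<Rightarrow> 'a l2op \<Rightarrow> complex" where
  "hs_inner M A B = (\<Sum>\<^sub>\<infinity>e\<in>some_onb M. l2_inner M (A e) (B e))"

text \<open>In the next definition \<open>P\<close> is the absolute value of \<open>A\<close>: it is positive with $P^2 = A^*A$.\<close>

definition trace_class_ops :: "'a measure \<Rightarrow> 'a l2op set" where
  "trace_class_ops M = {A \<in> bounded_ops M. \<exists>P\<in>bounded_ops M. positive_op M P \<and>
     (\<forall>f\<in>L2_space M. \<forall>g\<in>L2_space M. l2_inner M (P f) (P g) = l2_inner M (A f) (A g)) \<and>
     (\<lambda>e. l2_inner M (P e) e) summable_on some_onb M}"

definition l2_trace :: "'a measure \<Rightarrow> 'a l2op \<Rightarrow> complex" where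
  "l2_trace M A = (\<Sum>\<^sub>\<infinity>e\<in>some_onb M. l2_inner M (A e) e)"

text \<open>The duality pairing between the bounded and the trace class operators.\<close>

definition trace_pairing :: "'a measure \<Rightarrow> 'a l2op \<Rightarrow> 'a l2op \<Rightarrow> complex" where
  "trace_pairing M A Y = l2_trace M (A \<circ> Y)"

text \<open>
  The weak* topology is the initial topology for the functionals \<open>\<lambda>A. trace_pairing M A Y\<close>,
  \<open>Y\<close> of trace class.
\<close>

definition weak_star :: "'a measure \<Rightarrow> 'a l2op topology" where
  "weak_star M = pullback_topology (bounded_ops M)
     (\<lambda>A. \<lambda>Y\<in>trace_class_ops M. trace_pairing M A Y)
     (product_topology (\<lambda>_. euclidean) (trace_class_ops M))"


section \<open>Maps between spaces of operators\<close>

text \<open>Bounded linear maps from a space of operators \<open>S\<close>, with the operator norm, to $B(L^2(M))$.\<close>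

definition bounded_linear_on_ops ::
    "'a measure \<Rightarrow> 'a l2op set \<Rightarrow> ('a l2op \<Rightarrow> 'a l2op) \<Rightarrow> bool" where
  "bounded_linear_on_ops M S \<Phi> \<longleftrightarrow>
     (\<forall>A\<in>S. \<Phi> A \<in> bounded_ops M) \<and>
     (\<forall>A\<in>S. \<forall>B\<in>S. \<forall>c.
        op_eq M (\<Phi> (\<lambda>f x. A f x + c * B f x)) (\<lambda>f x. \<Phi> A f x + c * \<Phi> B f x)) \<and>
     (\<exists>C. \<forall>A\<in>S. op_norm M (\<Phi> A) \<le> C * op_norm M A)"

text \<open>
  An $n \times n$ matrix of operators is positive if it is positive as an operator on the
  $n$-fold Hilbert sum of $L^2(M)$.
\<close>

definition positive_op_matrix :: "'a measure \<Rightarrow> nat \<Rightarrow> (nat \<Rightarrow> nat \<Rightarrow> 'a l2op) \<Rightarrow> bool" where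
  "positive_op_matrix M n A \<longleftrightarrow>
     (\<forall>f. (\<forall>i<n. f i \<in> L2_space M) \<longrightarrow>
        (\<Sum>i<n. \<Sum>j<n. l2_inner M (A i j (f j)) (f i)) \<in> \<real>\<^sub>\<ge>\<^sub>0)"

definition completely_positive :: "'a measure \<Rightarrow> ('a l2op \<Rightarrow> 'a l2op) \<Rightarrow> bool" where
  "completely_positive M \<Phi> \<longleftrightarrow>
     (\<forall>n A. (\<forall>i<n. \<forall>j<n. A i j \<in> bounded_ops M) \<and> positive_op_matrix M n A \<longrightarrow>
        positive_op_matrix M n (\<lambda>i j. \<Phi> (A i j)))"

definition unital_map :: "'a measure \<Rightarrow> ('a l2op \<Rightarrow> 'a l2op) \<Rightarrow> bool" where
  "unital_map M \<Phi> \<longleftrightarrow> op_eq M (\<Phi> id) id"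

definition selfadjoint_map :: "'a measure \<Rightarrow> ('a l2op \<Rightarrow> 'a l2op) \<Rightarrow> bool" where
  "selfadjoint_map M \<Phi> \<longleftrightarrow>
     (\<forall>A\<in>hs_ops M. \<forall>B\<in>hs_ops M. hs_inner M (\<Phi> A) B = hs_inner M A (\<Phi> B))"


section \<open>Measurable Schur multipliers\<close>

definition square_measure :: "'a measure \<Rightarrow> ('a \<times> 'a) measure" where
  "square_measure M = completion (M \<Otimes>\<^sub>M M)"

definition Linf_space :: "'a measure \<Rightarrow> ('a \<Rightarrow> complex) set" where
  "Linf_space M = {f \<in> borel_measurable M. \<exists>C. AE x in M. norm (f x) \<le> C}"

definition kernel_op :: "'a measure \<Rightarrow> ('a \<times> 'a \<Rightarrow> complex) \<Rightarrow> 'a l2op" where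
  "kernel_op M f \<xi> = (\<lambda>x. \<integral>y. f (x, y) * \<xi> y \<partial>M)"

text \<open>
  \<open>\<Psi>\<close> is the bounded operator induced on the compact operators by
  $K_f \mapsto K_{\varphi f}$, and \<open>T\<close> is its weak* continuous extension $M_\varphi$.
\<close>

definition schur_multiplier ::
    "'a measure \<Rightarrow> ('a \<times> 'a \<Rightarrow> complex) \<Rightarrow> ('a l2op \<Rightarrow> 'a l2op) \<Rightarrow> bool" where
  "schur_multiplier M \<phi> T \<longleftrightarrow>
     \<phi> \<in> Linf_space (square_measure M) \<and>
     (\<exists>\<Psi>. bounded_linear_on_ops M (compact_ops M) \<Psi> \<and>
        (\<forall>f\<in>L2_space (square_measure M).
           op_eq M (\<Psi> (kernel_op M f)) (kernel_op M (\<lambda>p. \<phi> p * f p))) \<and>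
        (\<forall>A\<in>compact_ops M. op_eq M (T A) (\<Psi> A))) \<and>
     bounded_linear_on_ops M (bounded_ops M) T \<and>
     continuous_map (weak_star M) (weak_star M) T"

definition weak_star_semigroup :: "'a measure \<Rightarrow> (real \<Rightarrow> 'a l2op \<Rightarrow> 'a l2op) \<Rightarrow> bool" where
  "weak_star_semigroup M T \<longleftrightarrow>
     (\<forall>A\<in>bounded_ops M. op_eq M (T 0 A) A) \<and>
     (\<forall>s\<ge>0. \<forall>t\<ge>0. \<forall>A\<in>bounded_ops M. op_eq M (T (s + t) A) (T s (T t A))) \<and>
     (\<forall>A\<in>bounded_ops M. \<forall>Y\<in>trace_class_ops M.
        continuous_on {0..} (\<lambda>t. trace_pairing M (T t A) Y))"

text \<open>The function \<open>\<phi> t\<close> is (a representative of) the symbol of \<open>T t\<close>.\<close>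

definition markov_schur_semigroup ::
    "'a measure \<Rightarrow> (real \<Rightarrow> 'a l2op \<Rightarrow> 'a l2op) \<Rightarrow> (real \<Rightarrow> 'a \<times> 'a \<Rightarrow> complex) \<Rightarrow> bool" where
  "markov_schur_semigroup M T \<phi> \<longleftrightarrow>
     weak_star_semigroup M T \<and>
     (\<forall>t\<ge>0. schur_multiplier M (\<phi> t) (T t) \<and> selfadjoint_map M (T t) \<and>
        unital_map M (T t) \<and> completely_positive M (T t))"


section \<open>Radon measure spaces\<close>

text \<open>
  Locally compact spaces are understood to be Hausdorff. The measure is complete, all Borel sets
  are measurable, and (by completeness and outer regularity) the measure is the completion of its
  restriction to the Borel sets. The support of the measure need not be the whole space.
\<close>

definition second_countable_radon_space :: "'a topology \<Rightarrow> 'a measure \<Rightarrow> bool" where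
  "second_countable_radon_space X M \<longleftrightarrow>
     second_countable X \<and> locally_compact_space X \<and> Hausdorff_space X \<and>
     complete_measure M \<and> space M = topspace X \<and>
     (\<forall>U. openin X U \<longrightarrow> U \<in> sets M) \<and>
     (\<forall>K. compactin X K \<longrightarrow> emeasure M K < \<infinity>) \<and>
     (\<forall>A\<in>sets M. emeasure M A = (INF U\<in>{U. openin X U \<and> A \<subseteq> U}. emeasure M U)) \<and>
     (\<forall>U. openin X U \<longrightarrow> emeasure M U = (SUP K\<in>{K. compactin X K \<and> K \<subseteq> U}. emeasure M K))"


section \<open>The real Hilbert space $\ell^2(I)$\<close>

text \<open>
  HOL cannot quantify existentially over types, so a real Hilbert space whose existence is claimed
  has to live in a fixed type. Up to isometry, the closed linear subspaces of $\ell^2(I)$ are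
  exactly the real Hilbert spaces of Hilbert dimension at most $|I|$.
\<close>

typedef 'i ell2 = "{f :: 'i \<Rightarrow> real. (\<lambda>i. (f i)\<^sup>2) summable_on UNIV}"
  morphisms ell2_nth Abs_ell2
  by (rule exI[of _ "\<lambda>_. 0"]) simp

setup_lifting type_definition_ell2

lemma ell2_summable_mult:
  fixes f g :: "'i \<Rightarrow> real"
  assumes "(\<lambda>i. (f i)\<^sup>2) summable_on UNIV" and "(\<lambda>i. (g i)\<^sup>2) summable_on UNIV"
  shows "(\<lambda>i. f i * g i) summable_on UNIV"
proof -
  have "(\<lambda>i. norm (f i * g i)) summable_on UNIV"
    by (rule abs_summable_product) (use assms in \<open>simp_all flip: power2_eq_square\<close>)
  then show ?thesis
    by (rule summable_on_iff_abs_summable_on_real[THEN iffD2])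
qed

lemma ell2_summable_add:
  fixes f g :: "'i \<Rightarrow> real"
  assumes "(\<lambda>i. (f i)\<^sup>2) summable_on UNIV" and "(\<lambda>i. (g i)\<^sup>2) summable_on UNIV"
  shows "(\<lambda>i. (f i + g i)\<^sup>2) summable_on UNIV"
proof -
  have "(\<lambda>i. (f i)\<^sup>2 + (g i)\<^sup>2 + 2 * (f i * g i)) summable_on UNIV"
    by (intro summable_on_add summable_on_cmult_right ell2_summable_mult assms)
  then show ?thesis
    by (simp add: power2_sum mult.assoc)
qed

lemma ell2_summable_scale:
  fixes f :: "'i \<Rightarrow> real"
  assumes "(\<lambda>i. (f i)\<^sup>2) summable_on UNIV"
  shows "(\<lambda>i. (c * f i)\<^sup>2) summable_on UNIV"
  unfolding power_mult_distrib by (intro summable_on_cmult_right assms)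

instantiation ell2 :: (type) real_inner
begin

lift_definition zero_ell2 :: "'a ell2" is "\<lambda>_. 0" by simp

lift_definition plus_ell2 :: "'a ell2 \<Rightarrow> 'a ell2 \<Rightarrow> 'a ell2" is "\<lambda>f g i. f i + g i"
  by (rule ell2_summable_add)

lift_definition uminus_ell2 :: "'a ell2 \<Rightarrow> 'a ell2" is "\<lambda>f i. - f i" by simp

lift_definition minus_ell2 :: "'a ell2 \<Rightarrow> 'a ell2 \<Rightarrow> 'a ell2" is "\<lambda>f g i. f i - g i"
  subgoal for f g using ell2_summable_add[of f "\<lambda>i. - g i"] by simp
  done

lift_definition scaleR_ell2 :: "real \<Rightarrow> 'a ell2 \<Rightarrow> 'a ell2" is "\<lambda>c f i. c * f i"
  by (rule ell2_summable_scale)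

lift_definition inner_ell2 :: "'a ell2 \<Rightarrow> 'a ell2 \<Rightarrow> real" is "\<lambda>f g. \<Sum>\<^sub>\<infinity>i. f i * g i" .

definition norm_ell2 :: "'a ell2 \<Rightarrow> real" where "norm_ell2 x = sqrt (inner x x)"

definition sgn_ell2 :: "'a ell2 \<Rightarrow> 'a ell2" where "sgn_ell2 x = inverse (norm x) *\<^sub>R x"

definition dist_ell2 :: "'a ell2 \<Rightarrow> 'a ell2 \<Rightarrow> real" where "dist_ell2 x y = norm (x - y)"

definition uniformity_ell2 :: "('a ell2 \<times> 'a ell2) filter" where
  "uniformity_ell2 = (INF e\<in>{0<..}. principal {(x, y). dist x y < e})"

definition open_ell2 :: "'a ell2 set \<Rightarrow> bool" where
  "open_ell2 U \<longleftrightarrow> (\<forall>x\<in>U. \<forall>\<^sub>F (x', y) in uniformity. x' = x \<longrightarrow> y \<in> U)"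

instance
proof
  fix x y z :: "'a ell2" and r s :: real and U :: "'a ell2 set"
  show "x + y + z = x + (y + z)" by transfer (simp add: add.assoc)
  show "x + y = y + x" by transfer (simp add: add.commute)
  show "0 + x = x" by transfer simp
  show "- x + x = 0" by transfer simp
  show "x - y = x + - y" by transfer simp
  show "r *\<^sub>R (x + y) = r *\<^sub>R x + r *\<^sub>R y" by transfer (simp add: distrib_left)
  show "(r + s) *\<^sub>R x = r *\<^sub>R x + s *\<^sub>R x" by transfer (simp add: distrib_right)
  show "r *\<^sub>R s *\<^sub>R x = (r * s) *\<^sub>R x" by transfer (simp add: mult.assoc)
  show "1 *\<^sub>R x = x" by transfer simp
  show "sgn x = inverse (norm x) *\<^sub>R x" by (rule sgn_ell2_def)
  show "dist x y = norm (x - y)" by (rule dist_ell2_def)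
  show "uniformity = (INF e\<in>{0<..}. principal {(x :: 'a ell2, y). dist x y < e})"
    by (rule uniformity_ell2_def)
  show "open U = (\<forall>x\<in>U. \<forall>\<^sub>F (x', y) in uniformity. x' = x \<longrightarrow> y \<in> U)"
    by (rule open_ell2_def)
  show "inner x y = inner y x" by transfer (simp add: mult.commute)
  show "inner (x + y) z = inner x z + inner y z"
    by transfer (simp add: distrib_right infsum_add ell2_summable_mult)
  show "inner (r *\<^sub>R x) y = r * inner x y"
    by transfer (simp add: mult.assoc infsum_cmult_right')
  show "0 \<le> inner x x" by transfer (simp add: infsum_nonneg)
  show "inner x x = 0 \<longleftrightarrow> x = 0"
  proof transfer
    fix f :: "'a \<Rightarrow> real"
    assume f: "(\<lambda>i. (f i)\<^sup>2) summable_on UNIV"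
    show "(\<Sum>\<^sub>\<infinity>i. f i * f i) = 0 \<longleftrightarrow> f = (\<lambda>_. 0)"
    proof
      assume *: "(\<Sum>\<^sub>\<infinity>i. f i * f i) = 0"
      have "f i * f i = 0" for i
        by (rule nonneg_infsum_le_0D[where A = UNIV])
          (use * f in \<open>simp_all add: power2_eq_square\<close>)
      then show "f = (\<lambda>_. 0)" by auto
    qed simp
  qed
  show "norm x = sqrt (inner x x)" by (rule norm_ell2_def)
qed

end

lemma ell2_norm_squared: "(norm x)\<^sup>2 = (\<Sum>\<^sub>\<infinity>i. (ell2_nth x i)\<^sup>2)"
  by (simp only: power2_norm_eq_inner inner_ell2.rep_eq) (simp add: power2_eq_square)

lemma sum_le_ell2_norm:
  assumes "finite F"
  shows "(\<Sum>i\<in>F. (ell2_nth x i)\<^sup>2) \<le> (norm x)\<^sup>2"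
proof -
  have "(\<lambda>i. (ell2_nth x i)\<^sup>2) summable_on UNIV"
    using ell2_nth[of x] by simp
  then have "(\<Sum>i\<in>F. (ell2_nth x i)\<^sup>2) \<le> (\<Sum>\<^sub>\<infinity>i. (ell2_nth x i)\<^sup>2)"
    by (intro finite_sum_le_infsum) (use assms in auto)
  then show ?thesis by (simp only: ell2_norm_squared)
qed

instance ell2 :: (type) complete_space
proof
  fix X :: "nat \<Rightarrow> 'a ell2"
  assume X: "Cauchy X"
  have nth_diff: "ell2_nth (x - y) i = ell2_nth x i - ell2_nth y i" for x y :: "'a ell2" and i
    by (simp add: minus_ell2.rep_eq)
  have nth_le: "\<bar>ell2_nth x i\<bar> \<le> norm x" for x :: "'a ell2" and i
    by (rule power2_le_imp_le) (use sum_le_ell2_norm[of "{i}" x] in simp_all)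
  have "Cauchy (\<lambda>n. ell2_nth (X n) i)" for i
  proof (rule metric_CauchyI)
    fix e :: real assume "0 < e"
    then obtain N where N: "\<And>m n. m \<ge> N \<Longrightarrow> n \<ge> N \<Longrightarrow> dist (X m) (X n) < e"
      using X by (meson metric_CauchyD)
    have "dist (ell2_nth (X m) i) (ell2_nth (X n) i) < e" if "m \<ge> N" "n \<ge> N" for m n
      using N[OF that] nth_le[of "X m - X n" i] by (simp add: dist_norm nth_diff)
    then show "\<exists>N. \<forall>m\<ge>N. \<forall>n\<ge>N. dist (ell2_nth (X m) i) (ell2_nth (X n) i) < e"
      by blast
  qed
  then have "\<forall>i. \<exists>l. (\<lambda>n. ell2_nth (X n) i) \<longlonglongrightarrow> l"
    using convergent_eq_Cauchy by blast
  then obtain l where l: "\<And>i. (\<lambda>n. ell2_nth (X n) i) \<longlonglongrightarrow> l i"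
    by metis
  have bound: "(\<Sum>i\<in>F. (ell2_nth (X n) i - l i)\<^sup>2) \<le> e\<^sup>2"
    if e: "\<And>m. m \<ge> N \<Longrightarrow> dist (X n) (X m) \<le> e" and F: "finite F" for N n e F
  proof (rule LIMSEQ_le_const2)
    show "(\<lambda>m. \<Sum>i\<in>F. (ell2_nth (X n) i - ell2_nth (X m) i)\<^sup>2)
        \<longlonglongrightarrow> (\<Sum>i\<in>F. (ell2_nth (X n) i - l i)\<^sup>2)"
      by (intro tendsto_intros l)
    have "(\<Sum>i\<in>F. (ell2_nth (X n) i - ell2_nth (X m) i)\<^sup>2) \<le> e\<^sup>2" if "m \<ge> N" for m
    proof -
      have "(\<Sum>i\<in>F. (ell2_nth (X n) i - ell2_nth (X m) i)\<^sup>2) \<le> (norm (X n - X m))\<^sup>2"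
        using sum_le_ell2_norm[OF F, of "X n - X m"] by (simp add: nth_diff)
      also have "\<dots> \<le> e\<^sup>2"
        using e[OF that] by (intro power_mono) (simp_all add: dist_norm)
      finally show ?thesis .
    qed
    then show "\<exists>N. \<forall>m\<ge>N. (\<Sum>i\<in>F. (ell2_nth (X n) i - ell2_nth (X m) i)\<^sup>2) \<le> e\<^sup>2"
      by blast
  qed
  have summable: "(\<lambda>i. (ell2_nth (X n) i - l i)\<^sup>2) summable_on UNIV"
    if "\<And>m. m \<ge> N \<Longrightarrow> dist (X n) (X m) \<le> e" for N n e
    by (rule nonneg_bdd_above_summable_on)
      (use bound[OF that] in \<open>auto simp: bdd_above_def\<close>)
  obtain N1 where "\<And>m n. m \<ge> N1 \<Longrightarrow> n \<ge> N1 \<Longrightarrow> dist (X m) (X n) < 1"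
    using X by (meson metric_CauchyD zero_less_one)
  then have "(\<lambda>i. (ell2_nth (X N1) i - l i)\<^sup>2) summable_on UNIV"
    by (intro summable[of N1 N1 1]) (simp add: less_imp_le)
  moreover have "(\<lambda>i. (ell2_nth (X N1) i)\<^sup>2) summable_on UNIV"
    using ell2_nth[of "X N1"] by simp
  ultimately have "(\<lambda>i. (ell2_nth (X N1) i + (- 1) * (ell2_nth (X N1) i - l i))\<^sup>2) summable_on UNIV"
    by (intro ell2_summable_add ell2_summable_scale)
  then have L: "ell2_nth (Abs_ell2 l) = l"
    by (simp add: Abs_ell2_inverse)
  have "X \<longlonglongrightarrow> Abs_ell2 l"
  proof (rule metric_LIMSEQ_I)
    fix e :: real assume "0 < e"
    then obtain N where N: "\<And>m n. m \<ge> N \<Longrightarrow> n \<ge> N \<Longrightarrow> dist (X m) (X n) < e / 2"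
      using X by (meson metric_CauchyD half_gt_zero)
    have "dist (X n) (Abs_ell2 l) < e" if "n \<ge> N" for n
    proof -
      have d: "dist (X n) (X m) \<le> e / 2" if "m \<ge> N" for m
        using N[OF \<open>n \<ge> N\<close> that] by simp
      have "(norm (X n - Abs_ell2 l))\<^sup>2 = (\<Sum>\<^sub>\<infinity>i. (ell2_nth (X n) i - l i)\<^sup>2)"
        by (simp only: ell2_norm_squared nth_diff L)
      also have "\<dots> \<le> (e / 2)\<^sup>2"
        by (rule infsum_le_finite_sums[OF summable[OF d]]) (use bound[OF d] in auto)
      finally have "norm (X n - Abs_ell2 l) \<le> e / 2"
        by (rule power2_le_imp_le) (use \<open>0 < e\<close> in simp)
      then show ?thesis using \<open>0 < e\<close> by (simp add: dist_norm)
    qed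
    then show "\<exists>N. \<forall>n\<ge>N. dist (X n) (Abs_ell2 l) < e" by blast
  qed
  then show "convergent X" by (auto simp: convergent_def)
qed

text \<open>
  A real Hilbert space receiving a map \<open>\<alpha>\<close> from a subset of \<open>'a\<close> can always be replaced by the
  closed linear span of the values of \<open>\<alpha>\<close>, whose Hilbert dimension is at most the cardinality
  of \<open>'a + nat\<close>. So asserting the existence of \<open>H\<close> among the closed subspaces of
  \<open>('a + nat) ell2\<close> is equivalent to asserting the existence of an arbitrary real Hilbert space.
\<close>

definition real_hilbert_in :: "'i ell2 set \<Rightarrow> bool" where
  "real_hilbert_in H \<longleftrightarrow> subspace H \<and> closed H"

definition weak_measurable :: "'a measure \<Rightarrow> 'i ell2 set \<Rightarrow> ('a \<Rightarrow> 'i ell2) \<Rightarrow> bool" where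
  "weak_measurable M H \<alpha> \<longleftrightarrow>
     \<alpha> \<in> space M \<rightarrow> H \<and> (\<forall>h\<in>H. (\<lambda>x. inner (\<alpha> x) h) \<in> borel_measurable M)"

end

theory Submission
  imports Defs
begin

text \<open>
  Choose a strictly positive integrable weight \<open>w\<close>. The measure \<open>N = w M\<close> is finite and has the same
  null sets as \<open>M\<close>, and \<open>\<surd>w\<close> lies in $L^2(M)$, so every bounded function \<open>p\<close> yields a vector \<open>p \<surd>w\<close>.

  On a rank one operator a Schur multiplier is integration against its symbol
  (\<open>schur_multiplier_rank_one\<close>). Selfadjointness makes the symbol real; positivity, applied to
  the rank one operator of \<open>\<surd>w\<close>, makes it a bounded positive semidefinite kernel; and since a rank one
  projection lies below the identity, unitality bounds its averages over squares \<open>A \<times> A\<close> by one.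
  Such a kernel is almost everywhere a Gram kernel \<open>\<langle>\<beta>\<^sub>x, \<beta>\<^sub>y\<rangle>\<close> of vectors of length at most one
  (\<open>kernel_factorisation\<close>): on a countably generated \<open>\<sigma>\<close>-algebra the Gram--Schmidt process for the
  form of the kernel, applied to the indicators of a countable generator, produces the coordinates
  of \<open>\<beta>\<close>. The lengths of the \<open>\<beta>\<^sub>x\<close> are values on the diagonal, a null set in general, and need another
  argument: finite rank projections converge weak* to the identity, and comparing the two sides of
  \<open>T id = id\<close> along them shows that almost every \<open>\<beta>\<^sub>x\<close> is a unit vector
  (\<open>markov_multiplier_factorisation\<close>).

  The image of a rank one operator under a multiplier is the norm limit of the finite rank operators
  given by the coordinates of \<open>\<beta>\<close>, hence composition of multipliers multiplies their kernels
  (\<open>markov_semigroup_kernels\<close>). The kernels \<open>k\<^sub>t\<close> therefore satisfy \<open>k\<^sub>s\<^sub>+\<^sub>t = k\<^sub>s k\<^sub>t\<close> almost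
  everywhere for each pair of times. Weak* continuity at time zero excludes zeros, so that
  \<open>k\<^sub>t = exp (t ln k\<^sub>1)\<close> for each \<open>t\<close> (\<open>k_eq_exp\<close>).

  Now the argument of Schoenberg's theorem applies. Fix a base point \<open>y\<close>. The kernels
  \<open>n \<langle>\<beta>\<^sub>x - \<beta>\<^sub>y, \<beta>\<^sub>x\<^sub>' - \<beta>\<^sub>y\<rangle>\<close>, with \<open>\<beta>\<close> taken at time \<open>1/n\<close>, are positive semidefinite and converge to
  \<open>ln k\<^sub>1(x,x') - ln k\<^sub>1(x,y) - ln k\<^sub>1(y,x')\<close>. After normalisation the limit is bounded, and a second
  application of the factorisation yields \<open>\<alpha>\<close> (\<open>hilbert_embedding\<close>). The lengths of the vectors \<open>\<alpha>\<^sub>x\<close>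
  are again diagonal values; they are recovered because a closed relation between values of a
  measurable map that holds for almost all pairs holds for all pairs of essential points, equal
  ones included (\<open>closed_relation_on_essential_points\<close>).

  If the symbols are continuous, the formula holds at all pairs of essential
  points, where it forces \<open>\<alpha>\<close> to have small oscillation wherever \<open>1 - \<phi>\<^sub>1\<close> is small. Hence \<open>\<alpha>\<close> extends
  continuously to the closure of the set of essential points and, by Tietze's theorem for
  Hilbert space valued maps, to the whole space (\<open>continuous_representative\<close>).
\<close>

section \<open>Positive semidefinite bilinear forms\<close>

text \<open>
  The elementary geometry of a semidefinite inner product. The vectors are functions because all
  the forms that occur live on spaces of functions: bounded functions with the form of a kernel,
  and $L^2$ with the forms of positive operators.
\<close>

locale psd_form =
  fixes V :: "('z \<Rightarrow> 'c::real_vector) set" and B :: "('z \<Rightarrow> 'c) \<Rightarrow> ('z \<Rightarrow> 'c) \<Rightarrow> real"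
  assumes zero_mem: "(\<lambda>_. 0) \<in> V"
    and comb_mem: "f \<in> V \<Longrightarrow> g \<in> V \<Longrightarrow> (\<lambda>z. f z + c *\<^sub>R g z) \<in> V"
    and comb_left: "f \<in> V \<Longrightarrow> g \<in> V \<Longrightarrow> h \<in> V \<Longrightarrow> B (\<lambda>z. f z + c *\<^sub>R g z) h = B f h + c * B g h"
    and sym: "f \<in> V \<Longrightarrow> g \<in> V \<Longrightarrow> B f g = B g f"
    and nonneg: "f \<in> V \<Longrightarrow> 0 \<le> B f f"
begin

lemma zero_left: "h \<in> V \<Longrightarrow> B (\<lambda>_. 0) h = 0"
  using comb_left[OF zero_mem zero_mem, of h 1] by simp

lemma sum_mem: "finite I \<Longrightarrow> (\<And>i. i \<in> I \<Longrightarrow> v i \<in> V) \<Longrightarrow> (\<lambda>z. \<Sum>i\<in>I. c i *\<^sub>R v i z) \<in> V"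
proof (induction I rule: finite_induct)
  case (insert i I)
  then have "(\<lambda>z. (\<Sum>i\<in>I. c i *\<^sub>R v i z) + c i *\<^sub>R v i z) \<in> V"
    by (intro comb_mem) auto
  with insert show ?case by (simp add: add.commute)
qed (simp add: zero_mem)

lemma sum_left:
  "finite I \<Longrightarrow> (\<And>i. i \<in> I \<Longrightarrow> v i \<in> V) \<Longrightarrow> h \<in> V \<Longrightarrow>
     B (\<lambda>z. \<Sum>i\<in>I. c i *\<^sub>R v i z) h = (\<Sum>i\<in>I. c i * B (v i) h)"
proof (induction I rule: finite_induct)
  case (insert i I)
  have "B (\<lambda>z. (\<Sum>i\<in>I. c i *\<^sub>R v i z) + c i *\<^sub>R v i z) h
      = B (\<lambda>z. \<Sum>i\<in>I. c i *\<^sub>R v i z) h + c i * B (v i) h"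
    using insert by (intro comb_left sum_mem) auto
  with insert show ?case by (simp add: add.commute)
qed (simp add: zero_left)

lemma comb_right:
  "f \<in> V \<Longrightarrow> g \<in> V \<Longrightarrow> h \<in> V \<Longrightarrow> B h (\<lambda>z. f z + c *\<^sub>R g z) = B h f + c * B h g"
  using comb_left[of f g h c] sym comb_mem by metis

lemma sum_right:
  "finite I \<Longrightarrow> (\<And>i. i \<in> I \<Longrightarrow> v i \<in> V) \<Longrightarrow> h \<in> V \<Longrightarrow>
     B h (\<lambda>z. \<Sum>i\<in>I. c i *\<^sub>R v i z) = (\<Sum>i\<in>I. c i * B h (v i))"
  using sum_left[of I v h c] sym sum_mem[of I v c] by (simp cong: sum.cong)

lemma square_expand:
  assumes "f \<in> V" "g \<in> V"
  shows "B (\<lambda>z. f z + c *\<^sub>R g z) (\<lambda>z. f z + c *\<^sub>R g z) = B f f + 2 * c * B f g + c\<^sup>2 * B g g"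
  using assms sym[of g f]
  by (simp add: comb_left comb_right comb_mem power2_eq_square algebra_simps)

lemma Cauchy_Schwarz:
  assumes f: "f \<in> V" and g: "g \<in> V"
  shows "(B f g)\<^sup>2 \<le> B f f * B g g"
proof (cases "B g g = 0")
  case True
  have *: "0 \<le> B f f + 2 * c * B f g" for c
    using nonneg[OF comb_mem[OF f g, of c]] square_expand[OF f g, of c] True by simp
  have "B f g = 0"
  proof (rule ccontr)
    assume "B f g \<noteq> 0"
    then show False
      using *[of "- (B f f + 1) / (2 * B f g)"] by (simp add: field_simps)
  qed
  then show ?thesis using True by simp
next
  case False
  then have g0: "B g g > 0" using nonneg[OF g] by simp
  have "0 \<le> B f f + 2 * (- B f g / B g g) * B f g + (- B f g / B g g)\<^sup>2 * B g g"
    using nonneg[OF comb_mem[OF f g]] unfolding square_expand[OF f g] .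
  also have "\<dots> = B f f - (B f g)\<^sup>2 / B g g"
    using g0 by (simp add: field_simps power2_eq_square)
  finally show ?thesis using g0 by (simp add: field_simps)
qed

lemma null_vector: "f \<in> V \<Longrightarrow> g \<in> V \<Longrightarrow> B g g = 0 \<Longrightarrow> B f g = 0"
  using Cauchy_Schwarz[of f g] by simp

text \<open>
  Null vectors are permitted in an orthonormal system, so that the Gram--Schmidt process below
  never has to skip an index.
\<close>

definition ortho :: "('i \<Rightarrow> 'z \<Rightarrow> 'c) \<Rightarrow> 'i set \<Rightarrow> bool" where
  "ortho e I \<longleftrightarrow> (\<forall>i\<in>I. e i \<in> V \<and> B (e i) (e i) \<in> {0, 1}) \<and>
     (\<forall>i\<in>I. \<forall>j\<in>I. i \<noteq> j \<longrightarrow> B (e i) (e j) = 0)"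

lemma ortho_coeff:
  assumes "ortho e I" "f \<in> V" "i \<in> I"
  shows "B f (e i) * B (e i) (e i) = B f (e i)"
  using assms null_vector[of f "e i"] by (auto simp: ortho_def)

lemma ortho_expand:
  assumes e: "ortho e I" and I: "finite I" and J: "i \<in> I"
  shows "B (\<lambda>z. \<Sum>i\<in>I. c i *\<^sub>R e i z) (e i) = c i * B (e i) (e i)"
proof -
  have "B (\<lambda>z. \<Sum>i\<in>I. c i *\<^sub>R e i z) (e i) = (\<Sum>j\<in>I. c j * B (e j) (e i))"
    using e I J by (intro sum_left) (auto simp: ortho_def)
  also have "\<dots> = (\<Sum>j\<in>I. if j = i then c i * B (e i) (e i) else 0)"
    using e J by (intro sum.cong) (auto simp: ortho_def)
  finally show ?thesis using I J by simp
qed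

lemma ortho_sum_square:
  assumes e: "ortho e I" and I: "finite I"
  shows "B (\<lambda>z. \<Sum>i\<in>I. c i *\<^sub>R e i z) (\<lambda>z. \<Sum>i\<in>I. c i *\<^sub>R e i z) = (\<Sum>i\<in>I. (c i)\<^sup>2 * B (e i) (e i))"
    and "B (\<lambda>z. \<Sum>i\<in>I. c i *\<^sub>R e i z) (\<lambda>z. \<Sum>i\<in>I. c i *\<^sub>R e i z) \<le> (\<Sum>i\<in>I. (c i)\<^sup>2)"
proof -
  have V: "\<And>i. i \<in> I \<Longrightarrow> e i \<in> V" using e by (auto simp: ortho_def)
  show *: "B (\<lambda>z. \<Sum>i\<in>I. c i *\<^sub>R e i z) (\<lambda>z. \<Sum>i\<in>I. c i *\<^sub>R e i z) = (\<Sum>i\<in>I. (c i)\<^sup>2 * B (e i) (e i))"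
    by (subst sum_right[OF I V sum_mem[OF I V]])
      (simp_all add: ortho_expand[OF e I] power2_eq_square mult.assoc)
  show "B (\<lambda>z. \<Sum>i\<in>I. c i *\<^sub>R e i z) (\<lambda>z. \<Sum>i\<in>I. c i *\<^sub>R e i z) \<le> (\<Sum>i\<in>I. (c i)\<^sup>2)"
    unfolding * using e by (intro sum_mono) (auto simp: ortho_def)
qed

lemma Bessel:
  assumes e: "ortho e I" and I: "finite I" and f: "f \<in> V"
  shows "(\<Sum>i\<in>I. (B f (e i))\<^sup>2) \<le> B f f"
proof -
  have V: "\<And>i. i \<in> I \<Longrightarrow> e i \<in> V" using e by (auto simp: ortho_def)
  let ?p = "\<lambda>z. \<Sum>i\<in>I. B f (e i) *\<^sub>R e i z"
  have p: "?p \<in> V" by (intro sum_mem I V)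
  have "B f ?p = (\<Sum>i\<in>I. (B f (e i))\<^sup>2)"
    using sum_right[OF I V f] by (simp add: power2_eq_square)
  moreover have "B ?p ?p \<le> (\<Sum>i\<in>I. (B f (e i))\<^sup>2)"
    by (rule ortho_sum_square(2)[OF e I])
  moreover have "0 \<le> B f f + 2 * (-1) * B f ?p + (-1)\<^sup>2 * B ?p ?p"
    using nonneg[OF comb_mem[OF f p, of "-1"]] unfolding square_expand[OF f p] .
  ultimately show ?thesis by simp
qed

text \<open>
  The Gram--Schmidt process. A remainder of length zero is divided by zero and thereby becomes
  the zero vector, which is a legitimate member of an orthonormal system here.
\<close>

fun gram_schmidt :: "(nat \<Rightarrow> 'z \<Rightarrow> 'c) \<Rightarrow> nat \<Rightarrow> 'z \<Rightarrow> 'c" where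
  "gram_schmidt v n =
     (let r = (\<lambda>z. v n z - (\<Sum>k<n. B (v n) (gram_schmidt v k) *\<^sub>R gram_schmidt v k z))
      in (\<lambda>z. (1 / sqrt (B r r)) *\<^sub>R r z))"

declare gram_schmidt.simps [simp del]

text \<open>
  An orthonormal system \<open>e\<close> adapted to the sequence \<open>v\<close>: it is triangular, and with respect to the
  form each \<open>v i\<close> is the sum of its components along \<open>e 0, \<dots>, e i\<close>. Equality holds only modulo null
  vectors, which is why the expansion is stated for the values of the form.
\<close>

theorem Gram_Schmidt:
  assumes v: "\<And>n. v n \<in> V"
  obtains e :: "nat \<Rightarrow> 'z \<Rightarrow> 'c" where "ortho e UNIV"
    and "\<And>i u. u \<in> V \<Longrightarrow> B (v i) u = (\<Sum>k\<le>i. B (v i) (e k) * B (e k) u)"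
    and "\<And>i k. i < k \<Longrightarrow> B (v i) (e k) = 0"
proof -
  define e where "e = gram_schmidt v"
  define p where "p n = (\<lambda>z. \<Sum>k<n. B (v n) (e k) *\<^sub>R e k z)" for n
  define r where "r n = (\<lambda>z. v n z + (-1) *\<^sub>R p n z)" for n
  define s where "s n = sqrt (B (r n) (r n))" for n
  have e: "e n = (\<lambda>z. 0 + (1 / s n) *\<^sub>R r n z)" for n
    unfolding e_def gram_schmidt.simps[of v n] Let_def s_def r_def p_def by simp
  have "ortho e {..<n}" for n
  proof (induction n)
    case (Suc n)
    have eV: "\<And>k. k < n \<Longrightarrow> e k \<in> V" using Suc by (auto simp: ortho_def)
    have pV: "p n \<in> V" unfolding p_def by (intro sum_mem) (auto intro: eV)
    have rV: "r n \<in> V" unfolding r_def by (intro comb_mem v pV)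
    have enV: "e n \<in> V" unfolding e by (intro comb_mem zero_mem rV)
    have en: "B (e n) h = (1 / s n) * B (r n) h" if "h \<in> V" for h
      unfolding e using comb_left[OF zero_mem rV that] zero_left[OF that] by simp
    have "B (r n) (e k) = 0" if "k < n" for k
    proof -
      have "B (p n) (e k) = B (v n) (e k) * B (e k) (e k)"
        unfolding p_def by (rule ortho_expand[OF Suc]) (use that in auto)
      also have "\<dots> = B (v n) (e k)"
        using that by (intro ortho_coeff[OF Suc] v) auto
      finally show ?thesis
        unfolding r_def by (subst comb_left[OF v pV eV[OF that]]) simp
    qed
    then have "B (e n) (e k) = 0" if "k < n" for k
      using en[OF eV[OF that]] that by simp
    moreover from this have "B (e k) (e n) = 0" if "k < n" for k
      using sym[OF eV[OF that] enV] that by simp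
    moreover have "B (e n) (e n) \<in> {0, 1}"
    proof -
      have "B (e n) (e n) = (1 / s n) * ((1 / s n) * B (r n) (r n))"
        using en[OF enV] en[OF rV] sym[OF rV enV] by simp
      moreover have "B (r n) (r n) = (s n)\<^sup>2"
        unfolding s_def using nonneg[OF rV] by simp
      ultimately show ?thesis by (simp add: power2_eq_square)
    qed
    ultimately show ?case
      using Suc enV by (auto simp: ortho_def less_Suc_eq)
  qed (simp add: ortho_def)
  then have o: "ortho e {..<n}" for n .
  have oU: "ortho e UNIV"
    unfolding ortho_def
  proof (intro conjI ballI impI)
    fix i j :: nat
    show "e i \<in> V" "B (e i) (e i) \<in> {0, 1}" using o[of "Suc i"] by (auto simp: ortho_def)
    show "B (e i) (e j) = 0" if "i \<noteq> j"
      using o[of "Suc (max i j)"] that by (auto simp: ortho_def)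
  qed
  have eV: "e k \<in> V" for k using oU by (auto simp: ortho_def)
  have pV: "p n \<in> V" for n unfolding p_def by (intro sum_mem) (auto intro: eV)
  have rV: "r n \<in> V" for n unfolding r_def by (intro comb_mem v pV)
  have exp: "B (v i) u = (\<Sum>k\<le>i. B (v i) (e k) * B (e k) u)" if u: "u \<in> V" for i u
  proof -
    have en: "B (e i) h = (1 / s i) * B (r i) h" if "h \<in> V" for h
      unfolding e using comb_left[OF zero_mem rV that] zero_left[OF that] by simp
    have rp: "B (r i) h = B (v i) h - (\<Sum>k<i. B (v i) (e k) * B (e k) h)" if "h \<in> V" for h
      unfolding r_def comb_left[OF v pV that] unfolding p_def
      by (subst sum_left) (auto intro: eV that)
    \<comment> \<open>The last term of the expansion is the remainder \<open>r i\<close>, also when \<open>r i\<close> is a null vector.\<close>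
    have r0: "B (v i) (e i) * B (e i) u = B (r i) u"
    proof (cases "s i = 0")
      case True
      then have "B (r i) (r i) = 0" by (simp add: s_def)
      then have "B (r i) u = 0" using null_vector[OF u rV] sym[OF u rV] by simp
      then show ?thesis using en[OF u] by simp
    next
      case False
      have "B (v i) (e i) = B (r i) (e i)"
        using rp[OF eV[of i]] oU by (simp add: ortho_def)
      also have "\<dots> = B (e i) (r i)" by (rule sym[OF rV eV])
      also have "\<dots> = (1 / s i) * (s i)\<^sup>2"
        using en[OF rV] nonneg[OF rV] by (simp add: s_def)
      also have "\<dots> = s i" using False by (simp add: power2_eq_square)
      finally show ?thesis using en[OF u] False by simp
    qed
    have "(\<Sum>k\<le>i. B (v i) (e k) * B (e k) u)
        = (\<Sum>k<i. B (v i) (e k) * B (e k) u) + B (v i) (e i) * B (e i) u"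
      by (simp add: lessThan_Suc_atMost[symmetric])
    then show ?thesis using r0 rp[OF u] by simp
  qed
  have "B (v i) (e k) = 0" if "i < k" for i k
  proof -
    have "B (v i) (e k) = (\<Sum>l\<le>i. B (v i) (e l) * B (e l) (e k))" by (rule exp[OF eV])
    also have "\<dots> = 0" using oU that by (intro sum.neutral) (auto simp: ortho_def)
    finally show ?thesis .
  qed
  with oU exp that show thesis by blast
qed

end

section \<open>The sequence space\<close>

lemma ell2_nth_simps [simp]:
  "ell2_nth 0 i = 0" "ell2_nth (x + y) i = ell2_nth x i + ell2_nth y i"
  "ell2_nth (x - y) i = ell2_nth x i - ell2_nth y i" "ell2_nth (c *\<^sub>R x) i = c * ell2_nth x i"
  by (simp_all add: zero_ell2.rep_eq plus_ell2.rep_eq minus_ell2.rep_eq scaleR_ell2.rep_eq)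

lemma ell2_eqI: "(\<And>i. ell2_nth x i = ell2_nth y i) \<Longrightarrow> x = y"
  by (simp add: ell2_nth_inject[symmetric] fun_eq_iff)

lemma inner_ell2_sums: "(\<lambda>i. ell2_nth x i * ell2_nth y i) sums inner (x :: nat ell2) y"
proof -
  have "(\<lambda>i. ell2_nth x i * ell2_nth y i) summable_on UNIV"
    using ell2_nth[of x] ell2_nth[of y] by (intro ell2_summable_mult) auto
  then show ?thesis
    unfolding inner_ell2.rep_eq by (intro has_sum_imp_sums has_sum_infsum)
qed

lemma norm_ell2_sums: "(\<lambda>i. (ell2_nth x i)\<^sup>2) sums (norm (x :: nat ell2))\<^sup>2"
  using inner_ell2_sums[of x x] by (simp add: power2_eq_square dot_square_norm)

definition ell2_of :: "(nat \<Rightarrow> real) \<Rightarrow> nat ell2" where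
  "ell2_of f = (if summable (\<lambda>i. (f i)\<^sup>2) then Abs_ell2 f else 0)"

lemma ell2_nth_of: "summable (\<lambda>i. (f i)\<^sup>2) \<Longrightarrow> ell2_nth (ell2_of f) = f"
  unfolding ell2_of_def
  by (auto intro!: Abs_ell2_inverse simp: summable_on_UNIV_nonneg_real_iff)

text \<open>
  The finitely supported sequences with rational values, represented by association lists, form
  a countable dense set.
\<close>

instance ell2 :: (countable) second_countable_topology
proof
  define q :: "('a \<times> rat) list \<Rightarrow> 'a ell2" where
    "q l = Abs_ell2 (\<lambda>i. case map_of l i of None \<Rightarrow> 0 | Some r \<Rightarrow> of_rat r)" for l
  have nth_q: "ell2_nth (q l) i = (case map_of l i of None \<Rightarrow> 0 | Some r \<Rightarrow> of_rat r)" for l i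
  proof -
    let ?f = "\<lambda>i. case map_of l i of None \<Rightarrow> 0 | Some r \<Rightarrow> (of_rat r :: real)"
    have "(\<lambda>i. (?f i)\<^sup>2) summable_on dom (map_of l)"
      by (intro summable_on_finite finite_dom_map_of)
    then have "(\<lambda>i. (?f i)\<^sup>2) summable_on UNIV"
      by (rule summable_on_cong_neutral[THEN iffD1, rotated -1]) (auto split: option.splits)
    then show ?thesis unfolding q_def by (subst Abs_ell2_inverse) auto
  qed
  have dense: "\<exists>l. dist x (q l) < e" if "e > 0" for x :: "'a ell2" and e
  proof -
    have s: "(\<lambda>i. (ell2_nth x i)\<^sup>2) summable_on UNIV" using ell2_nth[of x] by simp
    have "((\<lambda>i. (ell2_nth x i)\<^sup>2) has_sum (norm x)\<^sup>2) UNIV"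
      using has_sum_infsum[OF s] by (simp add: ell2_norm_squared)
    then have "eventually (\<lambda>F. dist (\<Sum>i\<in>F. (ell2_nth x i)\<^sup>2) ((norm x)\<^sup>2) < e\<^sup>2 / 2) (finite_subsets_at_top UNIV)"
      using that unfolding has_sum_def by (intro tendstoD) auto
    then obtain F where F: "finite F" "dist (\<Sum>i\<in>F. (ell2_nth x i)\<^sup>2) ((norm x)\<^sup>2) < e\<^sup>2 / 2"
      unfolding eventually_finite_subsets_at_top by blast
    \<comment> \<open>With this error in each coordinate of \<open>F\<close>, the coordinates of \<open>F\<close> contribute at most \<open>e\<^sup>2 / 4\<close>.\<close>
    define d where "d = e / (2 * sqrt (real (card F) + 1))"
    have d: "d > 0" using that by (simp add: d_def)
    have "\<exists>r. \<bar>ell2_nth x i - of_rat r\<bar> < d" for i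
    proof -
      obtain r where "ell2_nth x i - d < of_rat r" "of_rat r < ell2_nth x i + d"
        using of_rat_dense[of "ell2_nth x i - d" "ell2_nth x i + d"] d by auto
      then show ?thesis by (intro exI[of _ r]) auto
    qed
    then obtain r where r: "\<And>i. \<bar>ell2_nth x i - of_rat (r i)\<bar> < d" by metis
    obtain l0 where l0: "set l0 = F" using finite_list[OF F(1)] by blast
    define l where "l = map (\<lambda>i. (i, r i)) l0"
    have ml: "map_of l i = (if i \<in> F then Some (r i) else None)" for i
      unfolding l_def using l0 by (auto simp: map_of_map_restrict restrict_map_def)
    have nf: "(norm (x - q l))\<^sup>2 = (\<Sum>\<^sub>\<infinity>i. (ell2_nth (x - q l) i)\<^sup>2)" by (rule ell2_norm_squared)
    also have "\<dots> = (\<Sum>\<^sub>\<infinity>i\<in>F. (ell2_nth (x - q l) i)\<^sup>2) + (\<Sum>\<^sub>\<infinity>i\<in>-F. (ell2_nth (x - q l) i)\<^sup>2)"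
    proof -
      have "(\<lambda>i. (ell2_nth (x - q l) i)\<^sup>2) summable_on UNIV" using ell2_nth[of "x - q l"] by simp
      then have "(\<lambda>i. (ell2_nth (x - q l) i)\<^sup>2) summable_on A" for A
        using summable_on_subset_banach by blast
      then show ?thesis by (subst infsum_Un_disjoint[symmetric]) auto
    qed
    also have "(\<Sum>\<^sub>\<infinity>i\<in>-F. (ell2_nth (x - q l) i)\<^sup>2) = (\<Sum>\<^sub>\<infinity>i\<in>-F. (ell2_nth x i)\<^sup>2)"
      by (rule infsum_cong) (simp add: nth_q ml)
    also have "\<dots> = (norm x)\<^sup>2 - (\<Sum>i\<in>F. (ell2_nth x i)\<^sup>2)"
    proof -
      have sA: "(\<lambda>i. (ell2_nth x i)\<^sup>2) summable_on A" for A
        using s summable_on_subset_banach by blast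
      have "(norm x)\<^sup>2 = (\<Sum>\<^sub>\<infinity>i\<in>F \<union> -F. (ell2_nth x i)\<^sup>2)" by (simp add: ell2_norm_squared)
      also have "\<dots> = (\<Sum>\<^sub>\<infinity>i\<in>F. (ell2_nth x i)\<^sup>2) + (\<Sum>\<^sub>\<infinity>i\<in>-F. (ell2_nth x i)\<^sup>2)"
        by (rule infsum_Un_disjoint) (auto intro: sA)
      finally show ?thesis using F(1) by simp
    qed
    also have "\<dots> < e\<^sup>2 / 2" using F(2) unfolding dist_real_def by linarith
    also have "(\<Sum>\<^sub>\<infinity>i\<in>F. (ell2_nth (x - q l) i)\<^sup>2) \<le> real (card F) * d\<^sup>2"
    proof -
      have "(\<Sum>i\<in>F. (ell2_nth (x - q l) i)\<^sup>2) \<le> (\<Sum>i\<in>F. d\<^sup>2)"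
      proof (rule sum_mono)
        fix i assume "i \<in> F"
        then have "\<bar>ell2_nth (x - q l) i\<bar> \<le> d" using r[of i] by (simp add: nth_q ml)
        then show "(ell2_nth (x - q l) i)\<^sup>2 \<le> d\<^sup>2" using d by (simp add: abs_le_square_iff[symmetric])
      qed
      then show ?thesis using F(1) by simp
    qed
    also have "real (card F) * d\<^sup>2 \<le> e\<^sup>2 / 4"
      unfolding d_def using that by (simp add: power_divide power_mult_distrib field_simps)
    finally have "(norm (x - q l))\<^sup>2 < e\<^sup>2 * (3 / 4)" by simp
    then have "(norm (x - q l))\<^sup>2 < e\<^sup>2" using zero_less_power[OF that, of 2] by linarith
    then have "dist x (q l) < e" using that by (metis dist_norm less_imp_le power2_less_imp_less)
    then show ?thesis by blast
  qed
  define Bs where "Bs = (\<lambda>(l, n). ball (q l) (1 / real (Suc n))) ` UNIV"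
  have "countable Bs" unfolding Bs_def by (intro countable_image) simp
  moreover have "topological_basis Bs"
  proof (rule topological_basisI)
    show "open B" if "B \<in> Bs" for B using that by (auto simp: Bs_def)
    fix O' :: "'a ell2 set" and x assume "open O'" "x \<in> O'"
    then obtain e where e: "e > 0" "ball x e \<subseteq> O'" by (meson openE)
    obtain n where n: "1 / real (Suc n) < e / 2" using nat_approx_posE[of "e/2"] e by auto
    obtain l where l: "dist x (q l) < 1 / real (Suc n)" using dense[of "1 / real (Suc n)" x] by auto
    have "ball (q l) (1 / real (Suc n)) \<subseteq> O'"
    proof
      fix y assume "y \<in> ball (q l) (1 / real (Suc n))"
      then have "dist x y < e" using l n dist_triangle[of x y "q l"] by (simp add: dist_commute)
      then show "y \<in> O'" using e by auto
    qed
    then show "\<exists>B'\<in>Bs. x \<in> B' \<and> B' \<subseteq> O'"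
      using l unfolding Bs_def
      by (intro bexI[of _ "ball (q l) (1 / real (Suc n))"]) (auto simp: dist_commute)
  qed
  ultimately show "\<exists>B::'a ell2 set set. countable B \<and> open = generate_topology B"
    using topological_basis_imp_subbasis by blast
qed

instance ell2 :: (type) banach ..

text \<open>
  The distance to a fixed vector is a countable sum in the coordinates, so preimages of balls are
  measurable; by separability countably many balls suffice.
\<close>

lemma borel_measurable_ell2I:
  fixes \<alpha> :: "'a \<Rightarrow> nat ell2"
  assumes [measurable]: "\<And>i. (\<lambda>x. ell2_nth (\<alpha> x) i) \<in> borel_measurable M"
  shows "\<alpha> \<in> borel_measurable M"
proof (rule borel_measurableI)
  fix S :: "nat ell2 set" assume "open S"
  obtain D :: "nat ell2 set" where
    basis: "topological_basis (case_prod ball ` (D \<times> (\<rat> \<inter> {0<..})))" and D: "countable D"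
    using balls_countable_basis by blast
  then obtain BB where BB: "BB \<subseteq> case_prod ball ` (D \<times> (\<rat> \<inter> {0<..}))" "\<Union>BB = S"
    using \<open>open S\<close> unfolding topological_basis_def by metis
  have "countable (case_prod ball ` (D \<times> (\<rat> \<inter> {(0::real)<..})))"
    using D countable_rat by blast
  then have c: "countable BB" using BB(1) countable_subset by blast
  have n: "norm (\<alpha> x - v) = sqrt (\<Sum>i. (ell2_nth (\<alpha> x) i - ell2_nth v i)\<^sup>2)" for x v
    using norm_ell2_sums[of "\<alpha> x - v"] by (simp add: sums_iff)
  have "\<alpha> -` b \<inter> space M \<in> sets M" if "b \<in> BB" for b
  proof -
    obtain v r where "b = ball v r" using BB(1) \<open>b \<in> BB\<close> by auto
    then have "\<alpha> -` b \<inter> space M = {x \<in> space M. norm (\<alpha> x - v) < r}"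
      by (auto simp: dist_norm norm_minus_commute)
    also have "\<dots> \<in> sets M" unfolding n by measurable
    finally show ?thesis .
  qed
  then have "(\<Union>b\<in>BB. \<alpha> -` b \<inter> space M) \<in> sets M"
    by (intro sets.countable_UN'' c) auto
  also have "(\<Union>b\<in>BB. \<alpha> -` b \<inter> space M) = \<alpha> -` S \<inter> space M" using BB(2) by auto
  finally show "\<alpha> -` S \<inter> space M \<in> sets M" .
qed

lemma norm_ell2_nth_le: "\<bar>ell2_nth x i\<bar> \<le> norm x"
  by (rule power2_le_imp_le) (use sum_le_ell2_norm[of "{i}" x] in simp_all)

lemma continuous_ell2_nth: "continuous_on UNIV (\<lambda>x. ell2_nth x i)"
proof (rule linear_continuous_on, rule bounded_linear_intro[where K = 1])
  show "norm (ell2_nth x i) \<le> norm x * 1" for x :: "'a ell2"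
    using norm_ell2_nth_le[of x i] by simp
qed simp_all

lemma borel_measurable_ell2_nth [measurable]:
  "\<alpha> \<in> borel_measurable M \<Longrightarrow> (\<lambda>x. ell2_nth (\<alpha> x) i) \<in> borel_measurable M"
  for \<alpha> :: "'a \<Rightarrow> nat ell2"
  using measurable_compose[OF _ borel_measurable_continuous_onI[OF continuous_ell2_nth]] .

section \<open>Functions on a product that are determined almost everywhere by rectangles\<close>

text \<open>
  The sets on which the two integrals agree form a Dynkin system.
\<close>

lemma AE_eq_if_integrals_eq_on_generator:
  fixes f g :: "'z \<Rightarrow> real"
  assumes f: "integrable Q f" and g: "integrable Q g"
    and E: "sets Q = sigma_sets (space Q) E" "Int_stable E" "E \<subseteq> Pow (space Q)" "space Q \<in> E"
    and eq: "\<And>R. R \<in> E \<Longrightarrow> (\<integral>z. indicator R z * f z \<partial>Q) = (\<integral>z. indicator R z * g z \<partial>Q)"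
  shows "AE z in Q. f z = g z"
proof (rule density_unique_real[OF f g])
  fix A assume "A \<in> sets Q"
  then have A: "A \<in> sigma_sets (space Q) E" using E(1) by simp
  have int: "integrable Q (\<lambda>z. indicator B z * f z)" "integrable Q (\<lambda>z. indicator B z * g z)"
    if "B \<in> sets Q" for B
    using integrable_mult_indicator[OF that f] integrable_mult_indicator[OF that g] by simp_all
  show "(LINT x:A|Q. f x) = (LINT x:A|Q. g x)"
  proof (use E(2,3) A in \<open>induction rule: sigma_sets_induct_disjoint\<close>)
    case (basic A)
    then show ?case using eq by (simp add: set_lebesgue_integral_def)
  next
    case (compl A)
    have A: "A \<in> sets Q" using compl E(1) by simp
    have "(LINT x:(space Q - A)|Q. h x) = (\<integral>z. indicator (space Q) z * h z \<partial>Q) - (LINT x:A|Q. h x)"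
      if "integrable Q h" for h :: "'z \<Rightarrow> real"
    proof -
      have "(LINT x:(space Q - A)|Q. h x) = (\<integral>z. indicator (space Q) z * h z - indicator A z * h z \<partial>Q)"
        unfolding set_lebesgue_integral_def
        using sets.sets_into_space[OF A]
        by (intro Bochner_Integration.integral_cong) (auto split: split_indicator)
      also have "\<dots> = (\<integral>z. indicator (space Q) z * h z \<partial>Q) - (LINT x:A|Q. h x)"
        unfolding set_lebesgue_integral_def
        using integrable_mult_indicator[OF A that] integrable_mult_indicator[OF sets.top that]
        by simp
      finally show ?thesis .
    qed
    then show ?case using compl eq[OF E(4)] f g by simp
  next
    case (union A)
    have A: "A i \<in> sets Q" for i using union E(1) by auto
    have "(LINT x:(\<Union>i. A i)|Q. h x) = (\<Sum>i. (LINT x:(A i)|Q. h x))"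
      if "integrable Q h" for h :: "'z \<Rightarrow> real"
    proof (rule lebesgue_integral_countable_add)
      show "set_integrable Q (\<Union>i. A i) h"
        unfolding set_integrable_def using A by (intro integrable_mult_indicator that) auto
    qed (use union(1) A in \<open>auto simp: disjoint_family_on_def\<close>)
    then show ?case using union f g by simp
  qed (simp add: set_lebesgue_integral_def)
qed

lemma rectangle_generator:
  assumes E: "sets N = sigma_sets (space N) E" "Int_stable E" "E \<subseteq> Pow (space N)" "space N \<in> E"
  defines "R \<equiv> {a \<times> b | a b. a \<in> E \<and> b \<in> E}"
  shows "sets (N \<Otimes>\<^sub>M N) = sigma_sets (space (N \<Otimes>\<^sub>M N)) R" "Int_stable R"
    "R \<subseteq> Pow (space (N \<Otimes>\<^sub>M N))" "space (N \<Otimes>\<^sub>M N) \<in> R"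
proof -
  show "R \<subseteq> Pow (space (N \<Otimes>\<^sub>M N))" unfolding R_def space_pair_measure using E(3) by auto
  moreover have "sets (N \<Otimes>\<^sub>M N) = sets (sigma (space N \<times> space N) R)"
    unfolding R_def
    by (rule sets_pair_eq[where Ca = "{space N}" and Cb = "{space N}"]) (use E in auto)
  ultimately show "sets (N \<Otimes>\<^sub>M N) = sigma_sets (space (N \<Otimes>\<^sub>M N)) R"
    by (simp add: space_pair_measure)
  show "space (N \<Otimes>\<^sub>M N) \<in> R" unfolding R_def space_pair_measure using E(4) by auto
  show "Int_stable R"
  proof (rule Int_stableI)
    fix r s assume "r \<in> R" "s \<in> R"
    then obtain a b c d where "r = a \<times> b" "s = c \<times> d" "a \<in> E" "b \<in> E" "c \<in> E" "d \<in> E"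
      unfolding R_def by auto
    then have "r \<inter> s = (a \<inter> c) \<times> (b \<inter> d)" "a \<inter> c \<in> E" "b \<inter> d \<in> E"
      using Int_stableD[OF E(2)] by auto
    then show "r \<inter> s \<in> R" unfolding R_def by blast
  qed
qed

lemma AE_eq_if_integrals_eq_on_rectangles:
  fixes f g :: "'a \<times> 'a \<Rightarrow> real"
  assumes f: "integrable (N \<Otimes>\<^sub>M N) f" and g: "integrable (N \<Otimes>\<^sub>M N) g"
    and E: "sets N = sigma_sets (space N) E" "Int_stable E" "E \<subseteq> Pow (space N)" "space N \<in> E"
    and eq: "\<And>a b. a \<in> E \<Longrightarrow> b \<in> E \<Longrightarrow>
      (\<integral>z. f z * indicator a (fst z) * indicator b (snd z) \<partial>(N \<Otimes>\<^sub>M N))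
      = (\<integral>z. g z * indicator a (fst z) * indicator b (snd z) \<partial>(N \<Otimes>\<^sub>M N))"
  shows "AE z in N \<Otimes>\<^sub>M N. f z = g z"
proof (rule AE_eq_if_integrals_eq_on_generator[OF f g rectangle_generator[OF E]], clarify)
  fix a b assume ab: "a \<in> E" "b \<in> E"
  have ind: "indicator (a \<times> b) z * h z = h z * indicator a (fst z) * indicator b (snd z)"
    for z and h :: "'a \<times> 'a \<Rightarrow> real"
    by (cases z) (simp split: split_indicator)
  show "(\<integral>z. indicator (a \<times> b) z * f z \<partial>(N \<Otimes>\<^sub>M N)) = (\<integral>z. indicator (a \<times> b) z * g z \<partial>(N \<Otimes>\<^sub>M N))"
    unfolding ind by (rule eq[OF ab])
qed

section \<open>Points whose neighbourhoods have positive measure\<close>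

text \<open>
  It suffices to remove the preimages of those members of a countable basis whose preimage is null.
\<close>

lemma essential_points:
  fixes F :: "'a \<Rightarrow> 'y::second_countable_topology"
  assumes [measurable]: "F \<in> borel_measurable N"
  obtains G where "G \<in> sets N" "AE x in N. x \<in> G"
    "\<And>x U. x \<in> G \<Longrightarrow> open U \<Longrightarrow> F x \<in> U \<Longrightarrow> emeasure N (F -` U \<inter> space N) \<noteq> 0"
proof -
  obtain B :: "'y set set" where B: "countable B" "topological_basis B"
    using ex_countable_basis by blast
  define B0 where "B0 = {b \<in> B. emeasure N (F -` b \<inter> space N) = 0}"
  have m: "F -` b \<inter> space N \<in> sets N" if "open b" for b
    using that by (intro measurable_sets[OF assms]) auto
  have B0: "countable B0" "\<And>b. b \<in> B0 \<Longrightarrow> F -` b \<inter> space N \<in> null_sets N"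
    using B m topological_basis_open[OF B(2)] by (auto simp: B0_def)
  have null: "(\<Union>b\<in>B0. F -` b \<inter> space N) \<in> null_sets N"
    by (intro null_sets_UN' B0)
  define G where "G = space N - (\<Union>b\<in>B0. F -` b \<inter> space N)"
  show thesis
  proof
    show "G \<in> sets N" unfolding G_def using null by auto
    show "AE x in N. x \<in> G" using AE_not_in[OF null] AE_space by eventually_elim (auto simp: G_def)
    fix x U assume x: "x \<in> G" "open U" "F x \<in> U"
    then obtain b where b: "b \<in> B" "F x \<in> b" "b \<subseteq> U"
      using topological_basisE[OF B(2), of U "F x"] by metis
    then have "b \<notin> B0" using x by (auto simp: G_def)
    then have "emeasure N (F -` b \<inter> space N) \<noteq> 0" using b by (auto simp: B0_def)
    moreover have "emeasure N (F -` b \<inter> space N) \<le> emeasure N (F -` U \<inter> space N)"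
      using b m x by (intro emeasure_mono) auto
    ultimately show "emeasure N (F -` U \<inter> space N) \<noteq> 0" by auto
  qed
qed

lemma (in sigma_finite_measure) AE_pair_inhabits_rectangle:
  assumes P: "AE z in M \<Otimes>\<^sub>M M. P z"
    and A: "A \<in> sets M" "emeasure M A \<noteq> 0" and B: "B \<in> sets M" "emeasure M B \<noteq> 0"
  shows "\<exists>x\<in>A. \<exists>y\<in>B. P (x, y)"
proof (rule ccontr)
  assume "\<not> ?thesis"
  then have "\<And>z. P z \<Longrightarrow> z \<notin> A \<times> B" by auto
  with P have "AE z in M \<Otimes>\<^sub>M M. z \<notin> A \<times> B" by (auto elim: eventually_mono)
  moreover have "A \<times> B \<in> sets (M \<Otimes>\<^sub>M M)" using A B by auto
  ultimately have "emeasure (M \<Otimes>\<^sub>M M) (A \<times> B) = 0"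
    by (simp add: AE_iff_null_sets null_setsD1)
  then show False using A B by (simp add: emeasure_pair_measure_Times)
qed

text \<open>
  If a closed relation fails at the values of two essential points, it fails on a product of
  neighbourhoods of these values, whose preimage is not null. The case \<open>x = y\<close> is included: this
  is how an almost everywhere statement on the square yields information on the diagonal.
\<close>

lemma (in sigma_finite_measure) closed_relation_on_essential_points:
  fixes F :: "'a \<Rightarrow> 'y::second_countable_topology"
  assumes [measurable]: "F \<in> borel_measurable M"
  obtains G where "G \<in> sets M" "AE x in M. x \<in> G"
    "\<And>C x y. closed C \<Longrightarrow> AE z in M \<Otimes>\<^sub>M M. (F (fst z), F (snd z)) \<in> C \<Longrightarrow>
       x \<in> G \<Longrightarrow> y \<in> G \<Longrightarrow> (F x, F y) \<in> C"
proof -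
  obtain G where G: "G \<in> sets M" "AE x in M. x \<in> G"
    "\<And>x U. x \<in> G \<Longrightarrow> open U \<Longrightarrow> F x \<in> U \<Longrightarrow> emeasure M (F -` U \<inter> space M) \<noteq> 0"
    using essential_points[OF assms] by blast
  show thesis
  proof (rule that[OF G(1,2)], rule ccontr)
    fix C :: "('y \<times> 'y) set" and x y
    assume C: "closed C" and ae: "AE z in M \<Otimes>\<^sub>M M. (F (fst z), F (snd z)) \<in> C"
      and xy: "x \<in> G" "y \<in> G" and n: "(F x, F y) \<notin> C"
    obtain U V where UV: "open U" "open V" "(F x, F y) \<in> U \<times> V" "U \<times> V \<subseteq> - C"
      using open_prod_elim[of "- C" "(F x, F y)"] C n by (metis ComplI open_Compl)
    obtain x' y' where "x' \<in> F -` U \<inter> space M" "y' \<in> F -` V \<inter> space M" "(F x', F y') \<in> C"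
      using AE_pair_inhabits_rectangle[OF ae, of "F -` U \<inter> space M" "F -` V \<inter> space M"]
        G(3)[OF xy(1) UV(1)] G(3)[OF xy(2) UV(2)] UV
      by (auto intro!: measurable_sets[OF assms])
    then show False using UV by auto
  qed
qed

section \<open>Positive semidefinite kernels\<close>

definition bounded_fun :: "'a measure \<Rightarrow> ('a \<Rightarrow> real) set" where
  "bounded_fun N = {p \<in> borel_measurable N. \<exists>c. \<forall>x. \<bar>p x\<bar> \<le> c}"

definition kform :: "'a measure \<Rightarrow> ('a \<times> 'a \<Rightarrow> real) \<Rightarrow> ('a \<Rightarrow> real) \<Rightarrow> ('a \<Rightarrow> real) \<Rightarrow> real" where
  "kform N K p q = (\<integral>z. K z * p (fst z) * q (snd z) \<partial>(N \<Otimes>\<^sub>M N))"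

text \<open>
  Positivity is tested by integration and not on finite sets of points, because the symbol of a
  multiplier is only determined almost everywhere.
\<close>

definition psd_kernel :: "'a measure \<Rightarrow> ('a \<times> 'a \<Rightarrow> real) \<Rightarrow> bool" where
  "psd_kernel N K \<longleftrightarrow> K \<in> borel_measurable (N \<Otimes>\<^sub>M N) \<and> (\<exists>c. \<forall>z. \<bar>K z\<bar> \<le> c) \<and>
     (\<forall>p\<in>bounded_fun N. \<forall>q\<in>bounded_fun N. kform N K p q = kform N K q p) \<and>
     (\<forall>p\<in>bounded_fun N. 0 \<le> kform N K p p)"

lemma bounded_fun_measurable: "p \<in> bounded_fun N \<Longrightarrow> p \<in> borel_measurable N"
  by (simp add: bounded_fun_def)

lemma bounded_fun_bound: "p \<in> bounded_fun N \<Longrightarrow> \<exists>c\<ge>0. \<forall>x. \<bar>p x\<bar> \<le> c"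
proof -
  assume "p \<in> bounded_fun N"
  then obtain c where c: "\<And>x. \<bar>p x\<bar> \<le> c" by (auto simp: bounded_fun_def)
  with order_trans[OF abs_ge_zero c[of undefined]] show ?thesis by blast
qed

lemma indicator_bounded_fun: "A \<in> sets N \<Longrightarrow> indicator A \<in> bounded_fun N"
  unfolding bounded_fun_def by (auto intro!: exI[of _ 1] split: split_indicator)

lemma comb_bounded_fun:
  assumes "p \<in> bounded_fun N" "q \<in> bounded_fun N"
  shows "(\<lambda>x. p x + c * q x) \<in> bounded_fun N"
proof -
  obtain a b where "\<And>x. \<bar>p x\<bar> \<le> a" "\<And>x. \<bar>q x\<bar> \<le> b" using assms unfolding bounded_fun_def by blast
  then have "\<bar>p x + c * q x\<bar> \<le> a + \<bar>c\<bar> * b" for x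
    by (intro order_trans[OF abs_triangle_ineq] add_mono) (auto simp: abs_mult mult_left_mono)
  moreover have "(\<lambda>x. p x + c * q x) \<in> borel_measurable N"
    using assms unfolding bounded_fun_def by (auto intro!: borel_measurable_add borel_measurable_times)
  ultimately show ?thesis unfolding bounded_fun_def by blast
qed

context finite_measure
begin

lemma finite_square: "finite_measure (M \<Otimes>\<^sub>M M)"
  by (intro finite_measure_pair_measure finite_measure_axioms)

lemma pair_sf: "pair_sigma_finite M M" ..

lemma integrable_bounded_fun: "p \<in> bounded_fun M \<Longrightarrow> integrable M p"
proof -
  assume p: "p \<in> bounded_fun M"
  then obtain c where "\<And>x. \<bar>p x\<bar> \<le> c" by (auto simp: bounded_fun_def)
  then show ?thesis using bounded_fun_measurable[OF p] by (intro integrable_const_bound[of _ c]) auto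
qed

lemma integrable_bounded_kernel:
  fixes K :: "'a \<times> 'a \<Rightarrow> real"
  assumes "K \<in> borel_measurable (M \<Otimes>\<^sub>M M)" "\<And>z. \<bar>K z\<bar> \<le> c" "p \<in> bounded_fun M" "q \<in> bounded_fun M"
  shows "integrable (M \<Otimes>\<^sub>M M) (\<lambda>z. K z * p (fst z) * q (snd z))"
proof -
  interpret Q: finite_measure "M \<Otimes>\<^sub>M M" by (rule finite_square)
  obtain a where a: "\<And>x. \<bar>p x\<bar> \<le> a" using assms(3) by (auto simp: bounded_fun_def)
  obtain b where b: "\<And>x. \<bar>q x\<bar> \<le> b" using assms(4) by (auto simp: bounded_fun_def)
  have [measurable]: "p \<in> borel_measurable M" "q \<in> borel_measurable M"
    using assms bounded_fun_measurable by auto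
  note assms(1)[measurable]
  have "\<bar>K z * p (fst z) * q (snd z)\<bar> \<le> c * a * b" for z
    unfolding abs_mult
    using assms(2)[of z] a[of "fst z"] b[of "snd z"]
    by (intro mult_mono) (auto intro: order_trans[OF abs_ge_zero] mult_nonneg_nonneg)
  then show ?thesis
    by (intro Q.integrable_const_bound[of _ "c * a * b"]) auto
qed

lemma kform_comb_left:
  assumes K: "K \<in> borel_measurable (M \<Otimes>\<^sub>M M)" "\<And>z. \<bar>K z\<bar> \<le> c0"
    and p: "p \<in> bounded_fun M" "q \<in> bounded_fun M" "r \<in> bounded_fun M"
  shows "kform M K (\<lambda>x. p x + c * q x) r = kform M K p r + c * kform M K q r"
proof -
  have "kform M K (\<lambda>x. p x + c * q x) r
      = (\<integral>z. K z * p (fst z) * r (snd z) + c * (K z * q (fst z) * r (snd z)) \<partial>(M \<Otimes>\<^sub>M M))"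
    unfolding kform_def by (rule Bochner_Integration.integral_cong) (auto simp: algebra_simps)
  also have "\<dots> = kform M K p r + c * kform M K q r"
    unfolding kform_def
    using integrable_bounded_kernel[OF K p(1,3)] integrable_bounded_kernel[OF K p(2,3)]
    by simp
  finally show ?thesis .
qed

lemma psd_form_kform:
  assumes "psd_kernel M K"
  shows "psd_form (bounded_fun M) (kform M K)"
proof
  show "(\<lambda>_. 0) \<in> bounded_fun M" by (auto simp: bounded_fun_def)
  fix p q r :: "'a \<Rightarrow> real" and c
  show "(\<lambda>z. p z + c *\<^sub>R q z) \<in> bounded_fun M" if "p \<in> bounded_fun M" "q \<in> bounded_fun M"
    using comb_bounded_fun[OF that, of c] by simp
  show "kform M K (\<lambda>z. p z + c *\<^sub>R q z) r = kform M K p r + c * kform M K q r"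
    if "p \<in> bounded_fun M" "q \<in> bounded_fun M" "r \<in> bounded_fun M"
  proof -
    obtain c0 where "\<And>z. \<bar>K z\<bar> \<le> c0" using assms by (auto simp: psd_kernel_def)
    then show ?thesis
      using kform_comb_left[of K c0 p q r c] that assms by (simp add: psd_kernel_def)
  qed
qed (use assms in \<open>auto simp: psd_kernel_def\<close>)

lemma kform_iterated:
  assumes K: "K \<in> borel_measurable (M \<Otimes>\<^sub>M M)" "\<And>z. \<bar>K z\<bar> \<le> c"
    and p: "p \<in> bounded_fun M" "q \<in> bounded_fun M"
  shows "kform M K p q = (\<integral>x. p x * (\<integral>y. K (x, y) * q y \<partial>M) \<partial>M)"
proof -
  interpret P: pair_sigma_finite M M by (rule pair_sf)
  have "kform M K p q = (\<integral>x. (\<integral>y. K (x, y) * p x * q y \<partial>M) \<partial>M)"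
    unfolding kform_def P.integral_fst'[OF integrable_bounded_kernel[OF K p], symmetric] by simp
  also have "\<dots> = (\<integral>x. p x * (\<integral>y. K (x, y) * q y \<partial>M) \<partial>M)"
  proof (rule Bochner_Integration.integral_cong)
    show "(\<integral>y. K (x, y) * p x * q y \<partial>M) = p x * (\<integral>y. K (x, y) * q y \<partial>M)" for x
      by (subst integral_mult_right_zero[symmetric])
        (rule Bochner_Integration.integral_cong, simp_all)
  qed simp
  finally show ?thesis .
qed

lemma integral_inner_kernel:
  fixes g :: "'a \<Rightarrow> nat ell2"
  assumes g: "integrable M g"
  shows "integrable (M \<Otimes>\<^sub>M M) (\<lambda>z. inner (g (fst z)) (g (snd z)))"
    and "(\<integral>z. inner (g (fst z)) (g (snd z)) \<partial>(M \<Otimes>\<^sub>M M)) = (norm (\<integral>x. g x \<partial>M))\<^sup>2"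
proof -
  interpret P: pair_sigma_finite M M by (rule pair_sf)
  have [measurable]: "g \<in> borel_measurable M" using g by auto
  have i: "integrable M (\<lambda>y. inner (g x) (g y))" for x
    using g by (intro integrable_inner_right)
  show int: "integrable (M \<Otimes>\<^sub>M M) (\<lambda>z. inner (g (fst z)) (g (snd z)))"
  proof (rule P.Fubini_integrable)
    show "integrable M (\<lambda>x. \<integral>y. norm (inner (g (fst (x, y))) (g (snd (x, y)))) \<partial>M)"
    proof (rule Bochner_Integration.integrable_bound)
      show "integrable M (\<lambda>x. norm (g x) * (\<integral>y. norm (g y) \<partial>M))"
        using g by (intro integrable_mult_left integrable_norm)
      show "AE x in M. norm (\<integral>y. norm (inner (g (fst (x, y))) (g (snd (x, y)))) \<partial>M)
          \<le> norm (norm (g x) * (\<integral>y. norm (g y) \<partial>M))"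
      proof (rule AE_I2)
        fix x
        have "(\<integral>y. norm (inner (g x) (g y)) \<partial>M) \<le> (\<integral>y. norm (g x) * norm (g y) \<partial>M)"
          using g i by (intro integral_mono integrable_norm integrable_mult_right)
            (auto simp: Cauchy_Schwarz_ineq2)
        then show "norm (\<integral>y. norm (inner (g (fst (x, y))) (g (snd (x, y)))) \<partial>M)
          \<le> norm (norm (g x) * (\<integral>y. norm (g y) \<partial>M))" by simp
      qed
    qed measurable
  qed (use i in auto)
  have "(\<integral>z. inner (g (fst z)) (g (snd z)) \<partial>(M \<Otimes>\<^sub>M M)) = (\<integral>x. (\<integral>y. inner (g x) (g y) \<partial>M) \<partial>M)"
    unfolding P.integral_fst'[OF int, symmetric] by simp
  also have "\<dots> = (\<integral>x. inner (g x) (\<integral>y. g y \<partial>M) \<partial>M)"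
    using g by (simp add: integral_inner_right)
  also have "\<dots> = inner (\<integral>x. g x \<partial>M) (\<integral>y. g y \<partial>M)"
    using g by (simp add: integral_inner_left)
  finally show "(\<integral>z. inner (g (fst z)) (g (snd z)) \<partial>(M \<Otimes>\<^sub>M M)) = (norm (\<integral>x. g x \<partial>M))\<^sup>2"
    by (simp add: power2_norm_eq_inner)
qed

text \<open>
  The form of a Gram kernel at \<open>p\<close> is the squared length of the integral of \<open>p g\<close>.
\<close>

lemma psd_kernel_inner:
  fixes g :: "'a \<Rightarrow> nat ell2"
  assumes [measurable]: "g \<in> borel_measurable M" and b: "\<And>x. norm (g x) \<le> b"
  shows "psd_kernel M (\<lambda>z. inner (g (fst z)) (g (snd z)))"
  unfolding psd_kernel_def
proof (intro conjI ballI)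
  show "(\<lambda>z. inner (g (fst z)) (g (snd z))) \<in> borel_measurable (M \<Otimes>\<^sub>M M)" by measurable
  have "\<bar>inner (g (fst z)) (g (snd z))\<bar> \<le> b * b" for z
    by (intro order_trans[OF Cauchy_Schwarz_ineq2] mult_mono b)
      (auto intro: order_trans[OF norm_ge_zero b])
  then show "\<exists>c. \<forall>z. \<bar>inner (g (fst z)) (g (snd z))\<bar> \<le> c" by blast
  interpret P: pair_sigma_finite M M by (rule pair_sf)
  fix p q assume p: "p \<in> bounded_fun M" and q: "q \<in> bounded_fun M"
  note [measurable] = bounded_fun_measurable[OF p] bounded_fun_measurable[OF q]
  show "kform M (\<lambda>z. inner (g (fst z)) (g (snd z))) p q = kform M (\<lambda>z. inner (g (fst z)) (g (snd z))) q p"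
    unfolding kform_def
    by (subst P.integral_product_swap[symmetric])
      (auto simp: split_beta' inner_commute mult.commute mult.left_commute)
next
  fix p assume p: "p \<in> bounded_fun M"
  note [measurable] = bounded_fun_measurable[OF p]
  obtain c where c: "\<And>x. \<bar>p x\<bar> \<le> c" using p by (auto simp: bounded_fun_def)
  have "norm (p x *\<^sub>R g x) \<le> c * b" for x
    unfolding norm_scaleR by (intro mult_mono c b) (auto intro: order_trans[OF abs_ge_zero c])
  then have "integrable M (\<lambda>x. p x *\<^sub>R g x)"
    by (intro integrable_const_bound[of _ "c * b"]) auto
  from integral_inner_kernel(2)[OF this]
  have "kform M (\<lambda>z. inner (g (fst z)) (g (snd z))) p p = (norm (\<integral>x. p x *\<^sub>R g x \<partial>M))\<^sup>2"
    by (simp add: kform_def mult.commute mult.left_commute)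
  then show "0 \<le> kform M (\<lambda>z. inner (g (fst z)) (g (snd z))) p p" by simp
qed

lemma psd_kernel_limit:
  assumes K: "\<And>n. psd_kernel M (K n)" and c: "\<And>n. AE z in M \<Otimes>\<^sub>M M. \<bar>K n z\<bar> \<le> c"
    and L[measurable]: "L \<in> borel_measurable (M \<Otimes>\<^sub>M M)" and Lc: "\<And>z. \<bar>L z\<bar> \<le> c'"
    and lim: "AE z in M \<Otimes>\<^sub>M M. (\<lambda>n. K n z) \<longlonglongrightarrow> L z"
  shows "psd_kernel M L"
proof -
  interpret Q: finite_measure "M \<Otimes>\<^sub>M M" by (rule finite_square)
  have [measurable]: "K n \<in> borel_measurable (M \<Otimes>\<^sub>M M)" for n using K by (simp add: psd_kernel_def)
  have l: "(\<lambda>n. kform M (K n) p q) \<longlonglongrightarrow> kform M L p q" if p: "p \<in> bounded_fun M" and q: "q \<in> bounded_fun M" for p q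
  proof -
    note [measurable] = bounded_fun_measurable[OF p] bounded_fun_measurable[OF q]
    obtain a where a: "\<And>x. \<bar>p x\<bar> \<le> a" using p by (auto simp: bounded_fun_def)
    obtain b where b: "\<And>x. \<bar>q x\<bar> \<le> b" using q by (auto simp: bounded_fun_def)
    show ?thesis
      unfolding kform_def
    proof (rule integral_dominated_convergence[where w = "\<lambda>_. c * a * b"])
      show "AE z in M \<Otimes>\<^sub>M M. (\<lambda>n. K n z * p (fst z) * q (snd z)) \<longlonglongrightarrow> L z * p (fst z) * q (snd z)"
        using lim by eventually_elim (auto intro!: tendsto_intros)
      show "AE z in M \<Otimes>\<^sub>M M. norm (K n z * p (fst z) * q (snd z)) \<le> c * a * b" for n
        using c[of n]
      proof eventually_elim
        case (elim z)
        then show ?case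
          unfolding real_norm_def abs_mult
          using a[of "fst z"] b[of "snd z"]
          by (intro mult_mono) (auto intro: order_trans[OF abs_ge_zero] mult_nonneg_nonneg)
      qed
    qed auto
  qed
  show ?thesis
    unfolding psd_kernel_def
  proof (intro conjI ballI)
    show "\<exists>c. \<forall>z. \<bar>L z\<bar> \<le> c" using Lc by blast
    fix p q assume p: "p \<in> bounded_fun M" and q: "q \<in> bounded_fun M"
    have "(\<lambda>n. kform M (K n) p q) \<longlonglongrightarrow> kform M L q p"
      using l[OF q p] K p q by (simp add: psd_kernel_def)
    then show "kform M L p q = kform M L q p" using LIMSEQ_unique l[OF p q] by blast
  next
    fix p assume p: "p \<in> bounded_fun M"
    show "0 \<le> kform M L p p"
      using l[OF p p] by (rule LIMSEQ_le_const) (use K p in \<open>auto simp: psd_kernel_def\<close>)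
  qed simp
qed

end

section \<open>Gram factorisation of bounded positive semidefinite kernels\<close>

lemma partial_inner_bound:
  fixes x y :: "nat ell2"
  assumes "norm x \<le> 1" "norm y \<le> 1"
  shows "\<bar>\<Sum>k<m. ell2_nth x k * ell2_nth y k\<bar> \<le> 1"
proof -
  have n: "(\<Sum>k<m. (ell2_nth z k)\<^sup>2) \<le> 1" if "norm z \<le> 1" for z :: "nat ell2"
    using sum_le_ell2_norm[of "{..<m}" z] power_mono[OF that norm_ge_zero, of 2] by simp
  have "(\<Sum>k<m. ell2_nth x k * ell2_nth y k)\<^sup>2 \<le> (\<Sum>k<m. (ell2_nth x k)\<^sup>2) * (\<Sum>k<m. (ell2_nth y k)\<^sup>2)"
    by (rule Cauchy_Schwarz_ineq_sum)
  also have "\<dots> \<le> 1 * 1" by (intro mult_mono n assms sum_nonneg) auto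
  finally show ?thesis by (simp add: abs_square_le_1)
qed

lemma ell2_of_bounded_sums:
  assumes b: "\<And>m. (\<Sum>k<m. (f k)\<^sup>2) \<le> b\<^sup>2" and b0: "0 \<le> b"
  shows "ell2_nth (ell2_of f) = f" "norm (ell2_of f) \<le> b"
proof -
  have s: "summable (\<lambda>k. (f k)\<^sup>2)"
    by (rule summableI_nonneg_bounded[OF _ b]) auto
  show n: "ell2_nth (ell2_of f) = f" by (rule ell2_nth_of[OF s])
  have "(norm (ell2_of f))\<^sup>2 \<le> b\<^sup>2"
    using norm_ell2_sums[of "ell2_of f"] b unfolding n sums_def
    by (intro LIMSEQ_le_const2) auto
  then show "norm (ell2_of f) \<le> b" using b0 by (rule power2_le_imp_le)
qed

context finite_measure
begin

text \<open>
  Let \<open>v\<close> enumerate the indicators of a countable generator and let \<open>e\<close> be the orthonormal system that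
  the Gram--Schmidt process for the form of \<open>K\<close> makes of \<open>v\<close>. The coordinate \<open>f k\<close> of the desired map
  represents the functional \<open>p \<mapsto> kform M K p (e k)\<close> as an integral. Bessel's inequality and the
  bound on the averages of \<open>K\<close> show that the averages of the vector \<open>(f k)\<^sub>k\<close> have length at most
  one, hence so has the vector at almost every point. Finally, the expansion of \<open>v i\<close> in terms of
  \<open>e\<close> says that the Gram kernel and \<open>K\<close> have the same integral over each rectangle of the generator.
\<close>

lemma kernel_factorisation_countably_generated:
  assumes psd: "psd_kernel M K"
    and avg: "\<And>A. A \<in> sets M \<Longrightarrow> kform M K (indicator A) (indicator A) \<le> (measure M A)\<^sup>2"
    and E: "sets M = sigma_sets (space M) E" "Int_stable E" "E \<subseteq> Pow (space M)" "space M \<in> E"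
      "countable E"
  obtains \<alpha> :: "'a \<Rightarrow> nat ell2" where "\<alpha> \<in> borel_measurable M" "\<And>x. norm (\<alpha> x) \<le> 1"
    "AE z in M \<Otimes>\<^sub>M M. K z = inner (\<alpha> (fst z)) (\<alpha> (snd z))"
proof -
  interpret Q: finite_measure "M \<Otimes>\<^sub>M M" by (rule finite_square)
  interpret P: pair_sigma_finite M M by (rule pair_sf)
  interpret F: psd_form "bounded_fun M" "kform M K" by (rule psd_form_kform[OF psd])
  have [measurable]: "K \<in> borel_measurable (M \<Otimes>\<^sub>M M)" using psd by (simp add: psd_kernel_def)
  obtain c where c: "\<And>z. \<bar>K z\<bar> \<le> c" using psd by (auto simp: psd_kernel_def)
  define v :: "nat \<Rightarrow> 'a \<Rightarrow> real" where "v n = indicator (from_nat_into E n)" for n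
  have EM: "from_nat_into E n \<in> sets M" for n
    using E(4) from_nat_into[of E n] E(1) by auto
  then have v: "v n \<in> bounded_fun M" for n unfolding v_def by (intro indicator_bounded_fun)
  obtain e where e: "F.ortho e UNIV"
    and exp: "\<And>i u. u \<in> bounded_fun M \<Longrightarrow> kform M K (v i) u = (\<Sum>k\<le>i. kform M K (v i) (e k) * kform M K (e k) u)"
    and tri: "\<And>i k. i < k \<Longrightarrow> kform M K (v i) (e k) = 0"
  proof (rule F.Gram_Schmidt[of v, OF v])
  qed (rule that; assumption)
  have eb: "e k \<in> bounded_fun M" for k using e by (auto simp: F.ortho_def)
  note [measurable] = bounded_fun_measurable[OF eb]
  define f where "f k x = (\<integral>y. K (x, y) * e k y \<partial>M)" for k x
  have [measurable]: "f k \<in> borel_measurable M" for k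
    unfolding f_def by (intro borel_measurable_lebesgue_integral) measurable
  have fb: "f k \<in> bounded_fun M" for k
  proof -
    obtain a where a: "a \<ge> 0" "\<And>x. \<bar>e k x\<bar> \<le> a" using bounded_fun_bound[OF eb] by blast
    have "\<bar>f k x\<bar> \<le> measure M (space M) * (c * a)" for x
    proof -
      have ca: "\<bar>K (x, y) * e k y\<bar> \<le> c * a" for y
        unfolding abs_mult using c[of "(x,y)"] a by (intro mult_mono) auto
      have "norm (f k x) \<le> (\<integral>y. c * a \<partial>M)"
      proof (cases "integrable M (\<lambda>y. K (x, y) * e k y)")
        case True
        have "norm (f k x) \<le> (\<integral>y. norm (K (x, y) * e k y) \<partial>M)"
          unfolding f_def by (rule integral_norm_bound)
        also have "\<dots> \<le> (\<integral>y. c * a \<partial>M)"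
          using ca True by (intro integral_mono integrable_norm) auto
        finally show ?thesis .
      next
        case False
        have "0 \<le> c * a" by (rule order_trans[OF abs_ge_zero ca])
        then have "0 \<le> (\<integral>y. c * a \<partial>M)" by (rule Bochner_Integration.integral_nonneg)
        then show ?thesis using False by (simp add: f_def not_integrable_integral_eq)
      qed
      then show ?thesis by simp
    qed
    then show ?thesis unfolding bounded_fun_def by auto
  qed
  have pair: "kform M K p (e k) = (\<integral>x. p x * f k x \<partial>M)" if "p \<in> bounded_fun M" for p k
    unfolding f_def by (rule kform_iterated[OF _ c that eb]) measurable
  \<comment> \<open>The averaging theorem turns a bound for the averages into a bound almost everywhere.\<close>
  have "AE x in M. (\<Sum>k<m. (f k x)\<^sup>2) \<le> 1" for m
  proof -
    define G where "G x = ell2_of (\<lambda>k. if k < m then f k x else 0)" for x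
    have nG: "ell2_nth (G x) = (\<lambda>k. if k < m then f k x else 0)" for x
      unfolding G_def by (rule ell2_nth_of, rule summable_finite[of "{..<m}"]) auto
    have normG: "(norm (G x))\<^sup>2 = (\<Sum>k<m. (f k x)\<^sup>2)" for x
    proof -
      have "(\<lambda>k. (ell2_nth (G x) k)\<^sup>2) sums (\<Sum>k<m. (ell2_nth (G x) k)\<^sup>2)"
        by (rule sums_finite) (auto simp: nG)
      with norm_ell2_sums[of "G x"] have "(norm (G x))\<^sup>2 = (\<Sum>k<m. (ell2_nth (G x) k)\<^sup>2)"
        by (rule sums_unique2)
      then show ?thesis by (simp add: nG)
    qed
    have [measurable]: "G \<in> borel_measurable M"
      by (rule borel_measurable_ell2I) (simp add: nG)
    obtain a where a: "\<And>k x. \<bar>f k x\<bar> \<le> a k"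
      using bounded_fun_bound[OF fb] by metis
    have "norm (G x) \<le> sqrt (\<Sum>k<m. (a k)\<^sup>2)" for x
      by (rule real_le_rsqrt) (auto simp: normG abs_le_square_iff[symmetric]
          intro!: sum_mono order_trans[OF a])
    then have iG: "integrable M G"
      by (intro integrable_const_bound[of _ "sqrt (\<Sum>k<m. (a k)\<^sup>2)"]) auto
    have "AE x in M. G x \<in> cball 0 1"
    proof (rule averaging_theorem[OF iG])
      fix A assume A: "A \<in> sets M" "measure M A > 0"
      define I where "I = set_lebesgue_integral M A G"
      have iA: "integrable M (\<lambda>x. indicator A x *\<^sub>R G x)"
        by (rule integrable_mult_indicator[OF A(1) iG])
      have nI: "ell2_nth I k = (if k < m then kform M K (indicator A) (e k) else 0)" for k
      proof -
        have "bounded_linear (\<lambda>x :: nat ell2. ell2_nth x k)"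
          by (rule bounded_linear_intro[where K = 1]) (use norm_ell2_nth_le[of _ k] in auto)
        from integral_bounded_linear[OF this iA]
        have "ell2_nth I k = (\<integral>x. indicator A x * ell2_nth (G x) k \<partial>M)"
          by (simp add: I_def set_lebesgue_integral_def)
        then show ?thesis
          using pair[OF indicator_bounded_fun[OF A(1)]] by (simp add: nG)
      qed
      have "(\<lambda>k. (ell2_nth I k)\<^sup>2) sums (\<Sum>k<m. (ell2_nth I k)\<^sup>2)"
        by (rule sums_finite) (auto simp: nI)
      with norm_ell2_sums[of I] have "(norm I)\<^sup>2 = (\<Sum>k<m. (ell2_nth I k)\<^sup>2)"
        by (rule sums_unique2)
      also have "\<dots> = (\<Sum>k<m. (kform M K (indicator A) (e k))\<^sup>2)" by (simp add: nI)
      also have "\<dots> \<le> kform M K (indicator A) (indicator A)"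
        using e by (intro F.Bessel indicator_bounded_fun A) (auto simp: F.ortho_def)
      also have "\<dots> \<le> (measure M A)\<^sup>2" by (rule avg[OF A(1)])
      finally have "norm I \<le> measure M A" by (rule power2_le_imp_le) simp
      then show "(1 / measure M A) *\<^sub>R set_lebesgue_integral M A G \<in> cball 0 1"
        using A(2) by (simp add: I_def[symmetric])
    qed auto
    then show ?thesis
    proof eventually_elim
      case (elim x)
      then show ?case unfolding normG[symmetric] by (simp add: abs_square_le_1)
    qed
  qed
  then have ae: "AE x in M. \<forall>m. (\<Sum>k<m. (f k x)\<^sup>2) \<le> 1"
    by (simp add: AE_all_countable)
  define g where "g x = (if \<forall>m. (\<Sum>k<m. (f k x)\<^sup>2) \<le> 1 then (\<lambda>k. f k x) else (\<lambda>_. 0))" for x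
  define \<alpha> where "\<alpha> x = ell2_of (g x)" for x
  have \<alpha>: "ell2_nth (\<alpha> x) = g x" "norm (\<alpha> x) \<le> 1" for x
    using ell2_of_bounded_sums[of "g x" 1] by (auto simp: \<alpha>_def g_def)
  have meas[measurable]: "\<alpha> \<in> borel_measurable M"
  proof (rule borel_measurable_ell2I)
    fix k
    have "(\<lambda>x. ell2_nth (\<alpha> x) k) = (\<lambda>x. if \<forall>m. (\<Sum>k<m. (f k x)\<^sup>2) \<le> 1 then f k x else 0)"
      by (auto simp: \<alpha> g_def)
    also have "\<dots> \<in> borel_measurable M" by measurable
    finally show "(\<lambda>x. ell2_nth (\<alpha> x) k) \<in> borel_measurable M" .
  qed
  have af: "AE x in M. \<forall>k. ell2_nth (\<alpha> x) k = f k x"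
    using ae by eventually_elim (auto simp: \<alpha> g_def)
  define S where "S = (\<lambda>z. inner (\<alpha> (fst z)) (\<alpha> (snd z)))"
  have S: "psd_kernel M S" unfolding S_def by (rule psd_kernel_inner[OF meas \<alpha>(2)])
  have Sm[measurable]: "S \<in> borel_measurable (M \<Otimes>\<^sub>M M)" using S by (simp add: psd_kernel_def)
  have Sb: "\<bar>S z\<bar> \<le> 1 * 1" for z
    unfolding S_def by (intro order_trans[OF Cauchy_Schwarz_ineq2] mult_mono \<alpha>) auto
  have "AE z in M \<Otimes>\<^sub>M M. K z = S z"
  proof (rule AE_eq_if_integrals_eq_on_rectangles[OF _ _ E(1-4)])
    show "integrable (M \<Otimes>\<^sub>M M) K" using c by (intro Q.integrable_const_bound[of _ c]) auto
    show "integrable (M \<Otimes>\<^sub>M M) S" using Sb by (intro Q.integrable_const_bound[of _ "1*1"]) auto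
    fix a b assume ab: "a \<in> E" "b \<in> E"
    obtain i j where ij: "a = from_nat_into E i" "b = from_nat_into E j"
      using ab from_nat_into_surj[OF E(5)] by metis
    have abM[measurable]: "a \<in> sets M" "b \<in> sets M" using ij EM by auto
    have vi: "v i = indicator a" "v j = indicator b" using ij by (auto simp: v_def)
    have coeff: "(\<integral>x. v i x * ell2_nth (\<alpha> x) k \<partial>M) = kform M K (v i) (e k)" for i k
    proof -
      note [measurable] = bounded_fun_measurable[OF v[of i]]
      have "(\<integral>x. v i x * ell2_nth (\<alpha> x) k \<partial>M) = (\<integral>x. v i x * f k x \<partial>M)"
        by (rule integral_cong_AE) (use af in \<open>auto elim!: eventually_mono\<close>)
      then show ?thesis using pair[OF v] by simp
    qed
    define T where "T m z = (\<Sum>k<m. ell2_nth (\<alpha> (fst z)) k * ell2_nth (\<alpha> (snd z)) k)" for m and z :: "'a \<times> 'a"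
    have [measurable]: "T m \<in> borel_measurable (M \<Otimes>\<^sub>M M)" for m unfolding T_def by measurable
    have Tb: "\<bar>T m z\<bar> \<le> 1" for m z unfolding T_def by (intro partial_inner_bound \<alpha>)
    have [measurable]: "v i \<in> borel_measurable M" for i using bounded_fun_measurable[OF v] .
    have "(\<lambda>m. \<integral>z. T m z * v i (fst z) * v j (snd z) \<partial>(M \<Otimes>\<^sub>M M)) \<longlonglongrightarrow> (\<integral>z. S z * v i (fst z) * v j (snd z) \<partial>(M \<Otimes>\<^sub>M M))"
    proof (rule integral_dominated_convergence[where w = "\<lambda>_. 1"])
      show "AE z in M \<Otimes>\<^sub>M M. (\<lambda>m. T m z * v i (fst z) * v j (snd z)) \<longlonglongrightarrow> S z * v i (fst z) * v j (snd z)"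
        using inner_ell2_sums unfolding T_def S_def sums_def by (intro AE_I2 tendsto_intros) auto
      show "AE z in M \<Otimes>\<^sub>M M. norm (T m z * v i (fst z) * v j (snd z)) \<le> 1" for m
        using Tb[of m] by (intro AE_I2) (auto simp: abs_mult vi split: split_indicator)
    qed auto
    \<comment> \<open>Since \<open>e\<close> is triangular, the partial sums are exact on this rectangle from the index \<open>Suc i\<close> on.\<close>
    moreover have "(\<integral>z. T m z * v i (fst z) * v j (snd z) \<partial>(M \<Otimes>\<^sub>M M)) = kform M K (v i) (v j)"
      if m: "m \<ge> Suc i" for m
    proof -
      have ai: "integrable M (\<lambda>x. v i x * ell2_nth (\<alpha> x) k)" for i k
      proof (rule integrable_const_bound[of _ "1 * 1"])
        show "AE x in M. norm (v i x * ell2_nth (\<alpha> x) k) \<le> 1 * 1"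
          unfolding norm_mult
          using order_trans[OF norm_ell2_nth_le \<alpha>(2)]
          by (intro AE_I2 mult_mono) (auto simp: v_def split: split_indicator)
      qed measurable
      have prod: "integrable (M \<Otimes>\<^sub>M M) (\<lambda>z. (v i (fst z) * ell2_nth (\<alpha> (fst z)) k) * (v j (snd z) * ell2_nth (\<alpha> (snd z)) k)) \<and>
        (\<integral>z. (v i (fst z) * ell2_nth (\<alpha> (fst z)) k) * (v j (snd z) * ell2_nth (\<alpha> (snd z)) k) \<partial>(M \<Otimes>\<^sub>M M))
          = kform M K (v i) (e k) * kform M K (v j) (e k)" for k
      proof -
        have int: "integrable (M \<Otimes>\<^sub>M M) (\<lambda>z. (v i (fst z) * ell2_nth (\<alpha> (fst z)) k) * (v j (snd z) * ell2_nth (\<alpha> (snd z)) k))"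
        proof (rule Q.integrable_const_bound[of _ "(1 * 1) * (1 * 1)"])
          show "AE z in M \<Otimes>\<^sub>M M. norm ((v i (fst z) * ell2_nth (\<alpha> (fst z)) k) * (v j (snd z) * ell2_nth (\<alpha> (snd z)) k)) \<le> (1 * 1) * (1 * 1)"
            unfolding norm_mult
            using order_trans[OF norm_ell2_nth_le \<alpha>(2)]
            by (intro AE_I2 mult_mono) (auto simp: v_def split: split_indicator)
        qed measurable
        have "(\<integral>z. (v i (fst z) * ell2_nth (\<alpha> (fst z)) k) * (v j (snd z) * ell2_nth (\<alpha> (snd z)) k) \<partial>(M \<Otimes>\<^sub>M M))
          = (\<integral>x. (\<integral>y. (v i x * ell2_nth (\<alpha> x) k) * (v j y * ell2_nth (\<alpha> y) k) \<partial>M) \<partial>M)"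
          unfolding P.integral_fst'[OF int, symmetric] by simp
        also have "\<dots> = (\<integral>x. (v i x * ell2_nth (\<alpha> x) k) * kform M K (v j) (e k) \<partial>M)"
          unfolding coeff[symmetric] integral_mult_right_zero ..
        also have "\<dots> = kform M K (v i) (e k) * kform M K (v j) (e k)"
          unfolding integral_mult_left_zero coeff ..
        finally show ?thesis using int by blast
      qed
      have "(\<integral>z. T m z * v i (fst z) * v j (snd z) \<partial>(M \<Otimes>\<^sub>M M))
          = (\<integral>z. (\<Sum>k<m. (v i (fst z) * ell2_nth (\<alpha> (fst z)) k) * (v j (snd z) * ell2_nth (\<alpha> (snd z)) k)) \<partial>(M \<Otimes>\<^sub>M M))"
        unfolding T_def sum_distrib_right
        by (intro Bochner_Integration.integral_cong sum.cong) auto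
      also have "\<dots> = (\<Sum>k<m. kform M K (v i) (e k) * kform M K (v j) (e k))"
        using prod by (subst Bochner_Integration.integral_sum) auto
      also have "\<dots> = (\<Sum>k\<le>i. kform M K (v i) (e k) * kform M K (v j) (e k))"
        using m by (intro sum.mono_neutral_right) (auto simp: tri)
      also have "\<dots> = kform M K (v i) (v j)"
        using exp[OF v] F.sym[OF v eb] by simp
      finally show ?thesis .
    qed
    ultimately have "kform M K (v i) (v j) = (\<integral>z. S z * v i (fst z) * v j (snd z) \<partial>(M \<Otimes>\<^sub>M M))"
      by (intro LIMSEQ_unique[OF tendsto_eventually]) (auto simp: eventually_at_top_linorder)
    then show "(\<integral>z. K z * indicator a (fst z) * indicator b (snd z) \<partial>(M \<Otimes>\<^sub>M M))
      = (\<integral>z. S z * indicator a (fst z) * indicator b (snd z) \<partial>(M \<Otimes>\<^sub>M M))"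
      by (simp add: kform_def vi)
  qed
  with meas \<alpha>(2) show thesis by (intro that) (auto simp: S_def)
qed

end

subsection \<open>Countably generated sub-\<open>\<sigma>\<close>-algebras\<close>

definition rectangles :: "'a set set \<Rightarrow> ('a \<times> 'a) set set" where
  "rectangles A = {a \<times> b | a b. a \<in> A \<and> b \<in> A}"

lemma rectangles_mono: "A \<subseteq> B \<Longrightarrow> rectangles A \<subseteq> rectangles B"
  unfolding rectangles_def by blast

text \<open>
  The union of all product \<open>\<sigma>\<close>-algebras that are generated by countably many sets is closed under
  complements and countable unions.
\<close>

lemma rectangle_set_countably_generated:
  assumes "S \<in> sets (N \<Otimes>\<^sub>M N)"
  shows "\<exists>A. countable A \<and> A \<subseteq> sets N \<and>
    S \<in> sigma_sets (space N \<times> space N) (rectangles A)"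
proof -
  from assms have "S \<in> sigma_sets (space N \<times> space N) (rectangles (sets N))" by (simp add: sets_pair_measure rectangles_def)
  then show ?thesis
  proof induction
    case (Basic s)
    then obtain a b where "s = a \<times> b" "a \<in> sets N" "b \<in> sets N" by (auto simp: rectangles_def)
    then show ?case by (intro exI[of _ "{a, b}"]) (auto simp: rectangles_def intro!: sigma_sets.Basic)
  next
    case Empty
    show ?case by (intro exI[of _ "{}"]) (auto intro: sigma_sets.Empty)
  next
    case (Compl s)
    then show ?case by (meson sigma_sets.Compl)
  next
    case (Union s)
    then have "\<forall>i. \<exists>A. countable A \<and> A \<subseteq> sets N \<and> s i \<in> sigma_sets (space N \<times> space N) (rectangles A)"
      by blast
    from choice[OF this] obtain A where "\<forall>i. countable (A i) \<and> A i \<subseteq> sets N \<and>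
      s i \<in> sigma_sets (space N \<times> space N) (rectangles (A i))" ..
    then have A: "countable (A i)" "A i \<subseteq> sets N"
      "s i \<in> sigma_sets (space N \<times> space N) (rectangles (A i))" for i by auto
    have "s i \<in> sigma_sets (space N \<times> space N) (rectangles (\<Union>i. A i))" for i
      using A(3)[of i] by (rule rev_subsetD) (intro sigma_sets_mono' rectangles_mono, blast)
    then show ?case
      using A by (intro exI[of _ "\<Union>i. A i"]) (auto intro: sigma_sets.Union)
  qed
qed

text \<open>
  The sublevel sets of \<open>K\<close> at rational levels use only countably many measurable sets; the finite
  intersections of these form the required generator.
\<close>

lemma kernel_countably_generated:
  fixes K :: "'a \<times> 'a \<Rightarrow> real"
  assumes K[measurable]: "K \<in> borel_measurable (N \<Otimes>\<^sub>M N)"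
  obtains E where "countable E" "E \<subseteq> sets N" "Int_stable E" "space N \<in> E"
    "K \<in> borel_measurable (sigma (space N) E \<Otimes>\<^sub>M sigma (space N) E)"
proof -
  let ?S = "\<lambda>q. {z \<in> space (N \<Otimes>\<^sub>M N). K z \<le> of_rat q}"
  have "\<forall>q. \<exists>A. countable A \<and> A \<subseteq> sets N \<and> ?S q \<in> sigma_sets (space N \<times> space N) (rectangles A)"
    by (intro allI rectangle_set_countably_generated) measurable
  from choice[OF this] obtain A where "\<forall>q. countable (A q) \<and> A q \<subseteq> sets N \<and>
    ?S q \<in> sigma_sets (space N \<times> space N) (rectangles (A q))" ..
  then have A: "countable (A q)" "A q \<subseteq> sets N"
    "?S q \<in> sigma_sets (space N \<times> space N) (rectangles (A q))" for q by auto
  define B where "B = (\<Union>q. A q)"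
  have B: "countable B" "B \<subseteq> sets N" using A unfolding B_def by auto
  define E where "E = (\<lambda>F. space N \<inter> \<Inter>F) ` {F. F \<subseteq> B \<and> finite F}"
  have BE: "B \<subseteq> E"
  proof
    fix b assume b: "b \<in> B"
    then have "b = space N \<inter> \<Inter>{b}" using B(2) sets.sets_into_space by auto
    with b show "b \<in> E" unfolding E_def by blast
  qed
  have cE: "countable E"
    unfolding E_def using countable_Collect_finite_subset[OF B(1)]
    by (simp add: conj_commute)
  have EN: "E \<subseteq> sets N"
  proof
    fix e assume "e \<in> E"
    then obtain F where F: "e = space N \<inter> \<Inter>F" "F \<subseteq> B" "finite F" by (auto simp: E_def)
    show "e \<in> sets N"
      using F(3,2) unfolding F(1)
    proof (induction F rule: finite_induct)
      case (insert x F)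
      have "space N \<inter> \<Inter>(insert x F) = x \<inter> (space N \<inter> \<Inter>F)" by auto
      then show ?case using insert B by auto
    qed simp
  qed
  have iE: "Int_stable E"
  proof (rule Int_stableI)
    fix a b assume "a \<in> E" "b \<in> E"
    then obtain F F' where "a = space N \<inter> \<Inter>F" "b = space N \<inter> \<Inter>F'"
      "F \<subseteq> B" "finite F" "F' \<subseteq> B" "finite F'" by (auto simp: E_def)
    then show "a \<inter> b \<in> E" unfolding E_def
      by (intro image_eqI[of _ _ "F \<union> F'"]) auto
  qed
  have sE: "space N \<in> E" unfolding E_def by (intro image_eqI[of _ _ "{}"]) auto
  have EP: "E \<subseteq> Pow (space N)" using EN sets.sets_into_space by blast
  let ?N = "sigma (space N) E"
  have "?S q \<in> sets (?N \<Otimes>\<^sub>M ?N)" for q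
  proof -
    have "sigma_sets (space N \<times> space N) (rectangles (A q)) \<subseteq> sigma_sets (space N \<times> space N) (rectangles (sets ?N))"
      using BE EP by (intro sigma_sets_mono' rectangles_mono) (auto simp: B_def intro!: sigma_sets.Basic)
    then show ?thesis using A(3)[of q] EP unfolding sets_pair_measure rectangles_def by (auto simp: space_measure_of_conv)
  qed
  moreover have "{z \<in> space (?N \<Otimes>\<^sub>M ?N). K z \<le> a} = (\<Inter>q\<in>{q. a < of_rat q}. ?S q)" for a
  proof -
    have "K z \<le> a \<longleftrightarrow> (\<forall>q. a < of_rat q \<longrightarrow> K z \<le> of_rat q)" for z
      by (meson less_le_trans not_le of_rat_dense order_le_less_trans order_less_imp_le)
    moreover have "\<exists>q. a < of_rat q" using of_rat_dense[of a "a+1"] by auto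
    ultimately show ?thesis by (auto simp: space_pair_measure space_measure_of_conv)
  qed
  moreover have "\<exists>q. a < of_rat q" for a :: real using of_rat_dense[of a "a+1"] by auto
  ultimately have "K \<in> borel_measurable (?N \<Otimes>\<^sub>M ?N)"
    unfolding borel_measurable_iff_le by (auto intro!: sets.countable_INT'')
  with cE EN iE sE show thesis by (intro that)
qed

text \<open>
  The measure is restricted to a countably generated \<open>\<sigma>\<close>-algebra for which \<open>K\<close> is still measurable,
  which changes neither the form of \<open>K\<close> nor its averages.
\<close>

theorem (in finite_measure) kernel_factorisation:
  assumes psd: "psd_kernel M K"
    and avg: "\<And>A. A \<in> sets M \<Longrightarrow> kform M K (indicator A) (indicator A) \<le> (measure M A)\<^sup>2"
  obtains \<alpha> :: "'a \<Rightarrow> nat ell2" where "\<alpha> \<in> borel_measurable M" "\<And>x. norm (\<alpha> x) \<le> 1"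
    "AE z in M \<Otimes>\<^sub>M M. K z = inner (\<alpha> (fst z)) (\<alpha> (snd z))"
proof -
  have K: "K \<in> borel_measurable (M \<Otimes>\<^sub>M M)" using psd by (simp add: psd_kernel_def)
  obtain E where E: "countable E" "E \<subseteq> sets M" "Int_stable E" "space M \<in> E"
    "K \<in> borel_measurable (sigma (space M) E \<Otimes>\<^sub>M sigma (space M) E)"
    using kernel_countably_generated[OF K] by blast
  have EP: "E \<subseteq> Pow (space M)" using E(2) sets.sets_into_space by blast
  define N where "N = distr M (sigma (space M) E) (\<lambda>x. x)"
  have id: "(\<lambda>x. x) \<in> measurable M (sigma (space M) E)"
    using E(2) EP by (intro measurable_measure_of) auto
  have sets_N: "sets N = sets (sigma (space M) E)" and space_N: "space N = space M"
    by (auto simp: N_def space_measure_of_conv)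
  have setsN: "sets N = sigma_sets (space N) E" using EP by (simp add: sets_N space_N)
  interpret N: finite_measure N unfolding N_def by (rule finite_measure_distr[OF id])
  have prod: "N \<Otimes>\<^sub>M N = distr (M \<Otimes>\<^sub>M M) (sigma (space M) E \<Otimes>\<^sub>M sigma (space M) E) (\<lambda>z. z)"
  proof -
    have "N \<Otimes>\<^sub>M N = distr (M \<Otimes>\<^sub>M M) (sigma (space M) E \<Otimes>\<^sub>M sigma (space M) E) (\<lambda>(x, y). (x, y))"
      unfolding N_def by (rule pair_measure_distr[OF id id]) (use N.sigma_finite_measure_axioms in \<open>simp add: N_def\<close>)
    then show ?thesis by (simp add: id_def)
  qed
  have id2: "(\<lambda>z. z) \<in> measurable (M \<Otimes>\<^sub>M M) (sigma (space M) E \<Otimes>\<^sub>M sigma (space M) E)"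
    using measurable_Pair[OF measurable_compose[OF measurable_fst id] measurable_compose[OF measurable_snd id]]
    by simp
  have bN: "p \<in> borel_measurable M" if "p \<in> borel_measurable N" for p :: "'a \<Rightarrow> 'c::topological_space"
    using measurable_compose[OF id, of p borel] that unfolding N_def by simp
  have kN: "kform N K p q = kform M K p q" if "p \<in> borel_measurable N" "q \<in> borel_measurable N" for p q
  proof -
    have [measurable]: "K \<in> borel_measurable (N \<Otimes>\<^sub>M N)" unfolding prod using E(5) by simp
    note [measurable] = that
    have "(\<lambda>z. K z * p (fst z) * q (snd z)) \<in> borel_measurable (N \<Otimes>\<^sub>M N)" by measurable
    then have "(\<lambda>z. K z * p (fst z) * q (snd z)) \<in> borel_measurable (sigma (space M) E \<Otimes>\<^sub>M sigma (space M) E)"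
      unfolding prod by simp
    then show ?thesis unfolding kform_def prod by (intro integral_distr id2)
  qed
  have bb: "p \<in> bounded_fun M" if "p \<in> bounded_fun N" for p using that bN unfolding bounded_fun_def by auto
  have psdN: "psd_kernel N K"
    unfolding psd_kernel_def
  proof (intro conjI ballI)
    show "K \<in> borel_measurable (N \<Otimes>\<^sub>M N)" unfolding prod using E(5) by simp
    show "\<exists>c. \<forall>z. \<bar>K z\<bar> \<le> c" using psd by (simp add: psd_kernel_def)
    fix p q assume "p \<in> bounded_fun N" "q \<in> bounded_fun N"
    then show "kform N K p q = kform N K q p"
      using kN[of p q] kN[of q p] psd bb[of p] bb[of q] by (simp add: psd_kernel_def bounded_fun_measurable)
  next
    fix p assume "p \<in> bounded_fun N"
    then show "0 \<le> kform N K p p"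
      using kN[of p p] psd bb[of p] by (simp add: psd_kernel_def bounded_fun_measurable)
  qed
  have avgN: "kform N K (indicator A) (indicator A) \<le> (measure N A)\<^sup>2" if "A \<in> sets N" for A
  proof -
    have A: "A \<in> sets (sigma (space M) E)" using that sets_N by simp
    have "measure N A = measure M A"
    proof -
      have "A \<subseteq> space M" using sets.sets_into_space[OF that] space_N by simp
      then have "(\<lambda>x. x) -` A \<inter> space M = A" by auto
      then show ?thesis unfolding N_def measure_distr[OF id A] by simp
    qed
    moreover have "A \<in> sets M"
      using measurable_sets[OF id A] sets.sets_into_space[OF that] space_N by (simp add: Int_absorb2)
    ultimately show ?thesis using avg[of A] kN[of "indicator A" "indicator A"] that by simp
  qed
  have gen: "Int_stable E" "E \<subseteq> Pow (space N)" "space N \<in> E" "countable E"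
    using E(1,3,4) EP space_N by auto
  obtain \<alpha> :: "'a \<Rightarrow> nat ell2" where \<alpha>: "\<alpha> \<in> borel_measurable N" "\<And>x. norm (\<alpha> x) \<le> 1"
    "AE z in N \<Otimes>\<^sub>M N. K z = inner (\<alpha> (fst z)) (\<alpha> (snd z))"
  proof (rule N.kernel_factorisation_countably_generated[OF psdN avgN setsN gen])
  qed (assumption | (rule that; assumption))+
  from \<alpha>(3) have "AE z in M \<Otimes>\<^sub>M M. K z = inner (\<alpha> (fst z)) (\<alpha> (snd z))"
    unfolding prod by (rule AE_distrD[OF id2])
  with \<alpha> bN show thesis by (intro that) auto
qed

section \<open>The Hilbert space of square integrable functions\<close>

lemma borel_measurable_cnj [measurable (raw)]:
  "f \<in> borel_measurable M \<Longrightarrow> (\<lambda>x. cnj (f x)) \<in> borel_measurable M"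
  by (rule borel_measurable_continuous_on) (intro continuous_intros)

lemma L2_measurable: "f \<in> L2_space M \<Longrightarrow> f \<in> borel_measurable M"
  by (simp add: L2_space_def)

lemma L2_integrable: "f \<in> L2_space M \<Longrightarrow> integrable M (\<lambda>x. (norm (f x))\<^sup>2)"
  by (simp add: L2_space_def)

lemma L2_bound:
  assumes g: "g \<in> borel_measurable M" and f: "integrable M f" and b: "\<And>x. (norm (g x))\<^sup>2 \<le> f x"
  shows "g \<in> L2_space M"
  unfolding L2_space_def using assms
  by (auto intro!: Bochner_Integration.integrable_bound[OF f] AE_I2 order_trans[OF b abs_ge_self])

lemma L2_zero [simp]: "(\<lambda>_. 0) \<in> L2_space M"
  by (simp add: L2_space_def)

lemma L2_comb:
  assumes "f \<in> L2_space M" "g \<in> L2_space M"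
  shows "(\<lambda>x. f x + c * g x) \<in> L2_space M"
proof (rule L2_bound)
  note [measurable] = L2_measurable[OF assms(1)] L2_measurable[OF assms(2)]
  show "(\<lambda>x. f x + c * g x) \<in> borel_measurable M" by measurable
  show "integrable M (\<lambda>x. 2 * (norm (f x))\<^sup>2 + 2 * (norm c)\<^sup>2 * (norm (g x))\<^sup>2)"
    using assms by (auto simp: L2_space_def)
  show "(norm (f x + c * g x))\<^sup>2 \<le> 2 * (norm (f x))\<^sup>2 + 2 * (norm c)\<^sup>2 * (norm (g x))\<^sup>2" for x
  proof -
    have "(norm (f x + c * g x))\<^sup>2 \<le> (norm (f x) + norm (c * g x))\<^sup>2"
      by (intro power_mono norm_triangle_ineq) auto
    also have "\<dots> \<le> 2 * (norm (f x))\<^sup>2 + 2 * (norm (c * g x))\<^sup>2"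
      using sum_squares_bound[of "norm (f x)" "norm (c * g x)"] by (simp add: power2_sum)
    finally show ?thesis by (simp add: norm_mult power_mult_distrib)
  qed
qed

lemma L2_mult:
  assumes f: "f \<in> L2_space M" and p: "p \<in> borel_measurable M" and b: "\<And>x. norm (p x) \<le> b"
  shows "(\<lambda>x. p x * f x) \<in> L2_space M"
proof (rule L2_bound)
  note [measurable] = L2_measurable[OF f] p
  show "(\<lambda>x. p x * f x) \<in> borel_measurable M" by measurable
  show "integrable M (\<lambda>x. b\<^sup>2 * (norm (f x))\<^sup>2)" using L2_integrable[OF f] by simp
  show "(norm (p x * f x))\<^sup>2 \<le> b\<^sup>2 * (norm (f x))\<^sup>2" for x
    unfolding norm_mult power_mult_distrib using b[of x]
    by (intro mult_right_mono power_mono) auto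
qed

lemma L2_scale: "f \<in> L2_space M \<Longrightarrow> (\<lambda>x. c * f x) \<in> L2_space M"
  using L2_comb[OF L2_zero, of f M c] by simp

lemma L2_diff: "f \<in> L2_space M \<Longrightarrow> g \<in> L2_space M \<Longrightarrow> (\<lambda>x. f x - g x) \<in> L2_space M"
  using L2_comb[of f M g "-1"] by simp

lemma L2_sum:
  "finite I \<Longrightarrow> (\<And>i. i \<in> I \<Longrightarrow> v i \<in> L2_space M) \<Longrightarrow> (\<lambda>x. \<Sum>i\<in>I. c i * v i x) \<in> L2_space M"
proof (induction I rule: finite_induct)
  case (insert i I)
  then have "(\<lambda>x. (\<Sum>i\<in>I. c i * v i x) + c i * v i x) \<in> L2_space M"
    by (intro L2_comb) auto
  with insert show ?case by (simp add: add.commute)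
qed simp

lemma l2_inner_integrable:
  assumes "f \<in> L2_space M" "g \<in> L2_space M"
  shows "integrable M (\<lambda>x. f x * cnj (g x))"
proof (rule Bochner_Integration.integrable_bound)
  note [measurable] = L2_measurable[OF assms(1)] L2_measurable[OF assms(2)]
  show "(\<lambda>x. f x * cnj (g x)) \<in> borel_measurable M" by measurable
  show "integrable M (\<lambda>x. (norm (f x))\<^sup>2 + (norm (g x))\<^sup>2)" using assms by (auto simp: L2_space_def)
  have "norm (f x * cnj (g x)) \<le> norm ((norm (f x))\<^sup>2 + (norm (g x))\<^sup>2)" for x
  proof -
    have "2 * (norm (f x) * norm (g x)) \<le> (norm (f x))\<^sup>2 + (norm (g x))\<^sup>2"
      using sum_squares_bound[of "norm (f x)" "norm (g x)"] by simp
    moreover have "0 \<le> norm (f x) * norm (g x)" by simp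
    ultimately have "norm (f x) * norm (g x) \<le> (norm (f x))\<^sup>2 + (norm (g x))\<^sup>2" by linarith
    then show ?thesis by (simp add: norm_mult)
  qed
  then show "AE x in M. norm (f x * cnj (g x)) \<le> norm ((norm (f x))\<^sup>2 + (norm (g x))\<^sup>2)" by simp
qed

lemma l2_inner_comb_left:
  assumes "f \<in> L2_space M" "g \<in> L2_space M" "h \<in> L2_space M"
  shows "l2_inner M (\<lambda>x. f x + c * g x) h = l2_inner M f h + c * l2_inner M g h"
proof -
  have "l2_inner M (\<lambda>x. f x + c * g x) h = (\<integral>x. f x * cnj (h x) + c * (g x * cnj (h x)) \<partial>M)"
    unfolding l2_inner_def by (rule Bochner_Integration.integral_cong) (auto simp: algebra_simps)
  also have "\<dots> = l2_inner M f h + c * l2_inner M g h"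
    unfolding l2_inner_def
    using l2_inner_integrable[OF assms(1,3)] l2_inner_integrable[OF assms(2,3)] by simp
  finally show ?thesis .
qed

lemma l2_inner_commute: "l2_inner M g f = cnj (l2_inner M f g)"
  unfolding l2_inner_def by (subst Bochner_Integration.integral_cnj[symmetric]) (simp add: mult.commute)

lemma l2_inner_cong_AE:
  assumes "AE x in M. f x = f' x" "f \<in> L2_space M" "f' \<in> L2_space M" "g \<in> L2_space M"
  shows "l2_inner M f g = l2_inner M f' g"
  unfolding l2_inner_def
  using assms L2_measurable[of _ M]
  by (intro integral_cong_AE) (auto intro!: borel_measurable_times simp: elim: eventually_mono)

lemma l2_inner_zero [simp]: "l2_inner M (\<lambda>_. 0) h = 0" "l2_inner M h (\<lambda>_. 0) = 0"
  by (simp_all add: l2_inner_def)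

lemma l2_inner_scale_left: "l2_inner M (\<lambda>x. c * f x) h = c * l2_inner M f h"
  unfolding l2_inner_def by (simp add: mult.assoc)

lemma l2_inner_scale_right: "l2_inner M h (\<lambda>x. c * f x) = cnj c * l2_inner M h f"
  unfolding l2_inner_def by (simp add: mult.left_commute)

lemma l2_inner_diff_left:
  assumes "f \<in> L2_space M" "g \<in> L2_space M" "h \<in> L2_space M"
  shows "l2_inner M (\<lambda>x. f x - g x) h = l2_inner M f h - l2_inner M g h"
  using l2_inner_comb_left[OF assms, of "-1"] by simp

lemma l2_inner_comb_right:
  assumes "f \<in> L2_space M" "g \<in> L2_space M" "h \<in> L2_space M"
  shows "l2_inner M h (\<lambda>x. f x + c * g x) = l2_inner M h f + cnj c * l2_inner M h g"
  using l2_inner_comb_left[OF assms, of c] by (simp add: l2_inner_commute[of M h])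

lemma l2_inner_sum_left:
  "finite I \<Longrightarrow> (\<And>i. i \<in> I \<Longrightarrow> v i \<in> L2_space M) \<Longrightarrow> h \<in> L2_space M \<Longrightarrow>
    l2_inner M (\<lambda>x. \<Sum>i\<in>I. c i * v i x) h = (\<Sum>i\<in>I. c i * l2_inner M (v i) h)"
proof (induction I rule: finite_induct)
  case (insert i I)
  have "l2_inner M (\<lambda>x. (\<Sum>i\<in>I. c i * v i x) + c i * v i x) h
     = l2_inner M (\<lambda>x. \<Sum>i\<in>I. c i * v i x) h + c i * l2_inner M (v i) h"
    using insert by (intro l2_inner_comb_left L2_sum) auto
  with insert show ?case by (simp add: add.commute)
qed simp

lemma l2_norm_nonneg [simp]: "0 \<le> l2_norm M f"
  by (simp add: l2_norm_def)

lemma l2_norm_square: "(l2_norm M f)\<^sup>2 = (\<integral>x. (norm (f x))\<^sup>2 \<partial>M)"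
  by (simp add: l2_norm_def)

lemma l2_inner_self: "l2_inner M f f = complex_of_real ((l2_norm M f)\<^sup>2)"
  unfolding l2_norm_square l2_inner_def integral_complex_of_real[symmetric]
  by (simp only: complex_norm_square)

lemma psd_form_l2: "psd_form (L2_space M) (\<lambda>f g. Re (l2_inner M f g))"
proof
  fix f g h :: "'a \<Rightarrow> complex" and c :: real
  show "(\<lambda>z. f z + c *\<^sub>R g z) \<in> L2_space M" if "f \<in> L2_space M" "g \<in> L2_space M"
    using L2_comb[OF that, of "complex_of_real c"] by (simp add: scaleR_conv_of_real)
  show "Re (l2_inner M (\<lambda>z. f z + c *\<^sub>R g z) h) = Re (l2_inner M f h) + c * Re (l2_inner M g h)"
    if "f \<in> L2_space M" "g \<in> L2_space M" "h \<in> L2_space M"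
    using l2_inner_comb_left[OF that, of "complex_of_real c"] by (simp add: scaleR_conv_of_real)
  show "Re (l2_inner M f g) = Re (l2_inner M g f)" by (subst l2_inner_commute) simp
  show "0 \<le> Re (l2_inner M f f)" by (simp add: l2_inner_self)
qed simp

lemma l2_Cauchy_Schwarz:
  assumes f: "f \<in> L2_space M" and g: "g \<in> L2_space M"
  shows "norm (l2_inner M f g) \<le> l2_norm M f * l2_norm M g"
proof (cases "l2_inner M f g = 0")
  case False
  interpret psd_form "L2_space M" "\<lambda>f g. Re (l2_inner M f g)" by (rule psd_form_l2)
  define c where "c = cnj (l2_inner M f g) / norm (l2_inner M f g)"
  have c: "norm c = 1" using False by (simp add: c_def norm_divide)
  have cf: "(\<lambda>x. c * f x) \<in> L2_space M" by (rule L2_scale[OF f])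
  have nf: "l2_norm M (\<lambda>x. c * f x) = l2_norm M f"
    by (simp add: l2_norm_def norm_mult c)
  have "l2_inner M (\<lambda>x. c * f x) g = complex_of_real (norm (l2_inner M f g))"
    unfolding l2_inner_scale_left c_def using False
    by (simp add: complex_norm_square[symmetric] mult.commute power2_eq_square)
  then have "(norm (l2_inner M f g))\<^sup>2 \<le> (l2_norm M f * l2_norm M g)\<^sup>2"
    using Cauchy_Schwarz[OF cf g] by (simp add: l2_inner_self nf power_mult_distrib)
  then show ?thesis by (rule power2_le_imp_le) simp
qed (simp add: mult_nonneg_nonneg)

lemma l2_norm_comb_square:
  assumes "f \<in> L2_space M" "g \<in> L2_space M"
  shows "(l2_norm M (\<lambda>x. f x + c * g x))\<^sup>2
    = (l2_norm M f)\<^sup>2 + 2 * Re (cnj c * l2_inner M f g) + (norm c)\<^sup>2 * (l2_norm M g)\<^sup>2"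
proof -
  have "complex_of_real ((l2_norm M (\<lambda>x. f x + c * g x))\<^sup>2)
      = l2_inner M f f + cnj c * l2_inner M f g + c * l2_inner M g f + c * cnj c * l2_inner M g g"
    unfolding l2_inner_self[symmetric]
    using assms L2_comb[OF assms, of c]
    by (simp add: l2_inner_comb_left l2_inner_comb_right algebra_simps)
  also have "c * l2_inner M g f = cnj (cnj c * l2_inner M f g)"
    by (subst l2_inner_commute) simp
  also have "l2_inner M f f + cnj c * l2_inner M f g + cnj (cnj c * l2_inner M f g) + c * cnj c * l2_inner M g g
    = complex_of_real ((l2_norm M f)\<^sup>2 + 2 * Re (cnj c * l2_inner M f g) + (norm c)\<^sup>2 * (l2_norm M g)\<^sup>2)"
    unfolding l2_inner_self
    by (rule complex_eqI, simp_all add: cmod_power2, simp_all add: power2_eq_square algebra_simps)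
  finally show ?thesis using of_real_eq_iff by blast
qed

lemma l2_triangle:
  assumes f: "f \<in> L2_space M" and g: "g \<in> L2_space M"
  shows "l2_norm M (\<lambda>x. f x + g x) \<le> l2_norm M f + l2_norm M g"
proof (rule power2_le_imp_le)
  have "Re (l2_inner M f g) \<le> l2_norm M f * l2_norm M g"
    using l2_Cauchy_Schwarz[OF f g] complex_Re_le_cmod[of "l2_inner M f g"] by linarith
  then show "(l2_norm M (\<lambda>x. f x + g x))\<^sup>2 \<le> (l2_norm M f + l2_norm M g)\<^sup>2"
    using l2_norm_comb_square[OF f g, of 1] by (simp add: power2_sum)
qed (simp add: add_nonneg_nonneg)

lemma l2_norm_scale: "l2_norm M (\<lambda>x. c * f x) = norm c * l2_norm M f"
  by (simp add: l2_norm_def norm_mult power_mult_distrib real_sqrt_mult)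

lemma l2_norm_minus_commute: "l2_norm M (\<lambda>x. f x - g x) = l2_norm M (\<lambda>x. g x - f x)"
  by (simp add: l2_norm_def norm_minus_commute)

lemma l2_norm_eq_0:
  assumes "f \<in> L2_space M" "l2_norm M f = 0"
  shows "AE x in M. f x = 0"
proof -
  have "(\<integral>x. (norm (f x))\<^sup>2 \<partial>M) = 0" using assms(2) l2_norm_square[of M f] by simp
  then have "AE x in M. (norm (f x))\<^sup>2 = 0"
    using L2_integrable[OF assms(1)] by (subst (asm) integral_nonneg_eq_0_iff_AE) auto
  then show ?thesis by eventually_elim simp
qed

lemma l2_norm_cong_AE:
  assumes "AE x in M. f x = f' x" "f \<in> L2_space M" "f' \<in> L2_space M"
  shows "l2_norm M f = l2_norm M f'"
proof -
  note [measurable] = L2_measurable[OF assms(2)] L2_measurable[OF assms(3)]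
  have "(\<integral>x. (norm (f x))\<^sup>2 \<partial>M) = (\<integral>x. (norm (f' x))\<^sup>2 \<partial>M)"
    by (rule integral_cong_AE) (use assms(1) in \<open>auto elim!: eventually_mono\<close>)
  then show ?thesis by (simp add: l2_norm_def)
qed

lemma (in sigma_finite_measure) positive_integrable_weight:
  obtains w :: "'a \<Rightarrow> real" where "w \<in> borel_measurable M" "\<And>x. 0 < w x" "integrable M w"
proof -
  obtain h where h: "h \<in> borel_measurable M" "integral\<^sup>N M h \<noteq> \<infinity>" "\<forall>x\<in>space M. 0 < h x \<and> h x < \<infinity>"
    using Ex_finite_integrable_function by blast
  define w where "w x = (if x \<in> space M then enn2real (h x) else 1)" for x
  have m: "w \<in> borel_measurable M"
    using h(1) unfolding w_def by measurable
  have pos: "0 < w x" for x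
    using h(3) by (auto simp: w_def enn2real_positive_iff)
  have "integral\<^sup>N M (\<lambda>x. ennreal (norm (w x))) = integral\<^sup>N M h"
    using h(3) by (intro nn_integral_cong) (auto simp: w_def)
  then have "integrable M w"
    using h(2) m by (intro integrableI_bounded) (auto simp: top.not_eq_extremum)
  with m pos show thesis by (rule that)
qed

subsection \<open>Completeness\<close>

text \<open>
  Completeness in the form in which it is needed: for a sequence whose increments decrease
  geometrically. Integrated against \<open>\<surd>w\<close> for a positive integrable weight \<open>w\<close>, the increments are
  summable almost everywhere, which gives a pointwise limit; Fatou's lemma controls its distance
  to the sequence.
\<close>

lemma (in sigma_finite_measure) L2_complete:
  assumes u: "\<And>n. u n \<in> L2_space M"
    and d: "\<And>n. l2_norm M (\<lambda>x. u (Suc n) x - u n x) \<le> (1/2)^n"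
  obtains h where "h \<in> L2_space M" "(\<lambda>n. l2_norm M (\<lambda>x. u n x - h x)) \<longlonglongrightarrow> 0"
proof -
  note [measurable] = L2_measurable[OF u]
  obtain w :: "'a \<Rightarrow> real" where w[measurable]: "w \<in> borel_measurable M" and w0: "\<And>x. 0 < w x"
    and wi: "integrable M w" using positive_integrable_weight by blast
  define sqrt_w where "sqrt_w x = complex_of_real (sqrt (w x))" for x
  have sqrt_w: "sqrt_w \<in> L2_space M"
    unfolding L2_space_def sqrt_w_def using wi w0 by (auto simp: less_imp_le)
  have diff: "(\<lambda>x. u m x - u n x) \<in> L2_space M" for m n by (rule L2_diff[OF u u])
  have ineq: "l2_norm M (\<lambda>x. u (n + k) x - u n x) \<le> 2 * (1/2)^n * (1 - (1/2)^k)" for n k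
  proof (induction k)
    case 0
    show ?case by (simp add: l2_norm_def)
  next
    case (Suc k)
    have "l2_norm M (\<lambda>x. u (n + Suc k) x - u n x)
        = l2_norm M (\<lambda>x. (u (n + k) x - u n x) + (u (Suc (n + k)) x - u (n + k) x))" by simp
    also have "\<dots> \<le> 2 * (1/2)^n * (1 - (1/2)^k) + (1/2)^(n + k)"
      by (rule order_trans[OF l2_triangle[OF diff diff] add_mono[OF Suc d]])
    also have "\<dots> = 2 * (1/2)^n * (1 - (1/2)^Suc k)" by (simp add: power_add algebra_simps)
    finally show ?case .
  qed
  have ineq2: "l2_norm M (\<lambda>x. u n x - u m x) \<le> 2 * (1/2)^n" if "m \<ge> n" for m n
  proof -
    have "l2_norm M (\<lambda>x. u m x - u n x) \<le> 2 * (1/2)^n * (1 - (1/2)^(m - n))"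
      using ineq[of n "m - n"] that by simp
    also have "\<dots> \<le> 2 * (1/2)^n" by (simp add: algebra_simps)
    finally show ?thesis by (simp add: l2_norm_minus_commute[of M "u m"])
  qed
  have "AE x in M. summable (\<lambda>n. norm (u (Suc n) x - u n x) * sqrt (w x))"
  proof -
    let ?t = "\<lambda>n x. norm (u (Suc n) x - u n x) * sqrt (w x)"
    have b: "(\<integral>\<^sup>+x. ennreal (?t n x) \<partial>M) \<le> ennreal (l2_norm M sqrt_w * (1/2)^n)" for n
    proof -
      have aL: "(\<lambda>x. complex_of_real (norm (u (Suc n) x - u n x))) \<in> L2_space M"
        using diff[of "Suc n" n] unfolding L2_space_def by auto
      have "integrable M (\<lambda>x. complex_of_real (?t n x))"
        using l2_inner_integrable[OF aL sqrt_w] by (simp add: sqrt_w_def)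
      then have i: "integrable M (?t n)" by (simp only: complex_of_real_integrable_eq)
      have "(\<integral>x. ?t n x \<partial>M) = Re (l2_inner M (\<lambda>x. complex_of_real (norm (u (Suc n) x - u n x))) sqrt_w)"
        unfolding l2_inner_def sqrt_w_def by (simp flip: of_real_mult)
      also have "\<dots> \<le> l2_norm M (\<lambda>x. complex_of_real (norm (u (Suc n) x - u n x))) * l2_norm M sqrt_w"
        using l2_Cauchy_Schwarz[OF aL sqrt_w] complex_Re_le_cmod order_trans by blast
      also have "l2_norm M (\<lambda>x. complex_of_real (norm (u (Suc n) x - u n x))) = l2_norm M (\<lambda>x. u (Suc n) x - u n x)"
        by (simp add: l2_norm_def)
      also have "\<dots> * l2_norm M sqrt_w \<le> (1/2)^n * l2_norm M sqrt_w" by (intro mult_right_mono d) simp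
      finally have "(\<integral>x. ?t n x \<partial>M) \<le> l2_norm M sqrt_w * (1/2)^n" by (simp add: mult.commute)
      then show ?thesis
        using i w0 by (subst nn_integral_eq_integral) (auto intro!: ennreal_leI simp: less_imp_le)
    qed
    have "(\<integral>\<^sup>+x. (\<Sum>n. ennreal (?t n x)) \<partial>M) = (\<Sum>n. \<integral>\<^sup>+x. ennreal (?t n x) \<partial>M)"
      by (rule nn_integral_suminf) measurable
    also have "\<dots> \<le> (\<Sum>n. ennreal (l2_norm M sqrt_w * (1/2)^n))" by (intro suminf_le b) auto
    also have "\<dots> = ennreal (\<Sum>n. l2_norm M sqrt_w * (1/2)^n)"
      by (intro suminf_ennreal2) (auto intro!: summable_mult summable_geometric)
    also have "\<dots> < \<infinity>" by simp
    finally have "AE x in M. (\<Sum>n. ennreal (?t n x)) \<noteq> \<infinity>"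
      by (intro nn_integral_noteq_infinite) auto
    then show ?thesis
      by eventually_elim (rule summable_suminf_not_top, auto simp: w0 less_imp_le)
  qed
  then have conv: "AE x in M. convergent (\<lambda>n. u n x)"
  proof eventually_elim
    case (elim x)
    then have "summable (\<lambda>n. norm (u (Suc n) x - u n x))"
      using summable_mult2[OF elim, of "inverse (sqrt (w x))"] w0[of x] by (simp add: mult.assoc)
    then have "summable (\<lambda>n. u (Suc n) x - u n x)" by (rule summable_norm_cancel)
    then have "convergent (\<lambda>n. (u n x - u 0 x) + u 0 x)"
      unfolding summable_iff_convergent
      by (subst (asm) sum_lessThan_telescope) (rule convergent_add, auto intro: convergent_const)
    then show ?case by simp
  qed
  define h where "h x = lim (\<lambda>n. u n x)" for x
  have hm[measurable]: "h \<in> borel_measurable M" unfolding h_def by measurable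
  have lim: "AE x in M. (\<lambda>n. u n x) \<longlonglongrightarrow> h x"
    using conv by eventually_elim (simp add: h_def convergent_LIMSEQ_iff)
  have bound: "(\<integral>\<^sup>+x. ennreal ((norm (u n x - h x))\<^sup>2) \<partial>M) \<le> ennreal ((2 * (1/2)^n)\<^sup>2)" for n
  proof -
    have "(\<integral>\<^sup>+x. ennreal ((norm (u n x - h x))\<^sup>2) \<partial>M)
        = (\<integral>\<^sup>+x. liminf (\<lambda>m. ennreal ((norm (u n x - u m x))\<^sup>2)) \<partial>M)"
    proof (rule nn_integral_cong_AE, use lim in eventually_elim)
      case (elim x)
      then have "(\<lambda>m. ennreal ((norm (u n x - u m x))\<^sup>2)) \<longlonglongrightarrow> ennreal ((norm (u n x - h x))\<^sup>2)"
        by (intro tendsto_intros)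
      then show ?case by (rule lim_imp_Liminf[OF trivial_limit_sequentially, symmetric])
    qed
    also have "\<dots> \<le> liminf (\<lambda>m. \<integral>\<^sup>+x. ennreal ((norm (u n x - u m x))\<^sup>2) \<partial>M)"
      by (rule nn_integral_liminf) measurable
    also have "\<dots> \<le> liminf (\<lambda>m. ennreal ((2 * (1/2)^n)\<^sup>2))"
    proof (rule Liminf_mono, rule eventually_sequentiallyI[of n])
      fix m assume "n \<le> m"
      then have "(l2_norm M (\<lambda>x. u n x - u m x))\<^sup>2 \<le> (2 * (1/2)^n)\<^sup>2"
        by (intro power_mono ineq2) auto
      then show "(\<integral>\<^sup>+x. ennreal ((norm (u n x - u m x))\<^sup>2) \<partial>M) \<le> ennreal ((2 * (1/2)^n)\<^sup>2)"
        using L2_integrable[OF diff[of n m]]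
        by (subst nn_integral_eq_integral) (auto intro!: ennreal_leI simp: l2_norm_square)
    qed
    also have "\<dots> = ennreal ((2 * (1/2)^n)\<^sup>2)" by (rule Liminf_const) simp
    finally show ?thesis .
  qed
  have L: "(\<lambda>x. u n x - h x) \<in> L2_space M" for n
    unfolding L2_space_def
    using bound[of n] by (auto intro!: integrableI_bounded simp: top.not_eq_extremum[symmetric] neq_top_trans
        dest: le_less_trans[OF _ ennreal_less_top])
  have le: "l2_norm M (\<lambda>x. u n x - h x) \<le> 2 * (1/2)^n" for n
  proof (rule power2_le_imp_le)
    have "ennreal ((l2_norm M (\<lambda>x. u n x - h x))\<^sup>2) \<le> ennreal ((2 * (1/2)^n)\<^sup>2)"
      using bound[of n] L2_integrable[OF L[of n]]
      by (subst (asm) nn_integral_eq_integral) (auto simp: l2_norm_square)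
    then show "(l2_norm M (\<lambda>x. u n x - h x))\<^sup>2 \<le> (2 * (1/2)^n)\<^sup>2" by (simp add: ennreal_le_iff)
  qed simp
  show thesis
  proof
    show "h \<in> L2_space M" using L2_diff[OF u[of 0] L[of 0]] by simp
    show "(\<lambda>n. l2_norm M (\<lambda>x. u n x - h x)) \<longlonglongrightarrow> 0"
    proof (rule tendsto_sandwich[OF _ _ tendsto_const])
      show "(\<lambda>n. 2 * (1/2 :: real)^n) \<longlonglongrightarrow> 0"
        by (intro tendsto_mult_right_zero LIMSEQ_realpow_zero) auto
    qed (use le in auto)
  qed
qed

lemma l2_norm_zero [simp]: "l2_norm M (\<lambda>_. 0) = 0"
  by (simp add: l2_norm_def)

subsection \<open>Orthonormal bases\<close>

lemma l2_Bessel_identity: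
  assumes F: "finite F" "F \<subseteq> L2_space M"
    and o: "\<forall>e\<in>F. \<forall>e'\<in>F. l2_inner M e e' = (if e = e' then 1 else 0)"
    and f: "f \<in> L2_space M"
  shows "(l2_norm M (\<lambda>x. f x - (\<Sum>e\<in>F. l2_inner M f e * e x)))\<^sup>2
    = (l2_norm M f)\<^sup>2 - (\<Sum>e\<in>F. (norm (l2_inner M f e))\<^sup>2)"
proof -
  let ?S = "\<lambda>x. \<Sum>e\<in>F. l2_inner M f e * e x"
  have L: "\<And>e. e \<in> F \<Longrightarrow> e \<in> L2_space M" using F by auto
  have S: "?S \<in> L2_space M" using L2_sum[of F "\<lambda>e. e" M] F L by auto
  have Sh: "l2_inner M ?S h = (\<Sum>e\<in>F. l2_inner M f e * l2_inner M e h)" if "h \<in> L2_space M" for h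
    using l2_inner_sum_left[of F "\<lambda>e. e" M h] F(1) L that by auto
  have Sf: "l2_inner M ?S f = complex_of_real (\<Sum>e\<in>F. (norm (l2_inner M f e))\<^sup>2)"
    unfolding Sh[OF f] by (subst l2_inner_commute) (simp only: complex_norm_square of_real_sum)
  have Se: "l2_inner M ?S e = l2_inner M f e" if e: "e \<in> F" for e
  proof -
    have "(\<Sum>e'\<in>F. l2_inner M f e' * l2_inner M e' e) = (\<Sum>e'\<in>F. if e' = e then l2_inner M f e else 0)"
      using o e by (intro sum.cong) auto
    then show ?thesis using Sh[OF L[OF e]] F(1) e by simp
  qed
  have "l2_inner M ?S ?S = (\<Sum>e\<in>F. l2_inner M f e * l2_inner M e ?S)" by (rule Sh[OF S])
  also have "\<dots> = (\<Sum>e\<in>F. l2_inner M f e * cnj (l2_inner M f e))"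
    by (intro sum.cong refl) (subst l2_inner_commute, simp add: Se)
  also have "\<dots> = complex_of_real (\<Sum>e\<in>F. (norm (l2_inner M f e))\<^sup>2)"
    by (simp only: complex_norm_square of_real_sum)
  finally have SS: "(l2_norm M ?S)\<^sup>2 = (\<Sum>e\<in>F. (norm (l2_inner M f e))\<^sup>2)"
    unfolding l2_inner_self of_real_eq_iff .
  have "l2_inner M f ?S = complex_of_real (\<Sum>e\<in>F. (norm (l2_inner M f e))\<^sup>2)"
    by (subst l2_inner_commute) (simp add: Sf)
  then show ?thesis
    using l2_norm_comb_square[OF f S, of "-1"] SS by simp
qed

text \<open>
  A maximal orthonormal set exists by Zorn's lemma. A vector orthogonal to it and different from
  zero could be normalised and added to it.
\<close>

lemma onb_exists: "\<exists>E. onb M E"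
proof -
  define A where "A = {E. E \<subseteq> L2_space M \<and> (\<forall>e\<in>E. \<forall>e'\<in>E. l2_inner M e e' = (if e = e' then 1 else 0))}"
  have A_iff: "E \<in> A \<longleftrightarrow> E \<subseteq> L2_space M \<and> (\<forall>e\<in>E. \<forall>e'\<in>E. l2_inner M e e' = (if e = e' then 1 else 0))" for E
    by (simp add: A_def)
  have "\<exists>E\<in>A. \<forall>X\<in>A. E \<subseteq> X \<longrightarrow> X = E"
  proof (rule subset_Zorn')
    fix C assume C: "subset.chain A C"
    then have CA: "C \<subseteq> A" and ch: "\<And>X Y. X \<in> C \<Longrightarrow> Y \<in> C \<Longrightarrow> X \<subseteq> Y \<or> Y \<subseteq> X"
      by (auto simp: subset_chain_def)
    have *: "l2_inner M e e' = (if e = e' then 1 else 0)" if ee: "e \<in> \<Union>C" "e' \<in> \<Union>C" for e e'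
    proof -
      obtain X Y where XY: "X \<in> C" "e \<in> X" "Y \<in> C" "e' \<in> Y" using ee by auto
      from ch[OF XY(1,3)] obtain Z where "Z \<in> C" "e \<in> Z" "e' \<in> Z" using XY by blast
      then have "Z \<in> A" using CA by blast
      then show ?thesis using A_iff[of Z] \<open>e \<in> Z\<close> \<open>e' \<in> Z\<close> by blast
    qed
    have "\<Union>C \<subseteq> L2_space M" using CA A_iff by blast
    then show "\<Union>C \<in> A" unfolding A_iff by (intro conjI ballI *)
  qed
  then obtain E where E: "E \<in> A" and max: "\<forall>X\<in>A. E \<subseteq> X \<longrightarrow> X = E" ..
  have "AE x in M. f x = 0" if f: "f \<in> L2_space M" and fE: "\<forall>e\<in>E. l2_inner M f e = 0" for f
  proof (rule ccontr)
    assume "\<not> (AE x in M. f x = 0)"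
    then have n0: "l2_norm M f \<noteq> 0" using l2_norm_eq_0[OF f] by blast
    define g where "g x = complex_of_real (1 / l2_norm M f) * f x" for x
    have g: "g \<in> L2_space M" unfolding g_def by (rule L2_scale[OF f])
    have gg: "l2_inner M g g = 1"
      unfolding g_def l2_inner_self l2_norm_scale using n0 by (simp add: norm_divide)
    have ge: "l2_inner M g e = 0" if "e \<in> E" for e
      unfolding g_def l2_inner_scale_left using fE that by simp
    have eg: "l2_inner M e g = 0" if "e \<in> E" for e
      by (subst l2_inner_commute) (simp add: ge[OF that])
    have "g \<notin> E" using ge gg by auto
    moreover have "insert g E \<in> A" using E g gg ge eg calculation unfolding A_iff by auto
    ultimately show False using max by blast
  qed
  then show ?thesis using E unfolding A_iff onb_def by blast
qed

lemma some_onb: "onb M (some_onb M)"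
  unfolding some_onb_def by (rule someI_ex[OF onb_exists])

lemma some_onb_L2: "e \<in> some_onb M \<Longrightarrow> e \<in> L2_space M"
  using some_onb[of M] by (auto simp: onb_def)

lemma some_onb_ortho: "e \<in> some_onb M \<Longrightarrow> e' \<in> some_onb M \<Longrightarrow> l2_inner M e e' = (if e = e' then 1 else 0)"
  using some_onb[of M] by (auto simp: onb_def)

definition onb_partial :: "'a measure \<Rightarrow> ('a \<Rightarrow> complex) set \<Rightarrow> ('a \<Rightarrow> complex) \<Rightarrow> 'a \<Rightarrow> complex" where
  "onb_partial M F f = (\<lambda>x. \<Sum>e\<in>F. l2_inner M f e * e x)"

lemma onb_partial_L2: "finite F \<Longrightarrow> F \<subseteq> some_onb M \<Longrightarrow> onb_partial M F f \<in> L2_space M"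
  unfolding onb_partial_def using L2_sum[of F "\<lambda>e. e" M] some_onb_L2[of _ M] by blast

lemma onb_remainder:
  assumes "finite F" "F \<subseteq> some_onb M" "f \<in> L2_space M"
  shows "(l2_norm M (\<lambda>x. f x - onb_partial M F f x))\<^sup>2
    = (l2_norm M f)\<^sup>2 - (\<Sum>e\<in>F. (norm (l2_inner M f e))\<^sup>2)"
  unfolding onb_partial_def
proof (rule l2_Bessel_identity)
  show "\<forall>e\<in>F. \<forall>e'\<in>F. l2_inner M e e' = (if e = e' then 1 else 0)"
    using some_onb_ortho[of _ M] assms(2) by (intro ballI) blast
qed (use assms some_onb_L2[of _ M] in auto)

lemma onb_Bessel:
  assumes "finite F" "F \<subseteq> some_onb M" "f \<in> L2_space M"
  shows "(\<Sum>e\<in>F. (norm (l2_inner M f e))\<^sup>2) \<le> (l2_norm M f)\<^sup>2"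
  using onb_remainder[OF assms] zero_le_power2[of "l2_norm M (\<lambda>x. f x - onb_partial M F f x)"] by linarith

text \<open>
  The sum of the squared coefficients converges by Bessel's inequality. Along finite sets \<open>F n\<close> with
  rapidly decreasing remainders the partial expansions \<open>u n\<close> of \<open>f\<close> converge to some \<open>h\<close> with the same
  coefficients, and the basis is total, so \<open>h = f\<close>.
\<close>

lemma (in sigma_finite_measure) Parseval:
  assumes f: "f \<in> L2_space M"
  shows "((\<lambda>e. (norm (l2_inner M f e))\<^sup>2) has_sum (l2_norm M f)\<^sup>2) (some_onb M)"
proof -
  let ?E = "some_onb M" and ?c = "\<lambda>e. (norm (l2_inner M f e))\<^sup>2"
  have sm: "?c summable_on ?E"
    using onb_Bessel[OF _ _ f] by (intro nonneg_bdd_above_summable_on) (auto simp: bdd_above_def)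
  define s where "s = (\<Sum>\<^sub>\<infinity>e\<in>?E. ?c e)"
  have hs: "(?c has_sum s) ?E" using sm by (simp add: s_def)
  have le_s: "sum ?c F \<le> s" if "finite F" "F \<subseteq> ?E" for F
    unfolding s_def by (rule finite_sum_le_infsum[OF sm that]) auto
  have "\<exists>F. finite F \<and> F \<subseteq> ?E \<and> s - sum ?c F < (1/4)^n / 4" for n
  proof -
    have "eventually (\<lambda>F. dist (sum ?c F) s < (1/4)^n / 4) (finite_subsets_at_top ?E)"
      using hs unfolding has_sum_def by (intro tendstoD) auto
    then obtain F where "finite F" "F \<subseteq> ?E" "dist (sum ?c F) s < (1/4)^n / 4"
      unfolding eventually_finite_subsets_at_top by blast
    then show ?thesis unfolding dist_real_def by (intro exI[of _ F] conjI) linarith+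
  qed
  then obtain F0 where F0: "\<And>n. finite (F0 n)" "\<And>n. F0 n \<subseteq> ?E" "\<And>n. s - sum ?c (F0 n) < (1/4)^n / 4"
    by metis
  define F where "F n = (\<Union>k\<le>n. F0 k)" for n
  have F: "finite (F n)" "F n \<subseteq> ?E" for n using F0 by (auto simp: F_def)
  have Fm: "F n \<subseteq> F (Suc n)" for n unfolding F_def by (rule UN_mono) auto
  have Fs: "s - sum ?c (F n) < (1/4)^n / 4" for n
  proof -
    have "sum ?c (F0 n) \<le> sum ?c (F n)" using F by (intro sum_mono2) (auto simp: F_def)
    with F0(3)[of n] show ?thesis by linarith
  qed
  define u where "u n = onb_partial M (F n) f" for n
  have u: "u n \<in> L2_space M" for n unfolding u_def by (rule onb_partial_L2[OF F])
  have ue: "l2_inner M (u n) e = (if e \<in> F n then l2_inner M f e else 0)" if e: "e \<in> ?E" for n e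
  proof -
    have "l2_inner M (u n) e = (\<Sum>e'\<in>F n. l2_inner M f e' * l2_inner M e' e)"
      unfolding u_def onb_partial_def
      using l2_inner_sum_left[of "F n" "\<lambda>e. e" M e] F[of n] some_onb_L2[of _ M] e by blast
    also have "\<dots> = (\<Sum>e'\<in>F n. if e' = e then l2_inner M f e else 0)"
      using F[of n] e some_onb_ortho[of _ M e] by (intro sum.cong) auto
    finally show ?thesis using F(1)[of n] by simp
  qed
  have step: "l2_norm M (\<lambda>x. u (Suc n) x - u n x) \<le> (1/2)^n" for n
  proof (rule power2_le_imp_le)
    have "u (Suc n) x - u n x = (\<Sum>e\<in>F (Suc n) - F n. l2_inner M f e * e x)" for x
      unfolding u_def onb_partial_def by (rule sum_diff[OF F(1) Fm, symmetric])
    then have d: "(\<lambda>x. u (Suc n) x - u n x) = onb_partial M (F (Suc n) - F n) f"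
      by (auto simp: onb_partial_def)
    define G where "G = F (Suc n) - F n"
    have G: "finite G" "G \<subseteq> ?E" using F by (auto simp: G_def)
    have ge: "l2_inner M (onb_partial M G f) e = (if e \<in> G then l2_inner M f e else 0)" if e: "e \<in> ?E" for e
    proof -
      have "l2_inner M (onb_partial M G f) e = (\<Sum>e'\<in>G. l2_inner M f e' * l2_inner M e' e)"
        unfolding onb_partial_def
        using l2_inner_sum_left[of G "\<lambda>e. e" M e] G some_onb_L2[of _ M] e by blast
      also have "\<dots> = (\<Sum>e'\<in>G. if e' = e then l2_inner M f e else 0)"
        using G e some_onb_ortho[of _ M e] by (intro sum.cong) auto
      finally show ?thesis using G by simp
    qed
    have "onb_partial M G (onb_partial M G f) = onb_partial M G f"
      unfolding onb_partial_def[of M G "onb_partial M G f"]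
      using G ge by (auto simp: onb_partial_def[of M G f] intro!: ext sum.cong)
    then have "(l2_norm M (onb_partial M G f))\<^sup>2 = (\<Sum>e\<in>G. (norm (l2_inner M (onb_partial M G f) e))\<^sup>2)"
      using onb_remainder[OF G onb_partial_L2[OF G, of f]] l2_norm_zero[of M] by simp
    also have "\<dots> = sum ?c G" using G ge by (intro sum.cong) auto
    also have "\<dots> = sum ?c (F (Suc n)) - sum ?c (F n)"
      unfolding G_def by (rule sum_diff[OF F(1) Fm])
    also have "\<dots> \<le> (1/4)^n"
    proof -
      have "(0::real) \<le> (1/4)^n" by simp
      then show ?thesis using Fs[of n] le_s[OF F, of "Suc n"] by linarith
    qed
    also have "\<dots> = ((1/2)^n)\<^sup>2" by (simp add: power2_eq_square flip: power_mult_distrib)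
    finally show "(l2_norm M (\<lambda>x. u (Suc n) x - u n x))\<^sup>2 \<le> ((1/2)^n)\<^sup>2" by (simp add: d G_def)
  qed simp
  obtain h where h: "h \<in> L2_space M" and lim: "(\<lambda>n. l2_norm M (\<lambda>x. u n x - h x)) \<longlonglongrightarrow> 0"
    using L2_complete[OF u step] by blast
  have "l2_inner M (\<lambda>x. f x - h x) e = 0" if e: "e \<in> ?E" for e
  proof -
    have eL: "e \<in> L2_space M" by (rule some_onb_L2[OF e])
    have "(\<lambda>n. l2_inner M (u n) e - l2_inner M h e) \<longlonglongrightarrow> 0"
    proof (rule Lim_null_comparison[OF _ tendsto_mult_left_zero[OF lim]])
      show "\<forall>\<^sub>F n in sequentially. norm (l2_inner M (u n) e - l2_inner M h e) \<le> l2_norm M (\<lambda>x. u n x - h x) * l2_norm M e"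
        using l2_Cauchy_Schwarz[OF L2_diff[OF u h] eL] l2_inner_diff_left[OF u h eL] by simp
    qed
    then have "(\<lambda>n. l2_inner M (u n) e) \<longlonglongrightarrow> l2_inner M h e" by (simp add: LIM_zero_iff)
    moreover have "(\<lambda>n. l2_inner M (u n) e) \<longlonglongrightarrow> l2_inner M f e"
    proof (cases "\<exists>n. e \<in> F n")
      case True
      then obtain n where n: "e \<in> F n" by blast
      have "F n \<subseteq> F m" if "m \<ge> n" for m using lift_Suc_mono_le[of F n m] Fm that by blast
      then have "\<forall>m\<ge>n. l2_inner M (u m) e = l2_inner M f e" using n ue[OF e] by auto
      then show ?thesis by (intro tendsto_eventually) (auto simp: eventually_at_top_linorder)
    next
      case False
      \<comment> \<open>A basis vector that is never used has a coefficient smaller than every remainder.\<close>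
      have "?c e \<le> (1/4)^n / 4" for n
      proof -
        have "sum ?c (insert e (F n)) \<le> s" using le_s[of "insert e (F n)"] F e by auto
        then show ?thesis using Fs[of n] False F(1)[of n] by auto
      qed
      then have "?c e \<le> 0"
        by (intro LIMSEQ_le_const[of "\<lambda>n. (1/4::real)^n / 4"])
          (auto intro!: tendsto_divide_zero LIMSEQ_realpow_zero)
      then have "l2_inner M f e = 0" by simp
      then show ?thesis using ue[OF e] False by simp
    qed
    ultimately have "l2_inner M f e = l2_inner M h e" using LIMSEQ_unique by blast
    then show ?thesis using l2_inner_diff_left[OF f h eL] by simp
  qed
  then have "AE x in M. f x - h x = 0"
    using some_onb[of M] L2_diff[OF f h] unfolding onb_def by blast
  then have fh: "AE x in M. h x = f x" by eventually_elim simp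
  have "l2_norm M (\<lambda>x. u n x - h x) = l2_norm M (\<lambda>x. f x - u n x)" for n
    unfolding l2_norm_minus_commute[of M "u n"]
    by (rule l2_norm_cong_AE) (use fh L2_diff[OF f u] L2_diff[OF h u] in \<open>auto elim!: eventually_mono\<close>)
  then have "(\<lambda>n. (l2_norm M (\<lambda>x. f x - u n x))\<^sup>2) \<longlonglongrightarrow> 0\<^sup>2"
    using lim by (intro tendsto_power) simp
  then have "(\<lambda>n. (l2_norm M f)\<^sup>2 - sum ?c (F n)) \<longlonglongrightarrow> 0"
    unfolding u_def onb_remainder[OF F f] by simp
  moreover have "(\<lambda>n. sum ?c (F n)) \<longlonglongrightarrow> s"
  proof (rule tendsto_sandwich[of "\<lambda>n. s - (1/4)^n / 4"])
    show "(\<lambda>n. s - (1/4)^n / 4) \<longlonglongrightarrow> s"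
      by (rule tendsto_eq_rhs[OF tendsto_diff[OF tendsto_const tendsto_divide_zero[OF LIMSEQ_realpow_zero]]]) auto
    show "\<forall>\<^sub>F n in sequentially. s - (1/4)^n / 4 \<le> sum ?c (F n)"
      using Fs by (intro always_eventually allI) (smt (verit))
    show "\<forall>\<^sub>F n in sequentially. sum ?c (F n) \<le> s" using le_s F by simp
  qed simp
  then have "(\<lambda>n. (l2_norm M f)\<^sup>2 - sum ?c (F n)) \<longlonglongrightarrow> (l2_norm M f)\<^sup>2 - s" by (intro tendsto_intros)
  ultimately have "(l2_norm M f)\<^sup>2 = s" using LIMSEQ_unique by fastforce
  then show ?thesis using hs by simp
qed

subsection \<open>Bounded operators\<close>

lemma bop_L2: "A \<in> bounded_ops M \<Longrightarrow> f \<in> L2_space M \<Longrightarrow> A f \<in> L2_space M"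
  by (simp add: bounded_ops_def)

lemma bop_bound:
  assumes "A \<in> bounded_ops M"
  obtains C where "0 \<le> C" "\<And>f. f \<in> L2_space M \<Longrightarrow> l2_norm M (A f) \<le> C * l2_norm M f"
proof -
  obtain C where C: "\<forall>f\<in>L2_space M. l2_norm M (A f) \<le> C * l2_norm M f"
    using assms by (auto simp: bounded_ops_def)
  have "l2_norm M (A f) \<le> \<bar>C\<bar> * l2_norm M f" if "f \<in> L2_space M" for f
    using C that by (meson abs_ge_self l2_norm_nonneg mult_right_mono order_trans)
  then show thesis by (intro that[of "\<bar>C\<bar>"]) auto
qed

lemma bop_inner_comb:
  assumes A: "A \<in> bounded_ops M" and f: "f \<in> L2_space M" and g: "g \<in> L2_space M" and h: "h \<in> L2_space M"
  shows "l2_inner M (A (\<lambda>x. f x + c * g x)) h = l2_inner M (A f) h + c * l2_inner M (A g) h"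
proof -
  have "AE x in M. A (\<lambda>x. f x + c * g x) x = A f x + c * A g x"
    using A f g by (auto simp: bounded_ops_def)
  then have "l2_inner M (A (\<lambda>x. f x + c * g x)) h = l2_inner M (\<lambda>x. A f x + c * A g x) h"
    by (rule l2_inner_cong_AE[OF _ bop_L2[OF A L2_comb[OF f g]]
          L2_comb[OF bop_L2[OF A f] bop_L2[OF A g]] h])
  then show ?thesis using l2_inner_comb_left[OF bop_L2[OF A f] bop_L2[OF A g] h] by simp
qed

lemma bop_inner_zero: "A \<in> bounded_ops M \<Longrightarrow> h \<in> L2_space M \<Longrightarrow> l2_inner M (A (\<lambda>_. 0)) h = 0"
  using bop_inner_comb[OF _ L2_zero L2_zero, of A M h 1] by simp

lemma bop_inner_scale:
  "A \<in> bounded_ops M \<Longrightarrow> f \<in> L2_space M \<Longrightarrow> h \<in> L2_space M \<Longrightarrow>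
    l2_inner M (A (\<lambda>x. c * f x)) h = c * l2_inner M (A f) h"
  using bop_inner_comb[OF _ L2_zero, of A M f h c] bop_inner_zero[of A M h] by simp

lemma bop_inner_sum:
  "A \<in> bounded_ops M \<Longrightarrow> finite I \<Longrightarrow> (\<And>i. i \<in> I \<Longrightarrow> v i \<in> L2_space M) \<Longrightarrow> h \<in> L2_space M \<Longrightarrow>
    l2_inner M (A (\<lambda>x. \<Sum>i\<in>I. c i * v i x)) h = (\<Sum>i\<in>I. c i * l2_inner M (A (v i)) h)"
proof (induction I rule: infinite_finite_induct)
  case empty
  then show ?case by (simp add: bop_inner_zero)
next
  case (insert i I)
  have "l2_inner M (A (\<lambda>x. (\<Sum>i\<in>I. c i * v i x) + c i * v i x)) h
     = l2_inner M (A (\<lambda>x. \<Sum>i\<in>I. c i * v i x)) h + c i * l2_inner M (A (v i)) h"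
    using insert by (intro bop_inner_comb L2_sum) auto
  with insert show ?case by (simp add: add.commute)
qed simp

text \<open>
  The remainders of the basis expansion of \<open>f\<close> tend to zero in norm by Parseval's identity. The formula
  evaluates traces and Hilbert--Schmidt pairings with rank one operators.
\<close>

lemma (in sigma_finite_measure) bop_expansion:
  assumes A: "A \<in> bounded_ops M" and f: "f \<in> L2_space M" and h: "h \<in> L2_space M"
  shows "((\<lambda>e. l2_inner M f e * l2_inner M (A e) h) has_sum l2_inner M (A f) h) (some_onb M)"
proof -
  let ?E = "some_onb M" and ?T = "finite_subsets_at_top (some_onb M)"
  obtain C where C: "0 \<le> C" "\<And>f. f \<in> L2_space M \<Longrightarrow> l2_norm M (A f) \<le> C * l2_norm M f"
    using bop_bound[OF A] by blast
  let ?r = "\<lambda>F. l2_norm M (\<lambda>x. f x - onb_partial M F f x)"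
  have "((\<lambda>F. (l2_norm M f)\<^sup>2 - (\<Sum>e\<in>F. (norm (l2_inner M f e))\<^sup>2)) \<longlongrightarrow> (l2_norm M f)\<^sup>2 - (l2_norm M f)\<^sup>2) ?T"
    using Parseval[OF f] unfolding has_sum_def by (intro tendsto_intros)
  then have "((\<lambda>F. (?r F)\<^sup>2) \<longlongrightarrow> 0) ?T"
    by (rule Lim_transform_eventually[THEN tendsto_eq_rhs])
      (auto simp: onb_remainder[OF _ _ f] intro!: eventually_finite_subsets_at_top_weakI)
  then have "((\<lambda>F. sqrt ((?r F)\<^sup>2)) \<longlongrightarrow> sqrt 0) ?T" by (intro tendsto_intros)
  then have r: "(?r \<longlongrightarrow> 0) ?T" by simp
  have "((\<lambda>F. (\<Sum>e\<in>F. l2_inner M f e * l2_inner M (A e) h) - l2_inner M (A f) h) \<longlongrightarrow> 0) ?T"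
  proof (rule Lim_null_comparison)
    show "((\<lambda>F. C * ?r F * l2_norm M h) \<longlongrightarrow> 0) ?T"
      using tendsto_mult_left_zero[OF tendsto_mult_right_zero[OF r]] .
    show "\<forall>\<^sub>F F in ?T. norm ((\<Sum>e\<in>F. l2_inner M f e * l2_inner M (A e) h) - l2_inner M (A f) h) \<le> C * ?r F * l2_norm M h"
    proof (rule eventually_finite_subsets_at_top_weakI)
      fix F assume F: "finite F" "F \<subseteq> ?E"
      have p: "onb_partial M F f \<in> L2_space M" by (rule onb_partial_L2[OF F])
      have d: "(\<lambda>x. f x - onb_partial M F f x) \<in> L2_space M" by (rule L2_diff[OF f p])
      have "l2_inner M (A (onb_partial M F f)) h = (\<Sum>e\<in>F. l2_inner M f e * l2_inner M (A e) h)"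
        unfolding onb_partial_def
        using bop_inner_sum[OF A F(1), of "\<lambda>e. e" h] F some_onb_L2[of _ M] h by blast
      then have "(\<Sum>e\<in>F. l2_inner M f e * l2_inner M (A e) h) - l2_inner M (A f) h
          = - l2_inner M (A (\<lambda>x. f x - onb_partial M F f x)) h"
        using bop_inner_comb[OF A f p h, of "-1"] by simp
      also have "norm \<dots> \<le> l2_norm M (A (\<lambda>x. f x - onb_partial M F f x)) * l2_norm M h"
        unfolding norm_minus_cancel by (rule l2_Cauchy_Schwarz[OF bop_L2[OF A d] h])
      also have "\<dots> \<le> C * ?r F * l2_norm M h" by (intro mult_right_mono C(2) d) simp
      finally show "norm ((\<Sum>e\<in>F. l2_inner M f e * l2_inner M (A e) h) - l2_inner M (A f) h) \<le> C * ?r F * l2_norm M h" .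
    qed
  qed
  then show ?thesis unfolding has_sum_def by (simp add: LIM_zero_iff)
qed

lemma id_bounded_op: "id \<in> bounded_ops M"
  unfolding bounded_ops_def by (auto intro!: exI[of _ 1])

lemma (in sigma_finite_measure) inner_expansion:
  assumes f: "f \<in> L2_space M" and h: "h \<in> L2_space M"
  shows "((\<lambda>e. l2_inner M f e * l2_inner M e h) has_sum l2_inner M f h) (some_onb M)"
  using bop_expansion[OF id_bounded_op f h] by simp

lemma bounded_op_comb:
  assumes A: "A \<in> bounded_ops M" and B: "B \<in> bounded_ops M"
  shows "(\<lambda>f x. A f x + c * B f x) \<in> bounded_ops M"
proof -
  obtain C where C: "0 \<le> C" "\<And>f. f \<in> L2_space M \<Longrightarrow> l2_norm M (A f) \<le> C * l2_norm M f"
    using bop_bound[OF A] by blast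
  obtain D where D: "0 \<le> D" "\<And>f. f \<in> L2_space M \<Longrightarrow> l2_norm M (B f) \<le> D * l2_norm M f"
    using bop_bound[OF B] by blast
  have "l2_norm M (\<lambda>x. A f x + c * B f x) \<le> (C + norm c * D) * l2_norm M f" if f: "f \<in> L2_space M" for f
  proof -
    have "l2_norm M (\<lambda>x. A f x + c * B f x) \<le> l2_norm M (A f) + l2_norm M (\<lambda>x. c * B f x)"
      by (intro l2_triangle L2_scale bop_L2[OF A f] bop_L2[OF B f])
    also have "\<dots> \<le> C * l2_norm M f + norm c * (D * l2_norm M f)"
      unfolding l2_norm_scale by (intro add_mono C D f mult_left_mono) auto
    finally show ?thesis by (simp add: algebra_simps)
  qed
  moreover have "AE x in M. A (\<lambda>y. f y + k * g y) x + c * B (\<lambda>y. f y + k * g y) x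
      = A f x + c * B f x + k * (A g x + c * B g x)"
    if f: "f \<in> L2_space M" and g: "g \<in> L2_space M" for f g k
  proof -
    have "AE x in M. A (\<lambda>y. f y + k * g y) x = A f x + k * A g x"
      "AE x in M. B (\<lambda>y. f y + k * g y) x = B f x + k * B g x"
      using A B f g by (auto simp: bounded_ops_def)
    then show ?thesis by eventually_elim (simp add: algebra_simps)
  qed
  moreover have "(\<lambda>x. A f x + c * B f x) \<in> L2_space M" if "f \<in> L2_space M" for f
    by (rule L2_comb[OF bop_L2[OF A that] bop_L2[OF B that]])
  ultimately show ?thesis
    unfolding bounded_ops_def by blast
qed

lemma zero_bounded_op: "(\<lambda>f x. 0) \<in> bounded_ops M"
  unfolding bounded_ops_def by (auto simp: l2_norm_def intro!: exI[of _ 0])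

lemma sum_bounded_op:
  "finite I \<Longrightarrow> (\<And>i. i \<in> I \<Longrightarrow> A i \<in> bounded_ops M) \<Longrightarrow> (\<lambda>f x. \<Sum>i\<in>I. A i f x) \<in> bounded_ops M"
proof (induction I rule: finite_induct)
  case (insert i I)
  then have "(\<lambda>f x. (\<Sum>i\<in>I. A i f x) + 1 * A i f x) \<in> bounded_ops M"
    by (intro bounded_op_comb) auto
  with insert show ?case by (simp add: add.commute)
qed (simp add: zero_bounded_op)

subsection \<open>Rank one operators\<close>

text \<open>
  The operator that physicists write $|a\rangle\langle b|$. Its integral kernel is a product of a
  function of \<open>x\<close> and a function of \<open>y\<close>.
\<close>

definition rank_one :: "'a measure \<Rightarrow> ('a \<Rightarrow> complex) \<Rightarrow> ('a \<Rightarrow> complex) \<Rightarrow> 'a l2op" where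
  "rank_one M a b = (\<lambda>f x. a x * l2_inner M f b)"

lemma rank_one_eq_kernel_op: "rank_one M a b = kernel_op M (\<lambda>(x, y). a x * cnj (b y))"
proof (intro ext)
  fix f x
  have "kernel_op M (\<lambda>(x, y). a x * cnj (b y)) f x = (\<integral>y. a x * (f y * cnj (b y)) \<partial>M)"
    unfolding kernel_op_def by (rule Bochner_Integration.integral_cong) (auto simp: ac_simps)
  then show "rank_one M a b f x = kernel_op M (\<lambda>(x, y). a x * cnj (b y)) f x"
    unfolding rank_one_def l2_inner_def by simp
qed

lemma rank_one_L2: "a \<in> L2_space M \<Longrightarrow> rank_one M a b f \<in> L2_space M"
  unfolding rank_one_def using L2_scale[of a M "l2_inner M f b"] by (simp add: mult.commute)

lemma rank_one_norm: "l2_norm M (rank_one M a b f) = l2_norm M a * norm (l2_inner M f b)"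
  unfolding rank_one_def using l2_norm_scale[of M "l2_inner M f b" a] by (simp add: mult.commute)

lemma rank_one_inner: "l2_inner M (rank_one M a b f) h = l2_inner M f b * l2_inner M a h"
  unfolding rank_one_def using l2_inner_scale_left[of M "l2_inner M f b" a h] by (simp add: mult.commute)

lemma rank_one_bounded:
  assumes a: "a \<in> L2_space M" and b: "b \<in> L2_space M"
  shows "rank_one M a b \<in> bounded_ops M"
proof -
  have "l2_norm M (rank_one M a b f) \<le> l2_norm M a * l2_norm M b * l2_norm M f" if f: "f \<in> L2_space M" for f
    unfolding rank_one_norm using mult_left_mono[OF l2_Cauchy_Schwarz[OF f b], of "l2_norm M a"]
    by (simp add: ac_simps)
  moreover have "rank_one M a b (\<lambda>y. f y + c * g y) x = rank_one M a b f x + c * rank_one M a b g x"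
    if "f \<in> L2_space M" "g \<in> L2_space M" for f g c x
    unfolding rank_one_def l2_inner_comb_left[OF that b] by (simp add: algebra_simps)
  ultimately show ?thesis
    unfolding bounded_ops_def using rank_one_L2[OF a]
    by (intro CollectI conjI ballI allI exI[of _ "l2_norm M a * l2_norm M b"]) auto
qed

lemma rank_one_compact:
  assumes a: "a \<in> L2_space M" and b: "b \<in> L2_space M"
  shows "rank_one M a b \<in> compact_ops M"
  unfolding compact_ops_def
proof (intro CollectI conjI allI impI)
  show "rank_one M a b \<in> bounded_ops M" by (rule rank_one_bounded[OF a b])
  fix u :: "nat \<Rightarrow> 'a \<Rightarrow> complex"
  assume u: "\<forall>n. u n \<in> L2_space M \<and> l2_norm M (u n) \<le> 1"
  have "l2_inner M (u n) b \<in> cball 0 (l2_norm M b)" for n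
  proof -
    have "norm (l2_inner M (u n) b) \<le> l2_norm M (u n) * l2_norm M b"
      using u by (intro l2_Cauchy_Schwarz b) auto
    also have "\<dots> \<le> 1 * l2_norm M b" using u by (intro mult_right_mono) auto
    finally show ?thesis by simp
  qed
  then obtain l r where r: "strict_mono r" and l: "((\<lambda>n. l2_inner M (u n) b) \<circ> r) \<longlonglongrightarrow> l"
    using compact_cball[of "0::complex" "l2_norm M b"] unfolding compact_def by metis
  have g: "(\<lambda>x. l * a x) \<in> L2_space M" by (rule L2_scale[OF a])
  have "l2_norm M (\<lambda>x. rank_one M a b (u (r n)) x - l * a x) = norm (l2_inner M (u (r n)) b - l) * l2_norm M a" for n
    unfolding rank_one_def using l2_norm_scale[of M "l2_inner M (u (r n)) b - l" a]
    by (simp add: algebra_simps)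
  moreover have "(\<lambda>n. norm (l2_inner M (u (r n)) b - l) * l2_norm M a) \<longlonglongrightarrow> norm (l - l) * l2_norm M a"
    using l by (intro tendsto_intros) (simp add: comp_def)
  ultimately have "(\<lambda>n. l2_norm M (\<lambda>x. rank_one M a b (u (r n)) x - l * a x)) \<longlonglongrightarrow> 0" by simp
  with r g show "\<exists>r g. strict_mono r \<and> g \<in> L2_space M \<and>
      (\<lambda>n. l2_norm M (\<lambda>x. rank_one M a b (u (r n)) x - g x)) \<longlonglongrightarrow> 0" by blast
qed

lemma rank_one_inner_self: "l2_inner M (rank_one M c c f) f = complex_of_real ((norm (l2_inner M f c))\<^sup>2)"
  unfolding rank_one_inner by (subst (2) l2_inner_commute) (simp only: complex_norm_square)

lemma rank_one_positive: "positive_op M (rank_one M c c)"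
  unfolding positive_op_def rank_one_inner_self by (simp add: complex_nonneg_Reals_iff)

context sigma_finite_measure
begin

lemma onb_summable: "c \<in> L2_space M \<Longrightarrow> (\<lambda>e. (norm (l2_inner M e c))\<^sup>2) summable_on some_onb M"
  using Parseval[of c] by (subst l2_inner_commute) (auto simp: summable_on_def)

lemma rank_one_hs:
  assumes a: "a \<in> L2_space M" and b: "b \<in> L2_space M"
  shows "rank_one M a b \<in> hs_ops M"
  unfolding hs_ops_def
  using rank_one_bounded[OF a b] summable_on_cmult_right[OF onb_summable[OF b], of "(l2_norm M a)\<^sup>2"]
  by (auto simp: rank_one_norm power_mult_distrib)

lemma rank_one_trace_class:
  assumes c: "c \<in> L2_space M"
  shows "rank_one M c c \<in> trace_class_ops M"
proof -
  have "(\<lambda>e. l2_inner M (rank_one M c c e) e) summable_on some_onb M"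
    unfolding rank_one_inner_self using onb_summable[OF c] summable_on_of_real by blast
  then show ?thesis
    unfolding trace_class_ops_def using rank_one_bounded[OF c c] rank_one_positive by blast
qed

text \<open>
  Vector states are weak* continuous: they are the pairings with rank one operators.
\<close>

lemma trace_pairing_rank_one:
  assumes A: "A \<in> bounded_ops M" and c: "c \<in> L2_space M"
  shows "trace_pairing M A (rank_one M c c) = l2_inner M (A c) c"
proof -
  have "l2_inner M ((A \<circ> rank_one M c c) e) e = l2_inner M (A c) e * l2_inner M e c" if e: "e \<in> some_onb M" for e
  proof -
    have "rank_one M c c e = (\<lambda>x. l2_inner M e c * c x)" by (simp add: rank_one_def mult.commute)
    then show ?thesis
      using bop_inner_scale[OF A c some_onb_L2[OF e]] by simp
  qed
  then have "trace_pairing M A (rank_one M c c) = (\<Sum>\<^sub>\<infinity>e\<in>some_onb M. l2_inner M (A c) e * l2_inner M e c)"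
    unfolding trace_pairing_def l2_trace_def by (intro infsum_cong) simp
  also have "\<dots> = l2_inner M (A c) c" by (rule infsumI[OF inner_expansion[OF bop_L2[OF A c] c]])
  finally show ?thesis .
qed

text \<open>
  Pairing with rank one operators recovers the matrix coefficients of an operator, so that
  selfadjointness on Hilbert--Schmidt operators becomes an identity between symbols.
\<close>

lemma hs_inner_rank_one:
  assumes A: "A \<in> bounded_ops M" and c: "c \<in> L2_space M" and d: "d \<in> L2_space M"
  shows "hs_inner M A (rank_one M c d) = l2_inner M (A d) c"
proof -
  have "l2_inner M (A e) (rank_one M c d e) = l2_inner M d e * l2_inner M (A e) c" for e
    unfolding l2_inner_commute[of M "A e" "rank_one M c d e"] rank_one_inner
    by (simp add: l2_inner_commute[of M c] l2_inner_commute[of M e d])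
  then show ?thesis
    unfolding hs_inner_def using infsumI[OF bop_expansion[OF A d c]] by simp
qed

lemma hs_inner_commute: "hs_inner M B A = cnj (hs_inner M A B)"
  unfolding hs_inner_def infsum_cnj[symmetric] by (subst l2_inner_commute) simp

subsection \<open>Absolute convergence of the trace\<close>

lemma has_sum_finite_sum:
  fixes f :: "'i \<Rightarrow> 'x \<Rightarrow> 'y::topological_comm_monoid_add"
  shows "finite I \<Longrightarrow> (\<And>i. i \<in> I \<Longrightarrow> (f i has_sum s i) A) \<Longrightarrow>
    ((\<lambda>x. \<Sum>i\<in>I. f i x) has_sum (\<Sum>i\<in>I. s i)) A"
  by (induction I rule: finite_induct) (auto intro: has_sum_add)

text \<open>
  Polarisation, with the scalars \<open>1\<close> and \<open>\<i>\<close>.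
\<close>

lemma positive_op_hermitian:
  assumes P: "P \<in> bounded_ops M" "positive_op M P" and f: "f \<in> L2_space M" and g: "g \<in> L2_space M"
  shows "l2_inner M (P f) g = l2_inner M f (P g)"
proof -
  have real: "Im (l2_inner M (P h) h) = 0" if "h \<in> L2_space M" for h
    using P(2) that unfolding positive_op_def by (auto simp: complex_nonneg_Reals_iff)
  have "Im (cnj c * l2_inner M (P f) g + c * l2_inner M (P g) f) = 0" for c
  proof -
    let ?h = "\<lambda>x. f x + c * g x"
    have h: "?h \<in> L2_space M" by (rule L2_comb[OF f g])
    have "l2_inner M (P ?h) ?h = l2_inner M (P f) f + cnj c * l2_inner M (P f) g
        + c * l2_inner M (P g) f + c * cnj c * l2_inner M (P g) g"
      unfolding bop_inner_comb[OF P(1) f g h]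
      by (simp add: l2_inner_comb_right[OF f g bop_L2[OF P(1) f]]
          l2_inner_comb_right[OF f g bop_L2[OF P(1) g]] algebra_simps)
    then show ?thesis
      using real[OF h] real[OF f] real[OF g] by (simp add: algebra_simps)
  qed
  from this[of 1] this[of \<i>] have "l2_inner M (P f) g = cnj (l2_inner M (P g) f)"
    by (intro complex_eqI) auto
  then show ?thesis by (simp add: l2_inner_commute[of M f])
qed

lemma bop_inner_combR:
  assumes "A \<in> bounded_ops M" "f \<in> L2_space M" "g \<in> L2_space M" "h \<in> L2_space M"
  shows "Re (l2_inner M (A (\<lambda>z. f z + c *\<^sub>R g z)) h) = Re (l2_inner M (A f) h) + c * Re (l2_inner M (A g) h)"
  using bop_inner_comb[OF assms, of "complex_of_real c"] by (simp add: scaleR_conv_of_real)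

lemma bop_inner_sumR:
  assumes "A \<in> bounded_ops M" "finite I" "\<And>i. i \<in> I \<Longrightarrow> v i \<in> L2_space M" "h \<in> L2_space M"
  shows "Re (l2_inner M (A (\<lambda>z. \<Sum>i\<in>I. c i *\<^sub>R v i z)) h) = (\<Sum>i\<in>I. c i * Re (l2_inner M (A (v i)) h))"
  using bop_inner_sum[where c = "\<lambda>i. complex_of_real (c i)", OF assms] by (simp add: scaleR_conv_of_real)

text \<open>
  Let \<open>P\<close> be the absolute value of \<open>Y\<close> and think of the polar decomposition \<open>Y = U P\<close>. Then
  \<open>\<langle>Y e, e\<rangle> = \<langle>P e, U* e\<rangle>\<close>, and by the Cauchy--Schwarz inequality for the form of \<open>P\<close> this is at most
  half the sum of \<open>\<langle>P e, e\<rangle>\<close> and \<open>\<langle>P U* e, U* e\<rangle>\<close>, both of which sum to at most the trace of \<open>P\<close>,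
  up to a factor.

  The proof constructs neither \<open>U\<close> nor a square root of \<open>P\<close>. It works with the three real forms
  \<open>R f g = Re \<langle>f, g\<rangle>\<close>, \<open>S f g = Re \<langle>P f, g\<rangle>\<close> and \<open>T f g = Re \<langle>P f, P g\<rangle> = Re \<langle>Y f, Y g\<rangle>\<close>. Given finitely
  many basis vectors \<open>v i\<close>, let \<open>q\<close> be their Gram--Schmidt system for \<open>T\<close>. The vectors \<open>P (q k)\<close> are
  orthonormal, up to zero vectors, and \<open>U\<close> maps them to \<open>Y (q k)\<close>, hence \<open>w i = \<Sum>\<^sub>k \<langle>Y (q k), v i\<rangle> P (q k)\<close> is the projection of
  \<open>U* (v i)\<close> to their span. To bound \<open>\<Sum>\<^sub>i S (w i) (w i)\<close>, expand in a Gram--Schmidt system \<open>g\<close> of the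
  \<open>P (q k)\<close> for the form \<open>S\<close>, and use Bessel's inequality for all three forms in turn. The factor
  \<open>2\<close> is the price of real forms: a complex basis vector \<open>e\<close> counts as the two real ones \<open>e\<close> and \<open>\<i> e\<close>.
\<close>

lemma trace_partial_sums_Re:
  assumes P: "P \<in> bounded_ops M" "positive_op M P" and Y: "Y \<in> bounded_ops M"
    and PY: "\<And>f g. f \<in> L2_space M \<Longrightarrow> g \<in> L2_space M \<Longrightarrow> l2_inner M (P f) (P g) = l2_inner M (Y f) (Y g)"
    and tr: "((\<lambda>e. Re (l2_inner M (P e) e)) has_sum \<tau>) (some_onb M)"
    and F: "finite F" "F \<subseteq> some_onb M"
  shows "(\<Sum>e\<in>F. \<bar>Re (l2_inner M (Y e) e)\<bar>) \<le> 2 * \<tau>"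
proof -
  let ?V = "L2_space M" and ?E = "some_onb M"
  define R where "R f g = Re (l2_inner M f g)" for f g
  define S where "S f g = Re (l2_inner M (P f) g)" for f g
  define T where "T f g = Re (l2_inner M (P f) (P g))" for f g
  interpret R: psd_form ?V R unfolding R_def by (rule psd_form_l2)
  have PL: "P f \<in> ?V" if "f \<in> ?V" for f by (rule bop_L2[OF P(1) that])
  have YL: "Y f \<in> ?V" if "f \<in> ?V" for f by (rule bop_L2[OF Y that])
  interpret S: psd_form ?V S
  proof
    fix f g h :: "'a \<Rightarrow> complex" and c :: real
    show "(\<lambda>z. f z + c *\<^sub>R g z) \<in> ?V" if "f \<in> ?V" "g \<in> ?V" by (rule R.comb_mem[OF that])
    show "S (\<lambda>z. f z + c *\<^sub>R g z) h = S f h + c * S g h" if "f \<in> ?V" "g \<in> ?V" "h \<in> ?V"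
      unfolding S_def by (rule bop_inner_combR[OF P(1) that])
    show "S f g = S g f" if "f \<in> ?V" "g \<in> ?V"
      unfolding S_def positive_op_hermitian[OF P that] by (subst l2_inner_commute) simp
    show "0 \<le> S f f" if "f \<in> ?V"
      using P(2) that unfolding S_def positive_op_def by (auto simp: complex_nonneg_Reals_iff)
  qed simp
  interpret T: psd_form ?V T
  proof
    fix f g h :: "'a \<Rightarrow> complex" and c :: real
    show "(\<lambda>z. f z + c *\<^sub>R g z) \<in> ?V" if "f \<in> ?V" "g \<in> ?V" by (rule R.comb_mem[OF that])
    show "T (\<lambda>z. f z + c *\<^sub>R g z) h = T f h + c * T g h" if "f \<in> ?V" "g \<in> ?V" "h \<in> ?V"
      unfolding T_def by (rule bop_inner_combR[OF P(1) that(1,2) PL[OF that(3)]])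
    show "T f g = T g f" if "f \<in> ?V" "g \<in> ?V"
      unfolding T_def by (subst l2_inner_commute) simp
    show "0 \<le> T f f" if "f \<in> ?V" unfolding T_def by (simp add: l2_inner_self)
  qed simp
  have ST: "S (P f) g = T f g" if "f \<in> ?V" "g \<in> ?V" for f g
    unfolding S_def T_def by (simp add: positive_op_hermitian[OF P PL[OF that(1)] that(2)])
  obtain h where h: "bij_betw h {..<card F} F"
    using ex_bij_betw_nat_finite[OF F(1)] by (auto simp: atLeast0LessThan)
  define n where "n = card F"
  define v where "v i = (if i < n then h i else (\<lambda>_. 0))" for i
  have vE: "v i \<in> ?E" if "i < n" for i
    using that h F(2) unfolding v_def n_def by (auto simp: bij_betw_def)
  have vV: "v i \<in> ?V" for i
    using vE[of i] some_onb_L2[of "v i" M] by (cases "i < n") (auto simp: v_def)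
  obtain q where q: "T.ortho q UNIV"
    and q_exp: "\<And>i u. u \<in> ?V \<Longrightarrow> T (v i) u = (\<Sum>k\<le>i. T (v i) (q k) * T (q k) u)"
    and q_tri: "\<And>i k. i < k \<Longrightarrow> T (v i) (q k) = 0"
  proof (rule T.Gram_Schmidt[of v])
  qed (rule vV | (rule that; assumption))+
  have qV: "q k \<in> ?V" for k using q by (auto simp: T.ortho_def)
  have q_exp': "T (v i) u = (\<Sum>k<n. T (v i) (q k) * T (q k) u)" if "i < n" "u \<in> ?V" for i u
    unfolding q_exp[OF that(2)] using that(1) by (intro sum.mono_neutral_left) (auto simp: q_tri)
  define a where "a i k = Re (l2_inner M (Y (q k)) (v i))" for i k
  \<comment> \<open>\<open>Y\<close> annihilates null vectors of \<open>T\<close>, so the expansion of \<open>v i\<close> for \<open>T\<close> may be inserted into \<open>Y\<close>.\<close>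
  have YR: "Re (l2_inner M (Y (v i)) g) = (\<Sum>k<n. T (v i) (q k) * Re (l2_inner M (Y (q k)) g))"
    if i: "i < n" and g: "g \<in> ?V" for i g
  proof -
    define p where "p = (\<lambda>z. \<Sum>k<n. T (v i) (q k) *\<^sub>R q k z)"
    define z where "z = (\<lambda>x. v i x + (-1) *\<^sub>R p x)"
    have p: "p \<in> ?V" unfolding p_def by (intro T.sum_mem qV) auto
    have zV: "z \<in> ?V" unfolding z_def by (intro T.comb_mem vV p)
    have Tz: "T z z = T (v i) z - T p z" unfolding z_def by (subst T.comb_left) (use vV p zV z_def in auto)
    have "T p z = (\<Sum>k<n. T (v i) (q k) * T (q k) z)"
      unfolding p_def by (rule T.sum_left) (auto intro: qV zV)
    then have "T z z = 0" using Tz q_exp'[OF i zV] by simp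
    moreover have "T z z = (l2_norm M (Y z))\<^sup>2"
      unfolding T_def PY[OF zV zV] by (simp add: l2_inner_self)
    ultimately have "l2_norm M (Y z) = 0" by simp
    then have "AE x in M. Y z x = 0" by (rule l2_norm_eq_0[OF YL[OF zV]])
    then have "l2_inner M (Y z) g = l2_inner M (\<lambda>_. 0) g"
      by (intro l2_inner_cong_AE YL zV g) auto
    then have "0 = Re (l2_inner M (Y z) g)" by simp
    also have "\<dots> = Re (l2_inner M (Y (v i)) g) - Re (l2_inner M (Y p) g)"
      unfolding z_def bop_inner_combR[OF Y vV p g] by simp
    also have "Re (l2_inner M (Y p) g) = (\<Sum>k<n. T (v i) (q k) * Re (l2_inner M (Y (q k)) g))"
      unfolding p_def by (rule bop_inner_sumR[OF Y]) (auto intro: qV g)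
    finally show ?thesis by simp
  qed
  define w where "w i = (\<lambda>x. \<Sum>k<n. a i k *\<^sub>R P (q k) x)" for i
  have wV: "w i \<in> ?V" for i unfolding w_def by (intro R.sum_mem PL qV) auto
  have Yw: "Re (l2_inner M (Y (v i)) (v i)) = S (v i) (w i)" if i: "i < n" for i
  proof -
    have "S (v i) (w i) = (\<Sum>k<n. a i k * S (v i) (P (q k)))"
      unfolding w_def by (rule S.sum_right) (auto intro: PL qV vV)
    also have "\<dots> = (\<Sum>k<n. T (v i) (q k) * Re (l2_inner M (Y (q k)) (v i)))"
      by (intro sum.cong refl) (simp add: S_def T_def a_def)
    finally show ?thesis using YR[OF i vV] by simp
  qed
  obtain g where g: "S.ortho g UNIV"
    and g_exp: "\<And>i u. u \<in> ?V \<Longrightarrow> S (P (q i)) u = (\<Sum>k\<le>i. S (P (q i)) (g k) * S (g k) u)"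
    and g_tri: "\<And>i k. i < k \<Longrightarrow> S (P (q i)) (g k) = 0"
  proof (rule S.Gram_Schmidt[of "\<lambda>i. P (q i)"])
  qed (rule PL qV | (rule that; assumption))+
  have gV: "g k \<in> ?V" for k using g by (auto simp: S.ortho_def)
  have g_exp': "S (P (q i)) u = (\<Sum>k<n. S (P (q i)) (g k) * S (g k) u)" if "i < n" "u \<in> ?V" for i u
    unfolding g_exp[OF that(2)] using that(1) by (intro sum.mono_neutral_left) (auto simp: g_tri)
  have ww: "S (w i) (w i) = (\<Sum>m<n. (S (w i) (g m))\<^sup>2)" for i
  proof -
    have Sw: "S (w i) u = (\<Sum>k<n. a i k * S (P (q k)) u)" if "u \<in> ?V" for u
      unfolding w_def by (rule S.sum_left) (auto intro: PL qV that)
    have "S (w i) (w i) = (\<Sum>k<n. \<Sum>m<n. a i k * S (P (q k)) (g m) * S (g m) (w i))"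
      unfolding Sw[OF wV] using wV by (intro sum.cong refl) (simp add: g_exp' sum_distrib_left mult.assoc)
    also have "\<dots> = (\<Sum>m<n. S (w i) (g m) * S (g m) (w i))"
      by (subst sum.swap) (simp add: Sw[OF gV] sum_distrib_right)
    finally show ?thesis by (simp add: S.sym[OF gV wV] power2_eq_square)
  qed
  have inner_m: "(\<Sum>i<n. (S (w i) (g m))\<^sup>2) \<le> (l2_norm M (P (g m)))\<^sup>2" for m
  proof -
    define u where "u = (\<lambda>x. \<Sum>k<n. S (P (q k)) (g m) *\<^sub>R q k x)"
    have u: "u \<in> ?V" unfolding u_def by (intro T.sum_mem qV) auto
    have "S (w i) (g m) = R (Y u) (v i)" for i
    proof -
      have "S (w i) (g m) = (\<Sum>k<n. a i k * S (P (q k)) (g m))"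
        unfolding w_def by (rule S.sum_left) (auto intro: PL qV gV)
      also have "\<dots> = R (Y u) (v i)"
        unfolding R_def u_def a_def
        by (subst bop_inner_sumR[OF Y]) (auto intro: qV vV simp: mult.commute)
      finally show ?thesis .
    qed
    then have "(\<Sum>i<n. (S (w i) (g m))\<^sup>2) = (\<Sum>i<n. (R (Y u) (v i))\<^sup>2)" by simp
    also have "\<dots> \<le> R (Y u) (Y u)"
    proof (rule R.Bessel)
      show "R.ortho v {..<n}"
        unfolding R.ortho_def
      proof (intro conjI ballI impI)
        fix i j assume "i \<in> {..<n}" "j \<in> {..<n}"
        then have i: "i < n" and j: "j < n" by auto
        show "v i \<in> ?V" by (rule vV)
        show "R (v i) (v i) \<in> {0, 1}" unfolding R_def using some_onb_ortho[OF vE[OF i] vE[OF i]] by simp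
        assume "i \<noteq> j"
        then have "v i \<noteq> v j" using h i j unfolding v_def n_def bij_betw_def inj_on_def by auto
        then show "R (v i) (v j) = 0" unfolding R_def using some_onb_ortho[OF vE[OF i] vE[OF j]] by simp
      qed
    qed (auto intro: YL u)
    also have "\<dots> = T u u" unfolding R_def T_def PY[OF u u] ..
    also have "\<dots> \<le> (\<Sum>k<n. (S (P (q k)) (g m))\<^sup>2)"
      unfolding u_def using q by (intro T.ortho_sum_square(2)) (auto simp: T.ortho_def)
    also have "\<dots> = (\<Sum>k<n. (T (g m) (q k))\<^sup>2)"
      by (intro sum.cong refl) (simp add: ST[OF qV gV] T.sym[OF gV qV])
    also have "\<dots> \<le> T (g m) (g m)"
      using q by (intro T.Bessel gV) (auto simp: T.ortho_def)
    also have "\<dots> = (l2_norm M (P (g m)))\<^sup>2" unfolding T_def l2_inner_self by simp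
    finally show ?thesis .
  qed
  have "(\<Sum>m<n. (l2_norm M (P (g m)))\<^sup>2) \<le> 2 * \<tau>"
  proof (rule has_sum_mono)
    show "((\<lambda>e. \<Sum>m<n. (norm (l2_inner M (P (g m)) e))\<^sup>2) has_sum (\<Sum>m<n. (l2_norm M (P (g m)))\<^sup>2)) ?E"
      by (intro has_sum_finite_sum Parseval PL gV) auto
    show "((\<lambda>e. 2 * Re (l2_inner M (P e) e)) has_sum 2 * \<tau>) ?E" by (rule has_sum_cmult_right[OF tr])
    fix e assume e: "e \<in> ?E"
    have eV: "e \<in> ?V" by (rule some_onb_L2[OF e])
    define ie where "ie = (\<lambda>x. \<i> * e x)"
    have ieV: "ie \<in> ?V" unfolding ie_def by (rule L2_scale[OF eV])
    have Sie: "S ie ie = S e e"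
    proof -
      have "l2_inner M (P ie) ie = \<i> * l2_inner M (P e) ie"
        using bop_inner_scale[OF P(1) eV ieV, of \<i>] by (simp only: ie_def[symmetric])
      also have "l2_inner M (P e) ie = cnj \<i> * l2_inner M (P e) e"
        unfolding ie_def by (rule l2_inner_scale_right)
      finally show ?thesis by (simp add: S_def)
    qed
    have "(norm (l2_inner M (P (g m)) e))\<^sup>2 = (S e (g m))\<^sup>2 + (S ie (g m))\<^sup>2" for m
    proof -
      have "S e (g m) = Re (l2_inner M (P (g m)) e)" using S.sym[OF eV gV] by (simp add: S_def)
      moreover have "S ie (g m) = Im (l2_inner M (P (g m)) e)"
        using S.sym[OF ieV gV] by (simp add: S_def ie_def l2_inner_scale_right)
      ultimately show ?thesis by (simp add: cmod_power2)
    qed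
    then have "(\<Sum>m<n. (norm (l2_inner M (P (g m)) e))\<^sup>2) = (\<Sum>m<n. (S e (g m))\<^sup>2) + (\<Sum>m<n. (S ie (g m))\<^sup>2)"
      by (simp add: sum.distrib)
    also have "\<dots> \<le> S e e + S ie ie"
      using g by (intro add_mono S.Bessel eV ieV) (auto simp: S.ortho_def)
    finally show "(\<Sum>m<n. (norm (l2_inner M (P (g m)) e))\<^sup>2) \<le> 2 * Re (l2_inner M (P e) e)"
      unfolding Sie by (simp add: S_def)
  qed
  then have wsum: "(\<Sum>i<n. S (w i) (w i)) \<le> 2 * \<tau>"
    unfolding ww by (subst sum.swap) (rule order_trans[OF sum_mono[OF inner_m]])
  have vsum: "(\<Sum>i<n. S (v i) (v i)) \<le> \<tau>"
  proof -
    have "(\<Sum>i<n. S (v i) (v i)) = (\<Sum>e\<in>F. S e e)"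
      using sum.reindex_bij_betw[OF h, of "\<lambda>e. S e e"] by (simp add: n_def v_def)
    also have "\<dots> \<le> \<tau>"
      using tr F unfolding S_def
      by (intro has_sum_mono2[OF has_sum_finite[OF F(1)] tr]) (use S.nonneg[OF some_onb_L2] in \<open>auto simp: S_def\<close>)
    finally show ?thesis .
  qed
  have "(\<Sum>e\<in>F. \<bar>Re (l2_inner M (Y e) e)\<bar>) = (\<Sum>i<n. \<bar>Re (l2_inner M (Y (v i)) (v i))\<bar>)"
    using sum.reindex_bij_betw[OF h, of "\<lambda>e. \<bar>Re (l2_inner M (Y e) e)\<bar>"] by (simp add: n_def v_def)
  also have "\<dots> \<le> (\<Sum>i<n. (S (v i) (v i) + S (w i) (w i)) / 2)"
  proof (rule sum_mono)
    fix i assume "i \<in> {..<n}"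
    then have i: "i < n" by simp
    have "(S (v i) (w i))\<^sup>2 \<le> ((S (v i) (v i) + S (w i) (w i)) / 2)\<^sup>2"
    proof -
      have "(S (v i) (w i))\<^sup>2 \<le> S (v i) (v i) * S (w i) (w i)" by (rule S.Cauchy_Schwarz[OF vV wV])
      also have "\<dots> \<le> ((S (v i) (v i) + S (w i) (w i)) / 2)\<^sup>2"
        using zero_le_power2[of "S (v i) (v i) - S (w i) (w i)"]
        by (simp add: power2_eq_square algebra_simps)
      finally show ?thesis .
    qed
    then have "\<bar>S (v i) (w i)\<bar> \<le> (S (v i) (v i) + S (w i) (w i)) / 2"
      using S.nonneg[OF vV, of i] S.nonneg[OF wV, of i] by (simp add: abs_le_square_iff[symmetric])
    then show "\<bar>Re (l2_inner M (Y (v i)) (v i))\<bar> \<le> (S (v i) (v i) + S (w i) (w i)) / 2"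
      unfolding Yw[OF i] .
  qed
  also have "\<dots> = ((\<Sum>i<n. S (v i) (v i)) + (\<Sum>i<n. S (w i) (w i))) / 2"
    by (simp add: sum_divide_distrib sum.distrib add_divide_distrib)
  also have "\<dots> \<le> 2 * \<tau>"
  proof -
    have "0 \<le> \<tau>" using tr S.nonneg[OF some_onb_L2] unfolding S_def by (rule has_sum_nonneg)
    then show ?thesis using wsum vsum by simp
  qed
  finally show ?thesis .
qed

text \<open>
  Membership in the trace class gives the summability of the diagonal of the absolute value; this
  transfers to the operator itself.
\<close>

lemma trace_class_summable:
  assumes Y: "Y \<in> trace_class_ops M"
  shows "(\<lambda>e. l2_inner M (Y e) e) summable_on some_onb M"
proof -
  let ?E = "some_onb M"
  obtain P where P: "P \<in> bounded_ops M" "positive_op M P"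
    and PY: "\<forall>f\<in>L2_space M. \<forall>g\<in>L2_space M. l2_inner M (P f) (P g) = l2_inner M (Y f) (Y g)"
    and s: "(\<lambda>e. l2_inner M (P e) e) summable_on ?E" and Yb: "Y \<in> bounded_ops M"
    using Y unfolding trace_class_ops_def by blast
  define \<tau> where "\<tau> = Re (\<Sum>\<^sub>\<infinity>e\<in>?E. l2_inner M (P e) e)"
  have tr: "((\<lambda>e. Re (l2_inner M (P e) e)) has_sum \<tau>) ?E"
    unfolding \<tau>_def by (intro has_sum_Re has_sum_infsum s)
  \<comment> \<open>The operator \<open>- \<i> Y\<close> has the same absolute value and exchanges real and imaginary parts.\<close>
  define Y' where "Y' = (\<lambda>f x. 0 + (- \<i>) * Y f x)"
  have Y'b: "Y' \<in> bounded_ops M"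
    unfolding Y'_def by (rule bounded_op_comb[OF zero_bounded_op Yb])
  have Y'1: "l2_inner M (Y' f) h = - \<i> * l2_inner M (Y f) h" for f h
    unfolding Y'_def using l2_inner_scale_left[of M "- \<i>" "Y f" h] by simp
  have Y'2: "l2_inner M (Y' f) (Y' g) = l2_inner M (Y f) (Y g)" for f g
    unfolding Y'1 by (subst l2_inner_commute) (simp add: Y'1 l2_inner_commute[of M "Y f" "Y g"])
  have b: "(\<Sum>e\<in>F. norm (l2_inner M (Y e) e)) \<le> 4 * \<tau>" if F: "finite F" "F \<subseteq> ?E" for F
  proof -
    have "(\<Sum>e\<in>F. norm (l2_inner M (Y e) e))
        \<le> (\<Sum>e\<in>F. \<bar>Re (l2_inner M (Y e) e)\<bar> + \<bar>Re (l2_inner M (Y' e) e)\<bar>)"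
      by (intro sum_mono) (simp add: Y'1 cmod_le)
    also have "\<dots> \<le> 2 * \<tau> + 2 * \<tau>"
      unfolding sum.distrib
      using trace_partial_sums_Re[OF P Yb _ tr F] trace_partial_sums_Re[OF P Y'b _ tr F] PY Y'2
      by (intro add_mono) auto
    finally show ?thesis by simp
  qed
  show ?thesis
    by (rule abs_summable_summable, rule nonneg_bdd_above_summable_on)
      (use b in \<open>auto simp: bdd_above_def\<close>)
qed

subsection \<open>Finite rank projections converge weak* to the identity\<close>

definition onb_proj :: "('a \<Rightarrow> complex) set \<Rightarrow> 'a l2op" where
  "onb_proj F = (\<lambda>f x. \<Sum>e\<in>F. rank_one M e e f x)"

lemma onb_proj_bounded: "finite F \<Longrightarrow> F \<subseteq> some_onb M \<Longrightarrow> onb_proj F \<in> bounded_ops M"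
  unfolding onb_proj_def by (intro sum_bounded_op rank_one_bounded some_onb_L2) auto

lemma trace_pairing_onb_proj:
  assumes F: "finite F" "F \<subseteq> some_onb M" and Y: "Y \<in> bounded_ops M"
  shows "trace_pairing M (onb_proj F) Y = (\<Sum>e\<in>F. l2_inner M (Y e) e)"
proof -
  have "l2_inner M ((onb_proj F \<circ> Y) e) e = (if e \<in> F then l2_inner M (Y e) e else 0)"
    if e: "e \<in> some_onb M" for e
  proof -
    have eL: "e \<in> L2_space M" by (rule some_onb_L2[OF e])
    have "l2_inner M ((onb_proj F \<circ> Y) e) e = l2_inner M (\<lambda>x. \<Sum>e'\<in>F. l2_inner M (Y e) e' * e' x) e"
      by (simp add: onb_proj_def rank_one_def mult.commute)
    also have "\<dots> = (\<Sum>e'\<in>F. l2_inner M (Y e) e' * l2_inner M e' e)"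
      using l2_inner_sum_left[of F "\<lambda>e. e" M e] F eL some_onb_L2[of _ M] by blast
    also have "\<dots> = (\<Sum>e'\<in>F. if e' = e then l2_inner M (Y e) e else 0)"
      using F e some_onb_ortho[of _ M e] by (intro sum.cong) auto
    finally show ?thesis using F(1) by simp
  qed
  then have "trace_pairing M (onb_proj F) Y
      = (\<Sum>\<^sub>\<infinity>e\<in>some_onb M. if e \<in> F then l2_inner M (Y e) e else 0)"
    unfolding trace_pairing_def l2_trace_def by (intro infsum_cong) simp
  also have "\<dots> = (\<Sum>\<^sub>\<infinity>e\<in>F. l2_inner M (Y e) e)"
    using F by (intro infsum_cong_neutral) auto
  finally show ?thesis using F by simp
qed

text \<open>
  Evaluated at a trace class operator \<open>Y\<close>, this is the convergence of the series that defines the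
  trace of \<open>Y\<close>.
\<close>

lemma onb_proj_weak_star_limit:
  "limitin (weak_star M) onb_proj id (finite_subsets_at_top (some_onb M))"
proof -
  let ?E = "some_onb M" and ?TC = "trace_class_ops M"
  let ?f = "\<lambda>A. \<lambda>Y\<in>?TC. trace_pairing M A Y"
  let ?P = "product_topology (\<lambda>_. euclidean :: complex topology) ?TC"
  have ev: "\<forall>\<^sub>F F in finite_subsets_at_top ?E. onb_proj F \<in> bounded_ops M"
    by (intro eventually_finite_subsets_at_top_weakI onb_proj_bounded)
  have "limitin ?P (\<lambda>F. ?f (onb_proj F)) (?f id) (finite_subsets_at_top ?E)"
    unfolding limitin_componentwise
  proof (intro conjI ballI)
    fix Y assume Y: "Y \<in> ?TC"
    then have Yb: "Y \<in> bounded_ops M" by (simp add: trace_class_ops_def)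
    have "((\<lambda>F. \<Sum>e\<in>F. l2_inner M (Y e) e) \<longlongrightarrow> trace_pairing M id Y) (finite_subsets_at_top ?E)"
      using has_sum_infsum[OF trace_class_summable[OF Y]]
      unfolding has_sum_def trace_pairing_def l2_trace_def by simp
    then have "((\<lambda>F. trace_pairing M (onb_proj F) Y) \<longlongrightarrow> trace_pairing M id Y) (finite_subsets_at_top ?E)"
      by (rule Lim_transform_eventually)
        (auto intro!: eventually_finite_subsets_at_top_weakI simp: trace_pairing_onb_proj Yb)
    then show "limitin euclidean (\<lambda>F. ?f (onb_proj F) Y) (?f id Y) (finite_subsets_at_top ?E)"
      using Y by simp
  qed auto
  then have l: "?f id \<in> topspace ?P"
    and lim: "\<And>U. openin ?P U \<Longrightarrow> ?f id \<in> U \<Longrightarrow> \<forall>\<^sub>F F in finite_subsets_at_top ?E. ?f (onb_proj F) \<in> U"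
    by (simp_all add: limitin_def)
  show ?thesis
    unfolding limitin_def weak_star_def topspace_pullback_topology openin_pullback_topology
  proof (intro conjI allI impI)
    show "id \<in> ?f -` topspace ?P \<inter> bounded_ops M" using l id_bounded_op[of M] by simp
    fix S assume "(\<exists>U. openin ?P U \<and> S = ?f -` U \<inter> bounded_ops M) \<and> id \<in> S"
    then obtain U where U: "openin ?P U" "S = ?f -` U \<inter> bounded_ops M" "id \<in> S" by blast
    then have "?f id \<in> U" by simp
    from lim[OF U(1) this] ev show "\<forall>\<^sub>F F in finite_subsets_at_top ?E. onb_proj F \<in> S"
      by eventually_elim (simp add: U(2))
  qed
qed

text \<open>
  A weak* continuous map is determined at the identity by its values on finite rank projections,
  where a Schur multiplier is given by its symbol.
\<close>

lemma weak_star_continuous_at_id: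
  assumes T: "continuous_map (weak_star M) (weak_star M) T"
    and Tb: "\<And>A. A \<in> bounded_ops M \<Longrightarrow> T A \<in> bounded_ops M" and c: "c \<in> L2_space M"
  shows "((\<lambda>F. l2_inner M (T (onb_proj F) c) c) \<longlongrightarrow> l2_inner M (T id c) c) (finite_subsets_at_top (some_onb M))"
proof -
  let ?Y = "rank_one M c c"
  have Y: "?Y \<in> trace_class_ops M" by (rule rank_one_trace_class[OF c])
  have "continuous_map (weak_star M) euclidean
      ((\<lambda>\<phi>. \<phi> ?Y) \<circ> (\<lambda>A. \<lambda>Y\<in>trace_class_ops M. trace_pairing M A Y))"
    unfolding weak_star_def
    by (intro continuous_map_pullback continuous_map_product_projection Y)
  then have "continuous_map (weak_star M) euclidean (\<lambda>A. trace_pairing M A ?Y)"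
    using Y by (simp add: comp_def)
  from continuous_map_compose[OF T this]
  have "continuous_map (weak_star M) euclidean (\<lambda>A. trace_pairing M (T A) ?Y)" by (simp add: comp_def)
  from continuous_map_limit[OF this onb_proj_weak_star_limit]
  have "((\<lambda>F. trace_pairing M (T (onb_proj F)) ?Y) \<longlongrightarrow> trace_pairing M (T id) ?Y) (finite_subsets_at_top (some_onb M))"
    by (simp add: comp_def)
  then have "((\<lambda>F. l2_inner M (T (onb_proj F) c) c) \<longlongrightarrow> trace_pairing M (T id) ?Y) (finite_subsets_at_top (some_onb M))"
    by (rule Lim_transform_eventually)
      (auto intro!: eventually_finite_subsets_at_top_weakI trace_pairing_rank_one Tb onb_proj_bounded c)
  then show ?thesis by (simp add: trace_pairing_rank_one Tb id_bounded_op c)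
qed

end

section \<open>Schur multipliers as kernels\<close>

lemma (in pair_sigma_finite) product_integral_pair:
  fixes f g :: "_ \<Rightarrow> 'c::{real_normed_field, banach, second_countable_topology}"
  assumes f: "integrable M1 f" and g: "integrable M2 g"
  shows "integrable (M1 \<Otimes>\<^sub>M M2) (\<lambda>z. f (fst z) * g (snd z))"
    and "(\<integral>z. f (fst z) * g (snd z) \<partial>(M1 \<Otimes>\<^sub>M M2)) = (\<integral>x. f x \<partial>M1) * (\<integral>y. g y \<partial>M2)"
proof -
  note [measurable] = borel_measurable_integrable[OF f] borel_measurable_integrable[OF g]
  show int: "integrable (M1 \<Otimes>\<^sub>M M2) (\<lambda>z. f (fst z) * g (snd z))"
  proof (rule Fubini_integrable)
    show "integrable M1 (\<lambda>x. \<integral>y. norm (f (fst (x, y)) * g (snd (x, y))) \<partial>M2)"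
      using f by (simp add: norm_mult)
    show "AE x in M1. integrable M2 (\<lambda>y. f (fst (x, y)) * g (snd (x, y)))" using g by simp
  qed measurable
  show "(\<integral>z. f (fst z) * g (snd z) \<partial>(M1 \<Otimes>\<^sub>M M2)) = (\<integral>x. f x \<partial>M1) * (\<integral>y. g y \<partial>M2)"
    unfolding integral_fst'[OF int, symmetric] by simp
qed

lemma integrable_bounded_mult:
  fixes f g :: "_ \<Rightarrow> 'c::{real_normed_field, banach, second_countable_topology}"
  assumes "integrable M f" "g \<in> borel_measurable M" "AE x in M. norm (g x) \<le> c"
  shows "integrable M (\<lambda>x. g x * f x)"
proof (rule Bochner_Integration.integrable_bound)
  show "integrable M (\<lambda>x. c * norm (f x))" using assms(1) by simp
  show "(\<lambda>x. g x * f x) \<in> borel_measurable M" using assms by measurable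
  show "AE x in M. norm (g x * f x) \<le> norm (c * norm (f x))"
    using assms(3)
  proof eventually_elim
    case (elim x)
    have "norm (g x * f x) \<le> c * norm (f x)" unfolding norm_mult by (intro mult_right_mono elim) simp
    then show ?case by simp
  qed
qed

lemma (in complete_measure) measurable_if_AE_eq:
  fixes f g :: "'a \<Rightarrow> 'b::topological_space"
  assumes g: "g \<in> borel_measurable M" and ae: "AE x in M. f x = g x"
  shows "f \<in> borel_measurable M"
proof (rule borel_measurableI)
  fix S :: "'b set" assume "open S"
  then have gS: "g -` S \<inter> space M \<in> sets M" using g by (intro measurable_sets[of g M borel]) auto
  have "AE x in M. x \<in> g -` S \<inter> space M \<longleftrightarrow> x \<in> f -` S \<inter> space M"
    using ae by eventually_elim simp
  from in_sets_AE[OF this gS] show "f -` S \<inter> space M \<in> sets M" by simp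
qed

text \<open>
  A symbol is measurable for the completed product measure; for integration over the product it
  is replaced by a measurable function that is bounded everywhere.
\<close>

lemma Linf_representative:
  assumes "\<phi> \<in> Linf_space (square_measure M)"
  obtains \<psi> C where "\<psi> \<in> borel_measurable (M \<Otimes>\<^sub>M M)" "\<And>z. norm (\<psi> z) \<le> C"
    "AE z in M \<Otimes>\<^sub>M M. \<phi> z = \<psi> z"
proof -
  let ?Q = "M \<Otimes>\<^sub>M M"
  obtain C where m: "\<phi> \<in> borel_measurable (completion ?Q)" and C: "AE z in completion ?Q. norm (\<phi> z) \<le> C"
    using assms by (auto simp: Linf_space_def square_measure_def)
  have mR: "(\<lambda>z. Re (\<phi> z)) \<in> borel_measurable (completion ?Q)"
    and mI: "(\<lambda>z. Im (\<phi> z)) \<in> borel_measurable (completion ?Q)"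
    using m by measurable
  obtain r where r: "r \<in> borel_measurable ?Q" "AE z in ?Q. Re (\<phi> z) = r z"
    using completion_ex_borel_measurable_real[OF mR] by blast
  obtain i where i: "i \<in> borel_measurable ?Q" "AE z in ?Q. Im (\<phi> z) = i z"
    using completion_ex_borel_measurable_real[OF mI] by blast
  note [measurable] = r(1) i(1)
  define \<psi> where "\<psi> z = (if norm (Complex (r z) (i z)) \<le> \<bar>C\<bar> then Complex (r z) (i z) else 0)" for z
  show thesis
  proof
    have [measurable]: "(\<lambda>z. Complex (r z) (i z)) \<in> borel_measurable ?Q"
      unfolding Complex_eq by measurable
    show "\<psi> \<in> borel_measurable ?Q" unfolding \<psi>_def by measurable
    show "norm (\<psi> z) \<le> \<bar>C\<bar>" for z by (simp add: \<psi>_def)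
    show "AE z in ?Q. \<phi> z = \<psi> z"
      using r(2) i(2) C[unfolded AE_completion_iff]
    proof eventually_elim
      case (elim z)
      then have "\<phi> z = Complex (r z) (i z)" by (simp add: complex_eq_iff)
      then show ?case using elim(3) by (auto simp: \<psi>_def)
    qed
  qed
qed

lemma ell2_tail:
  fixes x :: "nat ell2"
  obtains y where "\<And>k. ell2_nth y k = (if k < m then 0 else ell2_nth x k)"
    "(norm y)\<^sup>2 = (norm x)\<^sup>2 - (\<Sum>k<m. (ell2_nth x k)\<^sup>2)"
proof -
  let ?f = "\<lambda>k. if k < m then 0 else ell2_nth x k"
  have s: "(\<lambda>k. (ell2_nth x k)\<^sup>2) sums (norm x)\<^sup>2" by (rule norm_ell2_sums)
  have h: "(\<lambda>k. if k < m then (ell2_nth x k)\<^sup>2 else 0) sums (\<Sum>k<m. (ell2_nth x k)\<^sup>2)"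
    using sums_If_finite[of "\<lambda>k. k < m" "\<lambda>k. (ell2_nth x k)\<^sup>2"] by (simp add: lessThan_def)
  have d: "(\<lambda>k. (?f k)\<^sup>2) sums ((norm x)\<^sup>2 - (\<Sum>k<m. (ell2_nth x k)\<^sup>2))"
    using sums_diff[OF s h] by (rule sums_cong[THEN iffD1, rotated]) auto
  have n: "ell2_nth (ell2_of ?f) = ?f" by (rule ell2_nth_of[OF sums_summable[OF d]])
  show thesis
  proof (rule that[of "ell2_of ?f"])
    show "ell2_nth (ell2_of ?f) k = (if k < m then 0 else ell2_nth x k)" for k by (simp add: n)
    show "(norm (ell2_of ?f))\<^sup>2 = (norm x)\<^sup>2 - (\<Sum>k<m. (ell2_nth x k)\<^sup>2)"
      using sums_unique2[OF norm_ell2_sums[of "ell2_of ?f"]] d by (simp add: n)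
  qed
qed

text \<open>
  The length of the part of \<open>x\<close> beyond the first \<open>m\<close> coordinates.
\<close>

definition tail_norm :: "nat \<Rightarrow> nat ell2 \<Rightarrow> real" where
  "tail_norm m x = sqrt ((norm x)\<^sup>2 - (\<Sum>k<m. (ell2_nth x k)\<^sup>2))"

lemma tail_norm_bounds: "0 \<le> tail_norm m x" "tail_norm m x \<le> norm x"
proof -
  obtain y where "\<And>k. ell2_nth y k = (if k < m then 0 else ell2_nth x k)"
    and y: "(norm y)\<^sup>2 = (norm x)\<^sup>2 - (\<Sum>k<m. (ell2_nth x k)\<^sup>2)" using ell2_tail by blast
  then show "0 \<le> tail_norm m x" by (simp add: tail_norm_def y[symmetric])
  show "tail_norm m x \<le> norm x" unfolding tail_norm_def
    by (rule real_le_lsqrt) (auto simp: sum_nonneg)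
qed

lemma tail_norm_tendsto: "(\<lambda>m. tail_norm m x) \<longlonglongrightarrow> 0"
proof -
  have "(\<lambda>m. sqrt ((norm x)\<^sup>2 - (\<Sum>k<m. (ell2_nth x k)\<^sup>2))) \<longlonglongrightarrow> sqrt ((norm x)\<^sup>2 - (norm x)\<^sup>2)"
    using norm_ell2_sums[of x] unfolding sums_def by (intro tendsto_intros)
  then show ?thesis by (simp add: tail_norm_def)
qed

lemma inner_minus_partial_le:
  "\<bar>inner x y - (\<Sum>k<m. ell2_nth x k * ell2_nth y k)\<bar> \<le> tail_norm m x * tail_norm m y"
proof -
  obtain x' where x': "\<And>k. ell2_nth x' k = (if k < m then 0 else ell2_nth x k)"
    "(norm x')\<^sup>2 = (norm x)\<^sup>2 - (\<Sum>k<m. (ell2_nth x k)\<^sup>2)" using ell2_tail by blast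
  obtain y' where y': "\<And>k. ell2_nth y' k = (if k < m then 0 else ell2_nth y k)"
    "(norm y')\<^sup>2 = (norm y)\<^sup>2 - (\<Sum>k<m. (ell2_nth y k)\<^sup>2)" using ell2_tail by blast
  have h: "(\<lambda>k. if k < m then ell2_nth x k * ell2_nth y k else 0) sums (\<Sum>k<m. ell2_nth x k * ell2_nth y k)"
    using sums_If_finite[of "\<lambda>k. k < m" "\<lambda>k. ell2_nth x k * ell2_nth y k"] by (simp add: lessThan_def)
  have "(\<lambda>k. ell2_nth x' k * ell2_nth y' k) sums (inner x y - (\<Sum>k<m. ell2_nth x k * ell2_nth y k))"
    using sums_diff[OF inner_ell2_sums h] by (rule sums_cong[THEN iffD1, rotated]) (auto simp: x' y')
  from sums_unique2[OF inner_ell2_sums this]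
  have "\<bar>inner x y - (\<Sum>k<m. ell2_nth x k * ell2_nth y k)\<bar> \<le> norm x' * norm y'"
    using Cauchy_Schwarz_ineq2[of x' y'] by simp
  also have "norm x' = tail_norm m x" by (simp add: tail_norm_def x'(2)[symmetric])
  also have "norm y' = tail_norm m y" by (simp add: tail_norm_def y'(2)[symmetric])
  finally show ?thesis .
qed

lemma tail_norm_measurable [measurable]:
  assumes [measurable]: "\<alpha> \<in> borel_measurable N"
  shows "(\<lambda>x. tail_norm m (\<alpha> x)) \<in> borel_measurable N"
  unfolding tail_norm_def by measurable

context sigma_finite_measure
begin

lemma pair_sf': "pair_sigma_finite M M" ..

lemma L2_quadruple_integrable:
  assumes a: "a \<in> L2_space M" and b: "b \<in> L2_space M" and c: "c \<in> L2_space M" and d: "d \<in> L2_space M"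
    and k: "k \<in> borel_measurable (M \<Otimes>\<^sub>M M)" "AE z in M \<Otimes>\<^sub>M M. norm (k z) \<le> C"
  shows "integrable (M \<Otimes>\<^sub>M M) (\<lambda>z. k z * ((a (fst z) * cnj (c (fst z))) * (d (snd z) * cnj (b (snd z)))))"
  using pair_sigma_finite.product_integral_pair(1)[OF pair_sf' l2_inner_integrable[OF a c] l2_inner_integrable[OF d b]]
  by (rule integrable_bounded_mult[OF _ k])

lemma rank_one_kernel_L2:
  assumes a: "a \<in> L2_space M" and b: "b \<in> L2_space M"
  shows "(\<lambda>(x, y). a x * cnj (b y)) \<in> L2_space (square_measure M)"
proof -
  note [measurable] = L2_measurable[OF a] L2_measurable[OF b]
  have "integrable (M \<Otimes>\<^sub>M M) (\<lambda>z. (norm (a (fst z)))\<^sup>2 * (norm (b (snd z)))\<^sup>2)"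
    by (rule pair_sigma_finite.product_integral_pair(1)[OF pair_sf' L2_integrable[OF a] L2_integrable[OF b]])
  then have "integrable (M \<Otimes>\<^sub>M M) (\<lambda>z. (norm (case z of (x, y) \<Rightarrow> a x * cnj (b y)))\<^sup>2)"
    by (simp add: split_beta' norm_mult power_mult_distrib)
  moreover have "(\<lambda>(x, y). a x * cnj (b y)) \<in> borel_measurable (M \<Otimes>\<^sub>M M)" by measurable
  ultimately show ?thesis
    unfolding L2_space_def square_measure_def
    by (auto simp: integrable_completion intro: measurable_completion)
qed

text \<open>
  A rank one operator is compact and has a square integrable kernel, so the multiplier acts on it
  through the symbol. The four functions range over all of $L^2$: this formula is the only access
  to the values of a multiplier.
\<close>

lemma schur_multiplier_rank_one:
  assumes complete: "complete_measure M"
    and T: "schur_multiplier M \<phi> T"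
    and \<psi>: "\<psi> \<in> borel_measurable (M \<Otimes>\<^sub>M M)" "\<And>z. norm (\<psi> z) \<le> C" "AE z in M \<Otimes>\<^sub>M M. \<phi> z = \<psi> z"
    and a: "a \<in> L2_space M" and b: "b \<in> L2_space M" and c: "c \<in> L2_space M" and d: "d \<in> L2_space M"
  shows "l2_inner M (T (rank_one M a b) d) c
    = (\<integral>z. \<psi> z * ((a (fst z) * cnj (c (fst z))) * (d (snd z) * cnj (b (snd z)))) \<partial>(M \<Otimes>\<^sub>M M))"
proof -
  interpret P: pair_sigma_finite M M by (rule pair_sf')
  interpret C: complete_measure M by (rule complete)
  note [measurable] = \<psi>(1) L2_measurable[OF a] L2_measurable[OF b] L2_measurable[OF c] L2_measurable[OF d]
  obtain \<Psi> where \<Psi>: "\<And>f. f \<in> L2_space (square_measure M) \<Longrightarrow>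
      op_eq M (\<Psi> (kernel_op M f)) (kernel_op M (\<lambda>p. \<phi> p * f p))"
    "\<And>A. A \<in> compact_ops M \<Longrightarrow> op_eq M (T A) (\<Psi> A)"
    and Tb: "\<And>A. A \<in> bounded_ops M \<Longrightarrow> T A \<in> bounded_ops M"
    using T unfolding schur_multiplier_def bounded_linear_on_ops_def by blast
  let ?f = "\<lambda>(x, y). a x * cnj (b y)"
  have "AE x in M. T (rank_one M a b) d x = \<Psi> (rank_one M a b) d x"
    using \<Psi>(2)[OF rank_one_compact[OF a b]] d by (simp add: op_eq_def)
  moreover have "AE x in M. \<Psi> (rank_one M a b) d x = kernel_op M (\<lambda>p. \<phi> p * ?f p) d x"
    using \<Psi>(1)[OF rank_one_kernel_L2[OF a b]] d by (simp add: op_eq_def rank_one_eq_kernel_op)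
  moreover have "AE x in M. kernel_op M (\<lambda>p. \<phi> p * ?f p) d x = (\<integral>y. \<psi> (x, y) * (a x * (d y * cnj (b y))) \<partial>M)"
    using P.AE_pair[OF \<psi>(3)] AE_space
  proof eventually_elim
    case (elim x)
    have m: "(\<lambda>y. \<psi> (x, y)) \<in> borel_measurable M" using elim(2) by measurable
    have m': "(\<lambda>y. \<phi> (x, y)) \<in> borel_measurable M"
      by (rule C.measurable_if_AE_eq[OF m]) (use elim in auto)
    show ?case
      unfolding kernel_op_def
    proof (rule integral_cong_AE)
      show "AE y in M. \<phi> (x, y) * (case (x, y) of (x, y) \<Rightarrow> a x * cnj (b y)) * d y = \<psi> (x, y) * (a x * (d y * cnj (b y)))"
        using elim(1) by eventually_elim (simp add: ac_simps)
    qed (use m m' in auto)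
  qed
  ultimately have ae: "AE x in M. T (rank_one M a b) d x = (\<integral>y. \<psi> (x, y) * (a x * (d y * cnj (b y))) \<partial>M)"
    by eventually_elim simp
  have [measurable]: "T (rank_one M a b) d \<in> borel_measurable M"
    by (rule L2_measurable[OF bop_L2[OF Tb[OF rank_one_bounded[OF a b]] d]])
  have "l2_inner M (T (rank_one M a b) d) c = (\<integral>x. (\<integral>y. \<psi> (x, y) * (a x * (d y * cnj (b y))) \<partial>M) * cnj (c x) \<partial>M)"
    unfolding l2_inner_def
  proof (rule integral_cong_AE)
    show "(\<lambda>x. (\<integral>y. \<psi> (x, y) * (a x * (d y * cnj (b y))) \<partial>M) * cnj (c x)) \<in> borel_measurable M"
      by (intro borel_measurable_times borel_measurable_lebesgue_integral) measurable
  qed (use ae in \<open>auto elim: eventually_mono\<close>)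
  also have "\<dots> = (\<integral>x. (\<integral>y. \<psi> (x, y) * ((a x * cnj (c x)) * (d y * cnj (b y))) \<partial>M) \<partial>M)"
  proof (rule Bochner_Integration.integral_cong)
    fix x
    show "(\<integral>y. \<psi> (x, y) * (a x * (d y * cnj (b y))) \<partial>M) * cnj (c x)
        = (\<integral>y. \<psi> (x, y) * ((a x * cnj (c x)) * (d y * cnj (b y))) \<partial>M)"
      by (subst integral_mult_left_zero[symmetric])
        (rule Bochner_Integration.integral_cong, simp_all add: ac_simps)
  qed simp
  also have "\<dots> = (\<integral>z. \<psi> z * ((a (fst z) * cnj (c (fst z))) * (d (snd z) * cnj (b (snd z)))) \<partial>(M \<Otimes>\<^sub>M M))"
    using P.integral_fst'[OF L2_quadruple_integrable[OF a b c d \<psi>(1), of C]] \<psi>(2) by simp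
  finally show ?thesis .
qed

text \<open>
  Multiplication by the \<open>k\<close>-th coordinate of \<open>\<alpha>\<close>. Formally, the multiplier whose symbol is the Gram kernel
  of \<open>\<alpha>\<close> maps the rank one operator of \<open>a\<close> and \<open>b\<close> to the sum over \<open>k\<close> of those of \<open>coord \<alpha> k a\<close> and
  \<open>coord \<alpha> k b\<close>.
\<close>

definition coord :: "('a \<Rightarrow> nat ell2) \<Rightarrow> nat \<Rightarrow> ('a \<Rightarrow> complex) \<Rightarrow> 'a \<Rightarrow> complex" where
  "coord \<alpha> k a = (\<lambda>x. complex_of_real (ell2_nth (\<alpha> x) k) * a x)"

lemma coord_L2:
  assumes "\<alpha> \<in> borel_measurable M" "\<And>x. norm (\<alpha> x) \<le> 1" "a \<in> L2_space M"
  shows "coord \<alpha> k a \<in> L2_space M"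
  unfolding coord_def using assms order_trans[OF norm_ell2_nth_le assms(2)]
  by (intro L2_mult[of _ _ _ 1]) auto

text \<open>
  Truncating the Gram kernel after \<open>m\<close> coordinates, next to another bounded kernel \<open>\<gamma>\<close>. The truncations
  are bounded by one, so that dominated convergence applies. With a general \<open>\<gamma>\<close> this computes
  compositions of multipliers.
\<close>

lemma partial_kernel_integral:
  fixes \<gamma> :: "'a \<times> 'a \<Rightarrow> complex"
  assumes \<alpha>: "\<alpha> \<in> borel_measurable M" "\<And>x. norm (\<alpha> x) \<le> 1"
    and a: "a \<in> L2_space M" and b: "b \<in> L2_space M" and c: "c \<in> L2_space M" and d: "d \<in> L2_space M"
    and \<gamma>: "\<gamma> \<in> borel_measurable (M \<Otimes>\<^sub>M M)" "\<And>z. norm (\<gamma> z) \<le> C"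
  shows "(\<lambda>m. \<integral>z. \<gamma> z * complex_of_real (\<Sum>k<m. ell2_nth (\<alpha> (fst z)) k * ell2_nth (\<alpha> (snd z)) k)
        * ((a (fst z) * cnj (c (fst z))) * (d (snd z) * cnj (b (snd z)))) \<partial>(M \<Otimes>\<^sub>M M))
    \<longlonglongrightarrow> (\<integral>z. \<gamma> z * complex_of_real (inner (\<alpha> (fst z)) (\<alpha> (snd z)))
        * ((a (fst z) * cnj (c (fst z))) * (d (snd z) * cnj (b (snd z)))) \<partial>(M \<Otimes>\<^sub>M M))" (is "?lim")
    and "(\<integral>z. \<gamma> z * complex_of_real (\<Sum>k<m. ell2_nth (\<alpha> (fst z)) k * ell2_nth (\<alpha> (snd z)) k)
        * ((a (fst z) * cnj (c (fst z))) * (d (snd z) * cnj (b (snd z)))) \<partial>(M \<Otimes>\<^sub>M M))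
    = (\<Sum>k<m. \<integral>z. \<gamma> z * ((coord \<alpha> k a (fst z) * cnj (c (fst z))) * (d (snd z) * cnj (coord \<alpha> k b (snd z)))) \<partial>(M \<Otimes>\<^sub>M M))"
    (is "?eq")
proof -
  let ?X = "\<lambda>z. (a (fst z) * cnj (c (fst z))) * (d (snd z) * cnj (b (snd z)))"
  note [measurable] = \<alpha>(1) \<gamma>(1) L2_measurable[OF a] L2_measurable[OF b] L2_measurable[OF c] L2_measurable[OF d]
  have X: "integrable (M \<Otimes>\<^sub>M M) ?X"
    using L2_quadruple_integrable[OF a b c d, of "\<lambda>_. 1" 1] by simp
  have C0: "0 \<le> C" using order_trans[OF norm_ge_zero \<gamma>(2)] .
  show ?lim
  proof (rule integral_dominated_convergence[where w = "\<lambda>z. C * norm (?X z)"])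
    show "integrable (M \<Otimes>\<^sub>M M) (\<lambda>z. C * norm (?X z))" using X by simp
    show "AE z in M \<Otimes>\<^sub>M M. (\<lambda>m. \<gamma> z * complex_of_real (\<Sum>k<m. ell2_nth (\<alpha> (fst z)) k * ell2_nth (\<alpha> (snd z)) k) * ?X z)
        \<longlonglongrightarrow> \<gamma> z * complex_of_real (inner (\<alpha> (fst z)) (\<alpha> (snd z))) * ?X z"
      using inner_ell2_sums unfolding sums_def by (intro AE_I2 tendsto_intros) auto
    show "AE z in M \<Otimes>\<^sub>M M. norm (\<gamma> z * complex_of_real (\<Sum>k<m. ell2_nth (\<alpha> (fst z)) k * ell2_nth (\<alpha> (snd z)) k) * ?X z)
        \<le> C * norm (?X z)" for m
    proof (rule AE_I2)
      fix z
      have "norm (\<gamma> z * complex_of_real (\<Sum>k<m. ell2_nth (\<alpha> (fst z)) k * ell2_nth (\<alpha> (snd z)) k)) \<le> C * 1"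
        unfolding norm_mult norm_of_real
        by (intro mult_mono \<gamma>(2) partial_inner_bound \<alpha>(2) C0) auto
      then show "norm (\<gamma> z * complex_of_real (\<Sum>k<m. ell2_nth (\<alpha> (fst z)) k * ell2_nth (\<alpha> (snd z)) k) * ?X z)
        \<le> C * norm (?X z)" unfolding norm_mult[of _ "?X z"] by (intro mult_right_mono) auto
    qed
  qed measurable
  have ca: "coord \<alpha> k a \<in> L2_space M" "coord \<alpha> k b \<in> L2_space M" for k
    using coord_L2[OF \<alpha>] a b by auto
  have "(\<integral>z. \<gamma> z * complex_of_real (\<Sum>k<m. ell2_nth (\<alpha> (fst z)) k * ell2_nth (\<alpha> (snd z)) k) * ?X z \<partial>(M \<Otimes>\<^sub>M M))
     = (\<integral>z. (\<Sum>k<m. \<gamma> z * ((coord \<alpha> k a (fst z) * cnj (c (fst z))) * (d (snd z) * cnj (coord \<alpha> k b (snd z))))) \<partial>(M \<Otimes>\<^sub>M M))"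
    unfolding of_real_sum sum_distrib_left sum_distrib_right coord_def
    by (intro Bochner_Integration.integral_cong sum.cong refl) (simp add: ac_simps)
  also have "\<dots> = (\<Sum>k<m. \<integral>z. \<gamma> z * ((coord \<alpha> k a (fst z) * cnj (c (fst z))) * (d (snd z) * cnj (coord \<alpha> k b (snd z)))) \<partial>(M \<Otimes>\<^sub>M M))"
    using \<gamma> by (intro Bochner_Integration.integral_sum L2_quadruple_integrable[of _ _ _ _ _ C] ca c d) auto
  finally show ?eq .
qed

lemma factor_expansion:
  assumes \<alpha>: "\<alpha> \<in> borel_measurable M" "\<And>x. norm (\<alpha> x) \<le> 1"
    and a: "a \<in> L2_space M" and b: "b \<in> L2_space M" and c: "c \<in> L2_space M" and d: "d \<in> L2_space M"
  shows "(\<lambda>m. \<Sum>k<m. l2_inner M (coord \<alpha> k a) c * l2_inner M d (coord \<alpha> k b))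
    \<longlonglongrightarrow> (\<integral>z. complex_of_real (inner (\<alpha> (fst z)) (\<alpha> (snd z)))
        * ((a (fst z) * cnj (c (fst z))) * (d (snd z) * cnj (b (snd z)))) \<partial>(M \<Otimes>\<^sub>M M))"
proof -
  have "(\<integral>z. ((coord \<alpha> k a (fst z) * cnj (c (fst z))) * (d (snd z) * cnj (coord \<alpha> k b (snd z)))) \<partial>(M \<Otimes>\<^sub>M M))
      = l2_inner M (coord \<alpha> k a) c * l2_inner M d (coord \<alpha> k b)" for k
    unfolding l2_inner_def
    by (intro pair_sigma_finite.product_integral_pair(2)[OF pair_sf'] l2_inner_integrable coord_L2[OF \<alpha>] a b c d)
  then show ?thesis
    using partial_kernel_integral[OF \<alpha> a b c d, of "\<lambda>_. 1" 1] by simp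
qed

end

section \<open>Markov Schur multipliers are Gram kernels of unit vectors\<close>

lemma nonneg_Reals_D: "z \<in> \<real>\<^sub>\<ge>\<^sub>0 \<Longrightarrow> 0 \<le> Re z \<and> Im z = 0"
  by (auto simp: complex_nonneg_Reals_iff)

lemma positive_map_if_completely_positive:
  assumes cp: "completely_positive M T" and A: "A \<in> bounded_ops M" "positive_op M A"
  shows "positive_op M (T A)"
proof -
  have "positive_op_matrix M 1 (\<lambda>i j. A)" using A(2) by (simp add: positive_op_matrix_def positive_op_def)
  with A(1) have "positive_op_matrix M 1 (\<lambda>i j. T A)"
    using cp[unfolded completely_positive_def, THEN spec, THEN spec, of 1 "\<lambda>i j. A"] by simp
  then have *: "\<forall>g. (\<forall>i<(1::nat). g i \<in> L2_space M) \<longrightarrow>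
      (\<Sum>i<(1::nat). \<Sum>j<(1::nat). l2_inner M (T A (g j)) (g i)) \<in> \<real>\<^sub>\<ge>\<^sub>0"
    unfolding positive_op_matrix_def .
  have "l2_inner M (T A f) f \<in> \<real>\<^sub>\<ge>\<^sub>0" if "f \<in> L2_space M" for f
    using *[THEN spec, of "\<lambda>_. f"] that by simp
  then show ?thesis unfolding positive_op_def by blast
qed

text \<open>
  The weight replaces the \<open>\<sigma>\<close>-finite measure by the equivalent finite measure \<open>N\<close>, for which bounded
  kernels are integrable; multiplication by its square root embeds the bounded functions into
  $L^2(M)$.
\<close>

locale weighted_measure = sigma_finite_measure M for M :: "'a measure" +
  fixes w :: "'a \<Rightarrow> real"
  assumes complete: "complete_measure M"
    and w_measurable [measurable]: "w \<in> borel_measurable M"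
    and w_pos: "0 < w x"
    and w_integrable: "integrable M w"
begin

definition N where "N = density M (\<lambda>x. ennreal (w x))"

definition sqrt_w :: "'a \<Rightarrow> complex" where "sqrt_w x = complex_of_real (sqrt (w x))"

lemma sets_N [simp]: "sets N = sets M" and space_N [simp]: "space N = space M"
  by (simp_all add: N_def)

lemma measurable_N [simp]: "measurable N K = measurable M K"
  by (rule measurable_cong_sets) simp_all

lemma measurable_NN: "measurable (N \<Otimes>\<^sub>M N) K = measurable (M \<Otimes>\<^sub>M M) K"
  by (intro measurable_cong_sets sets_pair_measure_cong) simp_all

lemma finite_N: "finite_measure N"
proof (rule finite_measureI)
  have "emeasure N (space N) = (\<integral>\<^sup>+x. ennreal (w x) \<partial>M)"
    unfolding N_def by (subst emeasure_density) (auto intro!: nn_integral_cong)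
  also have "\<dots> = ennreal (\<integral>x. w x \<partial>M)"
    using w_integrable w_pos by (intro nn_integral_eq_integral) (auto simp: less_imp_le)
  finally show "emeasure N (space N) \<noteq> \<infinity>" by simp
qed

sublocale N: finite_measure N by (rule finite_N)

lemma NN: "N \<Otimes>\<^sub>M N = density (M \<Otimes>\<^sub>M M) (\<lambda>z. ennreal (w (fst z) * w (snd z)))"
proof -
  have "N \<Otimes>\<^sub>M N = density (M \<Otimes>\<^sub>M M) (\<lambda>(x, y). ennreal (w x) * ennreal (w y))"
    unfolding N_def
    by (rule pair_measure_density)
      (use N.sigma_finite_measure_axioms sigma_finite_measure_axioms in \<open>auto simp: N_def\<close>)
  also have "(\<lambda>(x, y). ennreal (w x) * ennreal (w y)) = (\<lambda>z. ennreal (w (fst z) * w (snd z)))"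
    by (auto simp: ennreal_mult less_imp_le[OF w_pos])
  finally show ?thesis .
qed

lemma AE_NN: "(AE z in N \<Otimes>\<^sub>M N. P z) \<longleftrightarrow> (AE z in M \<Otimes>\<^sub>M M. P z)"
  unfolding NN by (subst AE_density) (auto simp: w_pos)

lemma integral_NN:
  fixes f :: "'a \<times> 'a \<Rightarrow> 'c::{banach, second_countable_topology}"
  assumes "f \<in> borel_measurable (M \<Otimes>\<^sub>M M)"
  shows "(\<integral>z. f z \<partial>(N \<Otimes>\<^sub>M N)) = (\<integral>z. (w (fst z) * w (snd z)) *\<^sub>R f z \<partial>(M \<Otimes>\<^sub>M M))"
  unfolding NN by (rule integral_density) (use assms w_pos in \<open>auto simp: less_imp_le\<close>)

lemma sqrt_w_square: "sqrt_w x * sqrt_w x = complex_of_real (w x)" "cnj (sqrt_w x) = sqrt_w x"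
proof -
  have "sqrt (w x) * sqrt (w x) = w x" using w_pos[of x] by simp
  then show "sqrt_w x * sqrt_w x = complex_of_real (w x)" unfolding sqrt_w_def of_real_mult[symmetric] by simp
  show "cnj (sqrt_w x) = sqrt_w x" by (simp add: sqrt_w_def)
qed

lemma sqrt_w_L2: "sqrt_w \<in> L2_space M"
  unfolding L2_space_def sqrt_w_def using w_integrable w_pos by (auto simp: less_imp_le)

definition times_sqrt_w :: "('a \<Rightarrow> complex) \<Rightarrow> 'a \<Rightarrow> complex" where "times_sqrt_w p x = p x * sqrt_w x"

lemma times_sqrt_w_L2: "p \<in> borel_measurable M \<Longrightarrow> (\<And>x. norm (p x) \<le> C) \<Longrightarrow> times_sqrt_w p \<in> L2_space M"
  unfolding times_sqrt_w_def by (rule L2_mult[OF sqrt_w_L2])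

lemma times_sqrt_w_indicator_L2: "A \<in> sets M \<Longrightarrow> times_sqrt_w (indicator A) \<in> L2_space M"
  by (rule times_sqrt_w_L2[where C = 1]) (auto split: split_indicator)

lemma weighted_pairing:
  fixes \<gamma> :: "'a \<times> 'a \<Rightarrow> complex"
  assumes [measurable]: "\<gamma> \<in> borel_measurable (M \<Otimes>\<^sub>M M)" "p \<in> borel_measurable M" "q \<in> borel_measurable M"
    "p' \<in> borel_measurable M" "q' \<in> borel_measurable M"
  shows "(\<integral>z. \<gamma> z * ((times_sqrt_w p (fst z) * cnj (times_sqrt_w p' (fst z))) * (times_sqrt_w q (snd z) * cnj (times_sqrt_w q' (snd z)))) \<partial>(M \<Otimes>\<^sub>M M))
    = (\<integral>z. \<gamma> z * (p (fst z) * cnj (p' (fst z))) * (q (snd z) * cnj (q' (snd z))) \<partial>(N \<Otimes>\<^sub>M N))"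
proof (subst integral_NN)
  show "(\<lambda>z. \<gamma> z * (p (fst z) * cnj (p' (fst z))) * (q (snd z) * cnj (q' (snd z)))) \<in> borel_measurable (M \<Otimes>\<^sub>M M)"
    by measurable
  have "(times_sqrt_w p x * cnj (times_sqrt_w p' x)) * (times_sqrt_w q y * cnj (times_sqrt_w q' y))
     = complex_of_real (w x * w y) * ((p x * cnj (p' x)) * (q y * cnj (q' y)))" for x y
  proof -
    have "(times_sqrt_w p x * cnj (times_sqrt_w p' x)) * (times_sqrt_w q y * cnj (times_sqrt_w q' y))
       = (sqrt_w x * sqrt_w x) * (sqrt_w y * sqrt_w y) * ((p x * cnj (p' x)) * (q y * cnj (q' y)))"
      unfolding times_sqrt_w_def complex_cnj_mult sqrt_w_square(2) by (simp only: ac_simps)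
    then show ?thesis by (simp add: sqrt_w_square(1))
  qed
  then show "(\<integral>z. \<gamma> z * ((times_sqrt_w p (fst z) * cnj (times_sqrt_w p' (fst z))) * (times_sqrt_w q (snd z) * cnj (times_sqrt_w q' (snd z)))) \<partial>(M \<Otimes>\<^sub>M M))
    = (\<integral>z. (w (fst z) * w (snd z)) *\<^sub>R (\<gamma> z * (p (fst z) * cnj (p' (fst z))) * (q (snd z) * cnj (q' (snd z)))) \<partial>(M \<Otimes>\<^sub>M M))"
    by (intro Bochner_Integration.integral_cong refl) (simp add: scaleR_conv_of_real ac_simps)
qed

lemma bounded_kernel_integrable:
  fixes \<gamma> :: "'a \<times> 'a \<Rightarrow> 'c::{banach, second_countable_topology}"
  assumes "\<gamma> \<in> borel_measurable (M \<Otimes>\<^sub>M M)" "\<And>z. norm (\<gamma> z) \<le> C"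
  shows "integrable (N \<Otimes>\<^sub>M N) \<gamma>"
proof -
  interpret Q: finite_measure "N \<Otimes>\<^sub>M N" by (rule N.finite_square)
  show ?thesis using assms by (intro Q.integrable_const_bound[of _ C]) (auto simp: measurable_NN)
qed

lemma rectangle_sets_N: "sets N = sigma_sets (space N) (sets N)" "Int_stable (sets N)"
  "sets N \<subseteq> Pow (space N)" "space N \<in> sets N"
  using sets.sigma_sets_eq[of N] sets.Int_stable[of N] sets.space_closed[of N] by auto

text \<open>
  Taking for \<open>a\<close> and \<open>b\<close> the products of indicators with the root of the weight gives the integrals over all
  rectangles. The pairings that occur are those of a multiplier with rank one operators, one factor
  of which is fixed.
\<close>

lemma AE_eq_if_pairings_eq:
  fixes \<gamma> \<delta> :: "'a \<times> 'a \<Rightarrow> complex"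
  assumes \<gamma>: "\<gamma> \<in> borel_measurable (M \<Otimes>\<^sub>M M)" "\<And>z. norm (\<gamma> z) \<le> C"
    and \<delta>: "\<delta> \<in> borel_measurable (M \<Otimes>\<^sub>M M)" "\<And>z. norm (\<delta> z) \<le> D"
    and eq: "\<And>a b. a \<in> L2_space M \<Longrightarrow> b \<in> L2_space M \<Longrightarrow>
      (\<integral>z. \<gamma> z * ((a (fst z) * cnj (sqrt_w (fst z))) * (b (snd z) * cnj (sqrt_w (snd z)))) \<partial>(M \<Otimes>\<^sub>M M))
      = (\<integral>z. \<delta> z * ((a (fst z) * cnj (sqrt_w (fst z))) * (b (snd z) * cnj (sqrt_w (snd z)))) \<partial>(M \<Otimes>\<^sub>M M))"
  shows "AE z in M \<Otimes>\<^sub>M M. \<gamma> z = \<delta> z"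
proof -
  have sqrt_w_eq: "sqrt_w = times_sqrt_w (\<lambda>_. 1)" by (simp add: times_sqrt_w_def fun_eq_iff)
  have c: "(\<integral>z. \<gamma> z * indicator A (fst z) * indicator B (snd z) \<partial>(N \<Otimes>\<^sub>M N))
      = (\<integral>z. \<delta> z * indicator A (fst z) * indicator B (snd z) \<partial>(N \<Otimes>\<^sub>M N))"
    if A: "A \<in> sets M" and B: "B \<in> sets M" for A B
    using eq[OF times_sqrt_w_indicator_L2[OF A] times_sqrt_w_indicator_L2[OF B]] A B
    unfolding sqrt_w_eq by (subst (asm) weighted_pairing[OF \<gamma>(1)], simp_all, subst (asm) weighted_pairing[OF \<delta>(1)], simp_all)
  have r: "AE z in N \<Otimes>\<^sub>M N. T (\<gamma> z) = T (\<delta> z)" if T: "T = Re \<or> T = Im" for T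
  proof (rule AE_eq_if_integrals_eq_on_rectangles[OF _ _ rectangle_sets_N])
    have bl: "bounded_linear T" using T bounded_linear_Re bounded_linear_Im by auto
    show "integrable (N \<Otimes>\<^sub>M N) (\<lambda>z. T (\<gamma> z))" "integrable (N \<Otimes>\<^sub>M N) (\<lambda>z. T (\<delta> z))"
      using integrable_bounded_linear[OF bl] bounded_kernel_integrable[OF \<gamma>] bounded_kernel_integrable[OF \<delta>] by auto
    fix A B assume "A \<in> sets N" "B \<in> sets N"
    then have AB: "A \<in> sets M" "B \<in> sets M" by auto
    note [measurable] = AB
    have k: "(\<integral>z. T (\<gamma> z) * indicator A (fst z) * indicator B (snd z) \<partial>(N \<Otimes>\<^sub>M N))
       = T (\<integral>z. \<gamma> z * indicator A (fst z) * indicator B (snd z) \<partial>(N \<Otimes>\<^sub>M N))"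
      if \<gamma>: "\<gamma> \<in> borel_measurable (M \<Otimes>\<^sub>M M)" "\<And>z. norm (\<gamma> z) \<le> C" for \<gamma> C
    proof -
      note [measurable] = \<gamma>(1)
      have "integrable (N \<Otimes>\<^sub>M N) (\<lambda>z. \<gamma> z * indicator A (fst z) * indicator B (snd z))"
      proof (rule bounded_kernel_integrable[where C = C])
        show "norm (\<gamma> z * indicator A (fst z) * indicator B (snd z)) \<le> C" for z
          using \<gamma>(2)[of z] order_trans[OF norm_ge_zero \<gamma>(2)] by (auto split: split_indicator)
      qed measurable
      from integral_bounded_linear[OF bl this]
      have "(\<integral>z. T (\<gamma> z * indicator A (fst z) * indicator B (snd z)) \<partial>(N \<Otimes>\<^sub>M N))
         = T (\<integral>z. \<gamma> z * indicator A (fst z) * indicator B (snd z) \<partial>(N \<Otimes>\<^sub>M N))" .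
      moreover have "T (\<gamma> z * indicator A (fst z) * indicator B (snd z)) = T (\<gamma> z) * indicator A (fst z) * indicator B (snd z)" for z
        using T by (auto split: split_indicator)
      ultimately show ?thesis by simp
    qed
    show "(\<integral>z. T (\<gamma> z) * indicator A (fst z) * indicator B (snd z) \<partial>(N \<Otimes>\<^sub>M N))
      = (\<integral>z. T (\<delta> z) * indicator A (fst z) * indicator B (snd z) \<partial>(N \<Otimes>\<^sub>M N))"
      unfolding k[OF \<gamma>] k[OF \<delta>] c[OF AB] ..
  qed
  from r[of Re] r[of Im] have "AE z in N \<Otimes>\<^sub>M N. \<gamma> z = \<delta> z"
    by (auto simp: complex_eq_iff)
  then show ?thesis by (simp add: AE_NN)
qed

lemma multiplier_linear:
  assumes T: "bounded_linear_on_ops M (bounded_ops M) T" and A: "A \<in> bounded_ops M" and B: "B \<in> bounded_ops M"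
    and f: "f \<in> L2_space M" and h: "h \<in> L2_space M"
  shows "l2_inner M (T (\<lambda>f x. A f x + c * B f x) f) h = l2_inner M (T A f) h + c * l2_inner M (T B f) h"
proof -
  have Tb: "\<And>A. A \<in> bounded_ops M \<Longrightarrow> T A \<in> bounded_ops M"
    using T by (auto simp: bounded_linear_on_ops_def)
  have "op_eq M (T (\<lambda>f x. A f x + c * B f x)) (\<lambda>f x. T A f x + c * T B f x)"
    using T A B by (auto simp: bounded_linear_on_ops_def)
  then have "AE x in M. T (\<lambda>f x. A f x + c * B f x) f x = T A f x + c * T B f x"
    using f by (simp add: op_eq_def)
  then have "l2_inner M (T (\<lambda>f x. A f x + c * B f x) f) h = l2_inner M (\<lambda>x. T A f x + c * T B f x) h"
    by (rule l2_inner_cong_AE[OF _ bop_L2[OF Tb[OF bounded_op_comb[OF A B]] f]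
          L2_comb[OF bop_L2[OF Tb[OF A] f] bop_L2[OF Tb[OF B] f]] h])
  then show ?thesis
    using l2_inner_comb_left[OF bop_L2[OF Tb[OF A] f] bop_L2[OF Tb[OF B] f] h] by simp
qed

lemma multiplier_sum:
  assumes T: "bounded_linear_on_ops M (bounded_ops M) T" and f: "f \<in> L2_space M" and h: "h \<in> L2_space M"
  shows "finite I \<Longrightarrow> (\<And>i. i \<in> I \<Longrightarrow> A i \<in> bounded_ops M) \<Longrightarrow>
    l2_inner M (T (\<lambda>f x. \<Sum>i\<in>I. A i f x) f) h = (\<Sum>i\<in>I. l2_inner M (T (A i) f) h)"
proof (induction I rule: finite_induct)
  case empty
  have "l2_inner M (T (\<lambda>f x. 0) f) h = l2_inner M (T (\<lambda>f x. 0) f) h + 1 * l2_inner M (T (\<lambda>f x. 0) f) h"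
    using multiplier_linear[OF T zero_bounded_op zero_bounded_op f h, of 1] by simp
  then show ?case by simp
next
  case (insert i I)
  have "l2_inner M (T (\<lambda>f x. (\<Sum>i\<in>I. A i f x) + 1 * A i f x) f) h
     = l2_inner M (T (\<lambda>f x. \<Sum>i\<in>I. A i f x) f) h + 1 * l2_inner M (T (A i) f) h"
    using insert by (intro multiplier_linear[OF T _ _ f h] sum_bounded_op) auto
  with insert show ?case by (simp add: add.commute)
qed

lemma unital_at: 
  assumes "unital_map M T" "T id \<in> bounded_ops M" "f \<in> L2_space M" "h \<in> L2_space M"
  shows "l2_inner M (T id f) h = l2_inner M f h"
  using assms by (intro l2_inner_cong_AE) (auto simp: unital_map_def op_eq_def intro: bop_L2)

text \<open>
  The symbol, tested on rank one operators, is a real positive semidefinite kernel with averages at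
  most one, which gives Gram vectors in the unit ball. For their length, note that on the
  projection onto finitely many basis vectors \<open>T\<close> is the sum over \<open>k\<close> of the squeezed projections
  by the \<open>k\<close>-th coordinate of \<open>\<beta>\<close>; by Bessel's inequality its value in the state of \<open>\<surd>w\<close> is at most
  \<open>\<integral> |\<beta>\<^sub>x|\<^sup>2 w(x) dx\<close>. In the weak* limit this value becomes \<open>\<integral> w(x) dx\<close>.
\<close>

theorem markov_multiplier_factorisation:
  assumes sm: "schur_multiplier M \<phi> T" and sa: "selfadjoint_map M T"
    and un: "unital_map M T" and cp: "completely_positive M T"
  obtains \<beta> :: "'a \<Rightarrow> nat ell2" where "\<beta> \<in> borel_measurable M" "\<And>x. norm (\<beta> x) \<le> 1" "AE x in M. norm (\<beta> x) = 1"
    "AE z in M \<Otimes>\<^sub>M M. \<phi> z = complex_of_real (inner (\<beta> (fst z)) (\<beta> (snd z)))"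
proof -
  have Tlin: "bounded_linear_on_ops M (bounded_ops M) T" and wc: "continuous_map (weak_star M) (weak_star M) T"
    and Linf: "\<phi> \<in> Linf_space (square_measure M)"
    using sm by (auto simp: schur_multiplier_def)
  have Tb: "\<And>A. A \<in> bounded_ops M \<Longrightarrow> T A \<in> bounded_ops M"
    using Tlin by (auto simp: bounded_linear_on_ops_def)
  obtain \<psi> C where \<psi>: "\<psi> \<in> borel_measurable (M \<Otimes>\<^sub>M M)" "\<And>z. norm (\<psi> z) \<le> C" "AE z in M \<Otimes>\<^sub>M M. \<phi> z = \<psi> z"
    using Linf_representative[OF Linf] by blast
  note [measurable] = \<psi>(1)
  note pair = schur_multiplier_rank_one[OF complete sm \<psi>]
  \<comment> \<open>Selfadjointness makes the symbol real.\<close>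
  have "AE z in M \<Otimes>\<^sub>M M. \<psi> z = cnj (\<psi> z)"
  proof (rule AE_eq_if_pairings_eq[OF \<psi>(1,2)])
    fix a b assume a: "a \<in> L2_space M" and b: "b \<in> L2_space M"
    have "hs_inner M (T (rank_one M a sqrt_w)) (rank_one M sqrt_w b) = hs_inner M (rank_one M a sqrt_w) (T (rank_one M sqrt_w b))"
      using sa rank_one_hs a b sqrt_w_L2 unfolding selfadjoint_map_def by blast
    also have "\<dots> = cnj (hs_inner M (T (rank_one M sqrt_w b)) (rank_one M a sqrt_w))" by (rule hs_inner_commute)
    finally have "l2_inner M (T (rank_one M a sqrt_w) b) sqrt_w = cnj (l2_inner M (T (rank_one M sqrt_w b) sqrt_w) a)"
      by (simp add: hs_inner_rank_one Tb rank_one_bounded a b sqrt_w_L2)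
    then show "(\<integral>z. \<psi> z * ((a (fst z) * cnj (sqrt_w (fst z))) * (b (snd z) * cnj (sqrt_w (snd z)))) \<partial>(M \<Otimes>\<^sub>M M))
      = (\<integral>z. cnj (\<psi> z) * ((a (fst z) * cnj (sqrt_w (fst z))) * (b (snd z) * cnj (sqrt_w (snd z)))) \<partial>(M \<Otimes>\<^sub>M M))"
      unfolding pair[OF a sqrt_w_L2 sqrt_w_L2 b] pair[OF sqrt_w_L2 b a sqrt_w_L2]
      by (simp add: Bochner_Integration.integral_cnj[symmetric] ac_simps del: Bochner_Integration.integral_cnj)
  qed (use \<psi>(2) in auto)
  define k where "k z = Re (\<psi> z)" for z
  have km[measurable]: "k \<in> borel_measurable (M \<Otimes>\<^sub>M M)" unfolding k_def by measurable
  have kb: "\<bar>k z\<bar> \<le> C" for z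
    unfolding k_def using abs_Re_le_cmod[of "\<psi> z"] \<psi>(2)[of z] by linarith
  have \<psi>k: "AE z in M \<Otimes>\<^sub>M M. \<psi> z = complex_of_real (k z)"
    using \<open>AE z in M \<Otimes>\<^sub>M M. \<psi> z = cnj (\<psi> z)\<close>
    by eventually_elim (simp add: k_def complex_eq_iff)
  have \<phi>k: "AE z in M \<Otimes>\<^sub>M M. \<phi> z = complex_of_real (k z)"
    using \<psi>(3) \<psi>k by eventually_elim simp
  have pairk: "l2_inner M (T (rank_one M (times_sqrt_w p') (times_sqrt_w q')) (times_sqrt_w q)) (times_sqrt_w p)
      = (\<integral>z. complex_of_real (k z) * (p' (fst z) * cnj (p (fst z))) * (q (snd z) * cnj (q' (snd z))) \<partial>(N \<Otimes>\<^sub>M N))"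
    if m: "p \<in> borel_measurable M" "q \<in> borel_measurable M" "p' \<in> borel_measurable M" "q' \<in> borel_measurable M"
      and L: "times_sqrt_w p \<in> L2_space M" "times_sqrt_w q \<in> L2_space M" "times_sqrt_w p' \<in> L2_space M" "times_sqrt_w q' \<in> L2_space M" for p q p' q'
  proof -
    have "l2_inner M (T (rank_one M (times_sqrt_w p') (times_sqrt_w q')) (times_sqrt_w q)) (times_sqrt_w p)
      = (\<integral>z. complex_of_real (k z) * ((times_sqrt_w p' (fst z) * cnj (times_sqrt_w p (fst z))) * (times_sqrt_w q (snd z) * cnj (times_sqrt_w q' (snd z)))) \<partial>(M \<Otimes>\<^sub>M M))"
      by (rule schur_multiplier_rank_one[OF complete sm _ _ \<phi>k L(3,4,1,2)]) (use kb in auto)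
    then show ?thesis using weighted_pairing[of "\<lambda>z. complex_of_real (k z)"] m by simp
  qed
  have sqrt_w_eq: "sqrt_w = times_sqrt_w (\<lambda>_. 1)" by (simp add: times_sqrt_w_def fun_eq_iff)
  have bL: "times_sqrt_w (\<lambda>x. complex_of_real (p x)) \<in> L2_space M" if p: "p \<in> bounded_fun N" for p
  proof -
    obtain c where "\<And>x. \<bar>p x\<bar> \<le> c" using p by (auto simp: bounded_fun_def)
    then show ?thesis using bounded_fun_measurable[OF p] by (intro times_sqrt_w_L2[where C = c]) auto
  qed
  have int: "integrable (N \<Otimes>\<^sub>M N) (\<lambda>z. k z * p (fst z) * q (snd z))" if "p \<in> bounded_fun N" "q \<in> bounded_fun N" for p q
    by (rule N.integrable_bounded_kernel[OF _ kb that]) (simp add: measurable_NN)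
  \<comment> \<open>The image of the positive operator \<open>rank_one M sqrt_w sqrt_w\<close> is positive; real and imaginary part of its
    form at \<open>p + \<i> q\<close> give positivity and symmetry of the kernel.\<close>
  have pos: "kform N k p q = kform N k q p \<and> 0 \<le> kform N k p p + kform N k q q"
    if p: "p \<in> bounded_fun N" and q: "q \<in> bounded_fun N" for p q
  proof -
    note [measurable] = bounded_fun_measurable[OF p, simplified] bounded_fun_measurable[OF q, simplified]
    define h where "h x = complex_of_real (p x) + \<i> * complex_of_real (q x)" for x
    have [measurable]: "h \<in> borel_measurable M" unfolding h_def by measurable
    have "times_sqrt_w h = (\<lambda>x. times_sqrt_w (\<lambda>x. complex_of_real (p x)) x + \<i> * times_sqrt_w (\<lambda>x. complex_of_real (q x)) x)"
      by (auto simp: times_sqrt_w_def h_def algebra_simps)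
    then have hL: "times_sqrt_w h \<in> L2_space M" using L2_comb[OF bL[OF p] bL[OF q]] by simp
    have "positive_op M (T (rank_one M sqrt_w sqrt_w))"
      by (intro positive_map_if_completely_positive[OF cp] rank_one_bounded sqrt_w_L2 rank_one_positive)
    then have "l2_inner M (T (rank_one M sqrt_w sqrt_w) (times_sqrt_w h)) (times_sqrt_w h) \<in> \<real>\<^sub>\<ge>\<^sub>0"
      using hL by (simp add: positive_op_def)
    then have nn: "(\<integral>z. complex_of_real (k z) * cnj (h (fst z)) * h (snd z) \<partial>(N \<Otimes>\<^sub>M N)) \<in> \<real>\<^sub>\<ge>\<^sub>0"
      using pairk[of h h "\<lambda>_. 1" "\<lambda>_. 1"] hL sqrt_w_L2 by (simp add: sqrt_w_eq[symmetric])
    have "(\<lambda>z. complex_of_real (k z) * cnj (h (fst z)) * h (snd z))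
      = (\<lambda>z. complex_of_real (k z * p (fst z) * p (snd z) + k z * q (fst z) * q (snd z))
          + \<i> * complex_of_real (k z * p (fst z) * q (snd z) - k z * q (fst z) * p (snd z)))"
      by (rule ext, rule complex_eqI) (simp_all add: h_def algebra_simps)
    then have "(\<integral>z. complex_of_real (k z) * cnj (h (fst z)) * h (snd z) \<partial>(N \<Otimes>\<^sub>M N))
      = (\<integral>z. complex_of_real (k z * p (fst z) * p (snd z) + k z * q (fst z) * q (snd z))
          + \<i> * complex_of_real (k z * p (fst z) * q (snd z) - k z * q (fst z) * p (snd z)) \<partial>(N \<Otimes>\<^sub>M N))"
      by simp
    also have "\<dots> = complex_of_real (\<integral>z. k z * p (fst z) * p (snd z) + k z * q (fst z) * q (snd z) \<partial>(N \<Otimes>\<^sub>M N))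
          + \<i> * complex_of_real (\<integral>z. k z * p (fst z) * q (snd z) - k z * q (fst z) * p (snd z) \<partial>(N \<Otimes>\<^sub>M N))"
      unfolding integral_complex_of_real[symmetric] integral_mult_right_zero[symmetric]
      by (rule Bochner_Integration.integral_add)
        (intro integrable_mult_right integrable_of_real Bochner_Integration.integrable_add
          Bochner_Integration.integrable_diff int p q)+
    finally show ?thesis
      using nonneg_Reals_D[OF nn] int[OF p p] int[OF q q] int[OF p q] int[OF q p]
      by (simp add: kform_def)
  qed
  have psd: "psd_kernel N k"
    unfolding psd_kernel_def
  proof (intro conjI ballI)
    show "k \<in> borel_measurable (N \<Otimes>\<^sub>M N)" by (simp add: measurable_NN)
    show "\<exists>c. \<forall>z. \<bar>k z\<bar> \<le> c" using kb by blast
    show "kform N k p q = kform N k q p" if "p \<in> bounded_fun N" "q \<in> bounded_fun N" for p q using pos[OF that] by simp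
    show "0 \<le> kform N k p p" if "p \<in> bounded_fun N" for p using pos[OF that that] by simp
  qed
  \<comment> \<open>The projection onto the line of \<open>a = \<surd>w 1\<^sub>A\<close> is below the identity, hence so is its image under
    \<open>T\<close>; the value of the image in the state of \<open>a\<close> is the average of the kernel over \<open>A \<times> A\<close>.\<close>
  have avg: "kform N k (indicator A) (indicator A) \<le> (measure N A)\<^sup>2" if "A \<in> sets N" for A
  proof -
    have A[measurable]: "A \<in> sets M" using that by simp
    define a where "a = times_sqrt_w (indicator A)"
    have a: "a \<in> L2_space M" unfolding a_def by (rule times_sqrt_w_indicator_L2[OF A])
    have na: "(l2_norm M a)\<^sup>2 = measure N A"
    proof -
      have "(l2_norm M a)\<^sup>2 = (\<integral>x. w x * indicator A x \<partial>M)"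
        unfolding l2_norm_square a_def times_sqrt_w_def sqrt_w_def
        using w_pos by (intro Bochner_Integration.integral_cong refl)
          (auto simp: less_imp_le split: split_indicator)
      also have "\<dots> = (\<integral>x. indicator A x \<partial>N)"
        unfolding N_def using w_pos by (subst integral_density) (auto simp: less_imp_le)
      finally show ?thesis using that by simp
    qed
    have X: "l2_inner M (T (rank_one M a a) a) a = complex_of_real (kform N k (indicator A) (indicator A))"
    proof -
      have "l2_inner M (T (rank_one M a a) a) a = (\<integral>z. complex_of_real (k z) * (indicator A (fst z) * cnj (indicator A (fst z))) * (indicator A (snd z) * cnj (indicator A (snd z))) \<partial>(N \<Otimes>\<^sub>M N))"
        unfolding a_def by (rule pairk) (use A times_sqrt_w_indicator_L2 in auto)
      also have "\<dots> = (\<integral>z. complex_of_real (k z * indicator A (fst z) * indicator A (snd z)) \<partial>(N \<Otimes>\<^sub>M N))"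
        by (intro Bochner_Integration.integral_cong refl) (auto split: split_indicator)
      finally show ?thesis by (simp only: integral_complex_of_real kform_def)
    qed
    show ?thesis
    proof (cases "l2_norm M a = 0")
      case True
      have "norm (l2_inner M (T (rank_one M a a) a) a) \<le> l2_norm M (T (rank_one M a a) a) * l2_norm M a"
        by (rule l2_Cauchy_Schwarz[OF bop_L2[OF Tb[OF rank_one_bounded[OF a a]] a] a])
      then show ?thesis using True X by simp
    next
      case False
      define s where "s = 1 / (l2_norm M a)\<^sup>2"
      have s: "0 < s" "s * (l2_norm M a)\<^sup>2 = 1" using False by (auto simp: s_def)
      let ?B = "\<lambda>f x. id f x + (- complex_of_real s) * rank_one M a a f x"
      have B: "?B \<in> bounded_ops M" by (rule bounded_op_comb[OF id_bounded_op rank_one_bounded[OF a a]])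
      have "positive_op M ?B"
        unfolding positive_op_def
      proof
        fix f assume f: "f \<in> L2_space M"
        have "l2_inner M (?B f) f = complex_of_real ((l2_norm M f)\<^sup>2 - s * (norm (l2_inner M f a))\<^sup>2)"
        proof -
          have "l2_inner M (?B f) f = l2_inner M f f + (- complex_of_real s) * l2_inner M (rank_one M a a f) f"
            using l2_inner_comb_left[OF f rank_one_L2[OF a, of a f] f, of "- complex_of_real s"]
            by (simp only: id_apply)
          also have "l2_inner M (rank_one M a a f) f = complex_of_real ((norm (l2_inner M f a))\<^sup>2)"
            by (rule rank_one_inner_self)
          finally show ?thesis by (simp add: l2_inner_self)
        qed
        moreover have "s * (norm (l2_inner M f a))\<^sup>2 \<le> s * (l2_norm M f * l2_norm M a)\<^sup>2"
          using s(1) by (intro mult_left_mono power_mono l2_Cauchy_Schwarz f a) auto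
        moreover have "s * (l2_norm M f * l2_norm M a)\<^sup>2 = (l2_norm M f)\<^sup>2"
          using s(2) by (simp add: power_mult_distrib mult.left_commute)
        ultimately show "l2_inner M (?B f) f \<in> \<real>\<^sub>\<ge>\<^sub>0" by (simp add: complex_nonneg_Reals_iff)
      qed
      then have "l2_inner M (T ?B a) a \<in> \<real>\<^sub>\<ge>\<^sub>0"
        using positive_map_if_completely_positive[OF cp B] a by (simp add: positive_op_def)
      moreover have "l2_inner M (T ?B a) a = l2_inner M a a + (- complex_of_real s) * l2_inner M (T (rank_one M a a) a) a"
        using multiplier_linear[OF Tlin id_bounded_op rank_one_bounded[OF a a] a a, of "- complex_of_real s"]
        unfolding unital_at[OF un Tb[OF id_bounded_op] a a] .
      ultimately have "s * kform N k (indicator A) (indicator A) \<le> (l2_norm M a)\<^sup>2"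
        unfolding X l2_inner_self by (simp add: complex_nonneg_Reals_iff)
      then have "kform N k (indicator A) (indicator A) \<le> (l2_norm M a)\<^sup>2 * (l2_norm M a)\<^sup>2"
        unfolding s_def using False by (simp add: field_simps)
      then show ?thesis unfolding na by (simp add: power2_eq_square)
    qed
  qed
  obtain \<beta> :: "'a \<Rightarrow> nat ell2" where \<beta>': "\<beta> \<in> borel_measurable N" and \<beta>1: "\<And>x. norm (\<beta> x) \<le> 1"
    and k\<beta>: "AE z in N \<Otimes>\<^sub>M N. k z = inner (\<beta> (fst z)) (\<beta> (snd z))"
    using N.kernel_factorisation[OF psd avg] by blast
  have \<beta>[measurable]: "\<beta> \<in> borel_measurable M" using \<beta>' by simp
  have \<phi>\<beta>: "AE z in M \<Otimes>\<^sub>M M. \<phi> z = complex_of_real (inner (\<beta> (fst z)) (\<beta> (snd z)))"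
    using \<phi>k k\<beta>[unfolded AE_NN] by eventually_elim simp
  have \<beta>b: "\<bar>inner (\<beta> x) (\<beta> y)\<bar> \<le> 1 * 1" for x y
    by (rule order_trans[OF Cauchy_Schwarz_ineq2], rule mult_mono) (use \<beta>1 in auto)
  \<comment> \<open>The Gram vectors have length at most one; weak* continuity at the identity makes them unit vectors.\<close>
  have int2: "integrable M (\<lambda>x. (norm (\<beta> x))\<^sup>2 * w x)"
  proof (rule integrable_bounded_mult[OF w_integrable])
    show "AE x in M. norm ((norm (\<beta> x))\<^sup>2) \<le> 1" using \<beta>1 by (intro AE_I2) (simp add: power_le_one)
  qed measurable
  have upper: "Re (l2_inner M (T (onb_proj F) sqrt_w) sqrt_w) \<le> (\<integral>x. (norm (\<beta> x))\<^sup>2 * w x \<partial>M)"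
    if F: "finite F" "F \<subseteq> some_onb M" for F
  proof -
    have eL: "e \<in> L2_space M" if "e \<in> F" for e using F that some_onb_L2[of e M] by auto
    have TF: "l2_inner M (T (onb_proj F) sqrt_w) sqrt_w = (\<Sum>e\<in>F. l2_inner M (T (rank_one M e e) sqrt_w) sqrt_w)"
      unfolding onb_proj_def by (rule multiplier_sum[OF Tlin sqrt_w_L2 sqrt_w_L2 F(1)]) (intro rank_one_bounded eL)
    have "(\<lambda>m. \<Sum>k<m. l2_inner M (coord \<beta> k e) sqrt_w * l2_inner M sqrt_w (coord \<beta> k e))
        \<longlonglongrightarrow> l2_inner M (T (rank_one M e e) sqrt_w) sqrt_w" if e: "e \<in> F" for e
    proof -
      have "l2_inner M (T (rank_one M e e) sqrt_w) sqrt_w = (\<integral>z. complex_of_real (inner (\<beta> (fst z)) (\<beta> (snd z)))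
          * ((e (fst z) * cnj (sqrt_w (fst z))) * (sqrt_w (snd z) * cnj (e (snd z)))) \<partial>(M \<Otimes>\<^sub>M M))"
        by (rule schur_multiplier_rank_one[OF complete sm _ _ \<phi>\<beta> eL[OF e] eL[OF e] sqrt_w_L2 sqrt_w_L2, of 1])
          (use \<beta>b in auto)
      then show ?thesis using factor_expansion[OF \<beta> \<beta>1 eL[OF e] eL[OF e] sqrt_w_L2 sqrt_w_L2] by simp
    qed
    then have "(\<lambda>m. Re (\<Sum>e\<in>F. \<Sum>k<m. l2_inner M (coord \<beta> k e) sqrt_w * l2_inner M sqrt_w (coord \<beta> k e)))
        \<longlonglongrightarrow> Re (l2_inner M (T (onb_proj F) sqrt_w) sqrt_w)"
      unfolding TF by (intro tendsto_Re tendsto_sum)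
    then show ?thesis
    proof (rule LIMSEQ_le_const2, intro exI allI impI)
      fix m :: nat
      have sw: "l2_inner M (coord \<beta> k e) sqrt_w = l2_inner M e (coord \<beta> k sqrt_w)" for k e
        unfolding l2_inner_def coord_def by (intro Bochner_Integration.integral_cong) auto
      have "l2_inner M (coord \<beta> k e) sqrt_w * l2_inner M sqrt_w (coord \<beta> k e)
          = complex_of_real ((norm (l2_inner M (coord \<beta> k sqrt_w) e))\<^sup>2)" for k e
        unfolding l2_inner_commute[of M sqrt_w "coord \<beta> k e"] sw l2_inner_commute[of M e "coord \<beta> k sqrt_w"]
        by (simp only: complex_norm_square complex_cnj_cnj mult.commute)
      then have "Re (\<Sum>e\<in>F. \<Sum>k<m. l2_inner M (coord \<beta> k e) sqrt_w * l2_inner M sqrt_w (coord \<beta> k e))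
          = (\<Sum>k<m. \<Sum>e\<in>F. (norm (l2_inner M (coord \<beta> k sqrt_w) e))\<^sup>2)"
        by (simp add: sum.swap[of _ F])
      also have "\<dots> \<le> (\<Sum>k<m. (l2_norm M (coord \<beta> k sqrt_w))\<^sup>2)"
        by (intro sum_mono onb_Bessel[OF F] coord_L2[OF \<beta> \<beta>1] sqrt_w_L2)
      also have "\<dots> = (\<Sum>k<m. \<integral>x. (ell2_nth (\<beta> x) k)\<^sup>2 * w x \<partial>M)"
        unfolding l2_norm_square coord_def sqrt_w_def using w_pos
        by (intro sum.cong Bochner_Integration.integral_cong refl)
          (simp add: norm_mult power_mult_distrib less_imp_le)
      also have "\<dots> = (\<integral>x. (\<Sum>k<m. (ell2_nth (\<beta> x) k)\<^sup>2 * w x) \<partial>M)"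
      proof (rule Bochner_Integration.integral_sum[symmetric])
        fix k
        show "integrable M (\<lambda>x. (ell2_nth (\<beta> x) k)\<^sup>2 * w x)"
        proof (rule integrable_bounded_mult[OF w_integrable])
          show "AE x in M. norm ((ell2_nth (\<beta> x) k)\<^sup>2) \<le> 1"
            using order_trans[OF norm_ell2_nth_le \<beta>1] by (intro AE_I2) (simp add: abs_square_le_1)
        qed measurable
      qed
      also have "\<dots> \<le> (\<integral>x. (norm (\<beta> x))\<^sup>2 * w x \<partial>M)"
        unfolding sum_distrib_right[symmetric]
      proof (rule integral_mono[OF _ int2])
        show "(\<Sum>k<m. (ell2_nth (\<beta> x) k)\<^sup>2) * w x \<le> (norm (\<beta> x))\<^sup>2 * w x" for x
          using w_pos[of x] by (intro mult_right_mono sum_le_ell2_norm) auto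
        show "integrable M (\<lambda>x. (\<Sum>k<m. (ell2_nth (\<beta> x) k)\<^sup>2) * w x)"
        proof (rule integrable_bounded_mult[OF w_integrable])
          show "AE x in M. norm (\<Sum>k<m. (ell2_nth (\<beta> x) k)\<^sup>2) \<le> 1"
            using order_trans[OF sum_le_ell2_norm[OF finite_lessThan] power_le_one[OF norm_ge_zero \<beta>1]]
            by (intro AE_I2) (simp add: abs_of_nonneg sum_nonneg)
        qed measurable
      qed
      finally show "Re (\<Sum>e\<in>F. \<Sum>k<m. l2_inner M (coord \<beta> k e) sqrt_w * l2_inner M sqrt_w (coord \<beta> k e))
        \<le> (\<integral>x. (norm (\<beta> x))\<^sup>2 * w x \<partial>M)" .
    qed
  qed
  have "Re (l2_inner M (T id sqrt_w) sqrt_w) \<le> (\<integral>x. (norm (\<beta> x))\<^sup>2 * w x \<partial>M)"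
  proof (rule tendsto_upperbound)
    show "((\<lambda>F. Re (l2_inner M (T (onb_proj F) sqrt_w) sqrt_w)) \<longlongrightarrow> Re (l2_inner M (T id sqrt_w) sqrt_w)) (finite_subsets_at_top (some_onb M))"
      by (rule tendsto_Re[OF weak_star_continuous_at_id[OF wc Tb sqrt_w_L2]])
    show "\<forall>\<^sub>F F in finite_subsets_at_top (some_onb M). Re (l2_inner M (T (onb_proj F) sqrt_w) sqrt_w) \<le> (\<integral>x. (norm (\<beta> x))\<^sup>2 * w x \<partial>M)"
      by (intro eventually_finite_subsets_at_top_weakI upper)
  qed simp
  also have "Re (l2_inner M (T id sqrt_w) sqrt_w) = (\<integral>x. w x \<partial>M)"
  proof -
    have "(norm (sqrt_w x))\<^sup>2 = w x" for x using w_pos[of x] by (simp add: sqrt_w_def)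
    then show ?thesis
      unfolding unital_at[OF un Tb[OF id_bounded_op] sqrt_w_L2 sqrt_w_L2] l2_inner_self l2_norm_square by simp
  qed
  finally have le: "(\<integral>x. w x - (norm (\<beta> x))\<^sup>2 * w x \<partial>M) \<le> 0" using w_integrable int2 by simp
  have nn: "0 \<le> w x - (norm (\<beta> x))\<^sup>2 * w x" for x
    using mult_right_mono[OF power_le_one[OF norm_ge_zero \<beta>1, of x 2] less_imp_le[OF w_pos[of x]]] by simp
  have ge: "0 \<le> (\<integral>x. w x - (norm (\<beta> x))\<^sup>2 * w x \<partial>M)"
    by (rule Bochner_Integration.integral_nonneg_AE) (use nn in auto)
  have "AE x in M. w x - (norm (\<beta> x))\<^sup>2 * w x = 0"
    using le ge nn w_integrable int2
    by (subst integral_nonneg_eq_0_iff_AE[symmetric]) auto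
  then have unit: "AE x in M. norm (\<beta> x) = 1"
  proof eventually_elim
    case (elim x)
    then have "w x * 1 = w x * (norm (\<beta> x))\<^sup>2" by (simp add: mult.commute)
    then have "(norm (\<beta> x))\<^sup>2 = 1" using w_pos[of x] by simp
    then show ?case using norm_ge_zero[of "\<beta> x"] by (simp add: power2_eq_1_iff)
  qed
  show thesis by (rule that[OF \<beta> \<beta>1 unit \<phi>\<beta>])
qed

end

section \<open>The semigroup law for the symbols\<close>

lemma op_norm_le:
  assumes "0 \<le> C" "\<And>f. f \<in> L2_space M \<Longrightarrow> l2_norm M (A f) \<le> C * l2_norm M f"
  shows "op_norm M A \<le> C"
  unfolding op_norm_def using assms by (intro cInf_lower bdd_belowI[of _ 0]) auto

lemma op_norm_bound:
  assumes A: "A \<in> bounded_ops M" and f: "f \<in> L2_space M"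
  shows "l2_norm M (A f) \<le> op_norm M A * l2_norm M f" and "0 \<le> op_norm M A"
proof -
  let ?S = "{C. 0 \<le> C \<and> (\<forall>f\<in>L2_space M. l2_norm M (A f) \<le> C * l2_norm M f)}"
  obtain C where C: "0 \<le> C" "\<And>f. f \<in> L2_space M \<Longrightarrow> l2_norm M (A f) \<le> C * l2_norm M f"
    using bop_bound[OF A] by blast
  then have ne: "?S \<noteq> {}" by blast
  show "0 \<le> op_norm M A" unfolding op_norm_def by (rule cInf_greatest[OF ne]) auto
  show "l2_norm M (A f) \<le> op_norm M A * l2_norm M f"
  proof (cases "l2_norm M f = 0")
    case True
    then show ?thesis using C(2)[OF f] by simp
  next
    case False
    then have p: "l2_norm M f > 0" using l2_norm_nonneg[of M f] by linarith
    have "l2_norm M (A f) / l2_norm M f \<le> op_norm M A"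
      unfolding op_norm_def by (rule cInf_greatest[OF ne]) (use f p in \<open>auto simp: field_simps\<close>)
    then show ?thesis using p by (simp add: field_simps)
  qed
qed

context weighted_measure
begin

lemma pairing_kernel:
  fixes \<beta> :: "'a \<Rightarrow> nat ell2"
  assumes sm: "schur_multiplier M \<phi> T"
    and \<beta>: "\<beta> \<in> borel_measurable M" "\<And>x. norm (\<beta> x) \<le> 1"
    and \<phi>: "AE z in M \<Otimes>\<^sub>M M. \<phi> z = complex_of_real (inner (\<beta> (fst z)) (\<beta> (snd z)))"
    and L: "a \<in> L2_space M" "b \<in> L2_space M" "c \<in> L2_space M" "d \<in> L2_space M"
  shows "l2_inner M (T (rank_one M a b) d) c
    = (\<integral>z. complex_of_real (inner (\<beta> (fst z)) (\<beta> (snd z)))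
        * ((a (fst z) * cnj (c (fst z))) * (d (snd z) * cnj (b (snd z)))) \<partial>(M \<Otimes>\<^sub>M M))"
proof (rule schur_multiplier_rank_one[OF complete sm _ _ \<phi> L])
  note [measurable] = \<beta>(1)
  show "(\<lambda>z. complex_of_real (inner (\<beta> (fst z)) (\<beta> (snd z)))) \<in> borel_measurable (M \<Otimes>\<^sub>M M)" by measurable
  show "norm (complex_of_real (inner (\<beta> (fst z)) (\<beta> (snd z)))) \<le> 1 * 1" for z
    unfolding norm_of_real by (rule order_trans[OF Cauchy_Schwarz_ineq2], rule mult_mono) (use \<beta> in auto)
qed

text \<open>
  A Markov multiplier applied to a rank one operator is a norm limit of finite rank operators: the
  partial sums over the coordinates of the Gram vectors.
\<close>

lemma rank_one_image_approximation:
  assumes sm: "schur_multiplier M \<phi> T"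
    and \<beta>: "\<beta> \<in> borel_measurable M" "\<And>x. norm (\<beta> x) \<le> 1"
    and \<phi>: "AE z in M \<Otimes>\<^sub>M M. \<phi> z = complex_of_real (inner (\<beta> (fst z)) (\<beta> (snd z)))"
    and a: "a \<in> L2_space M" and b: "b \<in> L2_space M"
  shows "(\<lambda>m. op_norm M (\<lambda>f x. T (rank_one M a b) f x + (-1) * (\<Sum>k<m. rank_one M (coord \<beta> k a) (coord \<beta> k b) f x))) \<longlonglongrightarrow> 0"
proof -
  interpret P: pair_sigma_finite M M by (rule pair_sf')
  define A where "A = T (rank_one M a b)"
  define S where "S m = (\<lambda>f x. \<Sum>k<m. rank_one M (coord \<beta> k a) (coord \<beta> k b) f x)" for m
  have ca: "coord \<beta> k a \<in> L2_space M" "coord \<beta> k b \<in> L2_space M" for k using coord_L2[OF \<beta>] a b by auto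
  have A: "A \<in> bounded_ops M"
    using sm rank_one_bounded[OF a b] unfolding A_def schur_multiplier_def bounded_linear_on_ops_def by blast
  have S: "S m \<in> bounded_ops M" for m unfolding S_def by (intro sum_bounded_op rank_one_bounded ca) auto
  define t where "t m x = complex_of_real (tail_norm m (\<beta> x))" for m x
  note [measurable] = \<beta>(1) L2_measurable[OF a] L2_measurable[OF b]
  have tm[measurable]: "t m \<in> borel_measurable M" for m unfolding t_def by measurable
  have t1: "norm (t m x) \<le> 1" for m x
    using tail_norm_bounds[of m "\<beta> x"] \<beta>(2)[of x] by (simp add: t_def)
  have tL: "(\<lambda>x. t m x * f x) \<in> L2_space M" if "f \<in> L2_space M" for m f
    by (rule L2_mult[OF that tm t1])
  define r where "r m = l2_norm M (\<lambda>x. t m x * b x)" for m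
  \<comment> \<open>The tail of one factor is bounded by one, that of the other tends to zero and is absorbed into \<open>b\<close>.\<close>
  have diff: "norm (l2_inner M (\<lambda>x. A d x + (-1) * S m d x) c) \<le> l2_norm M a * l2_norm M c * (r m * l2_norm M d)"
    if d: "d \<in> L2_space M" and c: "c \<in> L2_space M" for c d m
  proof -
    note [measurable] = L2_measurable[OF c] L2_measurable[OF d]
    let ?X = "\<lambda>z. (a (fst z) * cnj (c (fst z))) * (d (snd z) * cnj (b (snd z)))"
    let ?s = "\<lambda>z. \<Sum>k<m. ell2_nth (\<beta> (fst z)) k * ell2_nth (\<beta> (snd z)) k"
    have X: "integrable (M \<Otimes>\<^sub>M M) ?X"
      using L2_quadruple_integrable[OF a b c d, of "\<lambda>_. 1" 1] by simp
    have iA: "integrable (M \<Otimes>\<^sub>M M) (\<lambda>z. complex_of_real (inner (\<beta> (fst z)) (\<beta> (snd z))) * ?X z)"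
    proof (rule integrable_bounded_mult[OF X])
      show "AE z in M \<Otimes>\<^sub>M M. norm (complex_of_real (inner (\<beta> (fst z)) (\<beta> (snd z)))) \<le> 1 * 1"
        unfolding norm_of_real using \<beta>(2)
        by (intro AE_I2 order_trans[OF Cauchy_Schwarz_ineq2] mult_mono) auto
    qed measurable
    have iS: "integrable (M \<Otimes>\<^sub>M M) (\<lambda>z. complex_of_real (?s z) * ?X z)"
      using partial_inner_bound[OF \<beta>(2) \<beta>(2)]
      by (intro integrable_bounded_mult[OF X, of _ 1] AE_I2) (auto simp del: of_real_sum)
    have "l2_inner M (S m d) c = (\<integral>z. complex_of_real (?s z) * ?X z \<partial>(M \<Otimes>\<^sub>M M))"
    proof -
      have "l2_inner M (S m d) c = l2_inner M (\<lambda>x. \<Sum>k<m. l2_inner M d (coord \<beta> k b) * coord \<beta> k a x) c"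
        by (simp add: S_def rank_one_def mult.commute)
      also have "\<dots> = (\<Sum>k<m. l2_inner M d (coord \<beta> k b) * l2_inner M (coord \<beta> k a) c)"
        by (rule l2_inner_sum_left) (auto intro: ca c)
      also have "\<dots> = (\<Sum>k<m. \<integral>z. 1 * ((coord \<beta> k a (fst z) * cnj (c (fst z))) * (d (snd z) * cnj (coord \<beta> k b (snd z)))) \<partial>(M \<Otimes>\<^sub>M M))"
      proof (intro sum.cong refl)
        fix k
        have "(\<integral>z. (coord \<beta> k a (fst z) * cnj (c (fst z))) * (d (snd z) * cnj (coord \<beta> k b (snd z))) \<partial>(M \<Otimes>\<^sub>M M))
            = l2_inner M (coord \<beta> k a) c * l2_inner M d (coord \<beta> k b)"
          unfolding l2_inner_def
          by (rule P.product_integral_pair(2)[OF l2_inner_integrable[OF ca(1) c] l2_inner_integrable[OF d ca(2)]])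
        then show "l2_inner M d (coord \<beta> k b) * l2_inner M (coord \<beta> k a) c
          = (\<integral>z. 1 * ((coord \<beta> k a (fst z) * cnj (c (fst z))) * (d (snd z) * cnj (coord \<beta> k b (snd z)))) \<partial>(M \<Otimes>\<^sub>M M))"
          by (simp add: mult.commute)
      qed
      also have "\<dots> = (\<integral>z. complex_of_real (?s z) * ?X z \<partial>(M \<Otimes>\<^sub>M M))"
        using partial_kernel_integral(2)[OF \<beta> a b c d, of "\<lambda>_. 1" 1 m] by (simp del: of_real_sum)
      finally show ?thesis .
    qed
    moreover have "l2_inner M (A d) c = (\<integral>z. complex_of_real (inner (\<beta> (fst z)) (\<beta> (snd z))) * ?X z \<partial>(M \<Otimes>\<^sub>M M))"
      unfolding A_def by (rule pairing_kernel[OF sm \<beta> \<phi> a b c d])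
    ultimately have "l2_inner M (\<lambda>x. A d x + (-1) * S m d x) c
      = (\<integral>z. complex_of_real (inner (\<beta> (fst z)) (\<beta> (snd z))) * ?X z - complex_of_real (?s z) * ?X z \<partial>(M \<Otimes>\<^sub>M M))"
      using l2_inner_comb_left[OF bop_L2[OF A d] bop_L2[OF S[of m] d] c, of "-1"] iA iS by simp
    then have "norm (l2_inner M (\<lambda>x. A d x + (-1) * S m d x) c)
      \<le> (\<integral>z. norm (complex_of_real (inner (\<beta> (fst z)) (\<beta> (snd z))) * ?X z - complex_of_real (?s z) * ?X z) \<partial>(M \<Otimes>\<^sub>M M))"
      by (simp only: integral_norm_bound)
    also have "\<dots> \<le> (\<integral>z. (norm (a (fst z)) * norm (c (fst z))) * (norm (d (snd z)) * norm (t m (snd z) * b (snd z))) \<partial>(M \<Otimes>\<^sub>M M))"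
    proof (rule integral_mono)
      show "integrable (M \<Otimes>\<^sub>M M) (\<lambda>z. norm (complex_of_real (inner (\<beta> (fst z)) (\<beta> (snd z))) * ?X z - complex_of_real (?s z) * ?X z))"
        by (intro integrable_norm Bochner_Integration.integrable_diff iA iS)
      have "integrable (M \<Otimes>\<^sub>M M) (\<lambda>z. norm (a (fst z) * cnj (c (fst z))) * norm (d (snd z) * cnj (t m (snd z) * b (snd z))))"
        by (intro P.product_integral_pair(1) integrable_norm l2_inner_integrable a c d tL b)
      then show "integrable (M \<Otimes>\<^sub>M M) (\<lambda>z. (norm (a (fst z)) * norm (c (fst z))) * (norm (d (snd z)) * norm (t m (snd z) * b (snd z))))"
        by (simp add: norm_mult)
      fix z
      have "norm (complex_of_real (inner (\<beta> (fst z)) (\<beta> (snd z))) * ?X z - complex_of_real (?s z) * ?X z)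
          = \<bar>inner (\<beta> (fst z)) (\<beta> (snd z)) - ?s z\<bar> * norm (?X z)"
        by (simp only: left_diff_distrib[symmetric] of_real_diff[symmetric] norm_mult norm_of_real)
      also have "\<dots> \<le> (1 * norm (t m (snd z))) * norm (?X z)"
      proof (intro mult_right_mono norm_ge_zero order_trans[OF inner_minus_partial_le] mult_mono)
        show "tail_norm m (\<beta> (fst z)) \<le> 1" using tail_norm_bounds(2)[of m "\<beta> (fst z)"] \<beta>(2)[of "fst z"] by simp
        show "tail_norm m (\<beta> (snd z)) \<le> norm (t m (snd z))" by (simp add: t_def)
      qed (auto simp: tail_norm_bounds)
      finally show "norm (complex_of_real (inner (\<beta> (fst z)) (\<beta> (snd z))) * ?X z - complex_of_real (?s z) * ?X z)
        \<le> (norm (a (fst z)) * norm (c (fst z))) * (norm (d (snd z)) * norm (t m (snd z) * b (snd z)))"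
        by (simp add: norm_mult ac_simps)
    qed
    also have "\<dots> = (\<integral>x. norm (a x) * norm (c x) \<partial>M) * (\<integral>y. norm (d y) * norm (t m y * b y) \<partial>M)"
    proof (rule P.product_integral_pair(2))
      show "integrable M (\<lambda>x. norm (a x) * norm (c x))"
        using integrable_norm[OF l2_inner_integrable[OF a c]] by (simp add: norm_mult)
      show "integrable M (\<lambda>y. norm (d y) * norm (t m y * b y))"
        using integrable_norm[OF l2_inner_integrable[OF d tL[OF b]]] by (simp add: norm_mult)
    qed
    also have "\<dots> \<le> (l2_norm M a * l2_norm M c) * (l2_norm M d * r m)"
    proof (intro mult_mono)
      have n: "(\<integral>x. norm (f x) * norm (g x) \<partial>M) \<le> l2_norm M f * l2_norm M g" if f: "f \<in> L2_space M" and g: "g \<in> L2_space M" for f g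
      proof -
        have L: "(\<lambda>x. complex_of_real (norm (h x))) \<in> L2_space M" if "h \<in> L2_space M" for h
          using that by (auto simp: L2_space_def)
        have nn: "l2_norm M (\<lambda>x. complex_of_real (norm (h x))) = l2_norm M h" for h by (simp add: l2_norm_def)
        have "l2_inner M (\<lambda>x. complex_of_real (norm (f x))) (\<lambda>x. complex_of_real (norm (g x)))
           = complex_of_real (\<integral>x. norm (f x) * norm (g x) \<partial>M)"
          unfolding l2_inner_def by (simp flip: of_real_mult)
        then show ?thesis
          using l2_Cauchy_Schwarz[OF L[OF f] L[OF g]] unfolding nn by simp
      qed
      show "(\<integral>x. norm (a x) * norm (c x) \<partial>M) \<le> l2_norm M a * l2_norm M c" by (rule n[OF a c])
      show "(\<integral>y. norm (d y) * norm (t m y * b y) \<partial>M) \<le> l2_norm M d * r m"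
        unfolding r_def by (rule n[OF d tL[OF b]])
    qed (auto simp: mult_nonneg_nonneg integral_nonneg_AE)
    finally show ?thesis by (simp add: mult.commute)
  qed
  have le: "op_norm M (\<lambda>f x. A f x + (-1) * S m f x) \<le> l2_norm M a * r m" for m
  proof (rule op_norm_le)
    show "0 \<le> l2_norm M a * r m" by (simp add: r_def)
    fix d assume d: "d \<in> L2_space M"
    let ?g = "\<lambda>x. A d x + (-1) * S m d x"
    have g: "?g \<in> L2_space M" by (rule L2_comb[OF bop_L2[OF A d] bop_L2[OF S d]])
    have "(l2_norm M ?g)\<^sup>2 \<le> l2_norm M a * l2_norm M ?g * (r m * l2_norm M d)"
      using diff[OF d g, of m] unfolding l2_inner_self norm_of_real by simp
    then have "l2_norm M ?g * l2_norm M ?g \<le> l2_norm M ?g * (l2_norm M a * r m * l2_norm M d)"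
      by (simp add: power2_eq_square ac_simps)
    then show "l2_norm M ?g \<le> l2_norm M a * r m * l2_norm M d"
    proof (cases "l2_norm M ?g = 0")
      case True
      have "0 \<le> l2_norm M a * r m * l2_norm M d" by (simp add: r_def)
      then show ?thesis unfolding True .
    next
      case False
      then have "0 < l2_norm M ?g" using l2_norm_nonneg[of M ?g] by linarith
      with \<open>l2_norm M ?g * l2_norm M ?g \<le> _\<close> show ?thesis by (rule mult_left_le_imp_le)
    qed
  qed
  have "(\<lambda>m. \<integral>x. (norm (t m x * b x))\<^sup>2 \<partial>M) \<longlonglongrightarrow> (\<integral>x. 0 \<partial>M)"
  proof (rule integral_dominated_convergence[where w = "\<lambda>x. (norm (b x))\<^sup>2"])
    show "AE x in M. (\<lambda>m. (norm (t m x * b x))\<^sup>2) \<longlonglongrightarrow> 0"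
    proof (rule AE_I2)
      fix x
      have "(\<lambda>m. (norm (t m x * b x))\<^sup>2) \<longlonglongrightarrow> (norm (complex_of_real 0 * b x))\<^sup>2"
        unfolding t_def by (intro tendsto_intros tail_norm_tendsto)
      then show "(\<lambda>m. (norm (t m x * b x))\<^sup>2) \<longlonglongrightarrow> 0" by simp
    qed
    show "AE x in M. norm ((norm (t m x * b x))\<^sup>2) \<le> (norm (b x))\<^sup>2" for m
    proof (rule AE_I2)
      fix x
      have "norm (t m x * b x) \<le> 1 * norm (b x)" unfolding norm_mult by (intro mult_right_mono t1) simp
      then show "norm ((norm (t m x * b x))\<^sup>2) \<le> (norm (b x))\<^sup>2" by (simp add: power_mono)
    qed
  qed (use L2_integrable[OF b] in auto)
  then have "(\<lambda>m. sqrt (\<integral>x. (norm (t m x * b x))\<^sup>2 \<partial>M)) \<longlonglongrightarrow> sqrt 0"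
    by (intro tendsto_real_sqrt) simp
  then have "r \<longlonglongrightarrow> 0" by (simp add: r_def[abs_def] l2_norm_def)
  then have r0: "(\<lambda>m. l2_norm M a * r m) \<longlonglongrightarrow> 0" by (rule tendsto_mult_right_zero)
  have "(\<lambda>m. op_norm M (\<lambda>f x. A f x + (-1) * S m f x)) \<longlonglongrightarrow> 0"
  proof (rule tendsto_sandwich[OF _ _ tendsto_const r0])
    show "\<forall>\<^sub>F m in sequentially. 0 \<le> op_norm M (\<lambda>f x. A f x + (-1) * S m f x)"
      using op_norm_bound(2)[OF bounded_op_comb[OF A S] L2_zero] by (intro always_eventually allI)
    show "\<forall>\<^sub>F m in sequentially. op_norm M (\<lambda>f x. A f x + (-1) * S m f x) \<le> l2_norm M a * r m"
      by (intro always_eventually allI le)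
  qed
  then show ?thesis by (simp add: A_def S_def)
qed

text \<open>
  Kernels multiply under composition. The outer multiplier \<open>T'\<close> is given by a kernel on rank one
  operators only, and \<open>T (rank_one M a b)\<close> has infinite rank, so it is approximated in norm by finite rank
  operators, to which the boundedness of \<open>T'\<close> applies.
\<close>

lemma composition_kernel:
  fixes \<beta> \<gamma> :: "'a \<Rightarrow> nat ell2"
  assumes sm: "schur_multiplier M \<phi> T" "schur_multiplier M \<phi>' T'"
    and \<beta>: "\<beta> \<in> borel_measurable M" "\<And>x. norm (\<beta> x) \<le> 1"
    and \<phi>: "AE z in M \<Otimes>\<^sub>M M. \<phi> z = complex_of_real (inner (\<beta> (fst z)) (\<beta> (snd z)))"
    and \<gamma>: "\<gamma> \<in> borel_measurable M" "\<And>x. norm (\<gamma> x) \<le> 1"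
    and \<phi>': "AE z in M \<Otimes>\<^sub>M M. \<phi>' z = complex_of_real (inner (\<gamma> (fst z)) (\<gamma> (snd z)))"
    and a: "a \<in> L2_space M" and b: "b \<in> L2_space M" and c: "c \<in> L2_space M" and d: "d \<in> L2_space M"
  shows "l2_inner M (T' (T (rank_one M a b)) d) c
    = (\<integral>z. complex_of_real (inner (\<gamma> (fst z)) (\<gamma> (snd z))) * complex_of_real (inner (\<beta> (fst z)) (\<beta> (snd z)))
        * ((a (fst z) * cnj (c (fst z))) * (d (snd z) * cnj (b (snd z)))) \<partial>(M \<Otimes>\<^sub>M M))"
proof -
  note [measurable] = \<beta>(1) \<gamma>(1)
  let ?g = "\<lambda>z. complex_of_real (inner (\<gamma> (fst z)) (\<gamma> (snd z)))"
  let ?X = "\<lambda>z. (a (fst z) * cnj (c (fst z))) * (d (snd z) * cnj (b (snd z)))"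
  define A where "A = T (rank_one M a b)"
  define S where "S m = (\<lambda>f x. \<Sum>k<m. rank_one M (coord \<beta> k a) (coord \<beta> k b) f x)" for m
  define D where "D m = (\<lambda>f x. A f x + (-1) * S m f x)" for m
  have ca: "coord \<beta> k a \<in> L2_space M" "coord \<beta> k b \<in> L2_space M" for k using coord_L2[OF \<beta>] a b by auto
  have A: "A \<in> bounded_ops M"
    using sm(1) rank_one_bounded[OF a b] unfolding A_def schur_multiplier_def bounded_linear_on_ops_def by blast
  have S: "S m \<in> bounded_ops M" for m unfolding S_def by (intro sum_bounded_op rank_one_bounded ca) auto
  have D: "D m \<in> bounded_ops M" for m unfolding D_def by (rule bounded_op_comb[OF A S])
  have T': "bounded_linear_on_ops M (bounded_ops M) T'" using sm(2) by (simp add: schur_multiplier_def)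
  then obtain C where C: "\<And>A. A \<in> bounded_ops M \<Longrightarrow> op_norm M (T' A) \<le> C * op_norm M A"
    and T'b: "\<And>A. A \<in> bounded_ops M \<Longrightarrow> T' A \<in> bounded_ops M"
    unfolding bounded_linear_on_ops_def by blast
  have gm: "?g \<in> borel_measurable (M \<Otimes>\<^sub>M M)" by measurable
  have gb: "norm (?g z) \<le> 1 * 1" for z
    unfolding norm_of_real by (rule order_trans[OF Cauchy_Schwarz_ineq2], rule mult_mono) (use \<gamma> in auto)
  have TS: "l2_inner M (T' (S m) d) c
      = (\<integral>z. ?g z * complex_of_real (\<Sum>k<m. ell2_nth (\<beta> (fst z)) k * ell2_nth (\<beta> (snd z)) k) * ?X z \<partial>(M \<Otimes>\<^sub>M M))" for m
  proof -
    have "l2_inner M (T' (S m) d) c = (\<Sum>k<m. l2_inner M (T' (rank_one M (coord \<beta> k a) (coord \<beta> k b)) d) c)"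
      unfolding S_def by (rule multiplier_sum[OF T' d c]) (auto intro: rank_one_bounded ca)
    also have "\<dots> = (\<Sum>k<m. \<integral>z. ?g z * ((coord \<beta> k a (fst z) * cnj (c (fst z))) * (d (snd z) * cnj (coord \<beta> k b (snd z)))) \<partial>(M \<Otimes>\<^sub>M M))"
      by (intro sum.cong refl pairing_kernel[OF sm(2) \<gamma> \<phi>' ca(1) ca(2) c d])
    also have "\<dots> = (\<integral>z. ?g z * complex_of_real (\<Sum>k<m. ell2_nth (\<beta> (fst z)) k * ell2_nth (\<beta> (snd z)) k) * ?X z \<partial>(M \<Otimes>\<^sub>M M))"
      by (rule partial_kernel_integral(2)[OF \<beta> a b c d gm gb, symmetric])
    finally show ?thesis .
  qed
  have lim1: "(\<lambda>m. l2_inner M (T' (S m) d) c) \<longlonglongrightarrow> (\<integral>z. ?g z * complex_of_real (inner (\<beta> (fst z)) (\<beta> (snd z))) * ?X z \<partial>(M \<Otimes>\<^sub>M M))"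
    unfolding TS by (rule partial_kernel_integral(1)[OF \<beta> a b c d gm gb])
  have "(\<lambda>m. l2_inner M (T' A d) c - l2_inner M (T' (S m) d) c) \<longlonglongrightarrow> 0"
  proof (rule Lim_null_comparison)
    have "(\<lambda>m. op_norm M (D m)) \<longlonglongrightarrow> 0"
      unfolding D_def A_def S_def by (rule rank_one_image_approximation[OF sm(1) \<beta> \<phi> a b])
    then show "(\<lambda>m. C * op_norm M (D m) * l2_norm M d * l2_norm M c) \<longlonglongrightarrow> 0"
      by (intro tendsto_mult_left_zero tendsto_mult_right_zero)
    show "\<forall>\<^sub>F m in sequentially. norm (l2_inner M (T' A d) c - l2_inner M (T' (S m) d) c)
        \<le> C * op_norm M (D m) * l2_norm M d * l2_norm M c"
    proof (intro always_eventually allI)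
      fix m
      have "l2_inner M (T' A d) c - l2_inner M (T' (S m) d) c = l2_inner M (T' (D m) d) c"
        using multiplier_linear[OF T' A S[of m] d c, of "-1"] by (simp add: D_def)
      also have "norm \<dots> \<le> l2_norm M (T' (D m) d) * l2_norm M c"
        by (rule l2_Cauchy_Schwarz[OF bop_L2[OF T'b[OF D] d] c])
      also have "\<dots> \<le> (C * op_norm M (D m) * l2_norm M d) * l2_norm M c"
        by (intro mult_right_mono l2_norm_nonneg order_trans[OF op_norm_bound(1)[OF T'b[OF D] d]] C D)
      finally show "norm (l2_inner M (T' A d) c - l2_inner M (T' (S m) d) c)
        \<le> C * op_norm M (D m) * l2_norm M d * l2_norm M c" .
    qed
  qed
  then have "(\<lambda>m. l2_inner M (T' (S m) d) c) \<longlonglongrightarrow> l2_inner M (T' A d) c"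
    using tendsto_diff[OF tendsto_const[of "l2_inner M (T' A d) c"]] by fastforce
  then show ?thesis unfolding A_def using LIMSEQ_unique[OF lim1] by simp
qed

text \<open>
  The factorisations of the individual multipliers, related by the semigroup law. Continuity in time
  survives in integrated form, as the pairing of the rank one operator of \<open>\<surd>w\<close> with itself.
\<close>

theorem markov_semigroup_kernels:
  assumes sg: "markov_schur_semigroup M T \<phi>"
  obtains \<beta> :: "real \<Rightarrow> 'a \<Rightarrow> nat ell2" where "\<And>t. 0 \<le> t \<Longrightarrow> \<beta> t \<in> borel_measurable M" "\<And>t x. 0 \<le> t \<Longrightarrow> norm (\<beta> t x) \<le> 1"
    "\<And>t. 0 \<le> t \<Longrightarrow> AE x in M. norm (\<beta> t x) = 1"
    "\<And>t. 0 \<le> t \<Longrightarrow> AE z in M \<Otimes>\<^sub>M M. \<phi> t z = complex_of_real (inner (\<beta> t (fst z)) (\<beta> t (snd z)))"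
    "\<And>s t. 0 \<le> s \<Longrightarrow> 0 \<le> t \<Longrightarrow> AE z in M \<Otimes>\<^sub>M M. inner (\<beta> (s + t) (fst z)) (\<beta> (s + t) (snd z))
        = inner (\<beta> s (fst z)) (\<beta> s (snd z)) * inner (\<beta> t (fst z)) (\<beta> t (snd z))"
    "AE z in M \<Otimes>\<^sub>M M. inner (\<beta> 0 (fst z)) (\<beta> 0 (snd z)) = 1"
    "continuous_on {0..} (\<lambda>t. \<integral>z. inner (\<beta> t (fst z)) (\<beta> t (snd z)) \<partial>(N \<Otimes>\<^sub>M N))"
proof -
  have sm: "schur_multiplier M (\<phi> t) (T t)" and sa: "selfadjoint_map M (T t)" and un: "unital_map M (T t)"
    and cp: "completely_positive M (T t)" if "0 \<le> t" for t
    using sg that by (auto simp: markov_schur_semigroup_def)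
  have T0: "\<And>A. A \<in> bounded_ops M \<Longrightarrow> op_eq M (T 0 A) A"
    and Tst: "\<And>s t A. 0 \<le> s \<Longrightarrow> 0 \<le> t \<Longrightarrow> A \<in> bounded_ops M \<Longrightarrow> op_eq M (T (s + t) A) (T s (T t A))"
    and Tc: "\<And>A Y. A \<in> bounded_ops M \<Longrightarrow> Y \<in> trace_class_ops M \<Longrightarrow> continuous_on {0..} (\<lambda>t. trace_pairing M (T t A) Y)"
    using sg unfolding markov_schur_semigroup_def weak_star_semigroup_def by blast+
  have Tb: "T t A \<in> bounded_ops M" if "0 \<le> t" "A \<in> bounded_ops M" for t A
    using sm[OF that(1)] that(2) unfolding schur_multiplier_def bounded_linear_on_ops_def by blast
  have "\<exists>\<beta> :: 'a \<Rightarrow> nat ell2. \<beta> \<in> borel_measurable M \<and> (\<forall>x. norm (\<beta> x) \<le> 1) \<and> (AE x in M. norm (\<beta> x) = 1) \<and>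
    (AE z in M \<Otimes>\<^sub>M M. \<phi> t z = complex_of_real (inner (\<beta> (fst z)) (\<beta> (snd z))))" if "0 \<le> t" for t
    by (rule markov_multiplier_factorisation[OF sm[OF that] sa[OF that] un[OF that] cp[OF that]]) blast
  then have "\<forall>t. \<exists>\<beta> :: 'a \<Rightarrow> nat ell2. 0 \<le> t \<longrightarrow> \<beta> \<in> borel_measurable M \<and> (\<forall>x. norm (\<beta> x) \<le> 1) \<and> (AE x in M. norm (\<beta> x) = 1) \<and>
    (AE z in M \<Otimes>\<^sub>M M. \<phi> t z = complex_of_real (inner (\<beta> (fst z)) (\<beta> (snd z))))" by blast
  from choice[OF this] obtain \<beta> :: "real \<Rightarrow> 'a \<Rightarrow> nat ell2" where "\<forall>t. 0 \<le> t \<longrightarrow> \<beta> t \<in> borel_measurable M \<and> (\<forall>x. norm (\<beta> t x) \<le> 1) \<and> (AE x in M. norm (\<beta> t x) = 1) \<and>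
    (AE z in M \<Otimes>\<^sub>M M. \<phi> t z = complex_of_real (inner (\<beta> t (fst z)) (\<beta> t (snd z))))" ..
  then have \<beta>: "\<beta> t \<in> borel_measurable M" and \<beta>1: "norm (\<beta> t x) \<le> 1" and \<beta>n: "AE x in M. norm (\<beta> t x) = 1"
    and \<phi>\<beta>: "AE z in M \<Otimes>\<^sub>M M. \<phi> t z = complex_of_real (inner (\<beta> t (fst z)) (\<beta> t (snd z)))"
    if "0 \<le> t" for t x using that by simp_all
  define k where "k t z = complex_of_real (inner (\<beta> t (fst z)) (\<beta> t (snd z)))" for t z
  have km: "k t \<in> borel_measurable (M \<Otimes>\<^sub>M M)" if "0 \<le> t" for t
  proof -
    note [measurable] = \<beta>[OF that]
    show ?thesis unfolding k_def by measurable
  qed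
  have kb: "norm (k t z) \<le> 1" if "0 \<le> t" for t z
    unfolding k_def norm_of_real
    using order_trans[OF Cauchy_Schwarz_ineq2 mult_mono[OF \<beta>1 \<beta>1], of t t] that by simp
  have pk: "l2_inner M (T t (rank_one M a b) d) c
      = (\<integral>z. k t z * ((a (fst z) * cnj (c (fst z))) * (d (snd z) * cnj (b (snd z)))) \<partial>(M \<Otimes>\<^sub>M M))"
    if "0 \<le> t" "a \<in> L2_space M" "b \<in> L2_space M" "c \<in> L2_space M" "d \<in> L2_space M" for t a b c d
    unfolding k_def by (rule pairing_kernel[OF sm[OF that(1)] \<beta>[OF that(1)] \<beta>1[OF that(1)] \<phi>\<beta>[OF that(1)] that(2-)])
  have "AE z in M \<Otimes>\<^sub>M M. k (s + t) z = k s z * k t z" if s: "0 \<le> s" and t: "0 \<le> t" for s t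
  proof (rule AE_eq_if_pairings_eq)
    have st: "0 \<le> s + t" using s t by simp
    show "k (s + t) \<in> borel_measurable (M \<Otimes>\<^sub>M M)" "\<And>z. norm (k (s + t) z) \<le> 1" using km[OF st] kb[OF st] by auto
    show "(\<lambda>z. k s z * k t z) \<in> borel_measurable (M \<Otimes>\<^sub>M M)" using km[OF s] km[OF t] by measurable
    show "norm (k s z * k t z) \<le> 1 * 1" for z
      unfolding norm_mult by (intro mult_mono kb s t) auto
    fix a b assume a: "a \<in> L2_space M" and b: "b \<in> L2_space M"
    have R: "rank_one M a sqrt_w \<in> bounded_ops M" by (rule rank_one_bounded[OF a sqrt_w_L2])
    have "l2_inner M (T (s + t) (rank_one M a sqrt_w) b) sqrt_w = l2_inner M (T s (T t (rank_one M a sqrt_w)) b) sqrt_w"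
      by (rule l2_inner_cong_AE[OF _ bop_L2[OF Tb[OF st R] b] bop_L2[OF Tb[OF s Tb[OF t R]] b] sqrt_w_L2])
        (use Tst[OF s t R] b in \<open>simp add: op_eq_def\<close>)
    then show "(\<integral>z. k (s + t) z * ((a (fst z) * cnj (sqrt_w (fst z))) * (b (snd z) * cnj (sqrt_w (snd z)))) \<partial>(M \<Otimes>\<^sub>M M))
      = (\<integral>z. k s z * k t z * ((a (fst z) * cnj (sqrt_w (fst z))) * (b (snd z) * cnj (sqrt_w (snd z)))) \<partial>(M \<Otimes>\<^sub>M M))"
      unfolding pk[OF st a sqrt_w_L2 sqrt_w_L2 b]
        composition_kernel[OF sm[OF t] sm[OF s] \<beta>[OF t] \<beta>1[OF t] \<phi>\<beta>[OF t] \<beta>[OF s] \<beta>1[OF s] \<phi>\<beta>[OF s] a sqrt_w_L2 sqrt_w_L2 b]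
      by (simp add: k_def)
  qed
  then have 5: "AE z in M \<Otimes>\<^sub>M M. inner (\<beta> (s + t) (fst z)) (\<beta> (s + t) (snd z))
        = inner (\<beta> s (fst z)) (\<beta> s (snd z)) * inner (\<beta> t (fst z)) (\<beta> t (snd z))" if "0 \<le> s" "0 \<le> t" for s t
    using that unfolding k_def of_real_mult[symmetric] of_real_eq_iff by blast
  have "AE z in M \<Otimes>\<^sub>M M. k 0 z = 1"
  proof (rule AE_eq_if_pairings_eq)
    show "k 0 \<in> borel_measurable (M \<Otimes>\<^sub>M M)" "\<And>z. norm (k 0 z) \<le> 1" using km[of 0] kb[of 0] by auto
    fix a b assume a: "a \<in> L2_space M" and b: "b \<in> L2_space M"
    have R: "rank_one M a sqrt_w \<in> bounded_ops M" by (rule rank_one_bounded[OF a sqrt_w_L2])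
    have "l2_inner M (T 0 (rank_one M a sqrt_w) b) sqrt_w = l2_inner M (rank_one M a sqrt_w b) sqrt_w"
      by (rule l2_inner_cong_AE[OF _ bop_L2[OF Tb[OF order_refl R] b] bop_L2[OF R b] sqrt_w_L2])
        (use T0[OF R] b in \<open>simp add: op_eq_def\<close>)
    also have "\<dots> = l2_inner M a sqrt_w * l2_inner M b sqrt_w" by (simp add: rank_one_inner)
    also have "\<dots> = (\<integral>z. (a (fst z) * cnj (sqrt_w (fst z))) * (b (snd z) * cnj (sqrt_w (snd z))) \<partial>(M \<Otimes>\<^sub>M M))"
      unfolding l2_inner_def
      by (rule pair_sigma_finite.product_integral_pair(2)[OF pair_sf' l2_inner_integrable[OF a sqrt_w_L2] l2_inner_integrable[OF b sqrt_w_L2], symmetric])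
    finally show "(\<integral>z. k 0 z * ((a (fst z) * cnj (sqrt_w (fst z))) * (b (snd z) * cnj (sqrt_w (snd z)))) \<partial>(M \<Otimes>\<^sub>M M))
      = (\<integral>z. 1 * ((a (fst z) * cnj (sqrt_w (fst z))) * (b (snd z) * cnj (sqrt_w (snd z)))) \<partial>(M \<Otimes>\<^sub>M M))"
      unfolding pk[OF order_refl a sqrt_w_L2 sqrt_w_L2 b] by simp
  qed auto
  then have 6: "AE z in M \<Otimes>\<^sub>M M. inner (\<beta> 0 (fst z)) (\<beta> 0 (snd z)) = 1"
    by eventually_elim (simp add: k_def)
  have sqrt_w_eq: "sqrt_w = times_sqrt_w (\<lambda>_. 1)" by (simp add: times_sqrt_w_def fun_eq_iff)
  have R: "rank_one M sqrt_w sqrt_w \<in> bounded_ops M" by (rule rank_one_bounded[OF sqrt_w_L2 sqrt_w_L2])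
  have "trace_pairing M (T t (rank_one M sqrt_w sqrt_w)) (rank_one M sqrt_w sqrt_w) = complex_of_real (\<integral>z. inner (\<beta> t (fst z)) (\<beta> t (snd z)) \<partial>(N \<Otimes>\<^sub>M N))"
    if t: "0 \<le> t" for t
  proof -
    have "trace_pairing M (T t (rank_one M sqrt_w sqrt_w)) (rank_one M sqrt_w sqrt_w) = l2_inner M (T t (rank_one M sqrt_w sqrt_w) sqrt_w) sqrt_w"
      by (rule trace_pairing_rank_one[OF Tb[OF t R] sqrt_w_L2])
    also have "\<dots> = (\<integral>z. k t z \<partial>(N \<Otimes>\<^sub>M N))"
      unfolding pk[OF t sqrt_w_L2 sqrt_w_L2 sqrt_w_L2 sqrt_w_L2]
      using weighted_pairing[OF km[OF t], of "\<lambda>_. 1" "\<lambda>_. 1" "\<lambda>_. 1" "\<lambda>_. 1"]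
      by (simp add: sqrt_w_eq[symmetric])
    finally show ?thesis by (simp add: k_def)
  qed
  then have "continuous_on {0..} (\<lambda>t. complex_of_real (\<integral>z. inner (\<beta> t (fst z)) (\<beta> t (snd z)) \<partial>(N \<Otimes>\<^sub>M N)))"
    by (intro continuous_on_eq[OF Tc[OF R rank_one_trace_class[OF sqrt_w_L2]]]) simp
  from continuous_on_Re[OF this]
  have "continuous_on {0..} (\<lambda>t. \<integral>z. inner (\<beta> t (fst z)) (\<beta> t (snd z)) \<partial>(N \<Otimes>\<^sub>M N))" by simp
  with \<beta> \<beta>1 \<beta>n \<phi>\<beta> 5 6 show thesis by (rule that)
qed

end

section \<open>From the kernels to a map into a Hilbert space\<close>

lemma floor_average_tendsto:
  fixes t :: real
  shows "(\<lambda>n. real_of_int \<lfloor>t * real (Suc n)\<rfloor> / real (Suc n)) \<longlonglongrightarrow> t"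
proof (rule tendsto_sandwich[OF _ _ _ tendsto_const])
  have "(\<lambda>n. t - 1 / real (Suc n)) \<longlonglongrightarrow> t - 0"
    by (intro tendsto_diff tendsto_const LIMSEQ_Suc[OF lim_1_over_n])
  then show "(\<lambda>n. t - 1 / real (Suc n)) \<longlonglongrightarrow> t" by simp
  have "t - 1 / real (Suc n) \<le> real_of_int \<lfloor>t * real (Suc n)\<rfloor> / real (Suc n)" for n
  proof -
    have "t * real (Suc n) - 1 \<le> real_of_int \<lfloor>t * real (Suc n)\<rfloor>" by linarith
    then have "(t * real (Suc n) - 1) / real (Suc n) \<le> real_of_int \<lfloor>t * real (Suc n)\<rfloor> / real (Suc n)"
      by (intro divide_right_mono) auto
    then show ?thesis by (simp add: diff_divide_distrib)
  qed
  then show "\<forall>\<^sub>F n in sequentially. t - 1 / real (Suc n) \<le> real_of_int \<lfloor>t * real (Suc n)\<rfloor> / real (Suc n)"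
    by simp
  have "real_of_int \<lfloor>t * real (Suc n)\<rfloor> / real (Suc n) \<le> t" for n
    by (simp add: pos_divide_le_eq del: of_nat_Suc)
  then show "\<forall>\<^sub>F n in sequentially. real_of_int \<lfloor>t * real (Suc n)\<rfloor> / real (Suc n) \<le> t" by simp
qed

lemma log_as_limit:
  fixes a :: real
  assumes "0 < a"
  shows "(\<lambda>n. real (Suc n) * (exp (ln a / real (Suc n)) - 1)) \<longlonglongrightarrow> ln a"
proof (cases "ln a = 0")
  case False
  have "((\<lambda>h::real. (exp (0 + h) - exp 0) / h) \<longlongrightarrow> 1) (at 0)"
    using DERIV_exp[of 0] unfolding DERIV_def by simp
  moreover have "filterlim (\<lambda>n. ln a / real (Suc n)) (at 0) sequentially"
    unfolding filterlim_at
  proof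
    show "\<forall>\<^sub>F n in sequentially. ln a / real (Suc n) \<in> UNIV \<and> ln a / real (Suc n) \<noteq> 0" using False by simp
    have "(\<lambda>n. ln a * (1 / real (Suc n))) \<longlonglongrightarrow> 0"
      by (intro tendsto_mult_right_zero LIMSEQ_Suc[OF lim_1_over_n])
    then show "(\<lambda>n. ln a / real (Suc n)) \<longlonglongrightarrow> 0" by simp
  qed
  ultimately have "(\<lambda>n. (exp (0 + ln a / real (Suc n)) - exp 0) / (ln a / real (Suc n))) \<longlonglongrightarrow> 1"
    by (rule filterlim_compose)
  then have "(\<lambda>n. ln a * ((exp (0 + ln a / real (Suc n)) - exp 0) / (ln a / real (Suc n)))) \<longlonglongrightarrow> ln a * 1"
    by (intro tendsto_intros)
  then show ?thesis using False by (simp add: mult.commute del: of_nat_Suc)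
qed simp

lemma exp_scaled_le:
  assumes "0 < a" "a \<le> 1" "0 < (n::real)"
  shows "n * (2 - 2 * exp (ln a / n)) \<le> - 2 * ln a"
proof -
  have "1 + ln a / n \<le> exp (ln a / n)" by (rule exp_ge_add_one_self)
  then have "n * (1 - exp (ln a / n)) \<le> n * (- (ln a / n))" using assms by (intro mult_left_mono) linarith+
  then show ?thesis using assms by (simp add: algebra_simps)
qed

context sigma_finite_measure
begin

lemma AE_fst: assumes "AE x in M. P x" shows "AE z in M \<Otimes>\<^sub>M M. P (fst z)"
proof -
  obtain S where S: "{x \<in> space M. \<not> P x} \<subseteq> S" "S \<in> null_sets M" using assms by (auto simp: eventually_ae_filter)
  have "S \<times> space M \<in> null_sets (M \<Otimes>\<^sub>M M)" using S(2) by auto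
  then show ?thesis by (rule AE_I') (use S(1) in \<open>auto simp: space_pair_measure\<close>)
qed

lemma AE_snd: assumes "AE x in M. P x" shows "AE z in M \<Otimes>\<^sub>M M. P (snd z)"
proof -
  obtain S where S: "{x \<in> space M. \<not> P x} \<subseteq> S" "S \<in> null_sets M" using assms by (auto simp: eventually_ae_filter)
  have "space M \<times> S \<in> null_sets (M \<Otimes>\<^sub>M M)" using S(2) by auto
  then show ?thesis by (rule AE_I') (use S(1) in \<open>auto simp: space_pair_measure\<close>)
qed

end

text \<open>
  A multiplicative one-parameter family of Gram kernels of unit vectors. All identities hold almost
  everywhere with an exceptional set that depends on the times involved.
\<close>

locale kernel_semigroup = weighted_measure +
  fixes \<beta> :: "real \<Rightarrow> 'a \<Rightarrow> nat ell2"
  assumes \<beta>_meas: "0 \<le> t \<Longrightarrow> \<beta> t \<in> borel_measurable M"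
    and \<beta>_le: "0 \<le> t \<Longrightarrow> norm (\<beta> t x) \<le> 1"
    and \<beta>_unit: "0 \<le> t \<Longrightarrow> AE x in M. norm (\<beta> t x) = 1"
    and \<beta>_add: "0 \<le> s \<Longrightarrow> 0 \<le> t \<Longrightarrow> AE z in M \<Otimes>\<^sub>M M. inner (\<beta> (s + t) (fst z)) (\<beta> (s + t) (snd z))
        = inner (\<beta> s (fst z)) (\<beta> s (snd z)) * inner (\<beta> t (fst z)) (\<beta> t (snd z))"
    and \<beta>_zero: "AE z in M \<Otimes>\<^sub>M M. inner (\<beta> 0 (fst z)) (\<beta> 0 (snd z)) = 1"
    and \<beta>_cont: "continuous_on {0..} (\<lambda>t. \<integral>z. inner (\<beta> t (fst z)) (\<beta> t (snd z)) \<partial>(N \<Otimes>\<^sub>M N))"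
begin

definition k where "k t z = inner (\<beta> t (fst z)) (\<beta> t (snd z))"

lemma k_meas: "0 \<le> t \<Longrightarrow> k t \<in> borel_measurable (M \<Otimes>\<^sub>M M)"
proof -
  assume "0 \<le> t"
  note [measurable] = \<beta>_meas[OF this]
  show ?thesis unfolding k_def by measurable
qed

lemma k_le: "0 \<le> t \<Longrightarrow> \<bar>k t z\<bar> \<le> 1"
  unfolding k_def using order_trans[OF Cauchy_Schwarz_ineq2 mult_mono[OF \<beta>_le \<beta>_le], of t t] by simp

lemma k_add: "0 \<le> s \<Longrightarrow> 0 \<le> t \<Longrightarrow> AE z in M \<Otimes>\<^sub>M M. k (s + t) z = k s z * k t z"
  unfolding k_def by (rule \<beta>_add)

lemma k_nonneg:
  assumes "0 \<le> t" shows "AE z in M \<Otimes>\<^sub>M M. 0 \<le> k t z"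
  using k_add[of "t / 2" "t / 2"] assms by (auto elim!: eventually_mono)

lemma k_power:
  assumes t: "0 \<le> t" shows "AE z in M \<Otimes>\<^sub>M M. k (real m * t) z = k t z ^ m"
proof (induction m)
  case 0
  show ?case using \<beta>_zero by (simp add: k_def)
next
  case (Suc m)
  have "AE z in M \<Otimes>\<^sub>M M. k (real m * t + t) z = k (real m * t) z * k t z" using t by (intro k_add) auto
  with Suc show ?case by eventually_elim (simp add: algebra_simps)
qed

text \<open>
  For the countably many rational times the exceptional sets can be united.
\<close>

lemma k_rational: "AE z in M \<Otimes>\<^sub>M M. \<forall>n m. 0 \<le> k (1 / real (Suc n)) z \<and> k (real m / real (Suc n)) z = k (1 / real (Suc n)) z ^ m"
  unfolding AE_all_countable
proof (intro allI)
  fix n m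
  show "AE z in M \<Otimes>\<^sub>M M. 0 \<le> k (1 / real (Suc n)) z \<and> k (real m / real (Suc n)) z = k (1 / real (Suc n)) z ^ m"
    using k_nonneg[of "1 / real (Suc n)"] k_power[of "1 / real (Suc n)" m] by simp
qed

lemma k_rational': "AE z in M \<Otimes>\<^sub>M M. 0 \<le> k 1 z \<and> (\<forall>n. k 1 z = k (1 / real (Suc n)) z ^ Suc n) \<and>
    (0 < k 1 z \<longrightarrow> (\<forall>n m. k (real m / real (Suc n)) z = exp (real m / real (Suc n) * ln (k 1 z))))"
  using k_rational k_nonneg[of 1, simplified]
proof eventually_elim
  case (elim z)
  let ?r = "\<lambda>n. k (1 / real (Suc n)) z"
  have p: "k 1 z = ?r n ^ Suc n" for n
    using elim(1)[rule_format, of n "Suc n"] by (simp del: of_nat_Suc power_Suc)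
  have "k (real m / real (Suc n)) z = exp (real m / real (Suc n) * ln (k 1 z))" if pos: "0 < k 1 z" for n m
  proof -
    have r: "0 < ?r n"
      using elim(1)[rule_format, of n 0] p[of n] pos by (cases "?r n = 0") (auto simp del: of_nat_Suc)
    have "ln (k 1 z) = real (Suc n) * ln (?r n)"
      unfolding p[of n] using r by (simp only: ln_realpow)
    then have "exp (real m / real (Suc n) * ln (k 1 z)) = exp (real m * ln (?r n))" by (simp del: of_nat_Suc)
    also have "\<dots> = ?r n ^ m" using r by (simp add: exp_of_nat_mult)
    finally show ?thesis using elim(1)[rule_format, of n m] by simp
  qed
  with elim(2) p show ?case by blast
qed

text \<open>
  The kernel at time \<open>1/n\<close> is the \<open>n\<close>-th root of \<open>k 1\<close> and converges to the indicator of the set where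
  \<open>k 1\<close> is positive. Continuity at time zero says that the integral of this indicator is the total mass.
\<close>

lemma k_pos: "AE z in M \<Otimes>\<^sub>M M. 0 < k 1 z"
proof -
  interpret Q: finite_measure "N \<Otimes>\<^sub>M N" by (rule N.finite_square)
  have km[measurable]: "k t \<in> borel_measurable (N \<Otimes>\<^sub>M N)" if "0 \<le> t" for t
    using k_meas[OF that] by (simp add: measurable_NN)
  let ?I = "\<lambda>z. if 0 < k 1 z then 1 else 0 :: real"
  have [measurable]: "k 1 \<in> borel_measurable (N \<Otimes>\<^sub>M N)" by (rule km) simp
  have "(\<lambda>n. \<integral>z. k (1 / real (Suc n)) z \<partial>(N \<Otimes>\<^sub>M N)) \<longlonglongrightarrow> (\<integral>z. ?I z \<partial>(N \<Otimes>\<^sub>M N))"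
  proof (rule integral_dominated_convergence[where w = "\<lambda>_. 1"])
    show "AE z in N \<Otimes>\<^sub>M N. (\<lambda>n. k (1 / real (Suc n)) z) \<longlonglongrightarrow> ?I z"
      unfolding AE_NN using k_rational'
    proof eventually_elim
      case (elim z)
      show ?case
      proof (cases "0 < k 1 z")
        case True
        have "(\<lambda>n. exp (1 / real (Suc n) * ln (k 1 z))) \<longlonglongrightarrow> exp (0 * ln (k 1 z))"
          by (intro tendsto_intros LIMSEQ_Suc[OF lim_1_over_n])
        moreover have "k (1 / real (Suc n)) z = exp (1 / real (Suc n) * ln (k 1 z))" for n
          using elim True by (metis of_nat_1)
        ultimately show ?thesis using True by (simp del: of_nat_Suc)
      next
        case False
        then have "k 1 z = 0" using elim by simp
        then have "k (1 / real (Suc n)) z = 0" for n using elim by (metis power_eq_0_iff)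
        then show ?thesis using False by simp
      qed
    qed
    show "AE z in N \<Otimes>\<^sub>M N. norm (k (1 / real (Suc n)) z) \<le> 1" for n using k_le by (intro AE_I2) simp
    show "(\<lambda>z. k (1 / real (Suc n)) z) \<in> borel_measurable (N \<Otimes>\<^sub>M N)" for n by (rule km) simp
  qed auto
  moreover have "(\<lambda>n. \<integral>z. k (1 / real (Suc n)) z \<partial>(N \<Otimes>\<^sub>M N)) \<longlonglongrightarrow> (\<integral>z. k 0 z \<partial>(N \<Otimes>\<^sub>M N))"
    using continuous_on_tendsto_compose[OF \<beta>_cont LIMSEQ_Suc[OF lim_1_over_n]] by (simp add: k_def)
  ultimately have "(\<integral>z. ?I z \<partial>(N \<Otimes>\<^sub>M N)) = (\<integral>z. k 0 z \<partial>(N \<Otimes>\<^sub>M N))" by (rule LIMSEQ_unique)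
  also have "\<dots> = (\<integral>z. 1 \<partial>(N \<Otimes>\<^sub>M N))"
  proof (rule integral_cong_AE)
    show "k 0 \<in> borel_measurable (N \<Otimes>\<^sub>M N)" by (rule km) simp
  qed (use \<beta>_zero in \<open>auto simp: AE_NN k_def\<close>)
  finally have eq: "(\<integral>z. 1 - ?I z \<partial>(N \<Otimes>\<^sub>M N)) = 0"
    by (subst Bochner_Integration.integral_diff) (auto intro!: Q.integrable_const_bound[of _ 1])
  have "AE z in N \<Otimes>\<^sub>M N. 1 - ?I z = 0"
    using eq by (subst integral_nonneg_eq_0_iff_AE[symmetric]) (auto intro!: Q.integrable_const_bound[of _ 1])
  then show ?thesis unfolding AE_NN by eventually_elim (simp split: if_splits)
qed

text \<open>
  The kernels take values in \<open>[0, 1]\<close> and therefore decrease in \<open>t\<close>, so the values at rational times,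
  which are those of a continuous function, determine the value at \<open>t\<close>.
\<close>

lemma k_eq_exp:
  assumes t: "0 \<le> t" shows "AE z in M \<Otimes>\<^sub>M M. k t z = exp (t * ln (k 1 z))"
proof (cases "t = 0")
  case True
  then show ?thesis using \<beta>_zero by (simp add: k_def)
next
  case False
  have mono: "AE z in M \<Otimes>\<^sub>M M. k b z \<le> k a z" if "0 \<le> a" "a \<le> b" for a b
  proof -
    have "AE z in M \<Otimes>\<^sub>M M. k b z = k a z * k (b - a) z" using k_add[of a "b - a"] that by simp
    with k_nonneg[OF that(1)] show ?thesis
    proof eventually_elim
    case (elim z)
    have "k a z * k (b - a) z \<le> k a z * 1"
      using elim k_le[of "b - a" z] that by (intro mult_left_mono) auto
    then show ?case using elim by simp
    qed
  qed
  have "AE z in M \<Otimes>\<^sub>M M. \<forall>n m. (real m / real (Suc n) \<le> t \<longrightarrow> k t z \<le> k (real m / real (Suc n)) z) \<and>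
      (t \<le> real m / real (Suc n) \<longrightarrow> k (real m / real (Suc n)) z \<le> k t z)"
    unfolding AE_all_countable
  proof (intro allI)
    fix n m
    have p: "0 \<le> real m / real (Suc n)" by simp
    show "AE z in M \<Otimes>\<^sub>M M. (real m / real (Suc n) \<le> t \<longrightarrow> k t z \<le> k (real m / real (Suc n)) z) \<and>
      (t \<le> real m / real (Suc n) \<longrightarrow> k (real m / real (Suc n)) z \<le> k t z)"
      using mono[OF p, of t] mono[OF t, of "real m / real (Suc n)"]
      by (cases "real m / real (Suc n) \<le> t"; cases "t \<le> real m / real (Suc n)") simp_all
  qed
  then show ?thesis
    using k_pos k_rational'
  proof eventually_elim
    case (elim z)
    define m where "m n = nat \<lfloor>t * real (Suc n)\<rfloor>" for n
    have rm: "real (m n) = real_of_int \<lfloor>t * real (Suc n)\<rfloor>" for n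
      unfolding m_def using t by (simp del: of_nat_Suc)
    have l1: "(\<lambda>n. real (m n) / real (Suc n)) \<longlonglongrightarrow> t"
      unfolding rm by (rule floor_average_tendsto)
    have "(\<lambda>n. real (m n) / real (Suc n) + 1 / real (Suc n)) \<longlonglongrightarrow> t + 0"
      by (intro tendsto_add l1 LIMSEQ_Suc[OF lim_1_over_n])
    then have l2: "(\<lambda>n. real (Suc (m n)) / real (Suc n)) \<longlonglongrightarrow> t"
      by (simp add: add_divide_distrib add.commute)
    have k: "k (real m / real (Suc n)) z = exp (real m / real (Suc n) * ln (k 1 z))" for n m
      using elim(2,3) by blast
    have le1: "real (m n) / real (Suc n) \<le> t" for n
      unfolding rm by (simp add: pos_divide_le_eq del: of_nat_Suc)
    have le2: "t \<le> real (Suc (m n)) / real (Suc n)" for n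
    proof -
      have "t * real (Suc n) \<le> real (Suc (m n))" using rm[of n] by (simp del: of_nat_Suc add: of_nat_Suc[of "m n"]) linarith
      then show ?thesis by (simp add: pos_le_divide_eq del: of_nat_Suc)
    qed
    have "k t z \<le> exp (t * ln (k 1 z))"
    proof (rule LIMSEQ_le_const)
      show "(\<lambda>n. exp (real (m n) / real (Suc n) * ln (k 1 z))) \<longlonglongrightarrow> exp (t * ln (k 1 z))"
        by (intro tendsto_intros l1)
      show "\<exists>N. \<forall>n\<ge>N. k t z \<le> exp (real (m n) / real (Suc n) * ln (k 1 z))"
        using elim(1) le1 unfolding k[symmetric] by blast
    qed
    moreover have "exp (t * ln (k 1 z)) \<le> k t z"
    proof (rule LIMSEQ_le_const2)
      show "(\<lambda>n. exp (real (Suc (m n)) / real (Suc n) * ln (k 1 z))) \<longlonglongrightarrow> exp (t * ln (k 1 z))"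
        by (intro tendsto_intros l2)
      show "\<exists>N. \<forall>n\<ge>N. exp (real (Suc (m n)) / real (Suc n) * ln (k 1 z)) \<le> k t z"
        using elim(1) le2 unfolding k[symmetric] by blast
    qed
    ultimately show ?case by simp
  qed
qed

text \<open>
  Write \<open>b n\<close> for the Gram vectors at time \<open>1/(n+1)\<close>, where the kernel is \<open>exp (ln (k 1) / (n+1))\<close>. For a
  suitable base point \<open>y\<close> the vectors \<open>v n x = \<surd>(n+1) (b n x - b n y)\<close> satisfy
  \<open>|v n x|\<^sup>2 \<le> - 2 ln k\<^sub>1(y, x)\<close>, uniformly in \<open>n\<close>, and their Gram kernels converge to \<open>J\<close>, the kernel
  \<open>ln k\<^sub>1(x, x') - ln k\<^sub>1(y, x) - ln k\<^sub>1(y, x')\<close>. The vectors themselves need not converge, but the limit of the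
  kernels is again a Gram kernel, of a map \<open>\<alpha>\<close>. Once \<open>|\<alpha>\<^sub>x|\<^sup>2 = - 2 ln k\<^sub>1(y, x)\<close> is known, which is \<open>J\<close> on the
  diagonal, the terms with \<open>y\<close> cancel in the squared distance of \<open>\<alpha>\<^sub>x\<close> and \<open>\<alpha>\<^sub>x\<^sub>'\<close>, and
  \<open>- 2 ln k\<^sub>1(x, x')\<close> remains.
\<close>

theorem hilbert_embedding:
  obtains \<alpha> :: "'a \<Rightarrow> nat ell2" where "\<alpha> \<in> borel_measurable M"
    "AE z in M \<Otimes>\<^sub>M M. ln (k 1 z) = - (norm (\<alpha> (fst z) - \<alpha> (snd z)))\<^sup>2"
proof (cases "emeasure M (space M) = 0")
  case True
  then have "space M \<in> null_sets M" by auto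
  then have "space M \<times> space M \<in> null_sets (M \<Otimes>\<^sub>M M)" by auto
  then have "AE z in M \<Otimes>\<^sub>M M. ln (k 1 z) = - (norm (0 - (0 :: nat ell2)))\<^sup>2"
    by (rule AE_I') (auto simp: space_pair_measure)
  then show thesis by (intro that[of "\<lambda>_. 0"]) auto
next
  case False
  interpret P: pair_sigma_finite M M by (rule pair_sf')
  define b where "b n = \<beta> (1 / real (Suc n))" for n
  have b_meas[measurable]: "b n \<in> borel_measurable M" for n unfolding b_def by (rule \<beta>_meas) simp
  have b_le: "norm (b n x) \<le> 1" for n x unfolding b_def by (rule \<beta>_le) simp
  have b0: "b 0 = \<beta> 1" by (simp add: b_def)
  have b_unit: "AE x in M. \<forall>n. norm (b n x) = 1"
    unfolding AE_all_countable b_def by (intro allI \<beta>_unit) simp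
  let ?R = "\<lambda>x y. 0 < inner (b 0 x) (b 0 y) \<and>
    (\<forall>n. inner (b n x) (b n y) = exp (ln (inner (b 0 x) (b 0 y)) / real (Suc n)))"
  have R: "AE z in M \<Otimes>\<^sub>M M. ?R (fst z) (snd z)"
    using k_pos k_rational'
  proof eventually_elim
    case (elim z)
    have "k (real 1 / real (Suc n)) z = exp (real 1 / real (Suc n) * ln (k 1 z))" for n
      using elim by blast
    then show ?case using elim(1) by (simp add: k_def b_def)
  qed
  have "AE y in M. (\<forall>n. norm (b n y) = 1) \<and> (AE x in M. ?R y x)"
    using b_unit P.AE_pair[OF R] by eventually_elim simp
  moreover have "ae_filter M \<noteq> bot" using False by (simp add: ae_filter_eq_bot_iff)
  ultimately have "\<exists>y. (\<forall>n. norm (b n y) = 1) \<and> (AE x in M. ?R y x)" by (intro eventually_happens')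
  then obtain y where y: "(\<forall>n. norm (b n y) = 1) \<and> (AE x in M. ?R y x)" ..
  then have y_unit: "norm (b n y) = 1" for n by simp
  from y have yR: "AE x in M. ?R y x" by simp
  define u where "u x = inner (b 0 y) (b 0 x)" for x
  have u_meas[measurable]: "u \<in> borel_measurable M" unfolding u_def by measurable
  have u_le: "u x \<le> 1" for x
    using order_trans[OF Cauchy_Schwarz_ineq2 mult_mono[OF b_le b_le], of 0 y 0 x] by (simp add: u_def inner_commute)
  have u: "AE x in M. 0 < u x \<and> (\<forall>n. inner (b n y) (b n x) = exp (ln (u x) / real (Suc n))) \<and> (\<forall>n. norm (b n x) = 1)"
    using yR b_unit unfolding u_def by eventually_elim blast
  define \<rho> where "\<rho> x = sqrt (2 * max 0 (- ln (u x)))" for x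
  have \<rho>_meas[measurable]: "\<rho> \<in> borel_measurable M" unfolding \<rho>_def by measurable
  have \<rho>0: "0 \<le> \<rho> x" for x by (simp add: \<rho>_def)
  \<comment> \<open>The difference quotients of the semigroup at zero, based at the point \<open>y\<close> and normalised by \<open>\<rho>\<close>.\<close>
  define v where "v n x = sqrt (real (Suc n)) *\<^sub>R (b n x - b n y)" for n x
  define g where "g n x = (if norm (v n x) \<le> \<rho> x then (1 / \<rho> x) *\<^sub>R v n x else 0)" for n x
  have v_meas[measurable]: "v n \<in> borel_measurable M" for n unfolding v_def by measurable
  have g_meas[measurable]: "g n \<in> borel_measurable M" for n unfolding g_def by measurable
  have g_le: "norm (g n x) \<le> 1" for n x
    unfolding g_def using \<rho>0[of x] by (auto simp: divide_le_eq_1)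
  have vg: "AE x in M. \<forall>n. v n x = \<rho> x *\<^sub>R g n x"
    using u
  proof eventually_elim
    case (elim x)
    have "norm (v n x) \<le> \<rho> x" for n
    proof (rule power2_le_imp_le[OF _ \<rho>0])
      have e: "inner (b n y) (b n x) = exp (ln (u x) / real (Suc n))" and n1: "norm (b n x) = 1" and u0: "0 < u x"
        using elim by blast+
      have "(norm (b n x - b n y))\<^sup>2 = (norm (b n x))\<^sup>2 + (norm (b n y))\<^sup>2 - 2 * inner (b n y) (b n x)"
        by (simp add: power2_norm_eq_inner inner_diff_left inner_diff_right inner_commute)
      then have "(norm (b n x - b n y))\<^sup>2 = 2 - 2 * exp (ln (u x) / real (Suc n))"
        unfolding e n1 y_unit by simp
      then have "(norm (v n x))\<^sup>2 = real (Suc n) * (2 - 2 * exp (ln (u x) / real (Suc n)))"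
        by (simp add: v_def power_mult_distrib del: of_nat_Suc)
      also have "\<dots> \<le> - 2 * ln (u x)" using u0 u_le[of x] by (intro exp_scaled_le) auto
      also have "\<dots> \<le> (\<rho> x)\<^sup>2" using u0 u_le[of x] by (simp add: \<rho>_def)
      finally show "(norm (v n x))\<^sup>2 \<le> (\<rho> x)\<^sup>2" .
    qed
    moreover have "v n x = 0" if "norm (v n x) \<le> \<rho> x" "\<rho> x = 0" for n using that by simp
    ultimately show ?case by (auto simp: g_def)
  qed
  define J where "J z = ln (inner (b 0 (fst z)) (b 0 (snd z))) - ln (u (fst z)) - ln (u (snd z))" for z
  have J_meas[measurable]: "J \<in> borel_measurable (M \<Otimes>\<^sub>M M)" unfolding J_def by measurable
  have limJ: "AE z in M \<Otimes>\<^sub>M M. (\<lambda>n. \<rho> (fst z) * \<rho> (snd z) * inner (g n (fst z)) (g n (snd z))) \<longlonglongrightarrow> J z"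
    using R AE_fst[OF u] AE_snd[OF u] AE_fst[OF vg] AE_snd[OF vg]
  proof eventually_elim
    case (elim z)
    let ?x = "fst z" and ?x' = "snd z"
    let ?c = "\<lambda>a n. real (Suc n) * (exp (ln a / real (Suc n)) - 1)"
    have "\<rho> ?x * \<rho> ?x' * inner (g n ?x) (g n ?x')
        = ?c (inner (b 0 ?x) (b 0 ?x')) n - ?c (u ?x) n - ?c (u ?x') n" for n
    proof -
      have e: "inner (b n ?x) (b n ?x') = exp (ln (inner (b 0 ?x) (b 0 ?x')) / real (Suc n))"
        "inner (b n y) (b n ?x) = exp (ln (u ?x) / real (Suc n))"
        "inner (b n y) (b n ?x') = exp (ln (u ?x') / real (Suc n))"
        using elim(1-3) by blast+
      have vx: "v n ?x = \<rho> ?x *\<^sub>R g n ?x" "v n ?x' = \<rho> ?x' *\<^sub>R g n ?x'" using elim(4,5) by blast+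
      have "\<rho> ?x * \<rho> ?x' * inner (g n ?x) (g n ?x') = inner (v n ?x) (v n ?x')"
        unfolding vx by simp
      also have "\<dots> = real (Suc n) * inner (b n ?x - b n y) (b n ?x' - b n y)"
        unfolding v_def by (simp del: of_nat_Suc)
      also have "inner (b n ?x - b n y) (b n ?x' - b n y)
          = inner (b n ?x) (b n ?x') - inner (b n y) (b n ?x) - inner (b n y) (b n ?x') + 1"
        using y_unit[of n] by (simp add: inner_diff_left inner_diff_right inner_commute dot_square_norm)
      finally show ?thesis unfolding e by (simp add: algebra_simps del: of_nat_Suc)
    qed
    moreover have "0 < inner (b 0 ?x) (b 0 ?x')" "0 < u ?x" "0 < u ?x'" using elim(1-3) by blast+
    ultimately show ?case
      unfolding J_def by (simp only:) (intro tendsto_diff log_as_limit)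
  qed
  \<comment> \<open>The clamping only makes the limit bounded everywhere; almost everywhere it changes nothing.\<close>
  define L where "L z = (if \<rho> (fst z) * \<rho> (snd z) = 0 then 0 else max (-1) (min 1 (J z / (\<rho> (fst z) * \<rho> (snd z)))))" for z
  have L_meas[measurable]: "L \<in> borel_measurable (M \<Otimes>\<^sub>M M)" unfolding L_def by measurable
  have L_le: "\<bar>L z\<bar> \<le> 1" for z by (auto simp: L_def)
  have g_inner: "\<bar>inner (g n x) (g n x')\<bar> \<le> 1" for n x x'
    using order_trans[OF Cauchy_Schwarz_ineq2 mult_mono[OF g_le g_le], of n x n x'] by (simp add: inner_commute)
  have limL: "AE z in M \<Otimes>\<^sub>M M. (\<lambda>n. inner (g n (fst z)) (g n (snd z))) \<longlonglongrightarrow> L z"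
    using limJ
  proof eventually_elim
    case (elim z)
    let ?p = "\<rho> (fst z) * \<rho> (snd z)"
    show ?case
    proof (cases "?p = 0")
      case True
      then have "inner (g n (fst z)) (g n (snd z)) = 0" for n by (auto simp: g_def)
      then show ?thesis using True by (simp add: L_def)
    next
      case False
      have "(\<lambda>n. ?p * inner (g n (fst z)) (g n (snd z)) / ?p) \<longlonglongrightarrow> J z / ?p"
        by (intro tendsto_divide elim tendsto_const False)
      then have l: "(\<lambda>n. inner (g n (fst z)) (g n (snd z))) \<longlonglongrightarrow> J z / ?p" using False by simp
      have "J z / ?p \<le> 1" using l g_inner by (intro LIMSEQ_le_const2[OF l]) (auto simp: abs_le_iff)
      moreover have "-1 \<le> J z / ?p"
        using l g_inner by (intro LIMSEQ_le_const[OF l]) (auto simp: abs_le_iff minus_le_iff)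
      ultimately show ?thesis using l False by (simp add: L_def)
    qed
  qed
  have psd: "psd_kernel N L"
  proof (rule N.psd_kernel_limit)
    show "psd_kernel N (\<lambda>z. inner (g n (fst z)) (g n (snd z)))" for n
      by (rule N.psd_kernel_inner[OF _ g_le]) simp
    show "AE z in N \<Otimes>\<^sub>M N. \<bar>inner (g n (fst z)) (g n (snd z))\<bar> \<le> 1" for n using g_inner by simp
    show "L \<in> borel_measurable (N \<Otimes>\<^sub>M N)" by (simp add: measurable_NN)
    show "AE z in N \<Otimes>\<^sub>M N. (\<lambda>n. inner (g n (fst z)) (g n (snd z))) \<longlonglongrightarrow> L z" using limL by (simp add: AE_NN)
  qed (rule L_le)
  have avg: "kform N L (indicator A) (indicator A) \<le> (measure N A)\<^sup>2" if A: "A \<in> sets N" for A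
  proof -
    have i: "integrable N (indicator A :: 'a \<Rightarrow> real)" using A by (intro N.integrable_bounded_fun indicator_bounded_fun)
    note p = pair_sigma_finite.product_integral_pair[OF N.pair_sf i i]
    have "kform N L (indicator A) (indicator A) \<le> (\<integral>z. indicator A (fst z) * indicator A (snd z) \<partial>(N \<Otimes>\<^sub>M N))"
      unfolding kform_def
    proof (rule integral_mono)
      show "integrable (N \<Otimes>\<^sub>M N) (\<lambda>z. L z * indicator A (fst z) * indicator A (snd z))"
        by (rule N.integrable_bounded_kernel[OF _ L_le]) (use A in \<open>auto simp: measurable_NN intro: indicator_bounded_fun\<close>)
      show "L z * indicator A (fst z) * indicator A (snd z) \<le> indicator A (fst z) * indicator A (snd z)" for z
        using L_le[of z] by (auto split: split_indicator)
    qed (rule p(1))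
    also have "\<dots> = (measure N A)\<^sup>2" unfolding p(2) using A by (simp add: power2_eq_square)
    finally show ?thesis .
  qed
  obtain \<gamma> :: "'a \<Rightarrow> nat ell2" where \<gamma>': "\<gamma> \<in> borel_measurable N" and L\<gamma>: "AE z in N \<Otimes>\<^sub>M N. L z = inner (\<gamma> (fst z)) (\<gamma> (snd z))"
    using N.kernel_factorisation[OF psd avg] by blast
  have [measurable]: "\<gamma> \<in> borel_measurable M" using \<gamma>' by simp
  define \<alpha> where "\<alpha> x = \<rho> x *\<^sub>R \<gamma> x" for x
  have \<alpha>_meas[measurable]: "\<alpha> \<in> borel_measurable M" unfolding \<alpha>_def by measurable
  have \<alpha>J: "AE z in M \<Otimes>\<^sub>M M. inner (\<alpha> (fst z)) (\<alpha> (snd z)) = J z"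
    using L\<gamma>[unfolded AE_NN] limJ limL
  proof eventually_elim
    case (elim z)
    have "(\<lambda>n. \<rho> (fst z) * \<rho> (snd z) * inner (g n (fst z)) (g n (snd z))) \<longlonglongrightarrow> \<rho> (fst z) * \<rho> (snd z) * L z"
      using elim by (intro tendsto_intros)
    then have "\<rho> (fst z) * \<rho> (snd z) * L z = J z" using elim LIMSEQ_unique by blast
    then show ?case using elim by (simp add: \<alpha>_def ac_simps)
  qed
  \<comment> \<open>The diagonal is a null set in general, so the length of \<open>\<alpha> x\<close> comes from a closed relation:
    the exponential of \<open>\<alpha>J\<close>, cleared of denominators, between the values of \<open>b 0\<close> and \<open>\<alpha>\<close>.\<close>
  define F where "F x = (b 0 x, \<alpha> x)" for x
  have F_meas: "F \<in> borel_measurable M" unfolding F_def by (intro borel_measurable_Pair) measurable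
  define C where "C = {p :: (nat ell2 \<times> nat ell2) \<times> (nat ell2 \<times> nat ell2).
    exp (inner (snd (fst p)) (snd (snd p))) * inner (b 0 y) (fst (fst p)) * inner (b 0 y) (fst (snd p))
      = inner (fst (fst p)) (fst (snd p))}"
  have C: "closed C" unfolding C_def by (intro closed_Collect_eq continuous_intros)
  have "AE z in M \<Otimes>\<^sub>M M. (F (fst z), F (snd z)) \<in> C"
    using R AE_fst[OF u] AE_snd[OF u] \<alpha>J
  proof eventually_elim
    case (elim z)
    have "0 < inner (b 0 (fst z)) (b 0 (snd z))" "0 < u (fst z)" "0 < u (snd z)" using elim(1-3) by blast+
    then have "exp (J z) * u (fst z) * u (snd z) = inner (b 0 (fst z)) (b 0 (snd z))"
      by (simp add: J_def exp_diff)
    then show ?case using elim(4) by (simp add: C_def F_def u_def)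
  qed
  note FC = this
  obtain G where G: "AE x in M. x \<in> G" "\<And>x. x \<in> G \<Longrightarrow> (F x, F x) \<in> C"
  proof (rule closed_relation_on_essential_points[OF F_meas])
    fix G assume "AE x in M. x \<in> G"
      and *: "\<And>C x y. closed C \<Longrightarrow> AE z in M \<Otimes>\<^sub>M M. (F (fst z), F (snd z)) \<in> C \<Longrightarrow>
        x \<in> G \<Longrightarrow> y \<in> G \<Longrightarrow> (F x, F y) \<in> C"
    then show thesis by (intro that[of G] *[OF C FC])
  qed
  have diag: "AE x in M. (norm (\<alpha> x))\<^sup>2 = - 2 * ln (u x)"
    using G(1) u
  proof eventually_elim
    case (elim x)
    have u0: "0 < u x" and n1: "norm (b 0 x) = 1" using elim(2) by blast+
    have "exp ((norm (\<alpha> x))\<^sup>2) * (u x * u x) = 1"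
      using G(2)[OF elim(1)] n1 by (simp add: C_def F_def u_def dot_square_norm mult.assoc)
    then have "ln (exp ((norm (\<alpha> x))\<^sup>2) * (u x * u x)) = 0" by simp
    then show ?case using u0 by (simp add: ln_mult)
  qed
  \<comment> \<open>The squared distances of \<open>\<alpha>\<close> are twice the wanted ones.\<close>
  define \<alpha>' where "\<alpha>' x = (1 / sqrt 2) *\<^sub>R \<alpha> x" for x
  have "AE z in M \<Otimes>\<^sub>M M. ln (k 1 z) = - (norm (\<alpha>' (fst z) - \<alpha>' (snd z)))\<^sup>2"
    using \<alpha>J AE_fst[OF diag] AE_snd[OF diag]
  proof eventually_elim
    case (elim z)
    have "(norm (\<alpha> (fst z) - \<alpha> (snd z)))\<^sup>2 = (norm (\<alpha> (fst z)))\<^sup>2 + (norm (\<alpha> (snd z)))\<^sup>2 - 2 * inner (\<alpha> (fst z)) (\<alpha> (snd z))"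
      by (simp add: power2_norm_eq_inner inner_diff_left inner_diff_right inner_commute)
    also have "\<dots> = - 2 * ln (k 1 z)" using elim by (simp add: J_def k_def b0)
    finally show ?case
      unfolding \<alpha>'_def scaleR_diff_right[symmetric] by (simp add: power_mult_distrib power_divide)
  qed
  moreover have "\<alpha>' \<in> borel_measurable M" unfolding \<alpha>'_def by measurable
  ultimately show thesis by (intro that)
qed

end

section \<open>Markov semigroups of Schur multipliers\<close>

theorem markov_schur_semigroup_embedding:
  assumes "complete_measure M" "sigma_finite_measure M" "markov_schur_semigroup M T \<phi>"
  obtains \<alpha> :: "'a \<Rightarrow> nat ell2" where "\<alpha> \<in> borel_measurable M"
    "\<And>t. 0 \<le> t \<Longrightarrow> AE z in M \<Otimes>\<^sub>M M. \<phi> t z = complex_of_real (exp (- t * (norm (\<alpha> (fst z) - \<alpha> (snd z)))\<^sup>2))"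
proof -
  interpret sigma_finite_measure M by fact
  obtain w :: "'a \<Rightarrow> real" where w: "w \<in> borel_measurable M" "\<And>x. 0 < w x" "integrable M w"
    using positive_integrable_weight by blast
  interpret weighted_measure M w 
    by (intro weighted_measure.intro weighted_measure_axioms.intro sigma_finite_measure_axioms assms(1) w)
  obtain \<beta> :: "real \<Rightarrow> 'a \<Rightarrow> nat ell2" where \<beta>: "\<And>t. 0 \<le> t \<Longrightarrow> \<beta> t \<in> borel_measurable M"
    "\<And>t x. 0 \<le> t \<Longrightarrow> norm (\<beta> t x) \<le> 1" "\<And>t. 0 \<le> t \<Longrightarrow> AE x in M. norm (\<beta> t x) = 1"
    and \<phi>: "\<And>t. 0 \<le> t \<Longrightarrow> AE z in M \<Otimes>\<^sub>M M. \<phi> t z = complex_of_real (inner (\<beta> t (fst z)) (\<beta> t (snd z)))"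
    and \<beta>': "\<And>s t. 0 \<le> s \<Longrightarrow> 0 \<le> t \<Longrightarrow> AE z in M \<Otimes>\<^sub>M M. inner (\<beta> (s + t) (fst z)) (\<beta> (s + t) (snd z))
        = inner (\<beta> s (fst z)) (\<beta> s (snd z)) * inner (\<beta> t (fst z)) (\<beta> t (snd z))"
    "AE z in M \<Otimes>\<^sub>M M. inner (\<beta> 0 (fst z)) (\<beta> 0 (snd z)) = 1"
    "continuous_on {0..} (\<lambda>t. \<integral>z. inner (\<beta> t (fst z)) (\<beta> t (snd z)) \<partial>(N \<Otimes>\<^sub>M N))"
  proof (rule markov_semigroup_kernels[OF assms(3)])
  qed (rule that; assumption)
  interpret kernel_semigroup M w \<beta> 
    by (intro kernel_semigroup.intro kernel_semigroup_axioms.intro weighted_measure_axioms \<beta> \<beta>')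
  obtain \<alpha> :: "'a \<Rightarrow> nat ell2" where \<alpha>: "\<alpha> \<in> borel_measurable M"
    "AE z in M \<Otimes>\<^sub>M M. ln (k 1 z) = - (norm (\<alpha> (fst z) - \<alpha> (snd z)))\<^sup>2"
    using hilbert_embedding by blast
  show thesis
  proof (rule that[OF \<alpha>(1)])
    fix t :: real assume t: "0 \<le> t"
    show "AE z in M \<Otimes>\<^sub>M M. \<phi> t z = complex_of_real (exp (- t * (norm (\<alpha> (fst z) - \<alpha> (snd z)))\<^sup>2))"
      using \<phi>[OF t] k_eq_exp[OF t] \<alpha>(2) by eventually_elim (simp add: k_def)
  qed
qed

text \<open>
  The isometric embedding onto the second summand; it places the separable space that has been
  constructed inside the prescribed one.
\<close>

definition ell2_emb :: "nat ell2 \<Rightarrow> ('a + nat) ell2" where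
  "ell2_emb x = Abs_ell2 (case_sum (\<lambda>_. 0) (ell2_nth x))"

lemma ell2_emb_nth: "ell2_nth (ell2_emb x) = case_sum (\<lambda>_. 0) (ell2_nth x)"
proof -
  have "(\<lambda>i. (ell2_nth x i)\<^sup>2) summable_on UNIV" using ell2_nth[of x] by simp
  then have "(\<lambda>i. (case_sum (\<lambda>_. 0) (ell2_nth x) i)\<^sup>2) summable_on range Inr"
    by (subst summable_on_reindex) (auto simp: comp_def)
  then have "(\<lambda>i. (case_sum (\<lambda>_. 0) (ell2_nth x) i)\<^sup>2) summable_on UNIV"
    by (rule summable_on_cong_neutral[THEN iffD1, rotated -1]) (auto split: sum.splits)
  then show ?thesis unfolding ell2_emb_def by (intro Abs_ell2_inverse) simp
qed

lemma ell2_emb_diff: "ell2_emb x - ell2_emb y = ell2_emb (x - y)"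
  by (rule ell2_eqI) (auto simp: ell2_emb_nth split: sum.splits)

lemma norm_ell2_emb: "norm (ell2_emb x :: ('a + nat) ell2) = norm x"
proof -
  have "(norm (ell2_emb x :: ('a + nat) ell2))\<^sup>2 = (\<Sum>\<^sub>\<infinity>i::'a + nat\<in>range Inr. (case_sum (\<lambda>_. 0) (ell2_nth x) i)\<^sup>2)"
    unfolding ell2_norm_squared ell2_emb_nth
    by (rule infsum_cong_neutral) (auto split: sum.splits)
  also have "\<dots> = (norm x)\<^sup>2"
    unfolding ell2_norm_squared by (subst infsum_reindex) (auto simp: comp_def)
  finally show ?thesis by (metis norm_ge_zero power2_eq_imp_eq)
qed

lemma continuous_ell2_emb: "continuous_on S ell2_emb"
  by (rule continuous_onI) (metis dist_norm ell2_emb_diff norm_ell2_emb order_less_imp_le)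

lemma real_hilbert_UNIV: "real_hilbert_in UNIV"
  by (simp add: real_hilbert_in_def)

section \<open>Continuous symbols\<close>

text \<open>
  Urysohn's metrisation argument: one function for each pair of basic open sets, the closure of one
  of which is contained in the other. Since \<open>X\<close> is a topology and not a type class instance, the
  embedding into a type is what makes the extension theorems for subsets of metric spaces available.
\<close>

lemma second_countable_regular_embedding:
  assumes X: "second_countable X" "regular_space X"
  obtains e :: "'a \<Rightarrow> nat \<Rightarrow> real" where "continuous_map X euclidean e"
    "\<And>U x. openin X U \<Longrightarrow> x \<in> U \<Longrightarrow> \<exists>V. open V \<and> e x \<in> V \<and> (\<forall>y\<in>topspace X. e y \<in> V \<longrightarrow> y \<in> U)"
proof -
  have normal: "normal_space X"
    using X by (intro regular_Lindelof_imp_normal_space second_countable_imp_Lindelof_space)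
  obtain B where B: "countable B" "\<And>V. V \<in> B \<Longrightarrow> openin X V"
    "\<And>U x. openin X U \<Longrightarrow> x \<in> U \<Longrightarrow> \<exists>V\<in>B. x \<in> V \<and> V \<subseteq> U"
    using X(1) unfolding second_countable_def by metis
  define good where "good U V \<longleftrightarrow> openin X U \<and> openin X V \<and> X closure_of U \<subseteq> V" for U V
  have "\<exists>f. continuous_map X euclideanreal f \<and>
      (good U V \<longrightarrow> f ` (X closure_of U) \<subseteq> {1} \<and> f ` (topspace X - V) \<subseteq> {0})" for U V
  proof (cases "good U V")
    case True
    then have "closedin X (X closure_of U)" "closedin X (topspace X - V)" "disjnt (X closure_of U) (topspace X - V)"
      by (auto simp: good_def disjnt_def)
    from Urysohn_lemma_alt[OF normal this, of 1 0] show ?thesis by metis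
  next
    case False
    then show ?thesis by (intro exI[of _ "\<lambda>_. 0"]) simp
  qed
  then obtain f where f: "\<And>U V. continuous_map X euclideanreal (f U V)"
    "\<And>U V. good U V \<Longrightarrow> f U V ` (X closure_of U) \<subseteq> {1} \<and> f U V ` (topspace X - V) \<subseteq> {0}"
    by metis
  define W where "W n = from_nat_into B n" for n
  define e where "e x n = f (W (fst (prod_decode n))) (W (snd (prod_decode n))) x" for x n
  show thesis
  proof
    have "continuous_map X (product_topology (\<lambda>i. euclidean) UNIV) e"
      by (rule continuous_map_coordinatewise_then_product) (auto simp: e_def f)
    then show "continuous_map X euclidean e" by (simp add: euclidean_product_topology)
    fix U x assume U: "openin X U" "x \<in> U"
    obtain V where V: "V \<in> B" "x \<in> V" "V \<subseteq> U" using B(3)[OF U] by blast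
    have "neighbourhood_base_of (closedin X) X" using X(2) by (simp add: neighbourhood_base_of_closedin)
    then obtain U1 C where U1: "openin X U1" "closedin X C" "x \<in> U1" "U1 \<subseteq> C" "C \<subseteq> V"
      unfolding neighbourhood_base_of using B(2)[OF V(1)] V(2) by metis
    obtain U2 where U2: "U2 \<in> B" "x \<in> U2" "U2 \<subseteq> U1" using B(3)[OF U1(1,3)] by blast
    have "X closure_of U2 \<subseteq> C" using U1 U2 by (intro closure_of_minimal) auto
    then have g: "good U2 V" using B(2) U1 U2 V by (auto simp: good_def)
    obtain i j where ij: "U2 = W i" "V = W j"
      unfolding W_def using from_nat_into_surj[OF B(1)] U2(1) V(1) by metis
    define n where "n = prod_encode (i, j)"
    have en: "e y n = f U2 V y" for y by (simp add: e_def n_def ij)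
    have xU: "x \<in> X closure_of U2" using U2 B(2) closure_of_subset[of U2 X] openin_subset by fastforce
    show "\<exists>V. open V \<and> e x \<in> V \<and> (\<forall>y\<in>topspace X. e y \<in> V \<longrightarrow> y \<in> U)"
    proof (intro exI[of _ "{h. h n > 1/2}"] conjI ballI impI)
      show "open {h :: nat \<Rightarrow> real. 1/2 < h n}"
        by (intro open_Collect_less continuous_on_const continuous_on_product_coordinates)
      show "e x \<in> {h. 1/2 < h n}" using f(2)[OF g] xU by (auto simp: en)
      fix y assume "y \<in> topspace X" "e y \<in> {h. 1/2 < h n}"
      then have "y \<in> V" using f(2)[OF g] by (force simp: en)
      then show "y \<in> U" using V(3) by blast
    qed
  qed
qed

text \<open>
  By local compactness the open sets of finite measure cover the space; by the Lindeloef property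
  countably many of them do.
\<close>

lemma radon_sigma_finite:
  assumes R: "second_countable_radon_space X M"
  shows "sigma_finite_measure M"
proof
  have X: "second_countable X" "locally_compact_space X" "space M = topspace X"
    and op: "\<And>U. openin X U \<Longrightarrow> U \<in> sets M" and co: "\<And>K. compactin X K \<Longrightarrow> emeasure M K < \<infinity>"
    and Hd: "Hausdorff_space X"
    using R by (auto simp: second_countable_radon_space_def)
  define \<U> where "\<U> = {U. openin X U \<and> emeasure M U < \<infinity>}"
  have "\<Union>\<U> = topspace X"
  proof
    show "\<Union>\<U> \<subseteq> topspace X" by (auto simp: \<U>_def dest: openin_subset)
    show "topspace X \<subseteq> \<Union>\<U>"
    proof
      fix x assume "x \<in> topspace X"
      then obtain U K where U: "openin X U" "compactin X K" "x \<in> U" "U \<subseteq> K"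
        using X(2) unfolding locally_compact_space_def by blast
      have "K \<in> sets M"
      proof -
        have "closedin X K" by (rule compactin_imp_closedin[OF Hd U(2)])
        then have "topspace X - K \<in> sets M" using op by (simp add: closedin_def)
        then have "topspace X - (topspace X - K) \<in> sets M"
          using sets.compl_sets X(3) by metis
        then show ?thesis using compactin_subset_topspace[OF U(2)] by (simp add: double_diff)
      qed
      then have "emeasure M U \<le> emeasure M K" using U by (intro emeasure_mono) auto
      then have "U \<in> \<U>" using U co[OF U(2)] by (auto simp: \<U>_def)
      then show "x \<in> \<Union>\<U>" using U(3) by blast
    qed
  qed
  then obtain \<V> where V: "countable \<V>" "\<V> \<subseteq> \<U>" "\<Union>\<V> = topspace X"
    using Lindelof_spaceD[OF second_countable_imp_Lindelof_space[OF X(1)], of \<U>] by (auto simp: \<U>_def)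
  then show "\<exists>A. countable A \<and> A \<subseteq> sets M \<and> \<Union>A = space M \<and> (\<forall>a\<in>A. emeasure M a \<noteq> \<infinity>)"
  proof (intro exI[of _ \<V>] conjI ballI subsetI)
    fix U assume "U \<in> \<V>"
    then have "U \<in> \<U>" using V(2) by blast
    then have "openin X U" "emeasure M U < \<infinity>" by (simp_all add: \<U>_def)
    then show "U \<in> sets M" "emeasure M U \<noteq> \<infinity>" using op by auto
  qed (use V X(3) in auto)
qed

text \<open>
  A map into a complete space with vanishing oscillation at each point of the closure of its domain
  has limits there. A sequence of neighbourhoods with oscillation below \<open>1 / (n+1)\<close> suffices to find
  the limit, also at points without a countable neighbourhood basis.
\<close>

lemma continuous_extension_to_closure:
  fixes \<alpha> :: "'a \<Rightarrow> 'h::complete_space"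
  assumes cauchy: "\<And>t \<epsilon>. t \<in> X closure_of G \<Longrightarrow> 0 < \<epsilon> \<Longrightarrow>
    \<exists>U. openin X U \<and> t \<in> U \<and> (\<forall>g\<in>G \<inter> U. \<forall>g'\<in>G \<inter> U. dist (\<alpha> g) (\<alpha> g') < \<epsilon>)"
    and G: "G \<subseteq> topspace X"
  obtains \<alpha>' where "\<And>g. g \<in> G \<Longrightarrow> \<alpha>' g = \<alpha> g"
    "\<And>t \<epsilon>. t \<in> X closure_of G \<Longrightarrow> 0 < \<epsilon> \<Longrightarrow>
      \<exists>U. openin X U \<and> t \<in> U \<and> (\<forall>s\<in>X closure_of G \<inter> U. dist (\<alpha>' s) (\<alpha>' t) < \<epsilon>)"
proof -
  let ?S = "X closure_of G"
  have "\<exists>l. \<forall>\<epsilon>>0. \<exists>U. openin X U \<and> t \<in> U \<and> (\<forall>g\<in>G \<inter> U. dist (\<alpha> g) l < \<epsilon>)" if t: "t \<in> ?S" for t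
  proof -
    have "\<forall>n. \<exists>U. openin X U \<and> t \<in> U \<and> (\<forall>g\<in>G \<inter> U. \<forall>g'\<in>G \<inter> U. dist (\<alpha> g) (\<alpha> g') < 1 / real (Suc n))"
      using cauchy[OF t] by simp
    from choice[OF this] obtain U where U: "\<forall>n. openin X (U n) \<and> t \<in> U n \<and>
      (\<forall>g\<in>G \<inter> U n. \<forall>g'\<in>G \<inter> U n. dist (\<alpha> g) (\<alpha> g') < 1 / real (Suc n))" ..
    have "\<exists>g. g \<in> G \<inter> (\<Inter>k\<le>n. U k)" for n
    proof -
      have "openin X (\<Inter>k\<le>n. U k)" using U by (intro openin_Inter) auto
      moreover have "t \<in> (\<Inter>k\<le>n. U k)" using U by auto
      ultimately show ?thesis using t unfolding in_closure_of by blast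
    qed
    then have "\<forall>n. \<exists>g. g \<in> G \<inter> (\<Inter>k\<le>n. U k)" by blast
    from choice[OF this] obtain g where g: "\<forall>n. g n \<in> G \<inter> (\<Inter>k\<le>n. U k)" ..
    have gU: "g n \<in> G \<inter> U k" if "k \<le> n" for n k using g that by blast
    have d: "dist (\<alpha> h) (\<alpha> (g n)) < 1 / real (Suc k)" if "k \<le> n" "h \<in> G \<inter> U k" for n k h
      using U gU[OF that(1)] that(2) by blast
    have "Cauchy (\<lambda>n. \<alpha> (g n))"
    proof (rule metric_CauchyI)
      fix \<epsilon> :: real assume "0 < \<epsilon>"
      then obtain k where k: "1 / real (Suc k) < \<epsilon>" using nat_approx_posE by blast
      have "dist (\<alpha> (g m)) (\<alpha> (g n)) < \<epsilon>" if "m \<ge> k" "n \<ge> k" for m n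
        using d[OF that(2) gU[OF that(1)]] k by linarith
      then show "\<exists>k. \<forall>m\<ge>k. \<forall>n\<ge>k. dist (\<alpha> (g m)) (\<alpha> (g n)) < \<epsilon>" by blast
    qed
    then obtain l where l: "(\<lambda>n. \<alpha> (g n)) \<longlonglongrightarrow> l"
      using Cauchy_convergent_iff convergent_def by blast
    have "\<exists>U. openin X U \<and> t \<in> U \<and> (\<forall>g\<in>G \<inter> U. dist (\<alpha> g) l < \<epsilon>)" if \<epsilon>: "0 < \<epsilon>" for \<epsilon>
    proof -
      obtain k where k: "1 / real (Suc k) < \<epsilon>" using nat_approx_posE[OF \<epsilon>] by blast
      have "dist (\<alpha> h) l \<le> 1 / real (Suc k)" if h: "h \<in> G \<inter> U k" for h
      proof (rule LIMSEQ_le_const2)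
        show "(\<lambda>n. dist (\<alpha> h) (\<alpha> (g n))) \<longlonglongrightarrow> dist (\<alpha> h) l" by (intro tendsto_intros l)
        show "\<exists>N. \<forall>n\<ge>N. dist (\<alpha> h) (\<alpha> (g n)) \<le> 1 / real (Suc k)"
          using d[OF _ h] by (intro exI[of _ k]) (auto intro: less_imp_le)
      qed
      then have "\<forall>g\<in>G \<inter> U k. dist (\<alpha> g) l < \<epsilon>" using k by (meson le_less_trans)
      then show ?thesis using U by blast
    qed
    then show ?thesis by blast
  qed
  then have "\<forall>t. \<exists>l. t \<in> ?S \<longrightarrow> (\<forall>\<epsilon>>0. \<exists>U. openin X U \<and> t \<in> U \<and> (\<forall>g\<in>G \<inter> U. dist (\<alpha> g) l < \<epsilon>))"
    by blast
  from choice[OF this] obtain \<alpha>' where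
    \<alpha>'0: "\<forall>t. t \<in> ?S \<longrightarrow> (\<forall>\<epsilon>>0. \<exists>U. openin X U \<and> t \<in> U \<and> (\<forall>g\<in>G \<inter> U. dist (\<alpha> g) (\<alpha>' t) < \<epsilon>))" ..
  have \<alpha>': "\<exists>U. openin X U \<and> t \<in> U \<and> (\<forall>g\<in>G \<inter> U. dist (\<alpha> g) (\<alpha>' t) < \<epsilon>)"
    if "t \<in> ?S" "0 < \<epsilon>" for t \<epsilon>
    by (rule \<alpha>'0[THEN spec, THEN mp, THEN spec, THEN mp, OF that])
  have GS: "G \<subseteq> ?S" by (rule closure_of_subset[OF G])
  show thesis
  proof
    fix g assume g: "g \<in> G"
    have gS: "g \<in> ?S" by (rule subsetD[OF GS g])
    have small: "dist (\<alpha> g) (\<alpha>' g) < \<epsilon>" if \<epsilon>: "0 < \<epsilon>" for \<epsilon>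
    proof -
      from \<alpha>'[OF gS \<epsilon>] obtain U where "openin X U \<and> g \<in> U \<and> (\<forall>h\<in>G \<inter> U. dist (\<alpha> h) (\<alpha>' g) < \<epsilon>)" ..
      then show ?thesis using g by simp
    qed
    show "\<alpha>' g = \<alpha> g"
    proof (rule ccontr)
      assume "\<alpha>' g \<noteq> \<alpha> g"
      then have "0 < dist (\<alpha> g) (\<alpha>' g)" by simp
      from small[OF this] show False by simp
    qed
  next
    fix t \<epsilon> assume t: "t \<in> ?S" and \<epsilon>: "(0::real) < \<epsilon>"
    have \<epsilon>2: "0 < \<epsilon> / 2" using \<epsilon> by simp
    from \<alpha>'[OF t \<epsilon>2] obtain U
      where U: "openin X U \<and> t \<in> U \<and> (\<forall>g\<in>G \<inter> U. dist (\<alpha> g) (\<alpha>' t) < \<epsilon> / 2)" ..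
    have "dist (\<alpha>' s) (\<alpha>' t) < \<epsilon>" if s: "s \<in> ?S \<inter> U" for s
    proof -
      have sS: "s \<in> ?S" using s by simp
      from \<alpha>'[OF sS \<epsilon>2] obtain W
        where W: "openin X W \<and> s \<in> W \<and> (\<forall>g\<in>G \<inter> W. dist (\<alpha> g) (\<alpha>' s) < \<epsilon> / 2)" ..
      have "s \<in> U \<inter> W \<and> openin X (U \<inter> W)" using U W s by auto
      then have "\<exists>g. g \<in> G \<and> g \<in> U \<inter> W" using sS unfolding in_closure_of by blast
      then obtain g where "g \<in> G" "g \<in> U \<inter> W" by (elim exE conjE)
      then have "dist (\<alpha> g) (\<alpha>' s) < \<epsilon> / 2" "dist (\<alpha> g) (\<alpha>' t) < \<epsilon> / 2" using U W by simp_all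
      then show ?thesis using dist_triangle3[of "\<alpha>' s" "\<alpha>' t" "\<alpha> g"] by linarith
    qed
    then show "\<exists>U. openin X U \<and> t \<in> U \<and> (\<forall>s\<in>?S \<inter> U. dist (\<alpha>' s) (\<alpha>' t) < \<epsilon>)"
      using U by (intro exI[of _ U]) simp
  qed
qed

text \<open>
  The Tietze theorem for inner product spaces, transported along the embedding of \<open>X\<close> into a space of
  sequences.
\<close>

lemma continuous_extension_from_closed:
  fixes f :: "'a \<Rightarrow> 'h::real_inner"
  assumes X: "second_countable X" "regular_space X" "Hausdorff_space X"
    and S: "closedin X S"
    and f: "\<And>t \<epsilon>. t \<in> S \<Longrightarrow> 0 < \<epsilon> \<Longrightarrow> \<exists>U. openin X U \<and> t \<in> U \<and> (\<forall>s\<in>S \<inter> U. dist (f s) (f t) < \<epsilon>)"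
  obtains g where "continuous_map X euclidean g" "\<And>x. x \<in> S \<Longrightarrow> g x = f x"
proof -
  obtain e :: "'a \<Rightarrow> nat \<Rightarrow> real" where e: "continuous_map X euclidean e"
    and sep: "\<And>U x. openin X U \<Longrightarrow> x \<in> U \<Longrightarrow> \<exists>V. open V \<and> e x \<in> V \<and> (\<forall>y\<in>topspace X. e y \<in> V \<longrightarrow> y \<in> U)"
    using second_countable_regular_embedding[OF X(1,2)] by blast
  have ST: "S \<subseteq> topspace X" by (rule closedin_subset[OF S])
  have inj: "inj_on e (topspace X)"
  proof (rule inj_onI, rule ccontr)
    fix x y assume xy: "x \<in> topspace X" "y \<in> topspace X" "e x = e y" "x \<noteq> y"
    then obtain U where "openin X U" "x \<in> U" "y \<notin> U"
      using X(3) unfolding Hausdorff_space_def disjnt_def by blast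
    with sep[of U x] xy show False by auto
  qed
  let ?E = "e ` topspace X"
  define h where "h v = f (inv_into (topspace X) e v)" for v
  have he: "h (e x) = f x" if "x \<in> topspace X" for x using inj that by (simp add: h_def)
  have "continuous_on (e ` S) h"
    unfolding continuous_on_topological
  proof (intro ballI allI impI)
    fix v B assume "v \<in> e ` S" and B: "open B" "h v \<in> B"
    then obtain x where x: "x \<in> S" "v = e x" by blast
    then have xT: "x \<in> topspace X" using ST by blast
    obtain \<epsilon> where \<epsilon>: "0 < \<epsilon>" "\<And>b. dist b (f x) < \<epsilon> \<Longrightarrow> b \<in> B"
      using B he[OF xT] x(2) unfolding open_dist by metis
    obtain U where U: "openin X U" "x \<in> U" "\<forall>s\<in>S \<inter> U. dist (f s) (f x) < \<epsilon>" using f[OF x(1) \<epsilon>(1)] by blast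
    obtain V where V: "open V" "e x \<in> V" "\<forall>y\<in>topspace X. e y \<in> V \<longrightarrow> y \<in> U" using sep[OF U(1,2)] by blast
    show "\<exists>A. open A \<and> v \<in> A \<and> (\<forall>y\<in>e ` S. y \<in> A \<longrightarrow> h y \<in> B)"
    proof (intro exI[of _ V] conjI ballI impI)
      fix y assume "y \<in> e ` S" "y \<in> V"
      then obtain s where s: "s \<in> S" "y = e s" by blast
      then have "s \<in> U" "s \<in> topspace X" using V(3) ST \<open>y \<in> V\<close> by auto
      then show "h y \<in> B" using U(3) s \<epsilon>(2) he by auto
    qed (use V x in auto)
  qed
  moreover have "closedin (top_of_set ?E) (e ` S)"
  proof -
    have "?E \<inter> closure (e ` S) \<subseteq> e ` S"
    proof
      fix v assume v: "v \<in> ?E \<inter> closure (e ` S)"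
      then obtain x where x: "x \<in> topspace X" "v = e x" by blast
      show "v \<in> e ` S"
      proof (rule ccontr)
        assume "v \<notin> e ` S"
        then have xS: "x \<in> topspace X - S" using x by auto
        have oS: "openin X (topspace X - S)" using S unfolding closedin_def by simp
        from sep[OF oS xS] obtain V where "open V \<and> e x \<in> V \<and> (\<forall>y\<in>topspace X. e y \<in> V \<longrightarrow> y \<in> topspace X - S)" ..
        then have V: "open V" "e x \<in> V" and V': "\<And>y. y \<in> topspace X \<Longrightarrow> e y \<in> V \<Longrightarrow> y \<notin> S" by simp_all
        have "V \<inter> e ` S = {}"
        proof (rule equals0I)
          fix v assume "v \<in> V \<inter> e ` S"
          then obtain s where "s \<in> S" "e s \<in> V" by auto
          then show False using V'[of s] ST by auto
        qed
        then have "V \<inter> closure (e ` S) = {}" using open_Int_closure_eq_empty[OF V(1)] by blast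
        then show False using V(2) v x by auto
      qed
    qed
    moreover have "e ` S \<subseteq> ?E \<inter> closure (e ` S)" using ST closure_subset[of "e ` S"] by blast
    ultimately have "e ` S = ?E \<inter> closure (e ` S)" by blast
    then show ?thesis unfolding closedin_closed using closed_closure by blast
  qed
  ultimately obtain g where g: "continuous_on ?E g" "\<And>v. v \<in> e ` S \<Longrightarrow> g v = h v"
    using Tietze_unbounded[of "e ` S" h ?E] by blast
  show thesis
  proof
    have "continuous_map X (top_of_set ?E) e"
      using e by (auto simp: continuous_map_in_subtopology)
    moreover have "continuous_map (top_of_set ?E) euclidean g" using g(1) by simp
    ultimately have "continuous_map X euclidean (g \<circ> e)" by (rule continuous_map_compose)
    then show "continuous_map X euclidean (\<lambda>x. g (e x))" by (simp add: comp_def)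
    show "g (e x) = f x" if "x \<in> S" for x using g(2)[of "e x"] he[of x] ST that by auto
  qed
qed

text \<open>
  The essential points are taken for the map \<open>x \<mapsto> (e x, \<alpha> x)\<close>, where \<open>e\<close> is the embedding of \<open>X\<close>: near such
  a point, points with nearby values of \<open>\<alpha>\<close> have positive measure. Continuity of \<open>\<phi>\<close> then extends the
  formula to all pairs of essential points, in particular \<open>\<phi> (x, x) = 1\<close> there and, by continuity, on
  their closure. Near a point of the closure \<open>\<phi>\<close> is close to one, so the values of \<open>\<alpha>\<close> are close to
  each other.
\<close>

lemma continuous_representative:
  fixes \<alpha> :: "'a \<Rightarrow> nat ell2" and \<phi> :: "'a \<times> 'a \<Rightarrow> complex"
  assumes R: "second_countable_radon_space X M"
    and \<phi>: "continuous_map (prod_topology X X) euclidean \<phi>"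
    and \<alpha>[measurable]: "\<alpha> \<in> borel_measurable M"
    and eq: "AE z in M \<Otimes>\<^sub>M M. \<phi> z = complex_of_real (exp (- (norm (\<alpha> (fst z) - \<alpha> (snd z)))\<^sup>2))"
  obtains \<alpha>' where "continuous_map X euclidean \<alpha>'" "AE x in M. \<alpha>' x = \<alpha> x"
proof -
  interpret sigma_finite_measure M by (rule radon_sigma_finite[OF R])
  have X: "second_countable X" "locally_compact_space X" "Hausdorff_space X" "space M = topspace X"
    and op: "\<And>U. openin X U \<Longrightarrow> U \<in> sets M"
    using R by (auto simp: second_countable_radon_space_def)
  have reg: "regular_space X" using X(2,3) by (intro locally_compact_Hausdorff_imp_regular_space)
  obtain e :: "'a \<Rightarrow> nat \<Rightarrow> real" where e: "continuous_map X euclidean e"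
    and sep: "\<And>U x. openin X U \<Longrightarrow> x \<in> U \<Longrightarrow> \<exists>V. open V \<and> e x \<in> V \<and> (\<forall>y\<in>topspace X. e y \<in> V \<longrightarrow> y \<in> U)"
    using second_countable_regular_embedding[OF X(1) reg] by blast
  have [measurable]: "e \<in> borel_measurable M"
  proof (rule borel_measurableI)
    fix S :: "(nat \<Rightarrow> real) set" assume "open S"
    then have "openin X {x \<in> topspace X. e x \<in> S}"
      using openin_continuous_map_preimage[OF e, of S] by simp
    moreover have "e -` S \<inter> space M = {x \<in> topspace X. e x \<in> S}" using X(4) by auto
    ultimately show "e -` S \<inter> space M \<in> sets M" using op by simp
  qed
  have Fm: "(\<lambda>x. (e x, \<alpha> x)) \<in> borel_measurable M" by (intro borel_measurable_Pair) measurable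
  obtain G where G: "G \<in> sets M" "AE x in M. x \<in> G"
    and ess: "\<And>x U. x \<in> G \<Longrightarrow> open U \<Longrightarrow> (e x, \<alpha> x) \<in> U \<Longrightarrow> emeasure M ((\<lambda>x. (e x, \<alpha> x)) -` U \<inter> space M) \<noteq> 0"
    using essential_points[OF Fm] by blast
  have GT: "G \<subseteq> topspace X" using sets.sets_into_space[OF G(1)] X(4) by simp
  have pos: "emeasure M {y \<in> U. \<alpha> y \<in> V} \<noteq> 0 \<and> {y \<in> U. \<alpha> y \<in> V} \<in> sets M"
    if x: "x \<in> G" and U: "openin X U" "x \<in> U" and V: "open V" "\<alpha> x \<in> V" for x U V
  proof -
    obtain W where W: "open W" "e x \<in> W" "\<forall>y\<in>topspace X. e y \<in> W \<longrightarrow> y \<in> U" using sep[OF U] by blast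
    have m: "{y \<in> U. \<alpha> y \<in> V} \<in> sets M"
    proof -
      have "{y \<in> U. \<alpha> y \<in> V} = U \<inter> (\<alpha> -` V \<inter> space M)" using openin_subset[OF U(1)] X(4) by auto
      then show ?thesis using op[OF U(1)] measurable_sets[OF \<alpha>, of V] V(1) by simp
    qed
    have "emeasure M ((\<lambda>x. (e x, \<alpha> x)) -` (W \<times> V) \<inter> space M) \<noteq> 0"
      using ess[OF x open_Times[OF W(1) V(1)]] W(2) V(2) by simp
    moreover have "emeasure M ((\<lambda>x. (e x, \<alpha> x)) -` (W \<times> V) \<inter> space M) \<le> emeasure M {y \<in> U. \<alpha> y \<in> V}"
      using W(3) X(4) by (intro emeasure_mono m) auto
    ultimately show ?thesis using m by auto
  qed
  have nbhd: "\<exists>U V. openin X U \<and> openin X V \<and> x \<in> U \<and> y \<in> V \<and> (\<forall>x'\<in>U. \<forall>y'\<in>V. dist (\<phi> (x', y')) (\<phi> (x, y)) < \<epsilon>)"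
    if "x \<in> topspace X" "y \<in> topspace X" "0 < \<epsilon>" for x y \<epsilon>
  proof -
    have "openin (prod_topology X X) {z \<in> topspace (prod_topology X X). \<phi> z \<in> ball (\<phi> (x, y)) \<epsilon>}"
      by (rule openin_continuous_map_preimage[OF \<phi>]) simp
    moreover have "(x, y) \<in> {z \<in> topspace (prod_topology X X). \<phi> z \<in> ball (\<phi> (x, y)) \<epsilon>}" using that by simp
    ultimately obtain U V where UV: "openin X U" "openin X V" "x \<in> U" "y \<in> V"
      "U \<times> V \<subseteq> {z \<in> topspace (prod_topology X X). \<phi> z \<in> ball (\<phi> (x, y)) \<epsilon>}"
      unfolding openin_prod_topology_alt by meson
    have "dist (\<phi> (x', y')) (\<phi> (x, y)) < \<epsilon>" if "x' \<in> U" "y' \<in> V" for x' y'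
      using subsetD[OF UV(5), of "(x', y')"] that by (simp add: dist_commute)
    with UV(1-4) show ?thesis by blast
  qed
  let ?k = "\<lambda>v v'. complex_of_real (exp (- (norm (v - v'))\<^sup>2))"
  have \<phi>G: "\<phi> (x, y) = ?k (\<alpha> x) (\<alpha> y)" if x: "x \<in> G" and y: "y \<in> G" for x y
  proof (rule ccontr)
    assume "\<phi> (x, y) \<noteq> ?k (\<alpha> x) (\<alpha> y)"
    then have d: "0 < dist (\<phi> (x, y)) (?k (\<alpha> x) (\<alpha> y)) / 2" (is "0 < ?d") by simp
    obtain U U' where U: "openin X U" "openin X U'" "x \<in> U" "y \<in> U'"
      "\<And>x' y'. x' \<in> U \<Longrightarrow> y' \<in> U' \<Longrightarrow> dist (\<phi> (x', y')) (\<phi> (x, y)) < ?d"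
      using nbhd[of x y ?d] d x y GT by blast
    have "open {p. dist (?k (fst p) (snd p)) (?k (\<alpha> x) (\<alpha> y)) < ?d}"
      by (intro open_Collect_less continuous_intros)
    moreover have "(\<alpha> x, \<alpha> y) \<in> {p. dist (?k (fst p) (snd p)) (?k (\<alpha> x) (\<alpha> y)) < ?d}" using d by simp
    ultimately obtain V V' where V: "open V" "open V'" "(\<alpha> x, \<alpha> y) \<in> V \<times> V'"
      "V \<times> V' \<subseteq> {p. dist (?k (fst p) (snd p)) (?k (\<alpha> x) (\<alpha> y)) < ?d}"
      by (rule open_prod_elim)
    obtain x' y' where "x' \<in> {y \<in> U. \<alpha> y \<in> V}" "y' \<in> {y \<in> U'. \<alpha> y \<in> V'}"
      and e: "\<phi> (x', y') = ?k (\<alpha> x') (\<alpha> y')"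
      using AE_pair_inhabits_rectangle[OF eq, of "{y \<in> U. \<alpha> y \<in> V}" "{y \<in> U'. \<alpha> y \<in> V'}"]
        pos[OF x U(1,3) V(1)] pos[OF y U(2,4) V(2)] V(3) by auto
    then have "dist (\<phi> (x', y')) (\<phi> (x, y)) < ?d" "dist (?k (\<alpha> x') (\<alpha> y')) (?k (\<alpha> x) (\<alpha> y)) < ?d"
      using U(5)[of x' y'] V(4) by auto
    then show False using e dist_triangle3[of "\<phi> (x, y)" "?k (\<alpha> x) (\<alpha> y)" "\<phi> (x', y')"] by simp
  qed
  have cauchy: "\<exists>U. openin X U \<and> t \<in> U \<and> (\<forall>g\<in>G \<inter> U. \<forall>g'\<in>G \<inter> U. dist (\<alpha> g) (\<alpha> g') < \<epsilon>)"
    if t: "t \<in> X closure_of G" and \<epsilon>: "0 < \<epsilon>" for t \<epsilon>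
  proof -
    have tT: "t \<in> topspace X" using t by (simp add: in_closure_of)
    have near: "\<exists>g. g \<in> G \<inter> U" if "openin X U" "t \<in> U" for U using t that unfolding in_closure_of by blast
    have one: "\<phi> (t, t) = 1"
    proof (rule ccontr)
      assume "\<phi> (t, t) \<noteq> 1"
      then obtain U V where U: "openin X U" "openin X V" "t \<in> U" "t \<in> V"
        "\<forall>x'\<in>U. \<forall>y'\<in>V. dist (\<phi> (x', y')) (\<phi> (t, t)) < dist 1 (\<phi> (t, t))"
        using nbhd[OF tT tT, of "dist 1 (\<phi> (t, t))"] by auto
      then obtain g where "g \<in> G \<inter> (U \<inter> V)" using near[of "U \<inter> V"] by auto
      then have "g \<in> G" "dist (\<phi> (g, g)) (\<phi> (t, t)) < dist 1 (\<phi> (t, t))" using U(5) by blast+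
      then show False using \<phi>G[of g g] by simp
    qed
    have d: "0 < 1 - exp (- \<epsilon>\<^sup>2)" using \<epsilon> by simp
    obtain U V where U: "openin X U" "openin X V" "t \<in> U" "t \<in> V"
      "\<forall>x'\<in>U. \<forall>y'\<in>V. dist (\<phi> (x', y')) (\<phi> (t, t)) < 1 - exp (- \<epsilon>\<^sup>2)"
      using nbhd[OF tT tT d] by blast
    have "dist (\<alpha> g) (\<alpha> g') < \<epsilon>" if g: "g \<in> G \<inter> (U \<inter> V)" "g' \<in> G \<inter> (U \<inter> V)" for g g'
    proof -
      have "g \<in> G" "g' \<in> G" "dist (\<phi> (g, g')) (\<phi> (t, t)) < 1 - exp (- \<epsilon>\<^sup>2)"
        using U(5) g by blast+
      then have "dist (?k (\<alpha> g) (\<alpha> g')) 1 < 1 - exp (- \<epsilon>\<^sup>2)"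
        using one \<phi>G[of g g'] by simp
      moreover have "?k (\<alpha> g) (\<alpha> g') - 1 = complex_of_real (exp (- (norm (\<alpha> g - \<alpha> g'))\<^sup>2) - 1)" by simp
      ultimately have "\<bar>exp (- (norm (\<alpha> g - \<alpha> g'))\<^sup>2) - 1\<bar> < 1 - exp (- \<epsilon>\<^sup>2)"
        unfolding dist_norm by (simp only: norm_of_real)
      then have "exp (- \<epsilon>\<^sup>2) < exp (- (norm (\<alpha> g - \<alpha> g'))\<^sup>2)" by linarith
      then have "(norm (\<alpha> g - \<alpha> g'))\<^sup>2 < \<epsilon>\<^sup>2" by simp
      from power_less_imp_less_base[OF this less_imp_le[OF \<epsilon>]] show ?thesis by (simp only: dist_norm)
    qed
    then show ?thesis using U by (intro exI[of _ "U \<inter> V"]) auto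
  qed
  obtain \<alpha>1 where \<alpha>1: "\<And>g. g \<in> G \<Longrightarrow> \<alpha>1 g = \<alpha> g"
    "\<And>t \<epsilon>. t \<in> X closure_of G \<Longrightarrow> 0 < \<epsilon> \<Longrightarrow>
      \<exists>U. openin X U \<and> t \<in> U \<and> (\<forall>s\<in>X closure_of G \<inter> U. dist (\<alpha>1 s) (\<alpha>1 t) < \<epsilon>)"
  proof (rule continuous_extension_to_closure[OF cauchy GT])
  qed (assumption | (rule that; assumption))+
  obtain \<alpha>2 where \<alpha>2: "continuous_map X euclidean \<alpha>2" "\<And>x. x \<in> X closure_of G \<Longrightarrow> \<alpha>2 x = \<alpha>1 x"
  proof (rule continuous_extension_from_closed[OF X(1) reg X(3) closedin_closure_of \<alpha>1(2)])
  qed (assumption | (rule that; assumption))+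
  have "AE x in M. \<alpha>2 x = \<alpha> x"
    using G(2)
  proof eventually_elim
    case (elim x)
    then show ?case using \<alpha>2(2)[of x] \<alpha>1(1)[of x] closure_of_subset[OF GT] by auto
  qed
  with \<alpha>2(1) show thesis by (rule that)
qed

theorem radon_markov_semigroup_embedding:
  assumes R: "second_countable_radon_space (X :: 'a topology) M"
    and sg: "markov_schur_semigroup M T \<phi>"
    and c: "\<forall>t\<ge>0. continuous_map (prod_topology X X) euclidean (\<phi> t)"
  shows "\<exists>(H :: ('a + nat) ell2 set) \<alpha>.
               real_hilbert_in H \<and> continuous_map X (top_of_set H) \<alpha> \<and>
               (\<forall>t\<ge>0. AE (x, y) in square_measure M.
                  \<phi> t (x, y) = complex_of_real (exp (- t * (norm (\<alpha> x - \<alpha> y))\<^sup>2)))"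
proof -
  interpret sigma_finite_measure M by (rule radon_sigma_finite[OF R])
  have complete: "complete_measure M" using R by (simp add: second_countable_radon_space_def)
  obtain \<alpha> :: "'a \<Rightarrow> nat ell2" where \<alpha>: "\<alpha> \<in> borel_measurable M"
    and eq: "\<And>t. 0 \<le> t \<Longrightarrow> AE z in M \<Otimes>\<^sub>M M. \<phi> t z = complex_of_real (exp (- t * (norm (\<alpha> (fst z) - \<alpha> (snd z)))\<^sup>2))"
    by (rule markov_schur_semigroup_embedding[OF complete sigma_finite_measure_axioms sg]) (rule that; assumption)
  have "AE z in M \<Otimes>\<^sub>M M. \<phi> 1 z = complex_of_real (exp (- (norm (\<alpha> (fst z) - \<alpha> (snd z)))\<^sup>2))"
    using eq[of 1] by simp
  note eq1 = this
  have c1: "continuous_map (prod_topology X X) euclidean (\<phi> 1)" using c by simp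
  obtain \<alpha>' where \<alpha>': "continuous_map X euclidean \<alpha>'" "AE x in M. \<alpha>' x = \<alpha> x"
    by (rule continuous_representative[OF R c1 \<alpha> eq1]) (rule that; assumption)
  have "continuous_map X euclidean (ell2_emb \<circ> \<alpha>' :: 'a \<Rightarrow> ('a + nat) ell2)"
    by (rule continuous_map_compose[OF \<alpha>'(1)]) (simp add: continuous_ell2_emb)
  moreover have "AE (x, y) in square_measure M.
      \<phi> t (x, y) = complex_of_real (exp (- t * (norm ((ell2_emb \<circ> \<alpha>') x - (ell2_emb \<circ> \<alpha>') y :: ('a + nat) ell2))\<^sup>2))"
    if t: "0 \<le> t" for t
    unfolding square_measure_def AE_completion_iff
    using eq[OF t] AE_fst[OF \<alpha>'(2)] AE_snd[OF \<alpha>'(2)]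
    by eventually_elim (auto simp: ell2_emb_diff norm_ell2_emb)
  ultimately show ?thesis
    by (intro exI[of _ UNIV] exI[of _ "ell2_emb \<circ> \<alpha>'"]) (auto simp: real_hilbert_UNIV)
qed

theorem measurable_markov_semigroup_embedding:
  assumes complete: "complete_measure (M :: 'b measure)" and sf: "sigma_finite_measure M"
    and sg: "markov_schur_semigroup M T \<phi>"
  shows "\<exists>(H :: ('b + nat) ell2 set) \<alpha>.
               real_hilbert_in H \<and> weak_measurable M H \<alpha> \<and>
               (\<forall>t\<ge>0. AE (x, y) in square_measure M.
                  \<phi> t (x, y) = complex_of_real (exp (- t * (norm (\<alpha> x - \<alpha> y))\<^sup>2)))"
proof -
  obtain \<alpha> :: "'b \<Rightarrow> nat ell2" where \<alpha>: "\<alpha> \<in> borel_measurable M"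
    and eq: "\<And>t. 0 \<le> t \<Longrightarrow> AE z in M \<Otimes>\<^sub>M M. \<phi> t z = complex_of_real (exp (- t * (norm (\<alpha> (fst z) - \<alpha> (snd z)))\<^sup>2))"
    by (rule markov_schur_semigroup_embedding[OF complete sf sg]) (rule that; assumption)
  let ?\<alpha> = "ell2_emb \<circ> \<alpha> :: 'b \<Rightarrow> ('b + nat) ell2"
  have "(\<lambda>x. inner (?\<alpha> x) h) \<in> borel_measurable M" for h
  proof -
    have "continuous_on UNIV (\<lambda>v. inner (ell2_emb v :: ('b + nat) ell2) h)"
      by (intro continuous_intros continuous_ell2_emb)
    from measurable_compose[OF \<alpha> borel_measurable_continuous_onI[OF this]] show ?thesis by simp
  qed
  then have "weak_measurable M UNIV ?\<alpha>" by (simp add: weak_measurable_def)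
  moreover have "AE (x, y) in square_measure M.
      \<phi> t (x, y) = complex_of_real (exp (- t * (norm (?\<alpha> x - ?\<alpha> y))\<^sup>2))" if t: "0 \<le> t" for t
    unfolding square_measure_def AE_completion_iff
    using eq[OF t] by eventually_elim (auto simp: ell2_emb_diff norm_ell2_emb)
  ultimately show ?thesis
    by (intro exI[of _ UNIV] exI[of _ ?\<alpha>]) (auto simp: real_hilbert_UNIV)
qed

theorem proposition4p10:
  shows "(\<forall>(X :: 'a topology) M T \<phi>.
            second_countable_radon_space X M \<and>
            markov_schur_semigroup M T \<phi> \<and>
            (\<forall>t\<ge>0. continuous_map (prod_topology X X) euclidean (\<phi> t)) \<longrightarrow>
            (\<exists>(H :: ('a + nat) ell2 set) \<alpha>.
               real_hilbert_in H \<and> continuous_map X (top_of_set H) \<alpha> \<and>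
               (\<forall>t\<ge>0. AE (x, y) in square_measure M.
                  \<phi> t (x, y) = complex_of_real (exp (- t * (norm (\<alpha> x - \<alpha> y))\<^sup>2)))))
       \<and> (\<forall>(M :: 'b measure) T \<phi>.
            complete_measure M \<and> sigma_finite_measure M \<and>
            markov_schur_semigroup M T \<phi> \<longrightarrow>
            (\<exists>(H :: ('b + nat) ell2 set) \<alpha>.
               real_hilbert_in H \<and> weak_measurable M H \<alpha> \<and>
               (\<forall>t\<ge>0. AE (x, y) in square_measure M.
                  \<phi> t (x, y) = complex_of_real (exp (- t * (norm (\<alpha> x - \<alpha> y))\<^sup>2)))))"
proof (intro conjI allI impI; elim conjE)
qed (rule radon_markov_semigroup_embedding measurable_markov_semigroup_embedding; assumption)+

end
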